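(* Let $X$ be an Asplund space, $T$ a nonempty index set, $f_t:X\to\mathbb{R}\cup\{+\infty\}$ ($t\in T$) lower semicontinuous functions, $f:=\sup_{t\in T}f_t$ and $\bar x\in X$. Suppose that the family $\{f_t:t\in T\}$ is SNEC on a neighborhood of $\bar x$ and satisfies the limiting condition on a neighborhood of $\bar x$. Then $$\partial f(\bar x)\subseteq\bigcap_{\epsilon>0}\mathrm{cl}^{w^*}\big(\mathcal{S}(\bar x,\epsilon)\big)\quad\text{and}\quad\partial^\infty f(\bar x)\subseteq\bigcap_{\epsilon>0}\mathrm{cl}^{w^*}\big([0,\epsilon]\cdot\mathcal{S}(\bar x,\epsilon)\big),$$ where $$\mathcal{S}(\bar x,\epsilon):=\bigcup\Big\{\sum_{t\in F}\lambda_t\circ\partial f_t(x')\ :\ F\subseteq T\text{ finite},\ x'\in\mathbb{B}(\bar x,\epsilon),\ |f_F(x')-f(\bar x)|\le\epsilon,\ \lambda\in\Delta(F),\ f_t(x')=f_F(x')\ \forall t\in\mathrm{supp}\,\lambda\Big\}.$$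
   Context: An Asplund space is a Banach space all of whose separable subspaces have separable dual. $\mathrm{cl}^{w^*}$ is weak$^*$ closure, $\mathbb{B}(\bar x,\epsilon)$ the closed ball, $f_F:=\max_{s\in F}f_s$, $\Delta(F):=\{(\lambda_t)_{t\in F}:\lambda_t\ge0,\ \sum_{t\in F}\lambda_t=1\}$, $\mathrm{supp}\,\lambda=\{t:\lambda_t\ne0\}$. For $g$ lsc and finite at $x$: $\hat\partial g(x)=\{x^*:\liminf_{h\to0}\frac{g(x+h)-g(x)-\langle x^*,h\rangle}{\|h\|}\ge0\}$; with $x_n\overset{g}{\to}x$ meaning $x_n\to x$ and $g(x_n)\to g(x)$, $\partial g(x)=\{w^*\text{-}\lim x_n^*:x_n^*\in\hat\partial g(x_n),\ x_n\overset{g}{\to}x\}$ and $\partial^\infty g(x)=\{w^*\text{-}\lim\lambda_nx_n^*:x_n^*\in\hat\partial g(x_n),\ x_n\overset{g}{\to}x,\ \lambda_n\to0^+\}$ (sequential limits). All are empty if $|g(x)|=+\infty$. Also $\lambda\circ\partial f_t(x):=\lambda\,\partial f_t(x)$ if $\lambda>0$ and $0\circ\partial f_t(x):=\partial^\infty f_t(x)$. SNEC (sequential normal epi-compactness): a function $g$ finite at $x$ is SNEC at $x$ if for any sequences $(\lambda_k,x_k,x_k^* )\in[0,+\infty)\times X\times X^*$ with $\lambda_k\to0$, $x_k\overset{g}{\to}x$, $x_k^*\in\hat\partial g(x_k)$ and $\lambda_kx_k^*\to0$ weak$^*$, one has $\|\lambda_kx_k^*\|\to0$. The family $\{f_t\}_{t\in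 T}$ is SNEC on a neighborhood of $\bar x$ if there is a neighborhood $U$ of $\bar x$ such that for all $x\in U$ all but at most one of the functions $f_t$ are SNEC at $x$ (functions not finite at $x$ impose no requirement at $x$). Limiting condition on a neighborhood of $\bar x$: there is a neighborhood $U$ of $\bar x$ such that for all $x\in U$ and all finite $F\subseteq T$: if $w_t^*\in\partial^\infty f_t(x)$ for $t\in F$ and $\sum_{t\in F}w_t^*=0$, then $w_t^*=0$ for all $t\in F$. *)

theory Defs
  imports "HOL-Analysis.Analysis"
begin

section \<open>Asplund spaces\<close>

text \<open>A subspace \<open>Y\<close> is a set, so its dual cannot be a \<open>blinfun\<close> type: it consists of the
  functions that are linear and bounded on \<open>Y\<close>, whose values outside \<open>Y\<close> play no role.\<close>

definition dual_on :: "'a::real_normed_vector set \<Rightarrow> ('a \<Rightarrow> real) set" where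
  "dual_on Y = {\<phi>. (\<forall>x\<in>Y. \<forall>y\<in>Y. \<phi> (x + y) = \<phi> x + \<phi> y)
                  \<and> (\<forall>c. \<forall>x\<in>Y. \<phi> (c *\<^sub>R x) = c * \<phi> x)
                  \<and> (\<exists>K. \<forall>x\<in>Y. \<bar>\<phi> x\<bar> \<le> K * norm x)}"

definition dual_norm_on :: "'a::real_normed_vector set \<Rightarrow> ('a \<Rightarrow> real) \<Rightarrow> real" where
  "dual_norm_on Y \<phi> = (SUP y\<in>Y \<inter> cball 0 1. \<bar>\<phi> y\<bar>)"

definition separable_dual :: "'a::real_normed_vector set \<Rightarrow> bool" where
  "separable_dual Y \<longleftrightarrow>
     (\<exists>D. countable D \<and> D \<subseteq> dual_on Y
        \<and> (\<forall>\<phi>\<in>dual_on Y. \<forall>e>0. \<exists>\<psi>\<in>D. dual_norm_on Y (\<lambda>y. \<phi> y - \<psi> y) < e))"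

definition asplund_space :: "'a::banach itself \<Rightarrow> bool" where
  "asplund_space _ \<longleftrightarrow>
     (\<forall>Y :: 'a set. subspace Y \<and> separable_space (top_of_set Y) \<longrightarrow> separable_dual Y)"


section \<open>The weak* topology\<close>

text \<open>For real-valued functionals the strong operator topology is the topology of pointwise
  convergence, that is, the weak* topology of the dual space.\<close>

abbreviation weak_star :: "('a::real_normed_vector \<Rightarrow>\<^sub>L real) topology" where
  "weak_star \<equiv> strong_operator_topology"

lemma limitin_weak_star_iff:
  fixes \<xi> :: "nat \<Rightarrow> 'a::real_normed_vector \<Rightarrow>\<^sub>L real"
  shows "limitin weak_star \<xi> \<eta> sequentially \<longleftrightarrow>
           (\<forall>v. (\<lambda>n. blinfun_apply (\<xi> n) v) \<longlonglongrightarrow> blinfun_apply \<eta> v)"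
proof
  assume "limitin weak_star \<xi> \<eta> sequentially"
  then show "\<forall>v. (\<lambda>n. blinfun_apply (\<xi> n) v) \<longlonglongrightarrow> blinfun_apply \<eta> v"
    using continuous_map_limit[OF strong_operator_topology_continuous_evaluation]
    by (fastforce simp: comp_def)
next
  assume R: "\<forall>v. (\<lambda>n. blinfun_apply (\<xi> n) v) \<longlonglongrightarrow> blinfun_apply \<eta> v"
  have lim: "((\<lambda>n. blinfun_apply (\<xi> n)) \<longlongrightarrow> blinfun_apply \<eta>) sequentially"
    using R limitin_componentwise[of "\<lambda>_::'a. euclidean :: real topology" UNIV
        "\<lambda>n. blinfun_apply (\<xi> n)" "blinfun_apply \<eta>" sequentially]
    by (simp add: euclidean_product_topology flip: limitin_canonical_iff)
  show "limitin weak_star \<xi> \<eta> sequentially"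
    unfolding limitin_def
  proof (intro conjI allI impI)
    fix U assume U: "openin strong_operator_topology U \<and> \<eta> \<in> U"
    then obtain V where V: "open V" "U = blinfun_apply -` V"
      by (auto simp: strong_operator_topology_def openin_pullback_topology)
    with lim U show "\<forall>\<^sub>F n in sequentially. \<xi> n \<in> U"
      by (auto dest!: topological_tendstoD)
  qed (simp add: strong_operator_topology_topspace)
qed


section \<open>Lower semicontinuity and subdifferentials\<close>

definition lsc :: "('a::topological_space \<Rightarrow> ereal) \<Rightarrow> bool" where
  "lsc g \<longleftrightarrow> (\<forall>x. g x \<le> Liminf (at x) g)"

definition frechet_subdiff ::
  "('a::real_normed_vector \<Rightarrow> ereal) \<Rightarrow> 'a \<Rightarrow> ('a \<Rightarrow>\<^sub>L real) set" where
  "frechet_subdiff g x =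
     {\<xi>. \<bar>g x\<bar> \<noteq> \<infinity> \<and>
         0 \<le> Liminf (at 0)
               (\<lambda>h. (g (x + h) - g x - ereal (blinfun_apply \<xi> h)) / ereal (norm h))}"

definition g_converges ::
  "('a::real_normed_vector \<Rightarrow> ereal) \<Rightarrow> (nat \<Rightarrow> 'a) \<Rightarrow> 'a \<Rightarrow> bool" where
  "g_converges g xs x \<longleftrightarrow> xs \<longlonglongrightarrow> x \<and> (\<lambda>n. g (xs n)) \<longlonglongrightarrow> g x"

definition limiting_subdiff ::
  "('a::real_normed_vector \<Rightarrow> ereal) \<Rightarrow> 'a \<Rightarrow> ('a \<Rightarrow>\<^sub>L real) set" where
  "limiting_subdiff g x =
     {\<eta>. \<bar>g x\<bar> \<noteq> \<infinity> \<and>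
         (\<exists>xs \<xi>. g_converges g xs x \<and> (\<forall>n. \<xi> n \<in> frechet_subdiff g (xs n))
               \<and> limitin weak_star \<xi> \<eta> sequentially)}"

definition singular_subdiff ::
  "('a::real_normed_vector \<Rightarrow> ereal) \<Rightarrow> 'a \<Rightarrow> ('a \<Rightarrow>\<^sub>L real) set" where
  "singular_subdiff g x =
     {\<eta>. \<bar>g x\<bar> \<noteq> \<infinity> \<and>
         (\<exists>xs \<xi> l. g_converges g xs x \<and> (\<forall>n. \<xi> n \<in> frechet_subdiff g (xs n))
               \<and> (\<forall>n. 0 < l n) \<and> l \<longlonglongrightarrow> 0
               \<and> limitin weak_star (\<lambda>n. l n *\<^sub>R \<xi> n) \<eta> sequentially)}"

definition circ_subdiff ::
  "real \<Rightarrow> ('a::real_normed_vector \<Rightarrow> ereal) \<Rightarrow> 'a \<Rightarrow> ('a \<Rightarrow>\<^sub>L real) set" where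
  "circ_subdiff l g x =
     (if l > 0 then (\<lambda>\<xi>. l *\<^sub>R \<xi>) ` limiting_subdiff g x else singular_subdiff g x)"


section \<open>SNEC and the limiting condition\<close>

definition snec_at :: "('a::real_normed_vector \<Rightarrow> ereal) \<Rightarrow> 'a \<Rightarrow> bool" where
  "snec_at g x \<longleftrightarrow>
     (\<forall>l xs \<xi>. (\<forall>k. 0 \<le> l k) \<and> l \<longlonglongrightarrow> 0 \<and> g_converges g xs x
         \<and> (\<forall>k. \<xi> k \<in> frechet_subdiff g (xs k))
         \<and> limitin weak_star (\<lambda>k. l k *\<^sub>R \<xi> k) 0 sequentially
         \<longrightarrow> (\<lambda>k. norm (l k *\<^sub>R \<xi> k)) \<longlonglongrightarrow> 0)"

definition snec_family_near ::
  "'t set \<Rightarrow> ('t \<Rightarrow> 'a::real_normed_vector \<Rightarrow> ereal) \<Rightarrow> 'a \<Rightarrow> bool" where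
  "snec_family_near T f x0 \<longleftrightarrow>
     (\<exists>U. open U \<and> x0 \<in> U \<and>
        (\<forall>x\<in>U. \<exists>\<^sub>\<le>\<^sub>1t. t \<in> T \<and> \<bar>f t x\<bar> \<noteq> \<infinity> \<and> \<not> snec_at (f t) x))"

definition limiting_condition_near ::
  "'t set \<Rightarrow> ('t \<Rightarrow> 'a::real_normed_vector \<Rightarrow> ereal) \<Rightarrow> 'a \<Rightarrow> bool" where
  "limiting_condition_near T f x0 \<longleftrightarrow>
     (\<exists>U. open U \<and> x0 \<in> U \<and>
        (\<forall>x\<in>U. \<forall>F w. finite F \<and> F \<subseteq> T \<and> (\<forall>t\<in>F. w t \<in> singular_subdiff (f t) x)
            \<and> (\<Sum>t\<in>F. w t) = 0 \<longrightarrow> (\<forall>t\<in>F. w t = 0)))"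


section \<open>The approximating sets\<close>

definition simplex_on :: "'t set \<Rightarrow> ('t \<Rightarrow> real) set" where
  "simplex_on F = {l. (\<forall>t\<in>F. 0 \<le> l t) \<and> (\<Sum>t\<in>F. l t) = 1}"

definition supp_on :: "'t set \<Rightarrow> ('t \<Rightarrow> real) \<Rightarrow> 't set" where
  "supp_on F l = {t \<in> F. l t \<noteq> 0}"

definition sup_family :: "'t set \<Rightarrow> ('t \<Rightarrow> 'a \<Rightarrow> ereal) \<Rightarrow> 'a \<Rightarrow> ereal" where
  "sup_family T f x = (SUP t\<in>T. f t x)"

text \<open>Only used for nonempty finite \<open>F\<close>.\<close>

definition max_family :: "'t set \<Rightarrow> ('t \<Rightarrow> 'a \<Rightarrow> ereal) \<Rightarrow> 'a \<Rightarrow> ereal" where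
  "max_family F f x = Max ((\<lambda>t. f t x) ` F)"

text \<open>\<open>F = {}\<close> is excluded because \<open>simplex_on {}\<close> is empty. If both values in
  \<open>max_family F f x - sup_family T f x0\<close> are infinite, the absolute value is \<open>\<infinity>\<close>, so the
  closeness condition fails.\<close>

definition approx_sums ::
  "'t set \<Rightarrow> ('t \<Rightarrow> 'a::real_normed_vector \<Rightarrow> ereal) \<Rightarrow> 'a \<Rightarrow> real \<Rightarrow> ('a \<Rightarrow>\<^sub>L real) set" where
  "approx_sums T f x0 e =
     \<Union> {{(\<Sum>t\<in>F. w t) | w. \<forall>t\<in>F. w t \<in> circ_subdiff (l t) (f t) x} | F x l.
           finite F \<and> F \<subseteq> T \<and> x \<in> cball x0 e
           \<and> \<bar>max_family F f x - sup_family T f x0\<bar> \<le> ereal e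
           \<and> l \<in> simplex_on F
           \<and> (\<forall>t\<in>supp_on F l. f t x = max_family F f x)}"

end

theory Submission
  imports Defs "HOL-Library.Function_Algebras"
begin

text \<open>A weak* neighbourhood tests only finitely many directions. Given a Frechet subgradient \<open>\<xi>\<close> of the
  supremum at \<open>x\<close>, compactness of the convex hull of these directions yields a finite maximum that, tilted by
  \<open>- \<xi>\<close> and by a sublinear penalty nearly vanishing on the directions, is almost minimal at \<open>x\<close>. Ekeland's
  principle moves to a nearby exact minimizer, where an exact multiplier rule for finite maxima gives the
  approximating sum.

  The exact rule is a limit of fuzzy rules: the square root of a sum of squares decouples the functions, and a
  smooth variational principle followed by one-variable optimality conditions produces Frechet subgradients at
  nearby points. Bounded sequences of functionals have weak* convergent subsequences, the limits are
  limiting or singular subgradients, and the SNEC and limiting conditions prevent all multipliers from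
  vanishing. Smooth approximations of the norm exist only along a separable subspace with separable dual; the
  Mazur--Orlicz theorem extends the subgradients found there to the whole space.\<close>

section \<open>The Hahn--Banach and Mazur--Orlicz theorems\<close>

text \<open>The recurring obstacle is nontriviality. Functionals with norms bounded away from 0 may
  converge weak* to 0, so the fuzzy rule records that either the weight \<open>a\<close> of the
  active functions is at least 1/2 or one functional is quantitatively negative at an explicit
  vector. An inequality at one vector survives separable reduction; in the limit SNEC sends all but
  at most one functional to 0 in norm, and the approximate sum rule takes care of the last one.
  There are two minimizations because a smooth approximation of the norm errs by some \<kappa>. The
  square root is smooth only away from 0, and local minimality yields a positive value only for the
  exact norm. Ekeland's principle with the exact norm therefore fixes a point and its value
  \<open>d > 0\<close> first; this point is put into the separable subspace, \<kappa> is chosen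
  small relative to \<open>d\<close>, and only then is the smooth principle applied along the
  subspace. Rational multipliers, values and radii occur because separable reduction closes a
  countable set under a family of operations, whose parameters must be countable.\<close>

definition sublinear :: "('v::real_vector \<Rightarrow> real) \<Rightarrow> bool" where
  "sublinear p \<longleftrightarrow>
     (\<forall>x y. p (x + y) \<le> p x + p y) \<and> (\<forall>c x. 0 \<le> c \<longrightarrow> p (c *\<^sub>R x) = c * p x)"

lemma sublinear_add: "sublinear p \<Longrightarrow> p (x + y) \<le> p x + p y"
  by (simp add: sublinear_def)

lemma sublinear_scaleR: "sublinear p \<Longrightarrow> 0 \<le> c \<Longrightarrow> p (c *\<^sub>R x) = c * p x"
  by (simp add: sublinear_def)

lemma sublinear_zero: "sublinear p \<Longrightarrow> p 0 = 0"
  using sublinear_scaleR[of p 0 0] by simp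

lemma sublinear_minus: "sublinear p \<Longrightarrow> - p (- x) \<le> p x"
  using sublinear_add[of p x "- x"] sublinear_zero[of p] by simp

text \<open>One inequality suffices for positive homogeneity: applied to \<open>inverse c\<close>
  and \<open>c *\<^sub>R x\<close> it yields the reverse one.\<close>

lemma sublinearI:
  assumes add: "\<And>x y. p (x + y) \<le> p x + p y"
    and scale: "\<And>c x. 0 < c \<Longrightarrow> p (c *\<^sub>R x) \<le> c * p x" and zero: "p 0 = 0"
  shows "sublinear p"
  unfolding sublinear_def
proof (intro conjI allI impI)
  fix x y show "p (x + y) \<le> p x + p y" by (rule add)
next
  fix c :: real and x assume c: "0 \<le> c"
  show "p (c *\<^sub>R x) = c * p x"
  proof (cases "c = 0")
    case True then show ?thesis by (simp add: zero)
  next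
    case False
    with c have c: "0 < c" by simp
    have "p x \<le> inverse c * p (c *\<^sub>R x)"
      using scale[of "inverse c" "c *\<^sub>R x"] c by simp
    then have "c * p x \<le> p (c *\<^sub>R x)" using c by (simp add: field_simps)
    with scale[OF c, of x] show ?thesis by simp
  qed
qed

lemma sublinear_norm: "0 \<le> M \<Longrightarrow> sublinear (\<lambda>x. M * norm x)"
  by (rule sublinearI) (auto simp: distrib_left[symmetric] norm_triangle_ineq mult_left_mono)

text \<open>Zorn's lemma. A nonempty chain is bounded below by its pointwise infimum: the values
  stay above \<open>- p (- x)\<close>, and subadditivity survives because of any two members the
  smaller one serves at both points.\<close>

lemma sublinear_minorant_minimal:
  assumes p: "sublinear p"
  obtains m where "sublinear m" "\<And>x. m x \<le> p x"
    "\<And>q. sublinear q \<Longrightarrow> (\<And>x. q x \<le> m x) \<Longrightarrow> q = m"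
proof -
  define A where "A = {q. sublinear q \<and> (\<forall>x. q x \<le> p x)}"
  \<comment> \<open>The order is reversed, so that the maximal element supplied by Zorn's lemma is
    pointwise minimal.\<close>
  define R where "R = (\<lambda>q q'::'a \<Rightarrow> real. \<forall>x. q' x \<le> q x)"
  have po: "partial_order_on A (relation_of R A)"
    unfolding partial_order_on_def preorder_on_def refl_on_def trans_def antisym_def relation_of_def R_def
    by (auto intro: order_trans simp: fun_eq_iff eq_iff)
  have "\<exists>m\<in>A. \<forall>q\<in>A. R m q \<longrightarrow> q = m"
  proof (rule predicate_Zorn[OF po])
    fix C assume C: "C \<in> Chains (relation_of R A)"
    then have CA: "q \<in> A" if "q \<in> C" for q using that by (auto simp: Chains_def relation_of_def)
    have cmp: "R q q' \<or> R q' q" if "q \<in> C" "q' \<in> C" for q q'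
      using C that by (auto simp: Chains_def relation_of_def)
    show "\<exists>u\<in>A. \<forall>a\<in>C. R a u"
    proof (cases "C = {}")
      case True
      then show ?thesis using p by (auto simp: A_def)
    next
      case False
      define u where "u x = (INF q\<in>C. q x)" for x
      have bdd: "bdd_below ((\<lambda>q. q x) ` C)" for x
      proof (rule bdd_belowI2[of _ "- p (- x)"])
        fix q assume "q \<in> C"
        then have "sublinear q" "q (- x) \<le> p (- x)" using CA by (auto simp: A_def)
        then show "- p (- x) \<le> q x" using sublinear_minus[of q x] by simp
      qed
      have le: "u x \<le> q x" if "q \<in> C" for q x
        unfolding u_def by (rule cINF_lower[OF bdd that])
      have ge: "b \<le> u x" if "\<And>q. q \<in> C \<Longrightarrow> b \<le> q x" for b x
        unfolding u_def by (rule cINF_greatest[OF False that])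
      have "sublinear u"
      proof (rule sublinearI)
        fix x y
        have *: "u (x + y) \<le> q1 x + q2 y" if q: "q1 \<in> C" "q2 \<in> C" for q1 q2
        proof -
          obtain q where "q \<in> C" "q x \<le> q1 x" "q y \<le> q2 y"
            using cmp[OF q] q by (auto simp: R_def)
          moreover have "q (x + y) \<le> q x + q y" using CA[OF \<open>q \<in> C\<close>] by (simp add: A_def sublinear_add)
          ultimately show ?thesis using le[OF \<open>q \<in> C\<close>, of "x + y"] by linarith
        qed
        have "u (x + y) - q1 x \<le> u y" if "q1 \<in> C" for q1
          by (rule ge) (use *[OF that] in \<open>simp add: diff_le_eq add.commute\<close>)
        then have "u (x + y) - u y \<le> u x" by (intro ge) (simp add: algebra_simps)
        then show "u (x + y) \<le> u x + u y" by simp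
      next
        fix c :: real and x assume c: "0 < c"
        have "u (c *\<^sub>R x) / c \<le> q x" if "q \<in> C" for q
          using le[OF that, of "c *\<^sub>R x"] CA[OF that] c
          by (simp add: A_def sublinear_scaleR pos_divide_le_eq mult.commute)
        then have "u (c *\<^sub>R x) / c \<le> u x" by (rule ge)
        then show "u (c *\<^sub>R x) \<le> c * u x" using c by (simp add: field_simps)
      next
        show "u 0 = 0" unfolding u_def
          using False CA by (simp add: A_def sublinear_zero cong: INF_cong)
      qed
      moreover have "u x \<le> p x" for x
      proof -
        obtain q where "q \<in> C" using False by auto
        then show ?thesis using le[of q x] CA[of q] by (auto simp: A_def intro: order_trans)
      qed
      ultimately show ?thesis using le by (auto simp: A_def R_def)
    qed
  qed
  then obtain m where m: "m \<in> A" "\<And>q. q \<in> A \<Longrightarrow> R m q \<Longrightarrow> q = m" by auto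
  show thesis
  proof
    show "sublinear m" "m x \<le> p x" for x using m(1) by (auto simp: A_def)
    fix q assume q: "sublinear q" "\<And>x. q x \<le> m x"
    then have "q \<in> A" using m(1) by (auto simp: A_def intro: order_trans)
    then show "q = m" using m(2) q(2) by (simp add: R_def)
  qed
qed

text \<open>The auxiliary \<open>q\<close> is sublinear and lies below \<open>m\<close>, hence
  equals \<open>m\<close>; the bound on \<open>q x\<close> from the parameter \<open>t = 1\<close>
  is then the missing superadditivity in direction \<open>v\<close>.\<close>

lemma minimal_sublinear_additive:
  assumes m: "sublinear m" and min: "\<And>q. sublinear q \<Longrightarrow> (\<And>x. q x \<le> m x) \<Longrightarrow> q = m"
  shows "m (x + v) = m x + m v"
proof -
  define q where "q x = (INF t\<in>{0..}. m (x + t *\<^sub>R v) - t * m v)" for x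
  have low: "- m (- x) \<le> m (x + t *\<^sub>R v) - t * m v" if "0 \<le> t" for x t
    using sublinear_add[OF m, of "x + t *\<^sub>R v" "- x"] sublinear_scaleR[OF m that, of v] by simp
  have bdd: "bdd_below ((\<lambda>t. m (x + t *\<^sub>R v) - t * m v) ` {0..})" for x
    by (rule bdd_belowI2[of _ "- m (- x)"]) (use low in auto)
  have le: "q x \<le> m (x + t *\<^sub>R v) - t * m v" if "0 \<le> t" for x t
    unfolding q_def by (rule cINF_lower[OF bdd]) (use that in simp)
  have ge: "b \<le> q x" if "\<And>t. 0 \<le> t \<Longrightarrow> b \<le> m (x + t *\<^sub>R v) - t * m v" for b x
    unfolding q_def by (rule cINF_greatest) (use that in auto)
  have "sublinear q"
  proof (rule sublinearI)
    fix x y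
    have *: "q (x + y) \<le> (m (x + s *\<^sub>R v) - s * m v) + (m (y + t *\<^sub>R v) - t * m v)"
      if "0 \<le> s" "0 \<le> t" for s t
      using le[of "s + t" "x + y"] sublinear_add[OF m, of "x + s *\<^sub>R v" "y + t *\<^sub>R v"] that
      by (simp add: algebra_simps)
    have "q (x + y) - (m (x + s *\<^sub>R v) - s * m v) \<le> q y" if "0 \<le> s" for s
      using *[OF that] by (intro ge) (simp add: algebra_simps)
    then have "q (x + y) - q y \<le> q x" by (intro ge) (simp add: algebra_simps)
    then show "q (x + y) \<le> q x + q y" by simp
  next
    fix c :: real and x assume c: "0 < c"
    have "q (c *\<^sub>R x) / c \<le> m (x + t *\<^sub>R v) - t * m v" if "0 \<le> t" for t
    proof -
      have "q (c *\<^sub>R x) \<le> m (c *\<^sub>R x + (c * t) *\<^sub>R v) - (c * t) * m v" using that c by (intro le) simp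
      also have "c *\<^sub>R x + (c * t) *\<^sub>R v = c *\<^sub>R (x + t *\<^sub>R v)" by (simp add: algebra_simps)
      also have "m \<dots> = c * m (x + t *\<^sub>R v)" using c by (intro sublinear_scaleR[OF m]) simp
      finally show ?thesis using c by (simp add: field_simps)
    qed
    then have "q (c *\<^sub>R x) / c \<le> q x" by (rule ge)
    then show "q (c *\<^sub>R x) \<le> c * q x" using c by (simp add: field_simps)
  next
    have "q 0 \<le> 0" using le[of 0 0] by (simp add: sublinear_zero[OF m])
    moreover have "0 \<le> q 0" by (rule ge) (simp add: sublinear_scaleR[OF m])
    ultimately show "q 0 = 0" by simp
  qed
  moreover have "q x \<le> m x" for x using le[of 0 x] by simp
  ultimately have "q = m" by (rule min)
  then have "m x \<le> m (x + v) - m v" using le[of 1 x] by simp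
  with sublinear_add[OF m, of x v] show ?thesis by simp
qed

theorem sublinear_minorant_linear:
  assumes p: "sublinear p"
  shows "\<exists>\<phi>. linear \<phi> \<and> (\<forall>x. \<phi> x \<le> p x)"
proof -
  obtain m where m: "sublinear m" "\<And>x. m x \<le> p x"
    "\<And>q. sublinear q \<Longrightarrow> (\<And>x. q x \<le> m x) \<Longrightarrow> q = m"
    using sublinear_minorant_minimal[OF p] by blast
  have add: "m (x + y) = m x + m y" for x y
    using minimal_sublinear_additive[OF m(1,3)] by blast
  have neg: "m (- x) = - m x" for x using add[of x "- x"] sublinear_zero[OF m(1)] by simp
  have "m (c *\<^sub>R x) = c * m x" for c x
  proof (cases "0 \<le> c")
    case True then show ?thesis by (rule sublinear_scaleR[OF m(1)])
  next
    case False
    then have "m ((- c) *\<^sub>R x) = - c * m x" by (intro sublinear_scaleR[OF m(1)]) simp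
    then show ?thesis using neg[of "c *\<^sub>R x"] by simp
  qed
  then have "linear m" by (intro linearI) (auto simp: add)
  with m(2) show ?thesis by blast
qed

section \<open>Finite systems of linear inequalities\<close>

definition comb_vec :: "(real \<times> 'v::real_vector \<times> real) list \<Rightarrow> 'v" where
  "comb_vec xs = (\<Sum>(\<nu>, d, r)\<leftarrow>xs. \<nu> *\<^sub>R d)"

definition comb_val :: "(real \<times> 'v::real_vector \<times> real) list \<Rightarrow> real" where
  "comb_val xs = (\<Sum>(\<nu>, d, r)\<leftarrow>xs. \<nu> * r)"

lemma comb_simps [simp]:
  "comb_vec [] = 0" "comb_vec ((\<nu>, d, r) # xs) = \<nu> *\<^sub>R d + comb_vec xs"
  "comb_val [] = 0" "comb_val ((\<nu>, d, r) # xs) = \<nu> * r + comb_val xs"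
  "comb_vec (xs @ ys) = comb_vec xs + comb_vec ys"
  "comb_val (xs @ ys) = comb_val xs + comb_val ys"
  by (auto simp: comb_vec_def comb_val_def)

lemma comb_scale:
  "comb_vec (map (\<lambda>(\<nu>, d, r). (c * \<nu>, d, r)) xs) = c *\<^sub>R comb_vec xs"
  "comb_val (map (\<lambda>(\<nu>, d, r). (c * \<nu>, d, r)) xs) = c * comb_val xs"
  by (induction xs) (auto simp: algebra_simps)

text \<open>A triple is a weight, a direction and a bound: the inequality
  \<open>\<phi> d \<le> r\<close> taken \<nu> times. With lists, adding combinations is
  concatenation, and a constraint may occur repeatedly.\<close>

definition combs :: "('v \<times> real) set \<Rightarrow> (real \<times> 'v \<times> real) list set" where
  "combs \<G> = {xs. \<forall>(\<nu>, d, r)\<in>set xs. 0 \<le> \<nu> \<and> (d, r) \<in> \<G>}"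

text \<open>\<open>L\<close> is the infimal convolution of \<open>P\<close> with the combined
  constraints. The hypothesis says that no nonnegative combination of constraints contradicts
  \<open>P\<close>, which keeps \<open>L\<close> finite with \<open>L 0 = 0\<close>. For a linear
  minorant of \<open>L\<close>, the empty list gives the bound by \<open>P\<close> and the singleton
  lists give the constraints.\<close>

theorem mazur_orlicz:
  fixes P :: "'v::real_vector \<Rightarrow> real"
  assumes P: "sublinear P"
    and cond: "\<And>xs. xs \<in> combs \<G> \<Longrightarrow> 0 \<le> comb_val xs + P (- comb_vec xs)"
  shows "\<exists>\<phi>. linear \<phi> \<and> (\<forall>x. \<phi> x \<le> P x) \<and> (\<forall>(d, r)\<in>\<G>. \<phi> d \<le> r)"
proof -
  define L where "L x = (INF xs\<in>combs \<G>. comb_val xs + P (x - comb_vec xs))" for x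
  have nil: "[] \<in> combs \<G>" by (simp add: combs_def)
  have low: "- P (- x) \<le> comb_val xs + P (x - comb_vec xs)" if "xs \<in> combs \<G>" for x xs
    using cond[OF that] sublinear_add[OF P, of "x - comb_vec xs" "- x"] by simp
  have bdd: "bdd_below ((\<lambda>xs. comb_val xs + P (x - comb_vec xs)) ` combs \<G>)" for x
    by (rule bdd_belowI2[of _ "- P (- x)"]) (use low in auto)
  have le: "L x \<le> comb_val xs + P (x - comb_vec xs)" if "xs \<in> combs \<G>" for x xs
    unfolding L_def by (rule cINF_lower[OF bdd that])
  have ge: "b \<le> L x" if "\<And>xs. xs \<in> combs \<G> \<Longrightarrow> b \<le> comb_val xs + P (x - comb_vec xs)" for b x
    unfolding L_def by (rule cINF_greatest) (use that nil in auto)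
  have "sublinear L"
  proof (rule sublinearI)
    fix x y
    have *: "L (x + y) \<le> (comb_val xs + P (x - comb_vec xs)) + (comb_val ys + P (y - comb_vec ys))"
      if "xs \<in> combs \<G>" "ys \<in> combs \<G>" for xs ys
    proof -
      have "xs @ ys \<in> combs \<G>" using that by (auto simp: combs_def)
      then show ?thesis using le[of "xs @ ys" "x + y"]
          sublinear_add[OF P, of "x - comb_vec xs" "y - comb_vec ys"]
        by (simp add: algebra_simps)
    qed
    have "L (x + y) - (comb_val xs + P (x - comb_vec xs)) \<le> L y" if "xs \<in> combs \<G>" for xs
      using *[OF that] by (intro ge) (simp add: algebra_simps)
    then have "L (x + y) - L y \<le> L x" by (intro ge) (simp add: algebra_simps)
    then show "L (x + y) \<le> L x + L y" by simp
  next
    fix c :: real and x assume c: "0 < c"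
    have "L (c *\<^sub>R x) / c \<le> comb_val xs + P (x - comb_vec xs)" if "xs \<in> combs \<G>" for xs
    proof -
      let ?ys = "map (\<lambda>(\<nu>, d, r). (c * \<nu>, d, r)) xs"
      have "?ys \<in> combs \<G>" using that c by (auto simp: combs_def)
      from le[OF this, of "c *\<^sub>R x"]
      have "L (c *\<^sub>R x) \<le> c * comb_val xs + P (c *\<^sub>R (x - comb_vec xs))"
        by (simp only: comb_scale scaleR_diff_right)
      also have "P (c *\<^sub>R (x - comb_vec xs)) = c * P (x - comb_vec xs)"
        using c by (intro sublinear_scaleR[OF P]) simp
      finally show ?thesis using c by (simp add: field_simps)
    qed
    then have "L (c *\<^sub>R x) / c \<le> L x" by (rule ge)
    then show "L (c *\<^sub>R x) \<le> c * L x" using c by (simp add: field_simps)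
  next
    have "L 0 \<le> 0" using le[OF nil, of 0] by (simp add: sublinear_zero[OF P])
    moreover have "0 \<le> L 0" by (rule ge) (use cond in simp)
    ultimately show "L 0 = 0" by simp
  qed
  then obtain \<phi> where \<phi>: "linear \<phi>" "\<And>x. \<phi> x \<le> L x" using sublinear_minorant_linear by blast
  have "\<phi> x \<le> P x" for x using \<phi>(2)[of x] le[OF nil, of x] by simp
  moreover have "\<phi> d \<le> r" if "(d, r) \<in> \<G>" for d r
    using \<phi>(2)[of d] le[of "[(1, d, r)]" d] that by (simp add: combs_def sublinear_zero[OF P])
  ultimately show ?thesis using \<phi>(1) by blast
qed

section \<open>Bounded functionals and subgradients of convex functions\<close>

lemma linear_bounded_blinfun:
  fixes \<phi> :: "'a::real_normed_vector \<Rightarrow> real"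
  assumes "linear \<phi>" "\<And>x. \<phi> x \<le> K * norm x"
  obtains \<xi> :: "'a \<Rightarrow>\<^sub>L real" where "\<And>x. \<xi> x = \<phi> x"
proof -
  have "\<bar>\<phi> x\<bar> \<le> K * norm x" for x
    using assms(2)[of x] assms(2)[of "- x"] linear_neg[OF assms(1), of x] by (simp add: abs_le_iff)
  then have "bounded_linear \<phi>"
    using assms(1) by (intro bounded_linear_intro[of _ K]) (auto simp: linear_add linear_scale mult.commute)
  then show thesis using that[of "Blinfun \<phi>"] by (simp add: bounded_linear_Blinfun_apply)
qed

lemma blinfun_norm_le:
  fixes \<xi> :: "'a::real_normed_vector \<Rightarrow>\<^sub>L real"
  assumes "0 \<le> K" "\<And>x. \<xi> x \<le> K * norm x"
  shows "norm \<xi> \<le> K"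
proof (rule norm_blinfun_bound[OF assms(1)])
  fix x show "norm (\<xi> x) \<le> K * norm x"
    using assms(2)[of x] assms(2)[of "- x"] by (simp add: blinfun.minus_right abs_le_iff)
qed

lemma blinfun_le_norm: "(\<xi> :: 'a::real_normed_vector \<Rightarrow>\<^sub>L real) x \<le> norm \<xi> * norm x"
  using norm_blinfun[of \<xi> x] by simp

text \<open>The subgradient inequalities, one for each \<open>h\<close>, form a Mazur--Orlicz system
  under \<open>L * norm\<close>, and convexity collapses every combination of them to a single
  one.\<close>

lemma convex_subgradient:
  fixes s :: "'a::real_normed_vector \<Rightarrow> real"
  assumes s: "convex_on UNIV s" and L: "\<And>h. s x - s (x + h) \<le> L * norm h" "0 \<le> L"
  obtains \<sigma> :: "'a \<Rightarrow>\<^sub>L real" where "\<And>h. \<sigma> h \<le> s (x + h) - s x"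
proof -
  define \<G> where "\<G> = range (\<lambda>h. (h, s (x + h) - s x))"
  \<comment> \<open>Jensen: a combination of total weight \<nu> dominates \<nu> times the one
    constraint at the averaged increment. Total weight 0 is kept apart because it has no
    average.\<close>
  have inv: "\<exists>\<nu>\<ge>0. (\<nu> = 0 \<longrightarrow> comb_vec xs = 0 \<and> comb_val xs = 0) \<and>
      (\<nu> > 0 \<longrightarrow> \<nu> * (s (x + comb_vec xs /\<^sub>R \<nu>) - s x) \<le> comb_val xs)"
    if "xs \<in> combs \<G>" for xs
    using that
  proof (induction xs)
    case Nil
    show ?case by (rule exI[of _ 0]) simp
  next
    case (Cons a xs)
    obtain \<mu> h where a: "a = (\<mu>, h, s (x + h) - s x)" "0 \<le> \<mu>"
      using Cons.prems by (auto simp: combs_def \<G>_def)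
    obtain \<nu> where \<nu>: "0 \<le> \<nu>" "\<nu> = 0 \<longrightarrow> comb_vec xs = 0 \<and> comb_val xs = 0"
      "\<nu> > 0 \<longrightarrow> \<nu> * (s (x + comb_vec xs /\<^sub>R \<nu>) - s x) \<le> comb_val xs"
      using Cons by (auto simp: combs_def)
    show ?case
    proof (cases "\<nu> = 0 \<or> \<mu> = 0")
      case True
      then show ?thesis using \<nu> a by (intro exI[of _ "\<nu> + \<mu>"]) auto
    next
      case False
      then have pos: "0 < \<nu>" "0 < \<mu>" using \<nu>(1) a(2) by auto
      let ?k = "comb_vec xs /\<^sub>R \<nu>"
      have w: "1 - \<mu> / (\<nu> + \<mu>) = \<nu> / (\<nu> + \<mu>)" using pos by (simp add: field_simps)
      have "s ((\<nu> / (\<nu> + \<mu>)) *\<^sub>R (x + ?k) + (\<mu> / (\<nu> + \<mu>)) *\<^sub>R (x + h))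
          \<le> \<nu> / (\<nu> + \<mu>) * s (x + ?k) + \<mu> / (\<nu> + \<mu>) * s (x + h)"
        using convex_onD[OF s, of "\<mu> / (\<nu> + \<mu>)" "x + ?k" "x + h"] pos by (simp add: w)
      moreover have "(\<nu> / (\<nu> + \<mu>)) *\<^sub>R (x + ?k) + (\<mu> / (\<nu> + \<mu>)) *\<^sub>R (x + h)
          = x + (\<mu> *\<^sub>R h + comb_vec xs) /\<^sub>R (\<nu> + \<mu>)"
      proof -
        have "(\<nu> / (\<nu> + \<mu>)) *\<^sub>R x + (\<mu> / (\<nu> + \<mu>)) *\<^sub>R x = x"
          using pos by (simp add: scaleR_left_distrib[symmetric] add_divide_distrib[symmetric])
        moreover have "(\<nu> / (\<nu> + \<mu>)) *\<^sub>R (x + ?k) + (\<mu> / (\<nu> + \<mu>)) *\<^sub>R (x + h)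
          = ((\<nu> / (\<nu> + \<mu>)) *\<^sub>R x + (\<mu> / (\<nu> + \<mu>)) *\<^sub>R x) + (\<mu> *\<^sub>R h + comb_vec xs) /\<^sub>R (\<nu> + \<mu>)"
          using pos by (simp add: scaleR_add_right divide_inverse mult.commute)
        ultimately show ?thesis by simp
      qed
      ultimately have "s (x + (\<mu> *\<^sub>R h + comb_vec xs) /\<^sub>R (\<nu> + \<mu>))
           \<le> (\<nu> * s (x + ?k) + \<mu> * s (x + h)) / (\<nu> + \<mu>)"
        by (simp add: add_divide_distrib)
      then have "(\<nu> + \<mu>) * s (x + (\<mu> *\<^sub>R h + comb_vec xs) /\<^sub>R (\<nu> + \<mu>))
           \<le> \<nu> * s (x + ?k) + \<mu> * s (x + h)"
        using pos by (simp add: pos_le_divide_eq mult.commute)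
      moreover have "\<nu> * s (x + ?k) - \<nu> * s x \<le> comb_val xs"
        using \<nu>(3) pos by (simp add: right_diff_distrib)
      ultimately have "(\<nu> + \<mu>) * (s (x + (\<mu> *\<^sub>R h + comb_vec xs) /\<^sub>R (\<nu> + \<mu>)) - s x)
           \<le> \<mu> * (s (x + h) - s x) + comb_val xs"
        by (simp add: right_diff_distrib distrib_right)
      then show ?thesis using a pos by (intro exI[of _ "\<nu> + \<mu>"]) auto
    qed
  qed
  have "0 \<le> comb_val xs + L * norm (- comb_vec xs)" if xs: "xs \<in> combs \<G>" for xs
  proof -
    obtain \<nu> where \<nu>: "0 \<le> \<nu>" "\<nu> = 0 \<longrightarrow> comb_vec xs = 0 \<and> comb_val xs = 0"
      "\<nu> > 0 \<longrightarrow> \<nu> * (s (x + comb_vec xs /\<^sub>R \<nu>) - s x) \<le> comb_val xs" using inv[OF xs] by blast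
    show ?thesis
    proof (cases "\<nu> = 0")
      case False
      then have "0 < \<nu>" using \<nu>(1) by simp
      moreover have "\<nu> * (s x - s (x + comb_vec xs /\<^sub>R \<nu>)) \<le> \<nu> * (L * norm (comb_vec xs /\<^sub>R \<nu>))"
        using \<open>0 < \<nu>\<close> by (intro mult_left_mono L(1)) auto
      moreover have "\<nu> * (L * norm (comb_vec xs /\<^sub>R \<nu>)) = L * norm (comb_vec xs)"
        using \<open>0 < \<nu>\<close> by simp
      moreover have "\<nu> * (s (x + comb_vec xs /\<^sub>R \<nu>) - s x) \<le> comb_val xs"
        using \<nu>(3) \<open>0 < \<nu>\<close> by blast
      ultimately show ?thesis unfolding norm_minus_cancel right_diff_distrib by linarith
    qed (use \<nu> in auto)
  qed
  then obtain \<phi> where \<phi>: "linear \<phi>" "\<And>h. \<phi> h \<le> L * norm h" "\<forall>(d, r)\<in>\<G>. \<phi> d \<le> r"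
    using mazur_orlicz[OF sublinear_norm[OF L(2)], of \<G>] by auto
  obtain \<sigma> :: "'a \<Rightarrow>\<^sub>L real" where \<sigma>: "\<And>h. \<sigma> h = \<phi> h" using linear_bounded_blinfun[OF \<phi>(1,2)] by blast
  show thesis by (rule that[of \<sigma>]) (use \<sigma> \<phi>(3) in \<open>auto simp: \<G>_def\<close>)
qed

text \<open>A subgradient of the norm at \<open>x\<close>; the increment \<open>- x\<close> forces
  the value \<open>norm x\<close>.\<close>

lemma norming_functional:
  obtains \<eta> :: "'a::real_normed_vector \<Rightarrow>\<^sub>L real" where "norm \<eta> \<le> 1" "\<eta> x = norm x"
proof -
  have 1: "convex_on UNIV (norm :: 'a \<Rightarrow> real)" using convex_on_dist[of UNIV "0::'a"] by simp
  have 2: "norm x - norm (x + h) \<le> 1 * norm h" for h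
    using norm_triangle_ineq4[of "x + h" h] by simp
  obtain \<eta> :: "'a \<Rightarrow>\<^sub>L real" where \<eta>: "\<And>h. \<eta> h \<le> norm (x + h) - norm x"
    using convex_subgradient[OF 1 2] by auto
  have "\<eta> h \<le> 1 * norm h" for h using \<eta>[of h] norm_triangle_ineq[of x h] by simp
  then have "norm \<eta> \<le> 1" by (intro blinfun_norm_le) auto
  moreover have "norm x \<le> \<eta> x" using \<eta>[of "- x"] by (simp add: blinfun.minus_right)
  ultimately show thesis using that blinfun_le_norm[of \<eta> x] mult_right_mono[of "norm \<eta>" 1 "norm x"]
    by auto
qed

section \<open>Separable subspaces and weak* sequential compactness\<close>

text \<open>Each list is finite, so it already lies in one of the increasing stages, and the results
  of all operations on it enter at the next stage.\<close>

lemma countable_closing_off: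
  fixes Op :: "'p::countable \<Rightarrow> 'a list \<Rightarrow> 'a set"
  assumes "countable E" and Op: "\<And>p xs. countable (Op p xs)"
  obtains D where "countable D" "E \<subseteq> D" "\<And>p xs. set xs \<subseteq> D \<Longrightarrow> Op p xs \<subseteq> D"
proof -
  define step where "step A = A \<union> (\<Union>p. \<Union>xs\<in>lists A. Op p xs)" for A
  define Dk where "Dk k = (step ^^ k) E" for k
  have Dk_Suc: "Dk (Suc k) = step (Dk k)" for k by (simp add: Dk_def)
  have cnt: "countable (Dk k)" for k
  proof (induction k)
    case (Suc k)
    have "countable (\<Union>p. \<Union>xs\<in>lists (Dk k). Op p xs)"
      by (intro countable_UN countable_lists Suc.IH Op countableI_type)
    with Suc.IH show ?case unfolding Dk_Suc step_def by simp
  qed (simp add: Dk_def assms(1))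
  have mono: "Dk k \<subseteq> Dk l" if "k \<le> l" for k l
    using that by (rule lift_Suc_mono_le[rotated]) (auto simp: Dk_Suc step_def)
  show thesis
  proof
    show "countable (\<Union>k. Dk k)" using cnt by auto
    show "E \<subseteq> (\<Union>k. Dk k)" using Dk_def[of 0] by auto
    fix p xs assume xs: "set xs \<subseteq> (\<Union>k. Dk k)"
    have "\<exists>k. set xs \<subseteq> Dk k" using xs
    proof (induction xs)
      case (Cons a xs)
      then obtain k l where "set xs \<subseteq> Dk k" "a \<in> Dk l" by auto
      then have "set (a # xs) \<subseteq> Dk (max k l)" using mono[of k "max k l"] mono[of l "max k l"] by auto
      then show ?case ..
    qed simp
    then obtain k where "xs \<in> lists (Dk k)" by auto
    then have "Op p xs \<subseteq> Dk (Suc k)" unfolding Dk_Suc step_def by blast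
    then show "Op p xs \<subseteq> (\<Union>k. Dk k)" by blast
  qed
qed

text \<open>A substitute for a subspace that is compatible with countability; the closure is a real
  subspace.\<close>

definition rational_subspace :: "'a::real_vector set \<Rightarrow> bool" where
  "rational_subspace D \<longleftrightarrow> D \<noteq> {} \<and> (\<forall>q::rat. \<forall>a\<in>D. \<forall>b\<in>D. of_rat q *\<^sub>R a + b \<in> D)"

lemma subspace_closure_rational:
  fixes D :: "'a::real_normed_vector set"
  assumes D: "rational_subspace D"
  shows "subspace (closure D)"
proof -
  obtain d where d: "d \<in> D" using D by (auto simp: rational_subspace_def)
  have "of_rat (- 1) *\<^sub>R d + d \<in> D" using D d unfolding rational_subspace_def by blast
  then have 0: "0 \<in> D" by (simp add: of_rat_minus)
  have lin: "c *\<^sub>R a + b \<in> closure D" if ab: "a \<in> closure D" "b \<in> closure D" for c a b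
  proof -
    obtain as where as: "\<And>n. as n \<in> D" "as \<longlonglongrightarrow> a" using ab(1) unfolding closure_sequential by blast
    obtain bs where bs: "\<And>n. bs n \<in> D" "bs \<longlonglongrightarrow> b" using ab(2) unfolding closure_sequential by blast
    have "\<exists>q::rat. \<bar>of_rat q - c\<bar> \<le> inverse (real (Suc n))" for n
    proof -
      have "c < c + inverse (real (Suc n))" by simp
      from of_rat_dense[OF this] obtain q :: rat
        where "c < of_rat q" "of_rat q < c + inverse (real (Suc n))" by blast
      then show ?thesis by (intro exI[of _ q]) linarith
    qed
    then obtain qs :: "nat \<Rightarrow> rat" where qs: "\<And>n. \<bar>of_rat (qs n) - c\<bar> \<le> inverse (real (Suc n))" by metis
    have "(\<lambda>n. of_rat (qs n) - c) \<longlonglongrightarrow> 0"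
      by (rule Lim_null_comparison[OF _ LIMSEQ_inverse_real_of_nat]) (use qs in \<open>simp add: eventuallyI\<close>)
    then have "(\<lambda>n. of_rat (qs n) :: real) \<longlonglongrightarrow> c" by (simp add: LIM_zero_iff)
    then have "(\<lambda>n. of_rat (qs n) *\<^sub>R as n + bs n) \<longlonglongrightarrow> c *\<^sub>R a + b"
      by (intro tendsto_intros as bs)
    moreover have "of_rat (qs n) *\<^sub>R as n + bs n \<in> D" for n
      using D as(1) bs(1) unfolding rational_subspace_def by blast
    ultimately show ?thesis unfolding closure_sequential by (auto intro: exI[of _ "\<lambda>n. of_rat (qs n) *\<^sub>R as n + bs n"])
  qed
  show ?thesis unfolding subspace_def
    using lin[of _ _ 1] lin[of _ 0] 0 closure_subset[of D] by auto
qed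

lemma separable_closure:
  assumes "countable D"
  shows "separable_space (top_of_set (closure D))"
  unfolding separable_space_def
  by (rule exI[of _ D]) (use assms closure_subset[of D] in \<open>auto simp: closure_of_subtopology Int_absorb1\<close>)

section \<open>Functionals on a subspace given as a set\<close>

lemma dual_on_bdd:
  assumes "\<phi> \<in> dual_on Y"
  shows "bdd_above ((\<lambda>y. \<bar>\<phi> y\<bar>) ` (Y \<inter> cball 0 1))"
proof -
  obtain K where K: "\<forall>x\<in>Y. \<bar>\<phi> x\<bar> \<le> K * norm x" using assms by (auto simp: dual_on_def)
  have "\<bar>\<phi> y\<bar> \<le> \<bar>K\<bar>" if "y \<in> Y \<inter> cball 0 1" for y
  proof -
    have "K * norm y \<le> \<bar>K\<bar> * 1" using that by (intro mult_mono) auto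
    moreover have "\<bar>\<phi> y\<bar> \<le> K * norm y" using K that by blast
    ultimately show ?thesis by simp
  qed
  then show ?thesis by (rule bdd_aboveI2)
qed

lemma dual_norm_on_ge:
  "\<phi> \<in> dual_on Y \<Longrightarrow> y \<in> Y \<Longrightarrow> norm y \<le> 1 \<Longrightarrow> \<bar>\<phi> y\<bar> \<le> dual_norm_on Y \<phi>"
  unfolding dual_norm_on_def by (rule cSUP_upper[OF _ dual_on_bdd]) auto

lemma dual_on_diff:
  assumes "\<phi> \<in> dual_on Y" "\<psi> \<in> dual_on Y"
  shows "(\<lambda>y. \<phi> y - \<psi> y) \<in> dual_on Y"
proof -
  obtain K K' where K: "\<forall>x\<in>Y. \<bar>\<phi> x\<bar> \<le> K * norm x" "\<forall>x\<in>Y. \<bar>\<psi> x\<bar> \<le> K' * norm x"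
    using assms by (auto simp: dual_on_def)
  have "\<bar>\<phi> y - \<psi> y\<bar> \<le> (K + K') * norm y" if "y \<in> Y" for y
    using bspec[OF K(1) that] bspec[OF K(2) that] unfolding distrib_right by linarith
  then have "\<exists>K. \<forall>y\<in>Y. \<bar>\<phi> y - \<psi> y\<bar> \<le> K * norm y" by blast
  then show ?thesis using assms unfolding dual_on_def by (simp add: algebra_simps)
qed

lemma linear_dual_on:
  assumes "linear \<phi>" "\<And>x. \<phi> x \<le> K * norm x"
  shows "\<phi> \<in> dual_on Y"
proof -
  have "\<bar>\<phi> x\<bar> \<le> K * norm x" for x
    using assms(2)[of x] assms(2)[of "- x"] linear_neg[OF assms(1), of x] by (simp add: abs_le_iff)
  then show ?thesis using assms(1) by (auto simp: dual_on_def linear_add linear_scale)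
qed

text \<open>Oscillation by more than \<delta> along \<open>M\<close>, with the gap located at
  \<open>a\<close>. Working with index sets instead of subsequences makes refinement mere
  inclusion.\<close>

definition splits :: "(nat \<Rightarrow> real) \<Rightarrow> nat set \<Rightarrow> real \<Rightarrow> real \<Rightarrow> bool" where
  "splits y M a \<delta> \<longleftrightarrow> infinite {n\<in>M. y n < a} \<and> infinite {n\<in>M. a + \<delta> < y n}"

text \<open>The limit is the infimum of the levels below which infinitely many terms lie, that is,
  the limit inferior.\<close>

lemma convergent_if_no_split:
  assumes bd: "\<And>n. \<bar>y n\<bar> \<le> K" and no: "\<And>a \<delta>. 0 < \<delta> \<Longrightarrow> \<not> splits y UNIV a \<delta>"
  shows "convergent y"
proof -
  define S where "S = {a. infinite {n. y n < a}}"
  have K: "- K \<le> y n" "y n \<le> K" for n using bd[of n] by auto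
  have "y n < K + 1" for n using K(2)[of n] by simp
  then have "K + 1 \<in> S" by (simp add: S_def)
  then have ne: "S \<noteq> {}" by auto
  have "{n. y n < a} = {}" if "a < - K" for a using K(1) that by (auto simp: not_less intro: order_trans less_imp_le)
  then have low: "- K \<le> a" if "a \<in> S" for a using that by (force simp: S_def not_less[symmetric])
  then have bdd: "bdd_below S" by (intro bdd_belowI)
  define \<alpha> where "\<alpha> = Inf S"
  have "y \<longlonglongrightarrow> \<alpha>"
  proof (rule LIMSEQ_I)
    fix r :: real assume r: "0 < r"
    have "\<exists>a\<in>S. a < \<alpha> + r / 3" using cInf_lessD[OF ne, of "\<alpha> + r / 3"] r by (simp add: \<alpha>_def)
    then obtain a where a: "a \<in> S" "a < \<alpha> + r / 3" by auto
    have "{n. y n < a} \<subseteq> {n. y n < \<alpha> + r / 3}" using a(2) by auto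
    then have "infinite {n. y n < \<alpha> + r / 3}" using a(1) by (auto simp: S_def dest: finite_subset)
    then have "finite {n. (\<alpha> + r / 3) + r / 3 < y n}"
      using no[of "r / 3" "\<alpha> + r / 3"] r by (auto simp: splits_def)
    moreover have "\<alpha> - r / 3 \<notin> S" using cInf_lower[OF _ bdd, of "\<alpha> - r / 3"] r by (auto simp: \<alpha>_def)
    then have "finite {n. y n < \<alpha> - r / 3}" by (simp add: S_def)
    ultimately have "finite ({n. (\<alpha> + r / 3) + r / 3 < y n} \<union> {n. y n < \<alpha> - r / 3})" by simp
    then obtain N where N: "\<forall>n\<in>{n. (\<alpha> + r / 3) + r / 3 < y n} \<union> {n. y n < \<alpha> - r / 3}. n < N"
      using finite_nat_set_iff_bounded by blast
    have "norm (y n - \<alpha>) < r" if "N \<le> n" for n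
    proof -
      have "\<not> ((\<alpha> + r / 3) + r / 3 < y n \<or> y n < \<alpha> - r / 3)" using N that by (auto simp: not_less[symmetric])
      then show ?thesis using r by (simp add: abs_less_iff)
    qed
    then show "\<exists>N. \<forall>n\<ge>N. norm (y n - \<alpha>) < r" by blast
  qed
  then show ?thesis by (auto simp: convergent_def)
qed

text \<open>The \<open>n\<close>-th term is taken from \<open>M n\<close>, so membership in
  \<open>M k\<close> holds from index \<open>k\<close> on and not merely eventually.\<close>

lemma diagonal_infinite_sets:
  fixes M :: "nat \<Rightarrow> nat set"
  assumes "\<And>k. infinite (M k)" "\<And>k. M (Suc k) \<subseteq> M k"
  obtains r where "strict_mono r" "\<And>k n. k \<le> n \<Longrightarrow> r n \<in> M k"
proof -
  have ex: "\<exists>m. m \<in> M k \<and> l < m" for k l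
  proof -
    have "\<not> M k \<subseteq> {..l}" using assms(1)[of k] finite_subset by blast
    then show ?thesis by (auto simp: not_le)
  qed
  have "\<exists>f. \<forall>n. f n \<in> M n \<and> f n < f (Suc n)"
    by (rule dependent_nat_choice) (use ex in blast)+
  then obtain r where r: "\<And>n. r n \<in> M n" "\<And>n. r n < r (Suc n)" by blast
  have "M n \<subseteq> M k" if "k \<le> n" for k n
    using that by (rule lift_Suc_antimono_le[rotated]) (rule assms(2))
  with r show thesis by (intro that[of r]) (simp add: strict_mono_Suc_iff, blast)
qed

text \<open>\<open>P\<close> is the limit superior, written as the infimum of the eventual upper
  bounds. Its linear minorant replaces a weak* cluster point before any convergent subsequence is
  available; applied to \<open>- x\<close>, the last property also turns eventual lower bounds into
  lower bounds.\<close>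

lemma eventually_le_sublinear_minorant:
  fixes \<xi> :: "nat \<Rightarrow> 'a::real_normed_vector \<Rightarrow>\<^sub>L real"
  assumes K: "\<And>n. norm (\<xi> n) \<le> K"
  obtains \<phi> where "linear \<phi>" "\<And>x. \<phi> x \<le> K * norm x"
    "\<And>x a. eventually (\<lambda>n. \<xi> n x \<le> a) sequentially \<Longrightarrow> \<phi> x \<le> a"
proof -
  define S where "S x = {a. eventually (\<lambda>n. \<xi> n x \<le> a) sequentially}" for x
  define P where "P x = Inf (S x)" for x
  have ab: "\<bar>\<xi> n x\<bar> \<le> K * norm x" for n x
    using norm_blinfun[of "\<xi> n" x] mult_right_mono[OF K[of n], of "norm x"] by simp
  have KS: "K * norm x \<in> S x" for x
    using ab[of _ x] unfolding S_def by (auto simp: abs_le_iff)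
  have low: "- K * norm x \<le> a" if a: "a \<in> S x" for x a
  proof -
    have "eventually (\<lambda>n. - K * norm x \<le> a) sequentially"
      using a unfolding S_def mem_Collect_eq
    proof (rule eventually_mono)
      fix n assume "\<xi> n x \<le> a"
      then show "- K * norm x \<le> a" using ab[of n x] by (simp add: abs_le_iff)
    qed
    then show ?thesis by simp
  qed
  have bdd: "bdd_below (S x)" for x using low by (intro bdd_belowI)
  have le: "P x \<le> a" if "a \<in> S x" for a x unfolding P_def by (rule cInf_lower[OF that bdd])
  have ge: "b \<le> P x" if "\<And>a. a \<in> S x \<Longrightarrow> b \<le> a" for b x
    unfolding P_def by (rule cInf_greatest) (use KS that in auto)
  have "sublinear P"
  proof (rule sublinearI)
    fix x y
    have *: "P (x + y) \<le> a + b" if "a \<in> S x" "b \<in> S y" for a b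
    proof (rule le)
      have "eventually (\<lambda>n. \<xi> n x \<le> a \<and> \<xi> n y \<le> b) sequentially"
        using that by (auto simp: S_def eventually_conj)
      then show "a + b \<in> S (x + y)" unfolding S_def mem_Collect_eq
        by (rule eventually_mono) (simp add: blinfun.add_right)
    qed
    have "P (x + y) - a \<le> P y" if "a \<in> S x" for a
      by (rule ge) (use *[OF that] in \<open>simp add: diff_le_eq add.commute\<close>)
    then have "P (x + y) - P y \<le> P x" by (intro ge) (simp add: algebra_simps)
    then show "P (x + y) \<le> P x + P y" by simp
  next
    fix c :: real and x assume c: "0 < c"
    have "P (c *\<^sub>R x) / c \<le> a" if "a \<in> S x" for a
    proof -
      have "c * a \<in> S (c *\<^sub>R x)" using that c unfolding S_def
        by (auto elim!: eventually_mono simp: blinfun.scaleR_right)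
      then show ?thesis using le c by (fastforce simp: pos_divide_le_eq mult.commute)
    qed
    then have "P (c *\<^sub>R x) / c \<le> P x" by (rule ge)
    then show "P (c *\<^sub>R x) \<le> c * P x" using c by (simp add: field_simps)
  next
    have "P 0 \<le> 0" by (rule le) (simp add: S_def)
    moreover have "0 \<le> P 0" by (rule ge) (use low[of _ 0] in simp)
    ultimately show "P 0 = 0" by simp
  qed
  then obtain \<phi> where \<phi>: "linear \<phi>" "\<And>x. \<phi> x \<le> P x" using sublinear_minorant_linear by blast
  show thesis
  proof (rule that[OF \<phi>(1)])
    show "\<phi> x \<le> K * norm x" for x using \<phi>(2)[of x] le[OF KS, of x] by simp
    show "\<phi> x \<le> a" if "eventually (\<lambda>n. \<xi> n x \<le> a) sequentially" for x a
      using \<phi>(2)[of x] le[of a x] that by (simp add: S_def)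
  qed
qed

text \<open>If the conclusion failed, a tree of subsequences with separating vectors would produce a
  separable subspace whose dual is not separable (Hagler and Johnson).\<close>

lemma uniformly_splitting_contradiction:
  fixes \<xi> :: "nat \<Rightarrow> 'a::banach \<Rightarrow>\<^sub>L real"
  assumes asp: "asplund_space TYPE('a)" and K: "\<And>n. norm (\<xi> n) \<le> K" and \<delta>: "0 < \<delta>"
    and M0: "infinite M0"
    and spl: "\<And>M. infinite M \<Longrightarrow> M \<subseteq> M0 \<Longrightarrow> \<exists>x a. norm x \<le> 1 \<and> splits (\<lambda>n. \<xi> n x) M a \<delta>"
  shows False
proof -
  obtain X A where XA: "\<And>M. infinite M \<Longrightarrow> M \<subseteq> M0 \<Longrightarrow> norm (X M) \<le> 1 \<and> splits (\<lambda>n. \<xi> n (X M)) M (A M) \<delta>"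
    using spl by metis
  define next_set where
    "next_set b M = {n\<in>M. if b then A M + \<delta> < \<xi> n (X M) else \<xi> n (X M) < A M}" for b M
  \<comment> \<open>A word of choices names a node of the tree; its head is the most recent
    choice.\<close>
  define T where "T s = foldr next_set s M0" for s
  have T_Cons: "T (b # s) = next_set b (T s)" for b s by (simp add: T_def)
  have T: "infinite (T s) \<and> T s \<subseteq> M0" for s
  proof (induction s)
    case Nil then show ?case by (simp add: T_def M0)
  next
    case (Cons b s)
    then show ?case using XA[of "T s"] by (cases b) (auto simp: T_Cons next_set_def splits_def)
  qed
  define E where "E = range (\<lambda>s. X (T s))"
  have "countable E" unfolding E_def by simp
  \<comment> \<open>The only operation forms rational combinations of two vectors; lists of other
    lengths produce nothing.\<close>
  obtain D where D: "countable D" "E \<subseteq> D"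
    "\<And>p xs. set xs \<subseteq> D \<Longrightarrow> (\<lambda>(p::rat) xs. case xs of [a, b] \<Rightarrow> {of_rat p *\<^sub>R a + b} | _ \<Rightarrow> {}) p xs \<subseteq> D"
    by (rule countable_closing_off[OF \<open>countable E\<close>, of "\<lambda>(p::rat) xs. case xs of [a, b] \<Rightarrow> {of_rat p *\<^sub>R a + b} | _ \<Rightarrow> {}"])
      (auto split: list.split)
  have rD: "rational_subspace D" unfolding rational_subspace_def
  proof (intro conjI allI ballI)
    show "D \<noteq> {}" using D(2) by (auto simp: E_def)
    show "of_rat q *\<^sub>R a + b \<in> D" if "a \<in> D" "b \<in> D" for q a b using D(3)[of "[a, b]" q] that by simp
  qed
  let ?Y = "closure D"
  have "separable_dual ?Y" using asp subspace_closure_rational[OF rD] separable_closure[OF D(1)]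
    unfolding asplund_space_def by blast
  then obtain B where B: "countable B" "B \<subseteq> dual_on ?Y"
    "\<And>\<phi> e. \<phi> \<in> dual_on ?Y \<Longrightarrow> 0 < e \<Longrightarrow> \<exists>\<psi>\<in>B. dual_norm_on ?Y (\<lambda>y. \<phi> y - \<psi> y) < e"
    unfolding separable_dual_def by blast
  have "(\<lambda>_. 0) \<in> dual_on ?Y" by (rule linear_dual_on[of _ 0]) (auto simp: linear_iff)
  then have "B \<noteq> {}" using B(3)[of "\<lambda>_. 0" 1] by auto
  define \<psi> where "\<psi> = from_nat_into B"
  have \<psi>: "range \<psi> = B" unfolding \<psi>_def by (rule range_from_nat_into[OF \<open>B \<noteq> {}\<close> B(1)])
  \<comment> \<open>Diagonalization: at level \<open>k\<close> the branch turns to the side of the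
    gap away from the \<open>k\<close>-th dense functional, so that the functional built along the
    branch differs from it by at least \<open>\<delta> / 2\<close> at a vector of the unit
    ball.\<close>
  define s where "s = rec_nat [] (\<lambda>k s. (\<psi> k (X (T s)) \<le> A (T s) + \<delta> / 2) # s)"
  have s: "s (Suc k) = (\<psi> k (X (T (s k))) \<le> A (T (s k)) + \<delta> / 2) # s k" for k by (simp add: s_def)
  define M where "M k = T (s k)" for k
  have MS: "M (Suc k) = next_set (\<psi> k (X (M k)) \<le> A (M k) + \<delta> / 2) (M k)" for k
    by (simp add: M_def s T_Cons)
  have "M (Suc k) \<subseteq> M k" for k by (auto simp: MS next_set_def)
  moreover have "infinite (M k)" for k using T by (simp add: M_def)
  ultimately obtain r where r: "strict_mono r" "\<And>k n. k \<le> n \<Longrightarrow> r n \<in> M k"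
    using diagonal_infinite_sets[of M] by blast
  obtain \<phi> where \<phi>: "linear \<phi>" "\<And>x. \<phi> x \<le> K * norm x"
    "\<And>x a. eventually (\<lambda>n. \<xi> (r n) x \<le> a) sequentially \<Longrightarrow> \<phi> x \<le> a"
    using eventually_le_sublinear_minorant[of "\<lambda>n. \<xi> (r n)" K] K by blast
  have XY: "X (M k) \<in> ?Y" "norm (X (M k)) \<le> 1" for k
    using D(2) closure_subset[of D] XA[of "M k"] T by (auto simp: E_def M_def)
  have far: "\<delta> / 2 \<le> \<bar>\<phi> (X (M k)) - \<psi> k (X (M k))\<bar>" for k
  proof (cases "\<psi> k (X (M k)) \<le> A (M k) + \<delta> / 2")
    case True
    have "eventually (\<lambda>n. \<xi> (r n) (- X (M k)) \<le> - (A (M k) + \<delta>)) sequentially"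
    proof (rule eventually_sequentiallyI[of "Suc k"])
      fix n assume "Suc k \<le> n"
      then have "r n \<in> M (Suc k)" by (rule r(2))
      then show "\<xi> (r n) (- X (M k)) \<le> - (A (M k) + \<delta>)"
        using True by (simp add: MS next_set_def blinfun.minus_right)
    qed
    from \<phi>(3)[OF this] show ?thesis using True unfolding linear_neg[OF \<phi>(1)] by linarith
  next
    case False
    have "eventually (\<lambda>n. \<xi> (r n) (X (M k)) \<le> A (M k)) sequentially"
    proof (rule eventually_sequentiallyI[of "Suc k"])
      fix n assume "Suc k \<le> n"
      then have "r n \<in> M (Suc k)" by (rule r(2))
      then show "\<xi> (r n) (X (M k)) \<le> A (M k)" using False by (simp add: MS next_set_def)
    qed
    from \<phi>(3)[OF this] show ?thesis using False by linarith
  qed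
  have \<phi>Y: "\<phi> \<in> dual_on ?Y" using \<phi>(1,2) by (rule linear_dual_on)
  obtain k where k: "dual_norm_on ?Y (\<lambda>y. \<phi> y - \<psi> k y) < \<delta> / 2"
    using B(3)[OF \<phi>Y, of "\<delta> / 2"] \<delta> \<psi> by auto
  have "\<psi> k \<in> dual_on ?Y" using B(2) \<psi> by auto
  from dual_norm_on_ge[OF dual_on_diff[OF \<phi>Y this] XY[of k]] far[of k] k show False by simp
qed

text \<open>The index sets are refined so that the \<open>k\<close>-th one admits no splitting of
  width \<open>1 / (k + 1)\<close> at any vector of the unit ball; without such refinements there
  would be uniform splitting, which is impossible in an Asplund space. A diagonal sequence then has
  no oscillation left at any point.\<close>

theorem weak_star_sequentially_compact:
  fixes \<xi> :: "nat \<Rightarrow> 'a::banach \<Rightarrow>\<^sub>L real"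
  assumes asp: "asplund_space TYPE('a)" and K: "\<And>n. norm (\<xi> n) \<le> K"
  obtains \<eta> :: "'a \<Rightarrow>\<^sub>L real" and r where "strict_mono r" "\<And>v. (\<lambda>n. \<xi> (r n) v) \<longlonglongrightarrow> \<eta> v" "norm \<eta> \<le> K"
proof -
  define good where "good M \<delta> \<longleftrightarrow> (\<forall>x a. norm x \<le> 1 \<longrightarrow> \<not> splits (\<lambda>n. \<xi> n x) M a \<delta>)" for M \<delta>
  have ex: "\<exists>M'. infinite M' \<and> M' \<subseteq> M \<and> good M' \<delta>" if "infinite M" "0 < \<delta>" for M \<delta>
  proof (rule ccontr)
    assume neg: "\<not> ?thesis"
    show False
    proof (rule uniformly_splitting_contradiction[OF asp K that(2,1)])
      fix M' assume "infinite M'" "M' \<subseteq> M"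
      then have "\<not> good M' \<delta>" using neg by blast
      then show "\<exists>x a. norm x \<le> 1 \<and> splits (\<lambda>n. \<xi> n x) M' a \<delta>" by (auto simp: good_def)
    qed
  qed
  have "\<exists>M. \<forall>k. (infinite (M k) \<and> good (M k) (inverse (real (Suc k)))) \<and> M (Suc k) \<subseteq> M k"
  proof (rule dependent_nat_choice)
    show "\<exists>M. infinite M \<and> good M (inverse (real (Suc 0)))" using ex[of UNIV "inverse (real (Suc 0))"] by auto
    show "\<exists>M'. (infinite M' \<and> good M' (inverse (real (Suc (Suc k))))) \<and> M' \<subseteq> M"
      if "infinite M \<and> good M (inverse (real (Suc k)))" for M k
      using ex[of M "inverse (real (Suc (Suc k)))"] that by auto
  qed
  then obtain M where M: "\<And>k. infinite (M k)" "\<And>k. good (M k) (inverse (real (Suc k)))" "\<And>k. M (Suc k) \<subseteq> M k"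
    by blast
  obtain r where r: "strict_mono r" "\<And>k n. k \<le> n \<Longrightarrow> r n \<in> M k"
    using diagonal_infinite_sets[of M] M(1,3) by blast
  have ab: "\<bar>\<xi> n x\<bar> \<le> K * norm x" for n x
    using norm_blinfun[of "\<xi> n" x] mult_right_mono[OF K[of n], of "norm x"] by simp
  have conv1: "convergent (\<lambda>n. \<xi> (r n) x)" if x: "norm x \<le> 1" for x
  proof (rule convergent_if_no_split)
    show "\<bar>\<xi> (r n) x\<bar> \<le> K * norm x" for n by (rule ab)
    fix a \<delta> :: real assume "0 < \<delta>"
    then obtain k where k: "inverse (real (Suc k)) < \<delta>" using reals_Archimedean by blast
    show "\<not> splits (\<lambda>n. \<xi> (r n) x) UNIV a \<delta>"
    proof
      assume sp: "splits (\<lambda>n. \<xi> (r n) x) UNIV a \<delta>"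
      \<comment> \<open>All but the first \<open>k\<close> diagonal terms lie in \<open>M k\<close>,
        so infinite sets of diagonal indices yield infinite subsets of \<open>M k\<close>.\<close>
      have tr: "infinite {n\<in>M k. Q n}" if inf: "infinite {n. Q (r n)}" for Q
      proof -
        have "infinite ({n. Q (r n)} - {..<k})" using inf by (simp add: Diff_infinite_finite)
        then have "infinite (r ` ({n. Q (r n)} - {..<k}))"
          using r(1) by (simp add: finite_image_iff strict_mono_imp_inj_on inj_on_subset)
        moreover have "r ` ({n. Q (r n)} - {..<k}) \<subseteq> {n\<in>M k. Q n}" using r(2) by auto
        ultimately show ?thesis using finite_subset by blast
      qed
      have "infinite {n\<in>M k. \<xi> n x < a}" "infinite {n\<in>M k. a + \<delta> < \<xi> n x}"
        using tr[of "\<lambda>n. \<xi> n x < a"] tr[of "\<lambda>n. a + \<delta> < \<xi> n x"] sp by (auto simp: splits_def)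
      moreover have "{n\<in>M k. a + \<delta> < \<xi> n x} \<subseteq> {n\<in>M k. a + inverse (real (Suc k)) < \<xi> n x}" using k by auto
      ultimately have "splits (\<lambda>n. \<xi> n x) (M k) a (inverse (real (Suc k)))"
        unfolding splits_def using finite_subset by blast
      then show False using M(2)[of k] x unfolding good_def by blast
    qed
  qed
  have conv: "convergent (\<lambda>n. \<xi> (r n) x)" for x
  proof (cases "x = 0")
    case False
    have "convergent (\<lambda>n. \<xi> (r n) (x /\<^sub>R norm x))" by (rule conv1) (simp add: False)
    then have "convergent (\<lambda>n. norm x * \<xi> (r n) (x /\<^sub>R norm x))" by (intro convergent_mult convergent_const)
    moreover have "norm x * \<xi> (r n) (x /\<^sub>R norm x) = \<xi> (r n) x" for n
      using False by (simp add: blinfun.scaleR_right)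
    ultimately show ?thesis by (simp only:)
  qed (simp add: convergent_const)
  define \<phi> where "\<phi> x = lim (\<lambda>n. \<xi> (r n) x)" for x
  have lim: "(\<lambda>n. \<xi> (r n) x) \<longlonglongrightarrow> \<phi> x" for x
    using conv unfolding \<phi>_def by (rule convergent_LIMSEQ_iff[THEN iffD1])
  have "linear \<phi>"
  proof (rule linearI)
    fix x y c
    have "(\<lambda>n. \<xi> (r n) (x + y)) \<longlonglongrightarrow> \<phi> x + \<phi> y"
      unfolding blinfun.add_right by (intro tendsto_add lim)
    then show "\<phi> (x + y) = \<phi> x + \<phi> y" using lim LIMSEQ_unique by blast
    have "(\<lambda>n. \<xi> (r n) (c *\<^sub>R x)) \<longlonglongrightarrow> c *\<^sub>R \<phi> x"
      unfolding blinfun.scaleR_right by (intro tendsto_scaleR tendsto_const lim)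
    then show "\<phi> (c *\<^sub>R x) = c *\<^sub>R \<phi> x" using lim LIMSEQ_unique by blast
  qed
  moreover have le: "\<phi> x \<le> K * norm x" for x
    by (rule LIMSEQ_le_const2[OF lim]) (use ab in \<open>auto simp: abs_le_iff\<close>)
  ultimately obtain \<eta> :: "'a \<Rightarrow>\<^sub>L real" where \<eta>: "\<And>x. \<eta> x = \<phi> x" using linear_bounded_blinfun by blast
  have "0 \<le> K" using K[of 0] norm_ge_zero order_trans by blast
  then have "norm \<eta> \<le> K" by (intro blinfun_norm_le) (simp_all add: \<eta> le)
  then show thesis by (intro that[OF r(1)]) (use lim \<eta> in simp_all)
qed

section \<open>Smooth approximation of the norm along a subspace with separable dual\<close>

text \<open>For convex continuous functions this is Frechet differentiability in the directions of
  \<open>Y\<close>, stated by second differences so that no derivative has to be named. The base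
  point may lie outside \<open>Y\<close>.\<close>

definition smooth_along :: "'a::real_normed_vector set \<Rightarrow> ('a \<Rightarrow> real) \<Rightarrow> 'a \<Rightarrow> bool" where
  "smooth_along Y s x \<longleftrightarrow>
     (\<forall>\<epsilon>>0. \<exists>\<delta>>0. \<forall>h\<in>Y. norm h < \<delta> \<longrightarrow> s (x + h) + s (x - h) - 2 * s x \<le> \<epsilon> * norm h)"

lemma dual_norm_on_le:
  assumes "0 \<in> Y" "\<And>y. y \<in> Y \<Longrightarrow> norm y \<le> 1 \<Longrightarrow> \<bar>\<phi> y\<bar> \<le> b"
  shows "dual_norm_on Y \<phi> \<le> b"
  unfolding dual_norm_on_def
proof (rule cSUP_least)
  have "0 \<in> Y \<inter> cball 0 1" using assms(1) by simp
  then show "Y \<inter> cball 0 1 \<noteq> {}" by blast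
qed (use assms(2) in simp)

lemma dual_norm_on_nonneg: "0 \<in> Y \<Longrightarrow> \<phi> \<in> dual_on Y \<Longrightarrow> 0 \<le> dual_norm_on Y \<phi>"
  using dual_norm_on_ge[of \<phi> Y 0] by auto

lemma dual_norm_on_bound:
  assumes Y: "subspace Y" and \<phi>: "\<phi> \<in> dual_on Y" and y: "y \<in> Y"
  shows "\<bar>\<phi> y\<bar> \<le> dual_norm_on Y \<phi> * norm y"
proof (cases "y = 0")
  case True
  have "\<phi> (0 *\<^sub>R y) = 0 * \<phi> y" using \<phi> y unfolding dual_on_def by blast
  then show ?thesis using True by simp
next
  case False
  have "y /\<^sub>R norm y \<in> Y" using Y y by (simp add: subspace_scale)
  then have "\<bar>\<phi> (y /\<^sub>R norm y)\<bar> \<le> dual_norm_on Y \<phi>" using False by (intro dual_norm_on_ge \<phi>) auto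
  moreover have "\<phi> (y /\<^sub>R norm y) = \<phi> y / norm y"
    using \<phi> y unfolding dual_on_def by (simp add: divide_inverse mult.commute)
  ultimately show ?thesis using False by (simp add: abs_divide pos_divide_le_eq)
qed

lemma blinfun_dual_on: "blinfun_apply \<eta> \<in> dual_on Y"
  for \<eta> :: "'a::real_normed_vector \<Rightarrow>\<^sub>L real"
  by (rule linear_dual_on[OF _ blinfun_le_norm])
    (auto simp: linear_iff blinfun.add_right blinfun.scaleR_right)

text \<open>The parallelogram identity gives equality at \<open>m = (a + b) / 2\<close>, and a
  smaller \<open>m\<close> only enlarges the right side.\<close>

lemma weighted_square_gap:
  fixes a b m :: real
  assumes "0 \<le> m" "m \<le> (a + b) / 2"
  shows "(a - b)\<^sup>2 / 4 \<le> (a\<^sup>2 + b\<^sup>2) / 2 - m\<^sup>2"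
proof -
  have "m\<^sup>2 \<le> ((a + b) / 2)\<^sup>2" using assms by (intro power_mono) auto
  then show ?thesis by (simp add: power2_eq_square algebra_simps) (simp add: field_simps)
qed

text \<open>The rotundity of \<open>N\<close> toward the dense functionals \<open>\<phi> j\<close> forces near-maximizers of
  \<open>\<eta> x - \<kappa> N \<eta>\<close> to cluster in norm around the maximizer, which gives smoothness of the supremum
  (as in Smulian's test).\<close>

locale separable_dual_smoothing =
  fixes Y :: "'a::banach set" and \<phi> :: "nat \<Rightarrow> 'a \<Rightarrow> real" and \<kappa> :: real
  assumes asp: "asplund_space TYPE('a)" and Y: "subspace Y" and \<kappa>: "0 < \<kappa>"
    and \<phi>: "\<And>j. \<phi> j \<in> dual_on Y"
    and dense: "\<And>\<psi> e. \<psi> \<in> dual_on Y \<Longrightarrow> 0 < e \<Longrightarrow> \<exists>j. dual_norm_on Y (\<lambda>y. \<psi> y - \<phi> j y) < e"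
begin

definition v :: "nat \<Rightarrow> ('a \<Rightarrow>\<^sub>L real) \<Rightarrow> real" where
  "v j \<eta> = dual_norm_on Y (\<lambda>y. \<eta> y - \<phi> j y)"

text \<open>Normalized so that the \<open>j\<close>-th term of \<open>N\<close> is at most
  \<open>(1 / 2) ^ Suc j\<close> on the unit ball; hence \<open>N\<close> lies between 0 and 1
  there.\<close>

definition c :: "nat \<Rightarrow> real" where
  "c j = (1 / 2) ^ Suc j / (1 + dual_norm_on Y (\<phi> j))\<^sup>2"

definition N :: "('a \<Rightarrow>\<^sub>L real) \<Rightarrow> real" where
  "N \<eta> = (\<Sum>j. c j * (v j \<eta>)\<^sup>2)"

text \<open>Without \<open>N\<close> the supremum would be the norm; the penalty lowers it by at
  most \<kappa>.\<close>

definition p :: "'a \<Rightarrow> real" where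
  "p x = (SUP \<eta>\<in>cball 0 1. blinfun_apply \<eta> x - \<kappa> * N \<eta>)"

lemma zero_Y: "0 \<in> Y" by (rule subspace_0[OF Y])

lemma vdual: "(\<lambda>y. blinfun_apply \<eta> y - \<phi> j y) \<in> dual_on Y"
  by (intro dual_on_diff blinfun_dual_on \<phi>)

lemma v_nonneg: "0 \<le> v j \<eta>"
  unfolding v_def by (rule dual_norm_on_nonneg[OF zero_Y vdual])

lemma c_pos: "0 < c j"
  unfolding c_def using dual_norm_on_nonneg[OF zero_Y \<phi>[of j]] by (intro divide_pos_pos) auto

lemma v_ge: "y \<in> Y \<Longrightarrow> norm y \<le> 1 \<Longrightarrow> \<bar>blinfun_apply \<eta> y - \<phi> j y\<bar> \<le> v j \<eta>"
  unfolding v_def by (rule dual_norm_on_ge[OF vdual])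

lemma v_le: "norm \<eta> \<le> 1 \<Longrightarrow> v j \<eta> \<le> 1 + dual_norm_on Y (\<phi> j)"
  unfolding v_def
proof (rule dual_norm_on_le[OF zero_Y])
  fix y assume "norm \<eta> \<le> 1" "y \<in> Y" "norm y \<le> 1"
  then have "\<bar>\<eta> y\<bar> \<le> 1 * 1"
    using norm_blinfun[of \<eta> y] mult_mono[of "norm \<eta>" 1 "norm y" 1] by simp
  moreover have "\<bar>\<phi> j y\<bar> \<le> dual_norm_on Y (\<phi> j)" by (rule dual_norm_on_ge[OF \<phi>]) fact+
  ultimately show "\<bar>\<eta> y - \<phi> j y\<bar> \<le> 1 + dual_norm_on Y (\<phi> j)" by linarith
qed

lemma term_le: "norm \<eta> \<le> 1 \<Longrightarrow> c j * (v j \<eta>)\<^sup>2 \<le> (1 / 2) ^ Suc j"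
proof -
  assume "norm \<eta> \<le> 1"
  then have "(v j \<eta>)\<^sup>2 \<le> (1 + dual_norm_on Y (\<phi> j))\<^sup>2" by (intro power_mono v_le v_nonneg)
  moreover have "0 < (1 + dual_norm_on Y (\<phi> j))\<^sup>2"
    using dual_norm_on_nonneg[OF zero_Y \<phi>[of j]] by simp
  ultimately have "(1 / 2) ^ Suc j * (v j \<eta>)\<^sup>2 / (1 + dual_norm_on Y (\<phi> j))\<^sup>2 \<le> (1 / 2) ^ Suc j * 1"
    by (subst pos_divide_le_eq) (auto intro!: mult_left_mono)
  then show ?thesis by (simp add: c_def)
qed

lemma term_nonneg: "0 \<le> c j * (v j \<eta>)\<^sup>2"
  using c_pos[of j] by simp

lemma summable_N: "norm \<eta> \<le> 1 \<Longrightarrow> summable (\<lambda>j. c j * (v j \<eta>)\<^sup>2)"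
  by (rule summable_comparison_test'[OF sums_summable[OF power_half_series], of 0])
    (use term_le term_nonneg in auto)

lemma N_nonneg: "norm \<eta> \<le> 1 \<Longrightarrow> 0 \<le> N \<eta>"
  unfolding N_def by (rule suminf_nonneg[OF summable_N term_nonneg])

lemma N_le_1: "norm \<eta> \<le> 1 \<Longrightarrow> N \<eta> \<le> 1"
  using suminf_le[OF term_le summable_N sums_summable[OF power_half_series], of \<eta>]
  unfolding N_def sums_unique[OF power_half_series, symmetric] by simp

lemma p_ge: "norm \<eta> \<le> 1 \<Longrightarrow> blinfun_apply \<eta> x - \<kappa> * N \<eta> \<le> p x"
  unfolding p_def
proof (rule cSUP_upper)
  show "bdd_above ((\<lambda>\<eta>. blinfun_apply \<eta> x - \<kappa> * N \<eta>) ` cball 0 1)"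
  proof (rule bdd_aboveI2)
    fix \<eta> :: "'a \<Rightarrow>\<^sub>L real" assume "\<eta> \<in> cball 0 1"
    then have "norm \<eta> \<le> 1" by simp
    then have "\<eta> x \<le> 1 * norm x" "0 \<le> \<kappa> * N \<eta>"
      using blinfun_le_norm[of \<eta> x] mult_right_mono[of "norm \<eta>" 1 "norm x"] N_nonneg[of \<eta>] \<kappa> by auto
    then show "\<eta> x - \<kappa> * N \<eta> \<le> norm x" by simp
  qed
qed simp

lemma p_least: "(\<And>\<eta>. norm \<eta> \<le> 1 \<Longrightarrow> blinfun_apply \<eta> x - \<kappa> * N \<eta> \<le> b) \<Longrightarrow> p x \<le> b"
  unfolding p_def by (rule cSUP_least) simp_all

lemma p_approx: "0 < e \<Longrightarrow> \<exists>\<eta>. norm \<eta> \<le> 1 \<and> p x - e < blinfun_apply \<eta> x - \<kappa> * N \<eta>"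
  using p_least[of x "p x - e"] by (force simp: not_less)

lemma blinfun_ball_le: "norm \<eta> \<le> 1 \<Longrightarrow> blinfun_apply \<eta> x \<le> norm x" for \<eta> :: "'a \<Rightarrow>\<^sub>L real"
  using blinfun_le_norm[of \<eta> x] mult_right_mono[of "norm \<eta>" 1 "norm x"] by simp

lemma p_le_norm: "p x \<le> norm x"
proof (rule p_least)
  fix \<eta> :: "'a \<Rightarrow>\<^sub>L real" assume "norm \<eta> \<le> 1"
  then have "\<eta> x \<le> norm x" "0 \<le> \<kappa> * N \<eta>" using blinfun_ball_le N_nonneg \<kappa> by simp_all
  then show "\<eta> x - \<kappa> * N \<eta> \<le> norm x" by linarith
qed

lemma p_ge_norm: "norm x - \<kappa> \<le> p x"
proof -
  obtain \<eta> :: "'a \<Rightarrow>\<^sub>L real" where \<eta>: "norm \<eta> \<le> 1" "\<eta> x = norm x" by (rule norming_functional)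
  have "\<kappa> * N \<eta> \<le> \<kappa> * 1" using N_le_1[OF \<eta>(1)] \<kappa> by (intro mult_left_mono) auto
  then show ?thesis using p_ge[OF \<eta>(1), of x] \<eta>(2) by simp
qed

lemma p_lipschitz: "p x - p y \<le> norm (x - y)"
proof -
  have "p x \<le> p y + norm (x - y)"
  proof (rule p_least)
    fix \<eta> :: "'a \<Rightarrow>\<^sub>L real" assume \<eta>: "norm \<eta> \<le> 1"
    show "\<eta> x - \<kappa> * N \<eta> \<le> p y + norm (x - y)"
      using p_ge[OF \<eta>, of y] blinfun_ball_le[OF \<eta>, of "x - y"] by (simp add: blinfun.diff_right)
  qed
  then show ?thesis by simp
qed

lemma p_convex: "convex_on UNIV p"
proof (rule convex_onI)
  fix t :: real and x y assume t: "0 < t" "t < 1"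
  show "p ((1 - t) *\<^sub>R x + t *\<^sub>R y) \<le> (1 - t) * p x + t * p y"
  proof (rule p_least)
    fix \<eta> :: "'a \<Rightarrow>\<^sub>L real" assume \<eta>: "norm \<eta> \<le> 1"
    have "(1 - t) * (\<eta> x - \<kappa> * N \<eta>) + t * (\<eta> y - \<kappa> * N \<eta>) \<le> (1 - t) * p x + t * p y"
      using t p_ge[OF \<eta>] by (intro add_mono mult_left_mono) auto
    moreover have "(1 - t) * (\<eta> x - \<kappa> * N \<eta>) + t * (\<eta> y - \<kappa> * N \<eta>)
        = \<eta> ((1 - t) *\<^sub>R x + t *\<^sub>R y) - \<kappa> * N \<eta>"
      unfolding blinfun.add_right blinfun.scaleR_right real_scaleR_def by (simp add: algebra_simps)
    ultimately show "\<eta> ((1 - t) *\<^sub>R x + t *\<^sub>R y) - \<kappa> * N \<eta> \<le> (1 - t) * p x + t * p y"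
      by simp
  qed
qed simp

lemma midpoint_ball: "norm \<eta> \<le> 1 \<Longrightarrow> norm \<theta> \<le> 1 \<Longrightarrow> norm ((1/2) *\<^sub>R (\<eta> + \<theta>)) \<le> 1"
  for \<eta> \<theta> :: "'a \<Rightarrow>\<^sub>L real"
  using norm_triangle_ineq[of \<eta> \<theta>] by simp

lemma v_midpoint: "v j ((1/2) *\<^sub>R (\<eta> + \<theta>)) \<le> (v j \<eta> + v j \<theta>) / 2"
  unfolding v_def[of j "(1/2) *\<^sub>R (\<eta> + \<theta>)"]
proof (rule dual_norm_on_le[OF zero_Y])
  fix y assume y: "y \<in> Y" "norm y \<le> 1"
  show "\<bar>((1/2) *\<^sub>R (\<eta> + \<theta>)) y - \<phi> j y\<bar> \<le> (v j \<eta> + v j \<theta>) / 2"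
    using v_ge[OF y, of \<eta> j] v_ge[OF y, of \<theta> j]
    by (simp add: blinfun.add_left blinfun.scaleR_left abs_le_iff field_simps)
qed

text \<open>Every term of \<open>N\<close> is midpoint convex with a quadratic gain; the gains are
  nonnegative, and that of the single term \<open>j\<close> is retained.\<close>

lemma N_gap:
  assumes "norm \<eta> \<le> 1" "norm \<theta> \<le> 1"
  shows "c j * ((v j \<eta> - v j \<theta>)\<^sup>2 / 4) \<le> (N \<eta> + N \<theta>) / 2 - N ((1/2) *\<^sub>R (\<eta> + \<theta>))"
proof -
  let ?m = "(1/2) *\<^sub>R (\<eta> + \<theta>)"
  define g where "g j = (c j * (v j \<eta>)\<^sup>2 + c j * (v j \<theta>)\<^sup>2) / 2 - c j * (v j ?m)\<^sup>2" for j
  have g: "c j * ((v j \<eta> - v j \<theta>)\<^sup>2 / 4) \<le> g j" for j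
    using mult_left_mono[OF weighted_square_gap[OF v_nonneg v_midpoint], of "c j" j \<eta> \<theta>] c_pos[of j]
    by (simp add: g_def algebra_simps add_divide_distrib)
  have sums: "g sums ((N \<eta> + N \<theta>) / 2 - N ?m)" unfolding g_def N_def
    using assms by (intro sums_diff sums_divide sums_add summable_sums summable_N midpoint_ball)
  have "c j * ((v j \<eta> - v j \<theta>)\<^sup>2 / 4) \<le> sum g {j}" using g by simp
  also have "\<dots> \<le> suminf g"
  proof (rule sum_le_suminf[OF sums_summable[OF sums]])
    fix i show "0 \<le> g i" using g[of i] c_pos[of i] by (smt (verit) divide_nonneg_nonneg mult_nonneg_nonneg zero_le_power2)
  qed simp
  finally show ?thesis using sums_unique[OF sums] by simp
qed

text \<open>A weak* limit of near-maximizers is a maximizer: each \<open>v j\<close> is a supremum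
  of evaluations on \<open>Y\<close>, so the partial sums of \<open>N\<close> are weak* lower
  semicontinuous along the sequence.\<close>

lemma p_attained:
  obtains \<eta> where "norm \<eta> \<le> 1" "blinfun_apply \<eta> x - \<kappa> * N \<eta> = p x"
proof -
  have "\<forall>n. \<exists>\<eta>. norm \<eta> \<le> 1 \<and> p x - inverse (real (Suc n)) < blinfun_apply \<eta> x - \<kappa> * N \<eta>"
    by (intro allI p_approx) simp
  from choice[OF this] obtain \<eta> :: "nat \<Rightarrow> 'a \<Rightarrow>\<^sub>L real" where \<eta>: "\<And>n. norm (\<eta> n) \<le> 1"
    "\<And>n. p x - inverse (real (Suc n)) < \<eta> n x - \<kappa> * N (\<eta> n)" by blast
  obtain \<theta> :: "'a \<Rightarrow>\<^sub>L real" and r where \<theta>: "strict_mono r" "\<And>y. (\<lambda>n. \<eta> (r n) y) \<longlonglongrightarrow> \<theta> y" "norm \<theta> \<le> 1"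
    by (rule weak_star_sequentially_compact[of \<eta> 1, OF asp \<eta>(1)]) (rule that)
  have inv: "(\<lambda>n. inverse (real (Suc (r n)))) \<longlonglongrightarrow> 0"
    using LIMSEQ_subseq_LIMSEQ[OF LIMSEQ_inverse_real_of_nat \<theta>(1)] by (simp add: comp_def)
  have part: "(\<Sum>j<J. c j * (v j \<theta>)\<^sup>2) \<le> (\<theta> x - p x) / \<kappa>" for J
  proof -
    have app: "(\<Sum>j<J. c j * (\<theta> (y j) - \<phi> j (y j))\<^sup>2) \<le> (\<theta> x - p x) / \<kappa>"
      if y: "\<And>j. y j \<in> Y \<and> norm (y j) \<le> 1" for y
    proof (rule LIMSEQ_le)
      show "(\<lambda>n. \<Sum>j<J. c j * (\<eta> (r n) (y j) - \<phi> j (y j))\<^sup>2) \<longlonglongrightarrow>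
          (\<Sum>j<J. c j * (\<theta> (y j) - \<phi> j (y j))\<^sup>2)"
        by (intro tendsto_intros \<theta>)
      have "(\<lambda>n. (\<eta> (r n) x - (p x - inverse (real (Suc (r n))))) / \<kappa>) \<longlonglongrightarrow> (\<theta> x - (p x - 0)) / \<kappa>"
        using \<kappa> by (intro tendsto_intros \<theta> inv) simp
      then show "(\<lambda>n. (\<eta> (r n) x - (p x - inverse (real (Suc (r n))))) / \<kappa>) \<longlonglongrightarrow> (\<theta> x - p x) / \<kappa>" by simp
      have "(\<Sum>j<J. c j * (\<eta> m (y j) - \<phi> j (y j))\<^sup>2) \<le> (\<eta> m x - (p x - inverse (real (Suc m)))) / \<kappa>" for m
      proof -
        have "(\<Sum>j<J. c j * (\<eta> m (y j) - \<phi> j (y j))\<^sup>2) \<le> (\<Sum>j<J. c j * (v j (\<eta> m))\<^sup>2)"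
        proof (intro sum_mono mult_left_mono)
          fix j show "(\<eta> m (y j) - \<phi> j (y j))\<^sup>2 \<le> (v j (\<eta> m))\<^sup>2"
            using v_ge[of "y j" "\<eta> m" j] y[of j] v_nonneg[of j "\<eta> m"] by (simp add: abs_le_square_iff[symmetric])
        qed (use c_pos in \<open>simp add: less_imp_le\<close>)
        also have "\<dots> \<le> N (\<eta> m)" unfolding N_def
          by (rule sum_le_suminf[OF summable_N[OF \<eta>(1)]]) (auto simp: term_nonneg)
        also have "\<dots> \<le> (\<eta> m x - (p x - inverse (real (Suc m)))) / \<kappa>"
          using \<eta>(2)[of m] \<kappa> by (simp add: pos_le_divide_eq mult.commute)
        finally show ?thesis .
      qed
      then show "\<exists>M. \<forall>n\<ge>M. (\<Sum>j<J. c j * (\<eta> (r n) (y j) - \<phi> j (y j))\<^sup>2)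
          \<le> (\<eta> (r n) x - (p x - inverse (real (Suc (r n))))) / \<kappa>" by blast
    qed
    \<comment> \<open>Test vectors that almost attain \<open>v j\<close>, chosen for every
      \<open>j\<close> separately. For fixed \<open>J\<close> only finitely many evaluations are
      involved, which is what pointwise convergence controls.\<close>
    have near: "\<exists>y. (y \<in> Y \<and> norm y \<le> 1) \<and> v j \<theta> - inverse (real (Suc n)) \<le> \<bar>\<theta> y - \<phi> j y\<bar>" for j n
    proof (rule ccontr)
      assume "\<not> ?thesis"
      then have "v j \<theta> \<le> v j \<theta> - inverse (real (Suc n))"
        by (subst v_def) (intro dual_norm_on_le[OF zero_Y], force)
      then show False by simp
    qed
    then obtain y where y: "\<And>j n. y j n \<in> Y \<and> norm (y j n) \<le> 1"
      "\<And>j n. v j \<theta> - inverse (real (Suc n)) \<le> \<bar>\<theta> (y j n) - \<phi> j (y j n)\<bar>" by metis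
    have lim: "(\<lambda>n. \<bar>\<theta> (y j n) - \<phi> j (y j n)\<bar>) \<longlonglongrightarrow> v j \<theta>" for j
    proof (rule tendsto_sandwich[of "\<lambda>n. v j \<theta> - inverse (real (Suc n))" _ _ "\<lambda>_. v j \<theta>"])
      show "(\<lambda>n. v j \<theta> - inverse (real (Suc n))) \<longlonglongrightarrow> v j \<theta>"
        using tendsto_diff[OF tendsto_const[of "v j \<theta>"] LIMSEQ_inverse_real_of_nat] by simp
    qed (use y v_ge in \<open>auto intro!: eventuallyI\<close>)
    have "(\<lambda>n. \<Sum>j<J. c j * \<bar>\<theta> (y j n) - \<phi> j (y j n)\<bar>\<^sup>2) \<longlonglongrightarrow> (\<Sum>j<J. c j * (v j \<theta>)\<^sup>2)"
      by (intro tendsto_sum tendsto_mult tendsto_const tendsto_power lim)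
    then show ?thesis
    proof (rule LIMSEQ_le_const2)
      have "(\<Sum>j<J. c j * \<bar>\<theta> (y j n) - \<phi> j (y j n)\<bar>\<^sup>2) \<le> (\<theta> x - p x) / \<kappa>" for n
        unfolding power2_abs by (rule app) (rule y(1))
      then show "\<exists>N. \<forall>n\<ge>N. (\<Sum>j<J. c j * \<bar>\<theta> (y j n) - \<phi> j (y j n)\<bar>\<^sup>2) \<le> (\<theta> x - p x) / \<kappa>" by blast
    qed
  qed
  have "N \<theta> \<le> (\<theta> x - p x) / \<kappa>" unfolding N_def
    by (rule suminf_le_const[OF summable_N[OF \<theta>(3)] part])
  then have "p x \<le> \<theta> x - \<kappa> * N \<theta>" using \<kappa> by (simp add: pos_le_divide_eq mult.commute)
  with p_ge[OF \<theta>(3), of x] show thesis using that[OF \<theta>(3)] by simp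
qed

text \<open>The midpoint of a near-maximizer and the maximizer \<theta> cannot exceed
  \<open>p x\<close>, so by rotundity the two have almost the same distance to a dense functional
  chosen close to \<theta>. Being close to the same functional, they are close to each other on
  \<open>Y\<close>.\<close>

lemma near_maximizers_cluster:
  assumes \<epsilon>: "0 < \<epsilon>"
  obtains \<tau> \<theta> where "0 < \<tau>"
    "\<And>\<eta> y. norm \<eta> \<le> 1 \<Longrightarrow> p x - \<tau> \<le> blinfun_apply \<eta> x - \<kappa> * N \<eta> \<Longrightarrow> y \<in> Y \<Longrightarrow> \<bar>\<eta> y - blinfun_apply \<theta> y\<bar> \<le> \<epsilon> * norm y"
proof -
  obtain \<theta> :: "'a \<Rightarrow>\<^sub>L real" where \<theta>: "norm \<theta> \<le> 1" "\<theta> x - \<kappa> * N \<theta> = p x" by (rule p_attained)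
  obtain j where "dual_norm_on Y (\<lambda>y. \<theta> y - \<phi> j y) < \<epsilon> / 3"
    using dense[OF blinfun_dual_on, of "\<epsilon> / 3"] \<epsilon> by auto
  then have j: "v j \<theta> < \<epsilon> / 3" by (simp add: v_def)
  \<comment> \<open>Near-optimality leaves the midpoint a gap of at most \<open>\<tau> / 2\<close>;
    compared with \<open>N_gap\<close> this is exactly the tolerance \<open>\<epsilon> / 3\<close>
    for the difference of the two distances.\<close>
  define \<tau> where "\<tau> = \<kappa> * c j * (\<epsilon> / 3)\<^sup>2 / 2"
  show thesis
  proof
    show "0 < \<tau>" using \<kappa> c_pos[of j] \<epsilon> by (simp add: \<tau>_def)
    fix \<eta> :: "'a \<Rightarrow>\<^sub>L real" and y assume \<eta>: "norm \<eta> \<le> 1" "p x - \<tau> \<le> \<eta> x - \<kappa> * N \<eta>" and y: "y \<in> Y"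
    let ?m = "(1/2) *\<^sub>R (\<eta> + \<theta>)"
    have "?m x - \<kappa> * N ?m \<le> p x" by (rule p_ge[OF midpoint_ball[OF \<eta>(1) \<theta>(1)]])
    then have "(\<eta> x + \<theta> x) / 2 - \<kappa> * N ?m \<le> p x" by (simp add: blinfun.add_left blinfun.scaleR_left)
    then have "\<kappa> * ((N \<eta> + N \<theta>) / 2 - N ?m) \<le> \<tau> / 2"
      using \<eta>(2) \<theta>(2) by (simp add: right_diff_distrib distrib_left add_divide_distrib)
    moreover have "\<kappa> * (c j * ((v j \<eta> - v j \<theta>)\<^sup>2 / 4)) \<le> \<kappa> * ((N \<eta> + N \<theta>) / 2 - N ?m)"
      using N_gap[OF \<eta>(1) \<theta>(1)] \<kappa> by (intro mult_left_mono) auto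
    ultimately have "\<kappa> * c j * ((v j \<eta> - v j \<theta>)\<^sup>2) \<le> \<kappa> * c j * (\<epsilon> / 3)\<^sup>2" by (simp add: \<tau>_def)
    then have "(v j \<eta> - v j \<theta>)\<^sup>2 \<le> (\<epsilon> / 3)\<^sup>2" using \<kappa> c_pos[of j] by simp
    then have "v j \<eta> - v j \<theta> \<le> \<epsilon> / 3" by (rule power2_le_imp_le) (use \<epsilon> in simp)
    then have "v j \<eta> + v j \<theta> \<le> \<epsilon>" using j by simp
    have "\<bar>\<eta> y - \<theta> y\<bar> \<le> \<bar>\<eta> y - \<phi> j y\<bar> + \<bar>\<theta> y - \<phi> j y\<bar>" by simp
    also have "\<dots> \<le> v j \<eta> * norm y + v j \<theta> * norm y"
      unfolding v_def by (intro add_mono dual_norm_on_bound[OF Y vdual y])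
    also have "\<dots> \<le> \<epsilon> * norm y"
      using \<open>v j \<eta> + v j \<theta> \<le> \<epsilon>\<close> by (simp add: distrib_right[symmetric] mult_right_mono)
    finally show "\<bar>\<eta> y - \<theta> y\<bar> \<le> \<epsilon> * norm y" .
  qed
qed

lemma p_smooth: "smooth_along Y p x"
  unfolding smooth_along_def
proof (intro allI impI)
  fix \<epsilon> :: real assume \<epsilon>: "0 < \<epsilon>"
  obtain \<tau> and \<theta> :: "'a \<Rightarrow>\<^sub>L real" where \<tau>: "0 < \<tau>"
    "\<And>\<eta> y. norm \<eta> \<le> 1 \<Longrightarrow> p x - \<tau> \<le> blinfun_apply \<eta> x - \<kappa> * N \<eta> \<Longrightarrow> y \<in> Y \<Longrightarrow> \<bar>\<eta> y - blinfun_apply \<theta> y\<bar> \<le> (\<epsilon> / 4) * norm y"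
    using near_maximizers_cluster[of "\<epsilon> / 4" x] \<epsilon> by auto
  \<comment> \<open>A functional that is \<open>e\<close>-optimal at \<open>x + h\<close> is
    \<tau>-optimal at \<open>x\<close>: the tolerance \<open>e\<close>, the change of
    \<open>p\<close> and the value at \<open>h\<close> each cost at most \<open>norm h\<close>. On
    \<open>h\<close> it therefore nearly agrees with \<theta>.\<close>
  have half: "p (x + h) \<le> \<theta> h + p x + (\<epsilon> / 2) * norm h" if h: "h \<in> Y" "3 * norm h \<le> \<tau>" for h
  proof (cases "h = 0")
    case False
    define e where "e = min (\<epsilon> / 4) 1 * norm h"
    have "0 < e" using \<epsilon> False by (simp add: e_def)
    then obtain \<eta> :: "'a \<Rightarrow>\<^sub>L real" where \<eta>: "norm \<eta> \<le> 1" "p (x + h) - e < \<eta> (x + h) - \<kappa> * N \<eta>" using p_approx by blast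
    have e: "e \<le> (\<epsilon> / 4) * norm h" "e \<le> norm h"
      unfolding e_def using mult_right_mono[of "min (\<epsilon> / 4) 1" "\<epsilon> / 4" "norm h"]
        mult_right_mono[of "min (\<epsilon> / 4) 1" 1 "norm h"] by simp_all
    have "p x \<le> p (x + h) + norm h" using p_lipschitz[of x "x + h"] by simp
    then have "p x - \<tau> \<le> \<eta> x - \<kappa> * N \<eta>"
      using \<eta>(2) blinfun_ball_le[OF \<eta>(1), of h] e(2) h(2) by (simp add: blinfun.add_right)
    from \<tau>(2)[OF \<eta>(1) this h(1)] have "\<eta> h \<le> \<theta> h + (\<epsilon> / 4) * norm h" by linarith
    moreover have "\<eta> x - \<kappa> * N \<eta> \<le> p x" by (rule p_ge[OF \<eta>(1)])
    ultimately show ?thesis using \<eta>(2) e(1) by (simp add: blinfun.add_right)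
  qed (use \<epsilon> in \<open>simp add: blinfun.zero_right\<close>)
  show "\<exists>\<delta>>0. \<forall>h\<in>Y. norm h < \<delta> \<longrightarrow> p (x + h) + p (x - h) - 2 * p x \<le> \<epsilon> * norm h"
  proof (intro exI conjI ballI impI)
    show "0 < \<tau> / 3" using \<tau>(1) by simp
    fix h assume h: "h \<in> Y" "norm h < \<tau> / 3"
    have "- h \<in> Y" using Y h(1) by (rule subspace_neg)
    then show "p (x + h) + p (x - h) - 2 * p x \<le> \<epsilon> * norm h"
      using half[of h] half[of "- h"] h by (simp add: blinfun.minus_right field_simps)
  qed
qed

end

theorem smooth_norm_approximation:
  fixes Y :: "'a::banach set"
  assumes "asplund_space TYPE('a)" "subspace Y" "separable_dual Y" "0 < \<kappa>"
  obtains p where "convex_on UNIV p" "\<And>x. norm x - \<kappa> \<le> p x" "\<And>x. p x \<le> norm x"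
    "\<And>x y. p x - p y \<le> norm (x - y)" "\<And>x. smooth_along Y p x"
proof -
  obtain B where B: "countable B" "B \<subseteq> dual_on Y"
    "\<And>\<phi> e. \<phi> \<in> dual_on Y \<Longrightarrow> 0 < e \<Longrightarrow> \<exists>\<psi>\<in>B. dual_norm_on Y (\<lambda>y. \<phi> y - \<psi> y) < e"
    using assms(3) unfolding separable_dual_def by blast
  have "blinfun_apply 0 \<in> dual_on Y" by (rule blinfun_dual_on)
  then have "B \<noteq> {}" using B(3)[of "blinfun_apply 0" 1] by auto
  then have ran: "range (from_nat_into B) = B" by (rule range_from_nat_into[OF _ B(1)])
  interpret separable_dual_smoothing Y "from_nat_into B" \<kappa>
  proof
    show "from_nat_into B j \<in> dual_on Y" for j using from_nat_into[OF \<open>B \<noteq> {}\<close>] B(2) by (rule subsetD[rotated])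
    show "\<exists>j. dual_norm_on Y (\<lambda>y. \<psi> y - from_nat_into B j y) < e" if \<psi>: "\<psi> \<in> dual_on Y" "0 < e" for \<psi> e
    proof -
      obtain \<psi>' where "\<psi>' \<in> range (from_nat_into B)" "dual_norm_on Y (\<lambda>y. \<psi> y - \<psi>' y) < e"
        using B(3)[OF \<psi>] unfolding ran by blast
      then show ?thesis by blast
    qed
  qed (use assms in auto)
  show thesis by (rule that[OF p_convex p_ge_norm p_le_norm p_lipschitz p_smooth])
qed

section \<open>A smooth variational principle\<close>

lemma smooth_alongD:
  assumes "smooth_along Y s x" "0 < \<epsilon>"
  obtains \<delta> where "0 < \<delta>" "\<And>h. h \<in> Y \<Longrightarrow> norm h < \<delta> \<Longrightarrow> s (x + h) + s (x - h) - 2 * s x \<le> \<epsilon> * norm h"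
  using assms unfolding smooth_along_def by blast

lemma smooth_along_add:
  assumes "smooth_along Y s x" "smooth_along Y t x"
  shows "smooth_along Y (\<lambda>y. s y + t y) x"
  unfolding smooth_along_def
proof (intro allI impI)
  fix \<epsilon> :: real assume "0 < \<epsilon>"
  then have e: "0 < \<epsilon> / 2" by simp
  obtain \<delta>1 where \<delta>1: "0 < \<delta>1" "\<And>h. h \<in> Y \<Longrightarrow> norm h < \<delta>1 \<Longrightarrow> s (x + h) + s (x - h) - 2 * s x \<le> \<epsilon> / 2 * norm h"
    by (rule smooth_alongD[OF assms(1) e]) (rule that)
  obtain \<delta>2 where \<delta>2: "0 < \<delta>2" "\<And>h. h \<in> Y \<Longrightarrow> norm h < \<delta>2 \<Longrightarrow> t (x + h) + t (x - h) - 2 * t x \<le> \<epsilon> / 2 * norm h"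
    by (rule smooth_alongD[OF assms(2) e]) (rule that)
  show "\<exists>\<delta>>0. \<forall>h\<in>Y. norm h < \<delta> \<longrightarrow> s (x + h) + t (x + h) + (s (x - h) + t (x - h)) - 2 * (s x + t x) \<le> \<epsilon> * norm h"
  proof (intro exI[of _ "min \<delta>1 \<delta>2"] conjI ballI impI)
    fix h assume "h \<in> Y" "norm h < min \<delta>1 \<delta>2"
    then show "s (x + h) + t (x + h) + (s (x - h) + t (x - h)) - 2 * (s x + t x) \<le> \<epsilon> * norm h"
      using \<delta>1(2)[of h] \<delta>2(2)[of h] by simp
  qed (use \<delta>1 \<delta>2 in simp)
qed

lemma smooth_along_cmult:
  assumes "smooth_along Y s x" "0 < c"
  shows "smooth_along Y (\<lambda>y. c * s y) x"
  unfolding smooth_along_def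
proof (intro allI impI)
  fix \<epsilon> :: real assume "0 < \<epsilon>"
  then have "0 < \<epsilon> / c" using assms(2) by simp
  then obtain \<delta> where \<delta>: "0 < \<delta>" "\<And>h. h \<in> Y \<Longrightarrow> norm h < \<delta> \<Longrightarrow> s (x + h) + s (x - h) - 2 * s x \<le> \<epsilon> / c * norm h"
    by (rule smooth_alongD[OF assms(1)]) (rule that)
  have "c * s (x + h) + c * s (x - h) - 2 * (c * s x) \<le> \<epsilon> * norm h" if "h \<in> Y" "norm h < \<delta>" for h
    using mult_left_mono[OF \<delta>(2)[OF that], of c] assms(2) by (simp add: algebra_simps)
  then show "\<exists>\<delta>>0. \<forall>h\<in>Y. norm h < \<delta> \<longrightarrow> c * s (x + h) + c * s (x - h) - 2 * (c * s x) \<le> \<epsilon> * norm h"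
    using \<delta>(1) by blast
qed

lemma smooth_along_const: "smooth_along Y (\<lambda>_. b) x"
  unfolding smooth_along_def by (auto intro: exI[of _ 1])

lemma smooth_along_translate: "smooth_along Y s (x - a) \<Longrightarrow> smooth_along Y (\<lambda>y. s (y - a)) x"
  unfolding smooth_along_def by (simp add: algebra_simps)

lemma convex_on_translate:
  fixes s :: "'a::real_vector \<Rightarrow> real"
  assumes "convex_on UNIV s"
  shows "convex_on UNIV (\<lambda>y. s (y - a))"
proof (rule convex_onI)
  fix t :: real and x y :: 'a assume t: "0 < t" "t < 1"
  have "(1 - t) *\<^sub>R x + t *\<^sub>R y - a = (1 - t) *\<^sub>R (x - a) + t *\<^sub>R (y - a)" by (simp add: algebra_simps)
  then show "s ((1 - t) *\<^sub>R x + t *\<^sub>R y - a) \<le> (1 - t) * s (x - a) + t * s (y - a)"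
    using convex_onD[OF assms, of t "x - a" "y - a"] t by simp
qed simp

text \<open>The exact norm is the case \<open>\<kappa> = 0\<close>, so that one variational
  principle covers both Ekeland's and the smooth one.\<close>

definition norm_like :: "real \<Rightarrow> ('a::real_normed_vector \<Rightarrow> real) \<Rightarrow> bool" where
  "norm_like \<kappa> p \<longleftrightarrow> convex_on UNIV p \<and> (\<forall>x. norm x - \<kappa> \<le> p x \<and> p x \<le> norm x)
     \<and> (\<forall>x y. p x - p y \<le> norm (x - y))"

lemma norm_like_norm: "norm_like 0 (norm :: 'a::real_normed_vector \<Rightarrow> real)"
  using convex_on_dist[of UNIV "0::'a"] by (auto simp: norm_like_def norm_triangle_ineq2)

text \<open>The weights add up to \<open>c\<close>, so with 1-Lipschitz \<open>p k\<close> the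
  perturbation is \<open>c\<close>-Lipschitz.\<close>

definition pert :: "real \<Rightarrow> (nat \<Rightarrow> 'a::real_normed_vector \<Rightarrow> real) \<Rightarrow> (nat \<Rightarrow> 'a) \<Rightarrow> 'a \<Rightarrow> real" where
  "pert c p a x = (\<Sum>k. c / 2 ^ Suc k * p k (x - a k))"

locale perturbation =
  fixes c \<kappa> :: real and p :: "nat \<Rightarrow> 'a::real_normed_vector \<Rightarrow> real" and a :: "nat \<Rightarrow> 'a"
  assumes c: "0 < c" and \<kappa>: "0 \<le> \<kappa>" and p: "\<And>k. norm_like (\<kappa> / 2 ^ k) (p k)"
    and a: "bounded (range a)"
begin

lemma p_lip: "p k x - p k y \<le> norm (x - y)"
  using p by (simp add: norm_like_def)

lemma p_lip': "p k (x - b) - p k (y - b) \<le> norm (x - y)"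
  using p_lip[of k "x - b" "y - b"] by simp

lemma weights: "(\<lambda>k. c / 2 ^ Suc k) sums c"
  using sums_mult[OF power_half_series, of c] by (simp add: power_one_over)

lemma pert_summable: "summable (\<lambda>k. c / 2 ^ Suc k * p k (x - a k))"
proof -
  obtain b where b: "\<And>k. norm (a k) \<le> b" using a unfolding bounded_iff by auto
  show ?thesis
  proof (rule summable_comparison_test')
    show "summable (\<lambda>k. c / 2 ^ Suc k * (norm x + b + \<kappa>))"
      by (rule summable_mult2[OF sums_summable[OF weights]])
    fix k
    have "\<kappa> / 2 ^ k \<le> \<kappa> / 1" using \<kappa> by (intro divide_left_mono) auto
    moreover have "norm (x - a k) \<le> norm x + b" using norm_triangle_ineq4[of x "a k"] b[of k] by simp
    moreover have "norm (x - a k) - \<kappa> / 2 ^ k \<le> p k (x - a k)" "p k (x - a k) \<le> norm (x - a k)"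
      using p by (auto simp: norm_like_def)
    ultimately have "\<bar>p k (x - a k)\<bar> \<le> norm x + b + \<kappa>"
      unfolding abs_le_iff using \<kappa> norm_ge_zero[of "x - a k"] by linarith
    then show "norm (c / 2 ^ Suc k * p k (x - a k)) \<le> c / 2 ^ Suc k * (norm x + b + \<kappa>)"
      unfolding real_norm_def abs_mult using c by (intro mult_mono) auto
  qed
qed

lemma pert_partial_lipschitz:
  "(\<Sum>k<n. c / 2 ^ Suc k * p k (x - a k)) - (\<Sum>k<n. c / 2 ^ Suc k * p k (y - a k)) \<le> c * norm (x - y)"
proof -
  have "(\<Sum>k<n. c / 2 ^ Suc k * p k (x - a k)) - (\<Sum>k<n. c / 2 ^ Suc k * p k (y - a k))
      = (\<Sum>k<n. c / 2 ^ Suc k * (p k (x - a k) - p k (y - a k)))"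
    by (simp add: sum_subtractf right_diff_distrib)
  also have "\<dots> \<le> (\<Sum>k<n. c / 2 ^ Suc k * norm (x - y))"
    using c by (intro sum_mono mult_left_mono p_lip') auto
  also have "\<dots> = (\<Sum>k<n. c / 2 ^ Suc k) * norm (x - y)" by (simp add: sum_distrib_right)
  also have "\<dots> \<le> c * norm (x - y)"
    using sum_le_suminf[OF sums_summable[OF weights], of "{..<n}"] sums_unique[OF weights] c
    by (intro mult_right_mono) auto
  finally show ?thesis .
qed

lemma pert_lim: "(\<lambda>n. \<Sum>k<n. c / 2 ^ Suc k * p k (x - a k)) \<longlonglongrightarrow> pert c p a x"
  unfolding pert_def by (rule summable_LIMSEQ[OF pert_summable])

lemma pert_lipschitz: "pert c p a x - pert c p a y \<le> c * norm (x - y)"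
  by (rule LIMSEQ_le_const2[OF tendsto_diff[OF pert_lim pert_lim]]) (use pert_partial_lipschitz in blast)

lemma pert_convex: "convex_on UNIV (pert c p a)"
proof (rule convex_onI)
  fix t :: real and x y :: 'a assume t: "0 < t" "t < 1"
  let ?z = "(1 - t) *\<^sub>R x + t *\<^sub>R y"
  have "pert c p a ?z \<le> (\<Sum>k. (1 - t) * (c / 2 ^ Suc k * p k (x - a k)) + t * (c / 2 ^ Suc k * p k (y - a k)))"
    unfolding pert_def
  proof (rule suminf_le[OF _ pert_summable])
    fix k
    have "p k (?z - a k) \<le> (1 - t) * p k (x - a k) + t * p k (y - a k)"
      using p t convex_onD[OF convex_on_translate, of "p k" t x y "a k"] by (simp add: norm_like_def)
    then have "c / 2 ^ Suc k * p k (?z - a k) \<le> c / 2 ^ Suc k * ((1 - t) * p k (x - a k) + t * p k (y - a k))"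
      using c by (intro mult_left_mono) auto
    then show "c / 2 ^ Suc k * p k (?z - a k) \<le> (1 - t) * (c / 2 ^ Suc k * p k (x - a k)) + t * (c / 2 ^ Suc k * p k (y - a k))"
      by (simp only: distrib_left mult.left_commute)
  qed (intro summable_add summable_mult pert_summable)
  also have "\<dots> = (1 - t) * pert c p a x + t * pert c p a y"
    unfolding pert_def by (intro sums_unique[symmetric] sums_add sums_mult summable_sums pert_summable)
  finally show "pert c p a ?z \<le> (1 - t) * pert c p a x + t * pert c p a y" .
qed simp

text \<open>The second difference of each term is at most \<open>2 * norm h\<close> times its
  weight, so a tail of small total weight is negligible uniformly in \<open>h\<close>, and the head
  is a finite sum.\<close>

lemma pert_smooth:
  assumes sm: "\<And>k y. smooth_along Y (p k) y"
  shows "smooth_along Y (pert c p a) x"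
  unfolding smooth_along_def
proof (intro allI impI)
  fix \<epsilon> :: real assume \<epsilon>: "0 < \<epsilon>"
  have tail: "(\<lambda>n. c - (\<Sum>k<n. c / 2 ^ Suc k)) \<longlonglongrightarrow> c - c"
    using weights unfolding sums_def by (intro tendsto_diff tendsto_const)
  then have "eventually (\<lambda>n. c - (\<Sum>k<n. c / 2 ^ Suc k) < \<epsilon> / 4) sequentially"
    using order_tendstoD(2)[OF tail, of "\<epsilon> / 4"] \<epsilon> by simp
  then obtain n where n: "c - (\<Sum>k<n. c / 2 ^ Suc k) < \<epsilon> / 4" by (auto simp: eventually_sequentially)
  have "smooth_along Y (\<lambda>y. \<Sum>k<m. c / 2 ^ Suc k * p k (y - a k)) x" for m
  proof (induction m)
    case (Suc m)
    have "smooth_along Y (\<lambda>y. c / 2 ^ Suc m * p m (y - a m)) x"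
      using c by (intro smooth_along_cmult smooth_along_translate sm) auto
    from smooth_along_add[OF Suc this] show ?case by simp
  qed (simp add: smooth_along_const)
  note sm_partial = this[of n]
  have "0 < \<epsilon> / 2" using \<epsilon> by simp
  obtain \<delta> where \<delta>: "0 < \<delta>" "\<And>h. h \<in> Y \<Longrightarrow> norm h < \<delta> \<Longrightarrow>
      (\<Sum>k<n. c / 2 ^ Suc k * p k (x + h - a k)) + (\<Sum>k<n. c / 2 ^ Suc k * p k (x - h - a k))
       - 2 * (\<Sum>k<n. c / 2 ^ Suc k * p k (x - a k)) \<le> \<epsilon> / 2 * norm h"
    by (rule smooth_alongD[OF sm_partial \<open>0 < \<epsilon> / 2\<close>]) (rule that)
  show "\<exists>\<delta>>0. \<forall>h\<in>Y. norm h < \<delta> \<longrightarrow> pert c p a (x + h) + pert c p a (x - h) - 2 * pert c p a x \<le> \<epsilon> * norm h"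
  proof (intro exI[of _ \<delta>] conjI ballI impI)
    fix h assume h: "h \<in> Y" "norm h < \<delta>"
    define g where "g k = c / 2 ^ Suc k * p k (x + h - a k) + c / 2 ^ Suc k * p k (x - h - a k)
       - 2 * (c / 2 ^ Suc k * p k (x - a k))" for k
    have g: "g sums (pert c p a (x + h) + pert c p a (x - h) - 2 * pert c p a x)"
      unfolding g_def pert_def by (intro sums_diff sums_add sums_mult summable_sums pert_summable)
    have gle: "g k \<le> c / 2 ^ Suc k * (2 * norm h)" for k
    proof -
      have "p k (x + h - a k) + p k (x - h - a k) - 2 * p k (x - a k) \<le> 2 * norm h"
        using p_lip[of k "x + h - a k" "x - a k"] p_lip[of k "x - h - a k" "x - a k"] by simp
      from mult_left_mono[OF this, of "c / 2 ^ Suc k"] show ?thesis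
        unfolding g_def using c by (simp add: algebra_simps)
    qed
    have "suminf g - sum g {..<n} = (\<Sum>k. g (k + n))"
      using suminf_split_initial_segment[OF sums_summable[OF g], of n] by simp
    also have "\<dots> \<le> (\<Sum>k. c / 2 ^ Suc (k + n) * (2 * norm h))"
      by (intro suminf_le gle summable_ignore_initial_segment[OF sums_summable[OF g]]
          summable_mult2 summable_ignore_initial_segment[OF sums_summable[OF weights]])
    also have "\<dots> = (\<Sum>k. c / 2 ^ Suc (k + n)) * (2 * norm h)"
      by (rule suminf_mult2[symmetric, OF summable_ignore_initial_segment[OF sums_summable[OF weights]]])
    also have "\<dots> = (c - (\<Sum>k<n. c / 2 ^ Suc k)) * (2 * norm h)"
      using suminf_split_initial_segment[OF sums_summable[OF weights], of n] sums_unique[OF weights] by simp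
    also have "\<dots> \<le> \<epsilon> / 4 * (2 * norm h)" using n by (intro mult_right_mono) auto
    finally have "suminf g \<le> sum g {..<n} + \<epsilon> / 2 * norm h" by simp
    moreover have "sum g {..<n} \<le> \<epsilon> / 2 * norm h"
      using \<delta>(2)[OF h] unfolding g_def by (simp add: sum.distrib sum_subtractf sum_distrib_left)
    ultimately show "pert c p a (x + h) + pert c p a (x - h) - 2 * pert c p a x \<le> \<epsilon> * norm h"
      using sums_unique[OF g] by simp
  qed (rule \<delta>(1))
qed

end

section \<open>Convergence of successive near-minimizers\<close>

lemma geometric_steps_converge:
  fixes x :: "nat \<Rightarrow> 'a::banach"
  assumes "\<And>k. norm (x (Suc k) - x k) \<le> E / 2 ^ k"
  shows "convergent x" "norm (x k - x 0) \<le> 2 * E"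
proof -
  have E: "(\<lambda>k. E / 2 ^ k) sums (2 * E)"
    using sums_mult[OF power_half_series, of "2 * E"] by (simp add: power_one_over)
  have sm: "summable (\<lambda>k. x (Suc k) - x k)"
    by (rule summable_comparison_test'[OF sums_summable[OF E], of 0]) (use assms in simp)
  have tel: "(\<Sum>k<n. x (Suc k) - x k) = x n - x 0" for n by (rule sum_lessThan_telescope)
  have "(\<lambda>n. x n - x 0) \<longlonglongrightarrow> (\<Sum>k. x (Suc k) - x k)" using summable_LIMSEQ[OF sm] by (simp add: tel)
  then have "(\<lambda>n. (x n - x 0) + x 0) \<longlonglongrightarrow> (\<Sum>k. x (Suc k) - x k) + x 0" by (intro tendsto_add tendsto_const)
  then show "convergent x" by (auto simp: convergent_def)
  have E0: "0 \<le> E / 2 ^ k" for k using assms[of k] norm_ge_zero order_trans by blast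
  have "norm (x k - x 0) \<le> (\<Sum>j<k. E / 2 ^ j)"
    unfolding tel[symmetric] by (rule order_trans[OF norm_sum sum_mono[OF assms]])
  also have "\<dots> \<le> 2 * E"
    using sum_le_suminf[OF sums_summable[OF E], of "{..<k}"] E0 sums_unique[OF E] by simp
  finally show "norm (x k - x 0) \<le> 2 * E" .
qed

lemma near_minimizer:
  fixes g :: "'b \<Rightarrow> real"
  assumes "S \<noteq> {}" "\<And>z. z \<in> S \<Longrightarrow> b \<le> g z" "0 < e"
  obtains z where "z \<in> S" "\<And>y. y \<in> S \<Longrightarrow> g z \<le> g y + e"
proof -
  have bdd: "bdd_below (g ` S)" using assms(2) by (auto intro!: bdd_belowI2)
  have "Inf (g ` S) < Inf (g ` S) + e" using assms(3) by simp
  from cInf_lessD[OF _ this] assms(1) obtain z where z: "z \<in> S" "g z < Inf (g ` S) + e" by blast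
  have "g z \<le> g y + e" if "y \<in> S" for y
    using z(2) cINF_lower[OF bdd that] by simp
  with z(1) show thesis by (rule that)
qed

text \<open>\<open>S\<close> may fail to be closed: membership of the limit is claimed only along
  sequences whose values have convergent upper bounds, as for the domain of a lower semicontinuous
  function.\<close>

definition coordinatewise_lsc :: "'i set \<Rightarrow> ('i \<Rightarrow> 'a::topological_space) set \<Rightarrow> (('i \<Rightarrow> 'a) \<Rightarrow> real) \<Rightarrow> bool" where
  "coordinatewise_lsc A S \<Theta> \<longleftrightarrow>
     (\<forall>zs L z l. (\<forall>n. zs n \<in> S \<and> \<Theta> (zs n) \<le> L n) \<and> L \<longlonglongrightarrow> l \<and> (\<forall>i\<in>A. (\<lambda>n. zs n i) \<longlonglongrightarrow> z i)
        \<longrightarrow> z \<in> S \<and> \<Theta> z \<le> l)"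

lemma coordinatewise_lscD:
  assumes "coordinatewise_lsc A S \<Theta>" "\<And>n. zs n \<in> S" "\<And>n. \<Theta> (zs n) \<le> L n" "L \<longlonglongrightarrow> l"
    "\<And>i. i \<in> A \<Longrightarrow> (\<lambda>n. zs n i) \<longlonglongrightarrow> z i"
  shows "z \<in> S" "\<Theta> z \<le> l"
  using assms(1)[unfolded coordinatewise_lsc_def, rule_format, of zs L l z] assms(2-) by auto

text \<open>Each near-minimizer is penalized by a term centred at it before the next one is chosen
  (Borwein and Preiss). The tolerances shrink like \<open>1 / 4 ^ k\<close>, the weights only like
  \<open>1 / 2 ^ k\<close>; so consecutive points are geometrically close, and the limit minimizes
  \<open>\<Theta>\<close> plus all penalties.\<close>

theorem smooth_variational_principle:
  fixes \<Theta> :: "('i \<Rightarrow> 'a::banach) \<Rightarrow> real" and \<kappa> \<tau> b c :: real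
  assumes A: "finite A" and lsc: "coordinatewise_lsc A S \<Theta>" and low: "\<And>z. z \<in> S \<Longrightarrow> b \<le> \<Theta> z"
    and z0: "z0 \<in> S" "\<And>z. z \<in> S \<Longrightarrow> \<Theta> z0 \<le> \<Theta> z + \<tau>" and \<tau>: "0 < \<tau>"
    and c: "0 < c" and \<kappa>: "0 \<le> \<kappa>" and p: "\<And>k. norm_like (\<kappa> / 2 ^ k) (p k)"
  obtains z a where "z \<in> S" "\<And>i. i \<in> A \<Longrightarrow> norm (z i - z0 i) \<le> 2 * (card A * \<kappa> + 4 * \<tau> / c)"
    "\<And>i. i \<in> A \<Longrightarrow> bounded (range (a i))"
    "\<And>y. y \<in> S \<Longrightarrow> \<Theta> z + (\<Sum>i\<in>A. pert c p (a i) (z i)) \<le> \<Theta> y + (\<Sum>i\<in>A. pert c p (a i) (y i))"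
proof -
  define step where "step k z y = c / 2 ^ Suc k * (\<Sum>i\<in>A. p k (y i - z i))" for k and z y :: "'i \<Rightarrow> 'a"
  \<comment> \<open>The last clause fixes the start of the dependent choice at
    \<open>(z0, \<Theta>)\<close>.\<close>
  define P where "P k x \<longleftrightarrow> (\<exists>b. \<forall>y\<in>S. b \<le> snd x y) \<and> fst x \<in> S \<and> (\<forall>y\<in>S. snd x (fst x) \<le> snd x y + \<tau> / 4 ^ k)
      \<and> (k = 0 \<longrightarrow> x = (z0, \<Theta>))"
    for k and x :: "('i \<Rightarrow> 'a) \<times> (('i \<Rightarrow> 'a) \<Rightarrow> real)"
  define Q where "Q k x x' \<longleftrightarrow> snd x' = (\<lambda>y. snd x y + step k (fst x) y)"
    for k and x x' :: "('i \<Rightarrow> 'a) \<times> (('i \<Rightarrow> 'a) \<Rightarrow> real)"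
  have pk: "norm x - \<kappa> / 2 ^ k \<le> p k x" "p k x \<le> norm x" for k x using p by (auto simp: norm_like_def)
  have step_low: "- (c * card A * \<kappa>) \<le> step k z y" for k z y
  proof -
    have "- \<kappa> \<le> p k x" for x
    proof -
      have "\<kappa> / 2 ^ k \<le> \<kappa> / 1" using \<kappa> by (intro divide_left_mono) auto
      then show ?thesis using pk(1)[of x k] norm_ge_zero[of x] by linarith
    qed
    then have "(\<Sum>i\<in>A. - \<kappa>) \<le> (\<Sum>i\<in>A. p k (y i - z i))" by (intro sum_mono)
    then have "c / 2 ^ Suc k * (- (card A * \<kappa>)) \<le> step k z y"
      unfolding step_def using c by (intro mult_left_mono) auto
    moreover have "c / 2 ^ Suc k * (card A * \<kappa>) \<le> c / 1 * (card A * \<kappa>)"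
      using c \<kappa> one_le_power[of "2::real" "Suc k"] by (intro mult_right_mono divide_left_mono) auto
    ultimately show ?thesis by simp
  qed
  have "\<exists>x. \<forall>k. P k (x k) \<and> Q k (x k) (x (Suc k))"
  proof (rule dependent_nat_choice)
    show "\<exists>x. P 0 x" by (rule exI[of _ "(z0, \<Theta>)"]) (use z0 low in \<open>auto simp: P_def\<close>)
    fix x k assume "P k x"
    then obtain b' where b': "\<And>y. y \<in> S \<Longrightarrow> b' \<le> snd x y" and "fst x \<in> S" unfolding P_def by blast
    define g where "g y = snd x y + step k (fst x) y" for y
    have glow: "b' - c * card A * \<kappa> \<le> g y" if "y \<in> S" for y
      using b'[OF that] step_low[of k "fst x" y] by (simp add: g_def)
    obtain z where "z \<in> S" "\<And>y. y \<in> S \<Longrightarrow> g z \<le> g y + \<tau> / 4 ^ Suc k"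
      by (rule near_minimizer[of S "b' - c * card A * \<kappa>" g "\<tau> / 4 ^ Suc k"]) (use glow \<open>fst x \<in> S\<close> \<tau> in auto)
    then show "\<exists>x'. P (Suc k) x' \<and> Q k x x'"
      by (intro exI[of _ "(z, g)"]) (use glow in \<open>auto simp: P_def Q_def g_def\<close>)
  qed
  then obtain x where x: "\<And>k. P k (x k)" "\<And>k. Q k (x k) (x (Suc k))" by blast
  define zs where "zs k = fst (x k)" for k
  define g where "g k = snd (x k)" for k
  define a where "a i k = zs k i" for i k
  have zsS: "zs k \<in> S" and gmin: "y \<in> S \<Longrightarrow> g k (zs k) \<le> g k y + \<tau> / 4 ^ k" for k y
    using x(1)[of k] by (auto simp: P_def zs_def g_def)
  have zs0: "zs 0 = z0" and g0: "g 0 = \<Theta>" using x(1)[of 0] by (auto simp: P_def zs_def g_def)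
  have gSuc: "g (Suc k) y = g k y + step k (zs k) y" for k y
    using x(2)[of k] by (simp add: Q_def zs_def g_def)
  have g: "g k y = \<Theta> y + (\<Sum>i\<in>A. \<Sum>j<k. c / 2 ^ Suc j * p j (y i - a i j))" for k y
    by (induction k) (simp_all add: g0 gSuc step_def a_def sum_distrib_left sum.distrib)
  \<comment> \<open>Dividing the tolerance \<open>2 * \<tau> / 4 ^ k\<close> by the weight
    \<open>c / 2 ^ Suc k\<close> leaves \<open>4 * \<tau> / c\<close> over \<open>2 ^ k\<close>; the
    other summand pays for replacing \<open>p k\<close> by the norm in every coordinate.\<close>
  define E where "E = card A * \<kappa> + 4 * \<tau> / c"
  have move: "(\<Sum>i\<in>A. norm (zs (Suc k) i - zs k i)) \<le> E / 2 ^ k" for k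
  proof -
    have "step k (zs k) (zs k) \<le> 0"
    proof -
      have "(\<Sum>i\<in>A. p k (zs k i - zs k i)) \<le> 0" using pk(2)[of k 0] by (intro sum_nonpos) auto
      then show ?thesis using c unfolding step_def by (intro mult_nonneg_nonpos) auto
    qed
    then have "step k (zs k) (zs (Suc k)) \<le> \<tau> / 4 ^ k + \<tau> / 4 ^ Suc k"
      using gmin[OF zsS, of "Suc k" k] gmin[OF zsS, of k "Suc k"] by (simp add: gSuc)
    also have "\<dots> \<le> 2 * \<tau> / 4 ^ k" using \<tau> by (simp add: field_simps)
    finally have "c / 2 ^ Suc k * (\<Sum>i\<in>A. p k (zs (Suc k) i - zs k i)) \<le> 2 * \<tau> / 4 ^ k" by (simp add: step_def)
    then have "(\<Sum>i\<in>A. p k (zs (Suc k) i - zs k i)) \<le> 2 * \<tau> / 4 ^ k / (c / 2 ^ Suc k)"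
    proof -
      have pos: "0 < c / 2 ^ Suc k" using c by simp
      show ?thesis if "c / 2 ^ Suc k * (\<Sum>i\<in>A. p k (zs (Suc k) i - zs k i)) \<le> 2 * \<tau> / 4 ^ k"
        using that unfolding pos_le_divide_eq[OF pos] by (simp only: mult.commute)
    qed
    also have "\<dots> = 4 * \<tau> / c / 2 ^ k"
    proof -
      have "(4::real) ^ k = 2 ^ k * 2 ^ k" by (simp add: power_mult_distrib[symmetric])
      then show ?thesis using c by (simp add: field_simps)
    qed
    finally have "(\<Sum>i\<in>A. p k (zs (Suc k) i - zs k i)) \<le> 4 * \<tau> / c / 2 ^ k" .
    moreover have "(\<Sum>i\<in>A. norm (zs (Suc k) i - zs k i) - \<kappa> / 2 ^ k) \<le> (\<Sum>i\<in>A. p k (zs (Suc k) i - zs k i))"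
      by (intro sum_mono pk)
    ultimately show ?thesis by (simp add: sum_subtractf E_def add_divide_distrib)
  qed
  have move_i: "norm (zs (Suc k) i - zs k i) \<le> E / 2 ^ k" if "i \<in> A" for i k
    using member_le_sum[OF that _ A, of "\<lambda>i. norm (zs (Suc k) i - zs k i)"] move[of k] by simp
  have conv: "convergent (\<lambda>k. zs k i)" and dist0: "norm (zs k i - zs 0 i) \<le> 2 * E" if "i \<in> A" for i k
    using geometric_steps_converge[of "\<lambda>k. zs k i" E] move_i[OF that] by blast+
  define z where "z i = lim (\<lambda>k. zs k i)" for i
  have lim: "(\<lambda>k. zs k i) \<longlonglongrightarrow> z i" if "i \<in> A" for i
    using conv[OF that] unfolding z_def by (rule convergent_LIMSEQ_iff[THEN iffD1])
  have bd: "bounded (range (a i))" if "i \<in> A" for i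
    using convergent_imp_bounded[OF lim[OF that]] by (simp add: a_def)
  have pt: "perturbation c \<kappa> p (a i)" if "i \<in> A" for i
    by unfold_locales (use c \<kappa> p bd[OF that] in auto)
  define Pn where "Pn n y = (\<Sum>i\<in>A. \<Sum>j<n. c / 2 ^ Suc j * p j (y i - a i j))" for n and y :: "'i \<Rightarrow> 'a"
  have Plim: "(\<lambda>n. Pn n y) \<longlonglongrightarrow> (\<Sum>i\<in>A. pert c p (a i) (y i))" for y
    unfolding Pn_def by (intro tendsto_sum perturbation.pert_lim[OF pt])
  \<comment> \<open>All partial penalties share the Lipschitz constant \<open>c\<close>, so the
    moving argument \<open>zs n\<close> may be replaced by the limit.\<close>
  have Pdiff: "Pn n z - Pn n (zs n) \<le> (\<Sum>i\<in>A. c * norm (z i - zs n i))" for n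
    unfolding Pn_def sum_subtractf[of _ _ A, symmetric] by (intro sum_mono perturbation.pert_partial_lipschitz[OF pt])
  have fin: "z \<in> S \<and> \<Theta> z \<le> \<Theta> y + (\<Sum>i\<in>A. pert c p (a i) (y i)) - (\<Sum>i\<in>A. pert c p (a i) (z i))"
    if y: "y \<in> S" for y
  proof -
    define L where "L n = \<Theta> y + Pn n y + \<tau> * (1/4) ^ n - Pn n z + (\<Sum>i\<in>A. c * norm (z i - zs n i))" for n
    have le: "\<Theta> (zs n) \<le> L n" for n
      using gmin[OF y, of n] Pdiff[of n] unfolding g Pn_def L_def by (simp add: power_one_over)
    have Llim: "L \<longlonglongrightarrow> \<Theta> y + (\<Sum>i\<in>A. pert c p (a i) (y i)) + \<tau> * 0
        - (\<Sum>i\<in>A. pert c p (a i) (z i)) + (\<Sum>i\<in>A. c * norm (z i - z i))"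
      unfolding L_def by (intro tendsto_intros Plim lim LIMSEQ_realpow_zero) auto
    show ?thesis
      using coordinatewise_lscD[OF lsc zsS le Llim lim] by simp
  qed
  show thesis
  proof
    show "z \<in> S" using fin[OF z0(1)] by blast
    show "norm (z i - z0 i) \<le> 2 * (card A * \<kappa> + 4 * \<tau> / c)" if i: "i \<in> A" for i
    proof (rule LIMSEQ_le_const2)
      show "(\<lambda>k. norm (zs k i - z0 i)) \<longlonglongrightarrow> norm (z i - z0 i)" by (intro tendsto_intros lim i)
      show "\<exists>N. \<forall>k\<ge>N. norm (zs k i - z0 i) \<le> 2 * (card A * \<kappa> + 4 * \<tau> / c)"
        using dist0[OF i] by (simp add: zs0 E_def)
    qed
    show "bounded (range (a i))" if "i \<in> A" for i by (rule bd[OF that])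
    show "\<Theta> z + (\<Sum>i\<in>A. pert c p (a i) (z i)) \<le> \<Theta> y + (\<Sum>i\<in>A. pert c p (a i) (y i))" if "y \<in> S" for y
      using fin[OF that] by simp
  qed
qed

text \<open>The case \<open>\<kappa> = 0\<close> with the norm itself; the Lipschitz bound turns the
  perturbation into the usual norm term.\<close>

corollary ekeland_variational_principle:
  fixes \<Theta> :: "('i \<Rightarrow> 'a::banach) \<Rightarrow> real"
  assumes A: "finite A" and lsc: "coordinatewise_lsc A S \<Theta>" and low: "\<And>z. z \<in> S \<Longrightarrow> b \<le> \<Theta> z"
    and z0: "z0 \<in> S" "\<And>z. z \<in> S \<Longrightarrow> \<Theta> z0 \<le> \<Theta> z + \<tau>" and \<tau>: "0 < \<tau>" and c: "0 < c"
  obtains z where "z \<in> S" "\<And>i. i \<in> A \<Longrightarrow> norm (z i - z0 i) \<le> 8 * \<tau> / c"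
    "\<And>y. y \<in> S \<Longrightarrow> \<Theta> z \<le> \<Theta> y + c * (\<Sum>i\<in>A. norm (y i - z i))"
proof -
  have nl: "norm_like (0 / 2 ^ k) (norm :: 'a \<Rightarrow> real)" for k :: nat by (simp add: norm_like_norm)
  obtain z a where z: "z \<in> S" "\<And>i. i \<in> A \<Longrightarrow> norm (z i - z0 i) \<le> 2 * (real (card A) * 0 + 4 * \<tau> / c)"
    "\<And>i. i \<in> A \<Longrightarrow> bounded (range (a i))"
    "\<And>y. y \<in> S \<Longrightarrow> \<Theta> z + (\<Sum>i\<in>A. pert c (\<lambda>_. norm) (a i) (z i)) \<le> \<Theta> y + (\<Sum>i\<in>A. pert c (\<lambda>_. norm) (a i) (y i))"
    by (rule smooth_variational_principle[OF A lsc low z0 \<tau> c order_refl nl]) (assumption | rule that)+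
  have lip: "pert c (\<lambda>_. norm) (a i) (y i) - pert c (\<lambda>_. norm) (a i) (z i) \<le> c * norm (y i - z i)" if "i \<in> A" for y i
    by (rule perturbation.pert_lipschitz[of c 0]) (unfold_locales, use c nl z(3)[OF that] in auto)
  have min: "\<Theta> z \<le> \<Theta> y + c * (\<Sum>i\<in>A. norm (y i - z i))" if "y \<in> S" for y
  proof -
    have "(\<Sum>i\<in>A. pert c (\<lambda>_. norm) (a i) (y i) - pert c (\<lambda>_. norm) (a i) (z i)) \<le> (\<Sum>i\<in>A. c * norm (y i - z i))"
      by (intro sum_mono lip)
    then show ?thesis using z(4)[OF that] by (simp add: sum_subtractf sum_distrib_left)
  qed
  show thesis by (rule that[OF z(1) _ min]) (use z(2) in simp_all)
qed

section \<open>Separable reduction for systems of Frechet subgradients\<close>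

text \<open>Pointwise operations make a tuple of vectors a single vector, to which
  \<open>mazur_orlicz\<close> applies.\<close>

instantiation "fun" :: (type, real_vector) real_vector
begin

definition scaleR_fun :: "real \<Rightarrow> ('a \<Rightarrow> 'b) \<Rightarrow> 'a \<Rightarrow> 'b" where
  "scaleR_fun c f = (\<lambda>x. c *\<^sub>R f x)"

instance
  by standard (simp_all add: scaleR_fun_def fun_eq_iff scaleR_add_right scaleR_add_left)

end

lemma scaleR_fun_apply [simp]: "(c *\<^sub>R f) x = c *\<^sub>R f x"
  for f :: "'a \<Rightarrow> 'b::real_vector"
  by (simp add: scaleR_fun_def)

text \<open>\<open>Y\<close> restricts only the test points. For \<open>Y = UNIV\<close> this is the
  Frechet subdifferential of the extension of \<open>g\<close> by \<infinity> off
  \<open>dm\<close>.\<close>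

definition fsub :: "'a::real_normed_vector set \<Rightarrow> ('a \<Rightarrow> real) \<Rightarrow> 'a set \<Rightarrow> 'a \<Rightarrow> ('a \<Rightarrow>\<^sub>L real) \<Rightarrow> bool" where
  "fsub dm g Y z \<xi> \<longleftrightarrow> z \<in> dm \<and> (\<forall>\<epsilon>>0. \<exists>\<delta>>0. \<forall>y\<in>dm \<inter> Y. norm (y - z) < \<delta> \<longrightarrow>
      g z + \<xi> (y - z) - \<epsilon> * norm (y - z) \<le> g y)"

text \<open>A generator names one linear constraint on a tuple \<open>\<zeta>\<close> of functionals, in the form required by
  \<open>mazur_orlicz\<close>: \<open>GF t k y\<close> is the Frechet inequality for \<open>\<zeta> t / \<mu> t\<close> at \<open>z t\<close>, tested at \<open>y\<close> with slope
  error \<open>1 / (k + 1)\<close>; \<open>GU u\<close> is \<open>- (\<Sum>t\<in>F. \<zeta> t u) \<le> N a u\<close>; \<open>GW\<close> is \<open>\<zeta> s w \<le> - c * norm w\<close>. Solvability on a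
  subspace \<open>Z\<close> thus becomes a condition on finite lists of points of \<open>Z\<close>, and it passes from a suitable
  separable subspace to the whole space by closing off under violating lists.\<close>

datatype ('t, 'a) gen = GF 't nat 'a | GU 'a | GW

text \<open>Only Frechet generators depend on base points and values, so this weight measures how
  much a combination changes when those are rounded.\<close>

primrec gen_weight :: "('t, 'a) gen \<Rightarrow> real" where
  "gen_weight (GF t k y) = 1"
| "gen_weight (GU u) = 0"
| "gen_weight GW = 0"

primrec gen_points :: "('t, 'a) gen \<Rightarrow> 'a set" where
  "gen_points (GF t k y) = {y}"
| "gen_points (GU u) = {u}"
| "gen_points GW = {}"

locale subgradient_system =
  fixes F :: "'t set" and dm :: "'t \<Rightarrow> 'a::real_normed_vector set" and g :: "'t \<Rightarrow> 'a \<Rightarrow> real"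
    and N :: "rat \<Rightarrow> 'a \<Rightarrow> real" and c :: real
  assumes finF: "finite F"
begin

primrec vec :: "('t \<Rightarrow> 'a) \<Rightarrow> 't \<Rightarrow> 'a \<Rightarrow> ('t, 'a) gen \<Rightarrow> 't \<Rightarrow> 'a" where
  "vec z s w (GF t k y) = (\<lambda>t'. if t' = t then y - z t else 0)"
| "vec z s w (GU u) = (\<lambda>t'. if t' \<in> F then - u else 0)"
| "vec z s w GW = (\<lambda>t'. if t' = s then w else 0)"

text \<open>\<open>r t\<close> stands for \<open>g t (z t)\<close> but is a separate argument, since
  the point and the value are rounded independently.\<close>

primrec val :: "('t \<Rightarrow> 'a) \<Rightarrow> ('t \<Rightarrow> real) \<Rightarrow> ('t \<Rightarrow> real) \<Rightarrow> rat \<Rightarrow> 'a \<Rightarrow> ('t, 'a) gen \<Rightarrow> real" where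
  "val z r \<mu> a w (GF t k y) = \<mu> t * (g t y - r t + norm (y - z t) / real (Suc k))"
| "val z r \<mu> a w (GU u) = N a u"
| "val z r \<mu> a w GW = - (c * norm w)"

primrec ok :: "'a set \<Rightarrow> ('t \<Rightarrow> 'a) \<Rightarrow> (nat \<Rightarrow> real) \<Rightarrow> ('t, 'a) gen \<Rightarrow> bool" where
  "ok Z z \<delta> (GF t k y) \<longleftrightarrow> t \<in> F \<and> y \<in> dm t \<inter> Z \<and> norm (y - z t) < \<delta> k"
| "ok Z z \<delta> (GU u) \<longleftrightarrow> u \<in> Z"
| "ok Z z \<delta> GW \<longleftrightarrow> True"

text \<open>Domination by \<open>P\<close> means that every component has norm at most 3. The
  functionals found at the minimizer have norm at most 2; the rest is room for rounding.\<close>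

definition P :: "('t \<Rightarrow> 'a) \<Rightarrow> real" where
  "P x = 3 * (\<Sum>t\<in>F. norm (x t))"

definition items :: "('t \<Rightarrow> 'a) \<Rightarrow> ('t \<Rightarrow> real) \<Rightarrow> ('t \<Rightarrow> real) \<Rightarrow> rat \<Rightarrow> 't \<Rightarrow> 'a \<Rightarrow> (real \<times> ('t, 'a) gen) list
    \<Rightarrow> (real \<times> ('t \<Rightarrow> 'a) \<times> real) list" where
  "items z r \<mu> a s w xs = map (\<lambda>(\<nu>, \<gamma>). (\<nu>, vec z s w \<gamma>, val z r \<mu> a w \<gamma>)) xs"

definition total :: "('t \<Rightarrow> 'a) \<Rightarrow> ('t \<Rightarrow> real) \<Rightarrow> ('t \<Rightarrow> real) \<Rightarrow> rat \<Rightarrow> 't \<Rightarrow> 'a \<Rightarrow> (real \<times> ('t, 'a) gen) list \<Rightarrow> real" where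
  "total z r \<mu> a s w xs = comb_val (items z r \<mu> a s w xs) + P (- comb_vec (items z r \<mu> a s w xs))"

definition weight :: "(real \<times> ('t, 'a) gen) list \<Rightarrow> real" where
  "weight xs = (\<Sum>(\<nu>, \<gamma>)\<leftarrow>xs. \<nu> * gen_weight \<gamma>)"

definition admissible :: "'a set \<Rightarrow> ('t \<Rightarrow> 'a) \<Rightarrow> (nat \<Rightarrow> real) \<Rightarrow> (real \<times> ('t, 'a) gen) list \<Rightarrow> bool" where
  "admissible Z z \<delta> xs \<longleftrightarrow> (\<forall>(\<nu>, \<gamma>)\<in>set xs. 0 \<le> \<nu> \<and> ok Z z \<delta> \<gamma>)"

section \<open>Finite combinations of constraints\<close>

lemma items_simps [simp]:
  "items z r \<mu> a s w [] = []"
  "items z r \<mu> a s w ((\<nu>, \<gamma>) # xs) = (\<nu>, vec z s w \<gamma>, val z r \<mu> a w \<gamma>) # items z r \<mu> a s w xs"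
  by (auto simp: items_def)

lemma weight_simps [simp]: "weight [] = 0" "weight ((\<nu>, \<gamma>) # xs) = \<nu> * gen_weight \<gamma> + weight xs"
  by (auto simp: weight_def)

lemma admissible_simps [simp]:
  "admissible Z z \<delta> []"
  "admissible Z z \<delta> ((\<nu>, \<gamma>) # xs) \<longleftrightarrow> 0 \<le> \<nu> \<and> ok Z z \<delta> \<gamma> \<and> admissible Z z \<delta> xs"
  by (auto simp: admissible_def)

lemma P_sublinear: "sublinear P"
proof (rule sublinearI)
  show "P (x + y) \<le> P x + P y" for x y
    unfolding P_def distrib_left[symmetric] sum.distrib[symmetric]
    by (intro mult_left_mono sum_mono) (auto simp: norm_triangle_ineq)
  show "P (b *\<^sub>R x) \<le> b * P x" if "0 < b" for b x
    using that by (simp add: P_def sum_distrib_left algebra_simps)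
qed (simp add: P_def)

lemma P_minus: "P (- x) = P x"
  by (simp add: P_def)

lemma comb_val_perturb:
  assumes "admissible Z z \<delta> xs" "\<And>t. t \<in> F \<Longrightarrow> \<bar>r t - r' t\<bar> \<le> \<eta>" "\<And>t. t \<in> F \<Longrightarrow> norm (z t - z' t) \<le> \<eta>"
    "\<And>t. t \<in> F \<Longrightarrow> 0 \<le> \<mu> t \<and> \<mu> t \<le> m"
  shows "comb_val (items z' r' \<mu> a s w xs) \<le> comb_val (items z r \<mu> a s w xs) + weight xs * (m * (2 * \<eta>))"
  using assms(1)
proof (induction xs)
  case (Cons x xs)
  obtain \<nu> \<gamma> where x: "x = (\<nu>, \<gamma>)" by (cases x)
  have "\<nu> * val z' r' \<mu> a w \<gamma> \<le> \<nu> * (val z r \<mu> a w \<gamma> + gen_weight \<gamma> * (m * (2 * \<eta>)))"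
  proof (rule mult_left_mono)
    show "0 \<le> \<nu>" using Cons.prems x by simp
    show "val z' r' \<mu> a w \<gamma> \<le> val z r \<mu> a w \<gamma> + gen_weight \<gamma> * (m * (2 * \<eta>))"
    proof (cases \<gamma>)
      case (GF t k y)
      then have t: "t \<in> F" using Cons.prems x by simp
      have "norm (y - z' t) \<le> norm (y - z t) + \<eta>"
        using norm_triangle_ineq[of "y - z t" "z t - z' t"] assms(3)[OF t] by simp
      then have "norm (y - z' t) / real (Suc k) \<le> (norm (y - z t) + \<eta>) / real (Suc k)"
        by (intro divide_right_mono) auto
      moreover have "0 \<le> \<eta>" using assms(2)[OF t] by simp
      then have "\<eta> / real (Suc k) \<le> \<eta> / 1" by (intro divide_left_mono) auto
      ultimately have "g t y - r' t + norm (y - z' t) / real (Suc k)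
          \<le> (g t y - r t + norm (y - z t) / real (Suc k)) + 2 * \<eta>"
        using assms(2)[OF t] unfolding add_divide_distrib by linarith
      then have "\<mu> t * (g t y - r' t + norm (y - z' t) / real (Suc k))
          \<le> \<mu> t * ((g t y - r t + norm (y - z t) / real (Suc k)) + 2 * \<eta>)"
        using assms(4)[OF t] by (intro mult_left_mono) auto
      also have "\<mu> t * (2 * \<eta>) \<le> m * (2 * \<eta>)" using assms(4)[OF t] \<open>0 \<le> \<eta>\<close> by (intro mult_right_mono) auto
      then have "\<mu> t * ((g t y - r t + norm (y - z t) / real (Suc k)) + 2 * \<eta>)
         \<le> \<mu> t * (g t y - r t + norm (y - z t) / real (Suc k)) + m * (2 * \<eta>)"
        by (simp only: distrib_left add_left_mono)
      finally show ?thesis using GF by simp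
    qed simp_all
  qed
  then show ?case using Cons x by (simp add: algebra_simps)
qed simp

lemma comb_vec_perturb:
  assumes "admissible Z z \<delta> xs" "\<And>t. t \<in> F \<Longrightarrow> norm (z t - z' t) \<le> \<eta>"
  shows "(\<Sum>t\<in>F. norm (comb_vec (items z' r' \<mu> a s w xs) t - comb_vec (items z r \<mu> a s w xs) t)) \<le> weight xs * \<eta>"
  using assms(1)
proof (induction xs)
  case (Cons x xs)
  obtain \<nu> \<gamma> where x: "x = (\<nu>, \<gamma>)" by (cases x)
  have \<nu>: "0 \<le> \<nu>" using Cons.prems x by simp
  have "(\<Sum>t\<in>F. norm (vec z' s w \<gamma> t - vec z s w \<gamma> t)) \<le> gen_weight \<gamma> * \<eta>"
  proof (cases \<gamma>)
    case (GF t k y)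
    then have t: "t \<in> F" using Cons.prems x by simp
    have "norm (vec z' s w \<gamma> t' - vec z s w \<gamma> t') = (if t' = t then norm (z t - z' t) else 0)" for t'
      using GF by simp
    then show ?thesis using t finF assms(2)[OF t] GF by simp
  qed simp_all
  then have "\<nu> * (\<Sum>t\<in>F. norm (vec z' s w \<gamma> t - vec z s w \<gamma> t)) \<le> \<nu> * (gen_weight \<gamma> * \<eta>)"
    using \<nu> by (rule mult_left_mono)
  moreover have "norm (comb_vec (items z' r' \<mu> a s w (x # xs)) t - comb_vec (items z r \<mu> a s w (x # xs)) t)
      \<le> \<nu> * norm (vec z' s w \<gamma> t - vec z s w \<gamma> t)
       + norm (comb_vec (items z' r' \<mu> a s w xs) t - comb_vec (items z r \<mu> a s w xs) t)" for t
  proof -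
    have "comb_vec (items z' r' \<mu> a s w (x # xs)) t - comb_vec (items z r \<mu> a s w (x # xs)) t
       = \<nu> *\<^sub>R (vec z' s w \<gamma> t - vec z s w \<gamma> t)
        + (comb_vec (items z' r' \<mu> a s w xs) t - comb_vec (items z r \<mu> a s w xs) t)"
      by (simp add: x algebra_simps)
    then show ?thesis using \<nu> norm_triangle_ineq by (metis abs_of_nonneg norm_scaleR)
  qed
  then have "(\<Sum>t\<in>F. norm (comb_vec (items z' r' \<mu> a s w (x # xs)) t - comb_vec (items z r \<mu> a s w (x # xs)) t))
      \<le> (\<Sum>t\<in>F. \<nu> * norm (vec z' s w \<gamma> t - vec z s w \<gamma> t)
       + norm (comb_vec (items z' r' \<mu> a s w xs) t - comb_vec (items z r \<mu> a s w xs) t))"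
    by (rule sum_mono)
  ultimately show ?case using Cons x by (simp add: sum.distrib sum_distrib_left[symmetric] algebra_simps)
qed simp

text \<open>A combination of weight at most 1 changes by a multiple of \<eta> that does not depend
  on its length, so a negative total stays negative under fine rounding.\<close>

lemma total_perturb:
  assumes "admissible Z z \<delta> xs" "\<And>t. t \<in> F \<Longrightarrow> \<bar>r t - r' t\<bar> \<le> \<eta>" "\<And>t. t \<in> F \<Longrightarrow> norm (z t - z' t) \<le> \<eta>"
    "\<And>t. t \<in> F \<Longrightarrow> 0 \<le> \<mu> t \<and> \<mu> t \<le> m" "weight xs \<le> 1" "0 \<le> m" "0 \<le> \<eta>"
  shows "total z' r' \<mu> a s w xs \<le> total z r \<mu> a s w xs + (2 * m + 3) * \<eta>"
proof -
  let ?v = "comb_vec (items z r \<mu> a s w xs)" and ?v' = "comb_vec (items z' r' \<mu> a s w xs)"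
  have "P ?v' \<le> P ?v + P (?v' - ?v)" using sublinear_add[OF P_sublinear, of ?v "?v' - ?v"] by simp
  also have "P (?v' - ?v) \<le> 3 * (weight xs * \<eta>)"
    unfolding P_def using comb_vec_perturb[OF assms(1,3)] by (intro mult_left_mono) auto
  finally have "P ?v' \<le> P ?v + 3 * (weight xs * \<eta>)" by simp
  moreover have "weight xs * (m * (2 * \<eta>)) + 3 * (weight xs * \<eta>) \<le> (2 * m + 3) * \<eta>"
    using mult_right_mono[OF assms(5), of "(2 * m + 3) * \<eta>"] assms(6,7) by (simp add: algebra_simps)
  moreover have "comb_val (items z' r' \<mu> a s w xs) \<le> comb_val (items z r \<mu> a s w xs) + weight xs * (m * (2 * \<eta>))"
    by (rule comb_val_perturb[OF assms(1)]) (use assms in auto)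
  ultimately show ?thesis unfolding total_def P_minus by linarith
qed

lemma total_scale:
  assumes "0 \<le> b"
  shows "total z r \<mu> a s w (map (\<lambda>(\<nu>, \<gamma>). (b * \<nu>, \<gamma>)) xs) = b * total z r \<mu> a s w xs"
    "weight (map (\<lambda>(\<nu>, \<gamma>). (b * \<nu>, \<gamma>)) xs) = b * weight xs"
proof -
  have it: "items z r \<mu> a s w (map (\<lambda>(\<nu>, \<gamma>). (b * \<nu>, \<gamma>)) xs)
      = map (\<lambda>(\<nu>, d, r). (b * \<nu>, d, r)) (items z r \<mu> a s w xs)"
    by (simp add: items_def case_prod_unfold)
  show "total z r \<mu> a s w (map (\<lambda>(\<nu>, \<gamma>). (b * \<nu>, \<gamma>)) xs) = b * total z r \<mu> a s w xs"
    unfolding total_def it comb_scale P_minus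
    using sublinear_scaleR[OF P_sublinear assms] by (simp add: distrib_left)
  show "weight (map (\<lambda>(\<nu>, \<gamma>). (b * \<nu>, \<gamma>)) xs) = b * weight xs"
    by (induction xs) (auto simp: algebra_simps)
qed

definition single :: "'t \<Rightarrow> 'a \<Rightarrow> 't \<Rightarrow> 'a" where
  "single t x = (\<lambda>t'. if t' = t then x else 0)"

lemma linear_single_sum:
  assumes \<phi>: "linear \<phi>" and supp: "\<And>t. t \<notin> F \<Longrightarrow> x t = 0"
  shows "\<phi> x = (\<Sum>t\<in>F. \<phi> (single t (x t)))"
proof -
  have "x = (\<Sum>t\<in>F. single t (x t))"
  proof
    fix t'
    have "(\<Sum>t\<in>A. single t (x t)) t' = (\<Sum>t\<in>A. single t (x t) t')" for A
      by (induction A rule: infinite_finite_induct) auto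
    then show "x t' = (\<Sum>t\<in>F. single t (x t)) t'"
      using finF supp[of t'] by (simp add: single_def)
  qed
  then have "\<phi> x = \<phi> (\<Sum>t\<in>F. single t (x t))" by simp
  also have "\<dots> = (\<Sum>t\<in>F. \<phi> (single t (x t)))" by (rule linear_sum[OF \<phi>])
  finally show ?thesis .
qed

text \<open>Mazur--Orlicz on the space of tuples; the components of the functional obtained are the
  wanted subgradients. Totals are positively homogeneous in the weights, so lists of weight at most
  1 decide the condition for all lists.\<close>

lemma subgradients_exist:
  assumes z: "\<And>t. t \<in> F \<Longrightarrow> z t \<in> dm t" and \<mu>: "\<And>t. t \<in> F \<Longrightarrow> 0 < \<mu> t" and s: "s \<in> F"
    and \<delta>: "\<And>k. 0 < \<delta> k"
    and nonneg: "\<And>xs. admissible UNIV z \<delta> xs \<Longrightarrow> weight xs \<le> 1 \<Longrightarrow> 0 \<le> total z (\<lambda>t. g t (z t)) \<mu> a s w xs"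
  obtains \<zeta> where "\<And>t. t \<in> F \<Longrightarrow> fsub (dm t) (g t) UNIV (z t) (\<zeta> t /\<^sub>R \<mu> t)"
    "\<And>t. t \<in> F \<Longrightarrow> norm (\<zeta> t) \<le> 3" "\<And>u. - (\<Sum>t\<in>F. blinfun_apply (\<zeta> t) u) \<le> N a u"
    "blinfun_apply (\<zeta> s) w \<le> - (c * norm w)"
proof -
  let ?r = "\<lambda>t. g t (z t)"
  define \<G> where "\<G> = {(vec z s w \<gamma>, val z ?r \<mu> a w \<gamma>) | \<gamma>. ok UNIV z \<delta> \<gamma>}"
  have "\<exists>\<phi>. linear \<phi> \<and> (\<forall>x. \<phi> x \<le> P x) \<and> (\<forall>(d, r)\<in>\<G>. \<phi> d \<le> r)"
  proof (rule mazur_orlicz[OF P_sublinear])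
    fix cs assume "cs \<in> combs \<G>"
    then have "\<exists>xs. admissible UNIV z \<delta> xs \<and> cs = items z ?r \<mu> a s w xs"
    proof (induction cs)
      case Nil then show ?case by (intro exI[of _ "[]"]) simp
    next
      case (Cons x cs)
      then obtain \<nu> \<gamma> where "x = (\<nu>, vec z s w \<gamma>, val z ?r \<mu> a w \<gamma>)" "0 \<le> \<nu>" "ok UNIV z \<delta> \<gamma>"
        by (auto simp: combs_def \<G>_def)
      moreover obtain xs where "admissible UNIV z \<delta> xs" "cs = items z ?r \<mu> a s w xs"
        using Cons by (auto simp: combs_def)
      ultimately show ?case by (intro exI[of _ "(\<nu>, \<gamma>) # xs"]) simp
    qed
    then obtain xs where xs: "admissible UNIV z \<delta> xs" "cs = items z ?r \<mu> a s w xs" by blast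
    \<comment> \<open>Scaling to weight at most 1; the maximum also covers lists of weight
      0.\<close>
    define b where "b = 1 / max 1 (weight xs)"
    have b: "0 < b" by (simp add: b_def)
    let ?ys = "map (\<lambda>(\<nu>, \<gamma>). (b * \<nu>, \<gamma>)) xs"
    have "admissible UNIV z \<delta> ?ys" using xs(1) b by (auto simp: admissible_def)
    moreover have "weight ?ys \<le> 1" unfolding total_scale(2)[OF less_imp_le[OF b]] by (simp add: b_def)
    ultimately have "0 \<le> total z ?r \<mu> a s w ?ys" by (rule nonneg)
    then have "0 \<le> total z ?r \<mu> a s w xs"
      unfolding total_scale(1)[OF less_imp_le[OF b]] using b by (simp add: zero_le_mult_iff)
    then show "0 \<le> comb_val cs + P (- comb_vec cs)" by (simp add: total_def xs(2))
  qed
  then obtain \<phi> where \<phi>1: "linear \<phi>" "\<And>x. \<phi> x \<le> P x" and \<phi>\<G>: "\<forall>(d, r)\<in>\<G>. \<phi> d \<le> r" by blast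
  have "\<phi> (vec z s w \<gamma>) \<le> val z ?r \<mu> a w \<gamma>" if "ok UNIV z \<delta> \<gamma>" for \<gamma>
    using \<phi>\<G> that by (auto simp: \<G>_def)
  note \<phi> = \<phi>1 this
  have single: "single t (x + y) = single t x + single t y" "single t (b *\<^sub>R x) = b *\<^sub>R single t x" for t x y b
    by (auto simp: single_def fun_eq_iff)
  have P_single: "P (single t x) = 3 * norm x" if "t \<in> F" for t x
    using finF that by (simp add: P_def single_def if_distrib[of norm] cong: if_cong)
  have "\<exists>\<zeta> :: 'a \<Rightarrow>\<^sub>L real. \<forall>x. \<zeta> x = \<phi> (single t x)" if t: "t \<in> F" for t
  proof -
    have "linear (\<lambda>x. \<phi> (single t x))"
      by (rule linearI) (simp_all add: single linear_add[OF \<phi>(1)] linear_scale[OF \<phi>(1)])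
    moreover have "\<phi> (single t x) \<le> 3 * norm x" for x using \<phi>(2)[of "single t x"] P_single[OF t] by simp
    ultimately show ?thesis by (rule linear_bounded_blinfun) blast
  qed
  then obtain \<zeta> :: "'t \<Rightarrow> 'a \<Rightarrow>\<^sub>L real" where \<zeta>: "\<And>t x. t \<in> F \<Longrightarrow> \<zeta> t x = \<phi> (single t x)" by metis
  show thesis
  proof
    show "norm (\<zeta> t) \<le> 3" if t: "t \<in> F" for t
      using \<phi>(2)[of "single t _"] by (intro blinfun_norm_le) (simp_all add: \<zeta>[OF t] P_single[OF t, symmetric])
    show "- (\<Sum>t\<in>F. blinfun_apply (\<zeta> t) u) \<le> N a u" for u
    proof -
      have "\<phi> (vec z s w (GU u)) = (\<Sum>t\<in>F. \<phi> (single t (vec z s w (GU u) t)))"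
        by (rule linear_single_sum[OF \<phi>(1)]) simp
      also have "\<dots> = (\<Sum>t\<in>F. \<zeta> t (- u))" by (intro sum.cong) (simp_all add: \<zeta>)
      finally show ?thesis using \<phi>(3)[of "GU u"] by (simp add: blinfun.minus_right sum_negf)
    qed
    show "blinfun_apply (\<zeta> s) w \<le> - (c * norm w)"
      using \<phi>(3)[of GW] \<zeta>[OF s, of w] by (simp add: single_def)
    show "fsub (dm t) (g t) UNIV (z t) (\<zeta> t /\<^sub>R \<mu> t)" if t: "t \<in> F" for t
      unfolding fsub_def
    proof (intro conjI allI impI)
      show "z t \<in> dm t" by (rule z[OF t])
      fix \<epsilon> :: real assume "0 < \<epsilon>"
      then obtain k where k: "inverse (real (Suc k)) < \<epsilon>" using reals_Archimedean by blast
      show "\<exists>\<delta>>0. \<forall>y\<in>dm t \<inter> UNIV. norm (y - z t) < \<delta> \<longrightarrow>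
          g t (z t) + (\<zeta> t /\<^sub>R \<mu> t) (y - z t) - \<epsilon> * norm (y - z t) \<le> g t y"
      proof (intro exI[of _ "\<delta> k"] conjI ballI impI)
        fix y assume y: "y \<in> dm t \<inter> UNIV" "norm (y - z t) < \<delta> k"
        have "\<zeta> t (y - z t) \<le> \<mu> t * (g t y - g t (z t) + norm (y - z t) / real (Suc k))"
          using \<phi>(3)[of "GF t k y"] y t \<zeta>[OF t, of "y - z t"] by (simp add: single_def)
        then have "\<zeta> t (y - z t) / \<mu> t \<le> g t y - g t (z t) + norm (y - z t) / real (Suc k)"
          using \<mu>[OF t] by (simp add: pos_divide_le_eq mult.commute)
        moreover have "norm (y - z t) / real (Suc k) \<le> \<epsilon> * norm (y - z t)"
          using mult_right_mono[OF less_imp_le[OF k], of "norm (y - z t)"] by (simp add: divide_inverse mult.commute)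
        ultimately show "g t (z t) + (\<zeta> t /\<^sub>R \<mu> t) (y - z t) - \<epsilon> * norm (y - z t) \<le> g t y"
          by (simp add: blinfun.scaleR_left divide_inverse mult.commute)
      qed (rule \<delta>)
    qed
  qed
qed

text \<open>The converse of \<open>subgradients_exist\<close>: evaluating existing functionals on a
  combination certifies its total. Only the points occurring in the list are tested, so functionals
  that work along \<open>Y\<close> settle all lists in \<open>Y\<close>.\<close>

lemma subgradients_along_total_nonneg:
  assumes \<mu>: "\<And>t. t \<in> F \<Longrightarrow> 0 < \<mu> t" and s: "s \<in> F"
    and sub: "\<And>t k y. t \<in> F \<Longrightarrow> y \<in> dm t \<inter> Y \<Longrightarrow> norm (y - z t) < \<delta> k \<Longrightarrow>
        g t (z t) + blinfun_apply (\<zeta> t /\<^sub>R \<mu> t) (y - z t) - norm (y - z t) / real (Suc k) \<le> g t y"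
    and bound: "\<And>t. t \<in> F \<Longrightarrow> norm (\<zeta> t) \<le> 3"
    and sum: "\<And>u. u \<in> Y \<Longrightarrow> - (\<Sum>t\<in>F. blinfun_apply (\<zeta> t) u) \<le> N a u"
    and w: "blinfun_apply (\<zeta> s) w \<le> - (c * norm w)"
    and xs: "admissible Y z \<delta> xs"
  shows "0 \<le> total z (\<lambda>t. g t (z t)) \<mu> a s w xs"
proof -
  let ?r = "\<lambda>t. g t (z t)"
  have gen: "(\<Sum>t\<in>F. \<zeta> t (vec z s w \<gamma> t)) \<le> val z ?r \<mu> a w \<gamma>" if "ok Y z \<delta> \<gamma>" for \<gamma>
  proof (cases \<gamma>)
    case (GF t k y)
    then have t: "t \<in> F" and y: "y \<in> dm t \<inter> Y" "norm (y - z t) < \<delta> k" using that by auto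
    have "(\<Sum>t'\<in>F. \<zeta> t' (vec z s w \<gamma> t')) = (\<Sum>t'\<in>F. if t' = t then \<zeta> t (y - z t) else 0)"
      by (intro sum.cong) (simp_all add: GF)
    also have "\<dots> = \<zeta> t (y - z t)" using t finF by simp
    also have "\<zeta> t (y - z t) / \<mu> t \<le> g t y - g t (z t) + norm (y - z t) / real (Suc k)"
      using sub[OF t y] by (simp add: blinfun.scaleR_left divide_inverse mult.commute)
    then have "\<zeta> t (y - z t) \<le> \<mu> t * (g t y - g t (z t) + norm (y - z t) / real (Suc k))"
      using \<mu>[OF t] by (simp add: pos_divide_le_eq mult.commute)
    finally show ?thesis using GF by simp
  next
    case (GU u)
    then have "(\<Sum>t\<in>F. \<zeta> t (vec z s w \<gamma> t)) = - (\<Sum>t\<in>F. \<zeta> t u)"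
      by (simp add: blinfun.minus_right sum_negf)
    then show ?thesis using sum[of u] that GU by simp
  next
    case GW
    have "(\<Sum>t\<in>F. \<zeta> t (vec z s w \<gamma> t)) = (\<Sum>t\<in>F. if t = s then \<zeta> s w else 0)"
      by (intro sum.cong) (simp_all add: GW)
    then show ?thesis using s finF w GW by simp
  qed
  have "(\<Sum>t\<in>F. \<zeta> t (comb_vec (items z ?r \<mu> a s w xs) t)) \<le> comb_val (items z ?r \<mu> a s w xs)"
    using xs
  proof (induction xs)
    case (Cons x xs)
    obtain \<nu> \<gamma> where x: "x = (\<nu>, \<gamma>)" by (cases x)
    have "\<nu> * (\<Sum>t\<in>F. \<zeta> t (vec z s w \<gamma> t)) \<le> \<nu> * val z ?r \<mu> a w \<gamma>"
      using Cons.prems gen x by (intro mult_left_mono) auto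
    then show ?case using Cons x
      by (simp add: blinfun.add_right blinfun.scaleR_right sum.distrib sum_distrib_left[symmetric])
  qed simp
  moreover have "- (\<Sum>t\<in>F. \<zeta> t (v t)) \<le> P v" for v
  proof -
    have "- \<zeta> t (v t) \<le> 3 * norm (v t)" if "t \<in> F" for t
      using norm_blinfun[of "\<zeta> t" "v t"] mult_right_mono[OF bound[OF that], of "norm (v t)"] by simp
    then show ?thesis unfolding P_def sum_negf[symmetric] sum_distrib_left by (rule sum_mono)
  qed
  from this[of "comb_vec (items z ?r \<mu> a s w xs)"] calculation show ?thesis
    unfolding total_def P_minus by linarith
qed

lemma total_cong:
  assumes "admissible Z z \<delta> xs" "\<And>t. t \<in> F \<Longrightarrow> \<mu> t = \<mu>' t"
  shows "total z r \<mu> a s w xs = total z r \<mu>' a s w xs"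
proof -
  have "items z r \<mu> a s w xs = items z r \<mu>' a s w xs"
    using assms(1)
  proof (induction xs)
    case (Cons x xs)
    obtain \<nu> \<gamma> where x: "x = (\<nu>, \<gamma>)" by (cases x)
    have "val z r \<mu> a w \<gamma> = val z r \<mu>' a w \<gamma>"
      using Cons.prems assms(2) x by (cases \<gamma>) auto
    then show ?case using Cons x by simp
  qed simp
  then show ?thesis by (simp add: total_def)
qed

text \<open>A list contains finitely many strict inequalities, so they share a margin \<theta>, and
  the radii involved have bounded index. Both make rounding to rational data possible.\<close>

lemma admissible_margin:
  assumes "admissible Z z \<delta> xs"
  obtains \<theta> K where "0 < \<theta>" "\<And>\<nu> t k y. (\<nu>, GF t k y) \<in> set xs \<Longrightarrow> norm (y - z t) + \<theta> < \<delta> k \<and> k < K"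
proof -
  have "\<exists>\<theta>>0. \<exists>K. \<forall>\<nu> t k y. (\<nu>, GF t k y) \<in> set xs \<longrightarrow> norm (y - z t) + \<theta> < \<delta> k \<and> k < K"
    using assms
  proof (induction xs)
    case Nil then show ?case by (intro exI[of _ 1]) simp
  next
    case (Cons x xs)
    obtain \<nu> \<gamma> where x: "x = (\<nu>, \<gamma>)" by (cases x)
    obtain \<theta> K where \<theta>: "0 < \<theta>" and K: "\<And>\<nu> t k y. (\<nu>, GF t k y) \<in> set xs \<Longrightarrow> norm (y - z t) + \<theta> < \<delta> k \<and> k < K"
      using Cons x by auto
    show ?case
    proof (cases \<gamma>)
      case (GF t k y)
      then have "norm (y - z t) < \<delta> k" using Cons.prems x by simp
      then obtain \<theta>' where \<theta>': "0 < \<theta>'" "norm (y - z t) + \<theta>' < \<delta> k"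
        by (metis add.commute diff_add_cancel dense less_diff_eq diff_gt_0_iff_gt)
      have "norm (y - z t') + min \<theta> \<theta>' < \<delta> k' \<and> k' < max K (Suc k)"
        if "(\<nu>', GF t' k' y) \<in> set (x # xs)" for \<nu>' t' k' y
        using that K[of \<nu>' t' k' y] \<theta>' GF x by auto
      then show ?thesis using \<theta> \<theta>'(1) by (intro exI[of _ "min \<theta> \<theta>'"] conjI exI[of _ "max K (Suc k)"]) auto
    next
      case (GU u)
      show ?thesis
        by (rule exI[of _ \<theta>], intro conjI exI[of _ K]) (use \<theta> K x GU in auto)
    next
      case GW
      show ?thesis
        by (rule exI[of _ \<theta>], intro conjI exI[of _ K]) (use \<theta> K x GW in auto)
    qed
  qed
  then show thesis using that by blast
qed

lemma uniform_radius:
  assumes sub: "\<And>t. t \<in> F \<Longrightarrow> fsub (dm t) (g t) Y (z t) (\<xi> t)"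
  obtains \<delta> where "\<And>k. 0 < \<delta> k" "\<And>t k y. t \<in> F \<Longrightarrow> y \<in> dm t \<inter> Y \<Longrightarrow> norm (y - z t) < \<delta> k \<Longrightarrow>
        g t (z t) + blinfun_apply (\<xi> t) (y - z t) - norm (y - z t) / real (Suc k) \<le> g t y"
proof -
  have "\<exists>\<delta>>0. \<forall>y\<in>dm t \<inter> Y. norm (y - z t) < \<delta> \<longrightarrow>
      g t (z t) + \<xi> t (y - z t) - norm (y - z t) / real (Suc k) \<le> g t y" if "t \<in> F" for t k
  proof -
    have "0 < inverse (real (Suc k))" by simp
    then show ?thesis using sub[OF that] unfolding fsub_def divide_inverse by (simp only: mult.commute)
  qed
  then obtain d where d: "\<And>t k. t \<in> F \<Longrightarrow> 0 < d t k"
    "\<And>t k y. t \<in> F \<Longrightarrow> y \<in> dm t \<inter> Y \<Longrightarrow> norm (y - z t) < d t k \<Longrightarrow>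
        g t (z t) + \<xi> t (y - z t) - norm (y - z t) / real (Suc k) \<le> g t y" by metis
  show thesis
  proof
    show "0 < Min (insert 1 ((\<lambda>t. d t k) ` F))" for k using finF d(1) by auto
    fix t k y assume t: "t \<in> F" "y \<in> dm t \<inter> Y" "norm (y - z t) < Min (insert 1 ((\<lambda>t. d t k) ` F))"
    then have "norm (y - z t) < d t k" using finF by auto
    then show "g t (z t) + \<xi> t (y - z t) - norm (y - z t) / real (Suc k) \<le> g t y" using d(2) t by blast
  qed
qed

text \<open>If the system were unsolvable on the whole space, some list would have negative total.
  With base points rounded to \<open>D\<close> and numbers to rationals, its data are one of
  countably many parameters, and for these the closing off has placed all points of some violating
  list in \<open>D\<close>. That list contradicts solvability along
  \<open>closure D\<close>.\<close>

theorem separable_reduction: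
  assumes E: "countable E"
  obtains D where "countable D" "E \<subseteq> D" "rational_subspace D"
    "\<And>z \<mu> a s w \<zeta>. (\<And>t. t \<in> F \<Longrightarrow> z t \<in> closure D) \<Longrightarrow> (\<And>t. t \<in> F \<Longrightarrow> 0 < real_of_rat (\<mu> t)) \<Longrightarrow>
      s \<in> F \<Longrightarrow> w \<in> D \<Longrightarrow>
      (\<And>t. t \<in> F \<Longrightarrow> fsub (dm t) (g t) (closure D) (z t) (\<zeta> t /\<^sub>R real_of_rat (\<mu> t))) \<Longrightarrow>
      (\<And>t. t \<in> F \<Longrightarrow> norm (\<zeta> t) \<le> 3) \<Longrightarrow>
      (\<And>u. u \<in> closure D \<Longrightarrow> - (\<Sum>t\<in>F. blinfun_apply (\<zeta> t) u) \<le> N a u) \<Longrightarrow>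
      blinfun_apply (\<zeta> s) w \<le> - (c * norm w) \<Longrightarrow>
      \<exists>\<zeta>'. (\<forall>t\<in>F. fsub (dm t) (g t) UNIV (z t) (\<zeta>' t /\<^sub>R real_of_rat (\<mu> t)) \<and> norm (\<zeta>' t) \<le> 3)
        \<and> (\<forall>u. - (\<Sum>t\<in>F. blinfun_apply (\<zeta>' t) u) \<le> N a u) \<and> blinfun_apply (\<zeta>' s) w \<le> - (c * norm w)"
proof -
  obtain e :: "'t \<Rightarrow> nat" and n where e: "e ` F = {i. i < n}" "inj_on e F"
    using finite_imp_inj_to_nat_seg[OF finF] by blast
  have en: "e t < n" if "t \<in> F" for t using e(1) that by auto
  have inv: "inv_into F e (e t) = t" if "t \<in> F" for t using e(2) that by simp
  \<comment> \<open>Tuples over \<open>F\<close> become lists of length \<open>n\<close>, so that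
    the parameters range over a countable type even if \<open>'t\<close> is uncountable.\<close>
  define enc where "enc x = map (\<lambda>i. x (inv_into F e i)) [0..<n]" for x :: "'t \<Rightarrow> rat"
  \<comment> \<open>Beyond the stored radii the default 0 makes the strict norm inequality false, so
    larger indices are excluded.\<close>
  define rad :: "rat list \<Rightarrow> nat \<Rightarrow> real" where "rad ds k = (if k < length ds then of_rat (ds ! k) else 0)" for ds k
  \<comment> \<open>In the list \<open>l\<close> the entry \<open>e t\<close> is the rounded base
    point of \<open>t\<close>, and the last entry \<open>l ! n\<close> is \<open>w\<close>.\<close>
  define V where "V = (\<lambda>(\<mu>l, rl, a, i, ds, \<rho>) l X.
      admissible UNIV (\<lambda>t. l ! e t) (rad ds) X \<and> weight X \<le> 1 \<and>
      total (\<lambda>t. l ! e t) (\<lambda>t. real_of_rat (rl ! e t)) (\<lambda>t. real_of_rat (\<mu>l ! e t)) a (inv_into F e i) (l ! n) X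
        < - real_of_rat \<rho>)"
  \<comment> \<open>Left parameters form rational combinations; right ones insert the points of one
    chosen violating list.\<close>
  define Op where "Op p l = (case p of
      Inl q \<Rightarrow> (case l of [x, y] \<Rightarrow> {of_rat q *\<^sub>R x + y} | _ \<Rightarrow> {})
    | Inr \<pi> \<Rightarrow> (if \<exists>X. V \<pi> l X then \<Union>(gen_points ` snd ` set (SOME X. V \<pi> l X)) else {}))"
    for p :: "rat + rat list \<times> rat list \<times> rat \<times> nat \<times> rat list \<times> rat" and l :: "'a list"
  have cOp: "countable (Op p l)" for p l
  proof -
    have "finite (gen_points \<gamma>)" for \<gamma> :: "('t, 'a) gen" by (cases \<gamma>) auto
    then show ?thesis unfolding Op_def by (auto split: sum.split list.split intro!: countable_finite)
  qed
  obtain D where D: "countable D" "E \<union> {0} \<subseteq> D" "\<And>p l. set l \<subseteq> D \<Longrightarrow> Op p l \<subseteq> D"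
  proof (rule countable_closing_off[of "E \<union> {0}" Op])
    show "countable (E \<union> {0})" using E by simp
  qed (use cOp in auto)
  have "rational_subspace D" unfolding rational_subspace_def
  proof (intro conjI allI ballI)
    show "D \<noteq> {}" using D(2) by auto
    show "of_rat q *\<^sub>R a + b \<in> D" if "a \<in> D" "b \<in> D" for q a b using D(3)[of "[a, b]" "Inl q"] that by (simp add: Op_def)
  qed
  show thesis
  proof (rule that[OF D(1) _ \<open>rational_subspace D\<close>])
    show "E \<subseteq> D" using D(2) by simp
    fix z :: "'t \<Rightarrow> 'a" and \<mu> :: "'t \<Rightarrow> rat" and a s w and \<zeta> :: "'t \<Rightarrow> 'a \<Rightarrow>\<^sub>L real"
    assume zD: "\<And>t. t \<in> F \<Longrightarrow> z t \<in> closure D" and \<mu>: "\<And>t. t \<in> F \<Longrightarrow> 0 < real_of_rat (\<mu> t)"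
      and s: "s \<in> F" and w: "w \<in> D"
      and sub: "\<And>t. t \<in> F \<Longrightarrow> fsub (dm t) (g t) (closure D) (z t) (\<zeta> t /\<^sub>R real_of_rat (\<mu> t))"
      and bound: "\<And>t. t \<in> F \<Longrightarrow> norm (\<zeta> t) \<le> 3"
      and sum: "\<And>u. u \<in> closure D \<Longrightarrow> - (\<Sum>t\<in>F. blinfun_apply (\<zeta> t) u) \<le> N a u"
      and low: "blinfun_apply (\<zeta> s) w \<le> - (c * norm w)"
    let ?\<mu> = "\<lambda>t. real_of_rat (\<mu> t)" and ?r = "\<lambda>t. g t (z t)"
    obtain \<delta> where \<delta>: "\<And>k. 0 < \<delta> k" "\<And>t k y. t \<in> F \<Longrightarrow> y \<in> dm t \<inter> closure D \<Longrightarrow> norm (y - z t) < \<delta> k \<Longrightarrow>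
        g t (z t) + blinfun_apply (\<zeta> t /\<^sub>R ?\<mu> t) (y - z t) - norm (y - z t) / real (Suc k) \<le> g t y"
      by (rule uniform_radius[OF sub]) (assumption, rule that, assumption+)
    have zdm: "z t \<in> dm t" if "t \<in> F" for t using sub[OF that] by (simp add: fsub_def)
    have nonneg: "0 \<le> total z ?r ?\<mu> a s w X" if X: "admissible UNIV z \<delta> X" "weight X \<le> 1" for X
    proof (rule ccontr)
      assume neg: "\<not> ?thesis"
      define S where "S = - total z ?r ?\<mu> a s w X"
      have "0 < S / 2" using neg by (simp add: S_def)
      \<comment> \<open>Rounding there and back costs less than \<rho> each time, so
        \<open>2 * \<rho> < S\<close> keeps the total negative on return.\<close>
      from of_rat_dense[OF this] obtain \<rho> :: rat where \<rho>: "0 < real_of_rat \<rho>" "real_of_rat \<rho> < S / 2" by blast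
      obtain \<theta> K where \<theta>: "0 < \<theta>" "\<And>\<nu> t k y. (\<nu>, GF t k y) \<in> set X \<Longrightarrow> norm (y - z t) + \<theta> < \<delta> k \<and> k < K"
        using admissible_margin[OF X(1)] by metis
      define m where "m = (\<Sum>t\<in>F. ?\<mu> t)"
      have m: "0 \<le> ?\<mu> t \<and> ?\<mu> t \<le> m" if "t \<in> F" for t
        unfolding m_def
        by (intro conjI member_le_sum[OF that _ finF, of "\<lambda>t. ?\<mu> t"] less_imp_le[OF \<mu>]) (use that in auto)
      have m0: "0 \<le> m" unfolding m_def using \<mu> by (intro sum_nonneg less_imp_le) auto
      define \<eta> where "\<eta> = min (\<theta> / 3) (real_of_rat \<rho> / (2 * (2 * m + 3)))"
      have \<eta>0: "0 < \<eta>" using \<theta>(1) \<rho>(1) m0 by (auto simp: \<eta>_def)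
      have "\<eta> \<le> \<theta> / 3" unfolding \<eta>_def by (rule min.cobounded1)
      note \<eta> = \<eta>0 this
      have "(2 * m + 3) * \<eta> \<le> (2 * m + 3) * (real_of_rat \<rho> / (2 * (2 * m + 3)))"
        using m0 by (intro mult_left_mono) (auto simp: \<eta>_def)
      also have "\<dots> = real_of_rat \<rho> / 2" using m0 by (simp add: field_simps)
      finally have m\<eta>: "(2 * m + 3) * \<eta> < real_of_rat \<rho>" using \<rho>(1) by linarith
      have "\<exists>x\<in>D. norm (z t - x) \<le> \<eta>" if t: "t \<in> F" for t
      proof -
        obtain x where "x \<in> D" "dist x (z t) < \<eta>" using zD[OF t] \<eta>(1) unfolding closure_approachable by blast
        then show ?thesis by (intro bexI[of _ x]) (auto simp: dist_norm norm_minus_commute)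
      qed
      then obtain z' where z': "\<And>t. t \<in> F \<Longrightarrow> z' t \<in> D" "\<And>t. t \<in> F \<Longrightarrow> norm (z t - z' t) \<le> \<eta>" by metis
      have "\<exists>q. \<bar>?r t - real_of_rat q\<bar> \<le> \<eta>" for t
      proof -
        have "?r t < ?r t + \<eta>" using \<eta>(1) by simp
        from of_rat_dense[OF this] obtain q where "?r t < real_of_rat q" "real_of_rat q < ?r t + \<eta>" by blast
        then show ?thesis by (intro exI[of _ q]) linarith
      qed
      then obtain r' where r': "\<And>t. \<bar>?r t - real_of_rat (r' t)\<bar> \<le> \<eta>" by metis
      \<comment> \<open>The rational radius lies in the middle third of the margin. Base points move
        by at most \<open>\<theta> / 3\<close>, so \<open>X\<close> remains admissible after
        rounding, and the list \<open>X'\<close> found for the rounded data remains admissible after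
        rounding back.\<close>
      have "\<exists>q. \<delta> k - 2 * \<theta> / 3 < real_of_rat q \<and> real_of_rat q < \<delta> k - \<theta> / 3" for k
        using \<theta>(1) by (intro of_rat_dense) simp
      then obtain dq where dq: "\<And>k. \<delta> k - 2 * \<theta> / 3 < real_of_rat (dq k)" "\<And>k. real_of_rat (dq k) < \<delta> k - \<theta> / 3" by metis
      define ds where "ds = map dq [0..<K]"
      define l where "l = map (\<lambda>i. z' (inv_into F e i)) [0..<n] @ [w]"
      have ln: "l ! n = w" and le: "\<And>t. t \<in> F \<Longrightarrow> l ! e t = z' t"
        using en inv by (auto simp: l_def nth_append)
      have lD: "set l \<subseteq> D"
      proof -
        have "inv_into F e i \<in> F" if "i < n" for i using e(1) that by (intro inv_into_into) auto
        then show ?thesis using z'(1) w by (auto simp: l_def)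
      qed
      have enc_e: "enc x ! e t = x t" if "t \<in> F" for t and x :: "'t \<Rightarrow> rat"
        using en[OF that] inv[OF that] by (simp add: enc_def)
      let ?\<pi> = "(enc \<mu>, enc r', a, e s, ds, \<rho>)"
      let ?z = "\<lambda>t. l ! e t" and ?r' = "\<lambda>t. real_of_rat (enc r' ! e t)" and ?m = "\<lambda>t. real_of_rat (enc \<mu> ! e t)"
      have close: "\<bar>?r t - ?r' t\<bar> \<le> \<eta>" "norm (z t - ?z t) \<le> \<eta>" "?m t = ?\<mu> t" "0 \<le> ?m t \<and> ?m t \<le> m" if "t \<in> F" for t
        using r'[of t] z'(2)[OF that] m[OF that] by (simp_all add: enc_e[OF that] le[OF that])
      have V_iff: "V ?\<pi> l X \<longleftrightarrow> admissible UNIV ?z (rad ds) X \<and> weight X \<le> 1 \<and>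
          total ?z ?r' ?m a s w X < - real_of_rat \<rho>" for X
        by (simp add: V_def ln inv[OF s])
      have "V ?\<pi> l X"
      proof -
        have "admissible UNIV ?z (rad ds) X"
          unfolding admissible_def
        proof (intro ballI, clarify)
          fix \<nu> \<gamma> assume mem: "(\<nu>, \<gamma>) \<in> set X"
          then have ok: "0 \<le> \<nu>" "ok UNIV z \<delta> \<gamma>" using X(1) by (auto simp: admissible_def)
          have "ok UNIV ?z (rad ds) \<gamma>"
          proof (cases \<gamma>)
            case (GF t k y)
            then have t: "t \<in> F" "y \<in> dm t" using ok(2) by auto
            have k: "norm (y - z t) + \<theta> < \<delta> k" "k < K" using \<theta>(2) mem GF by auto
            have "norm (y - ?z t) \<le> norm (y - z t) + \<eta>"
              using norm_triangle_ineq[of "y - z t" "z t - ?z t"] close(2)[OF t(1)] by simp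
            then have "norm (y - ?z t) < real_of_rat (dq k)" using k(1) dq(1)[of k] \<eta>(2) by linarith
            then show ?thesis using GF t k(2) by (simp add: rad_def ds_def)
          qed simp_all
          then show "0 \<le> \<nu> \<and> ok UNIV ?z (rad ds) \<gamma>" using ok(1) by simp
        qed
        moreover have "total ?z ?r' ?\<mu> a s w X \<le> total z ?r ?\<mu> a s w X + (2 * m + 3) * \<eta>"
          by (rule total_perturb[OF X(1) close(1,2) m X(2) m0]) (use \<eta> in auto)
        moreover have "total ?z ?r' ?m a s w X = total ?z ?r' ?\<mu> a s w X"
          by (rule total_cong[OF calculation(1)]) (rule close(3))
        ultimately show ?thesis using X(2) m\<eta> \<rho>(2) unfolding V_iff S_def by (simp add: field_simps)
      qed
      define X' where "X' = (SOME X. V ?\<pi> l X)"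
      have VX': "V ?\<pi> l X'" unfolding X'_def by (rule someI[of "V ?\<pi> l"]) fact
      have pts: "gen_points \<gamma> \<subseteq> D" if "(\<nu>, \<gamma>) \<in> set X'" for \<nu> \<gamma>
      proof -
        have "Op (Inr ?\<pi>) l = \<Union>(gen_points ` snd ` set X')" using \<open>V ?\<pi> l X\<close> by (auto simp: Op_def X'_def)
        then show ?thesis using D(3)[OF lD, of "Inr ?\<pi>"] that by force
      qed
      have adm': "admissible UNIV ?z (rad ds) X'" and wt': "weight X' \<le> 1"
        and tot': "total ?z ?r' ?m a s w X' < - real_of_rat \<rho>" using VX' unfolding V_iff by auto
      have adm: "admissible (closure D) z \<delta> X'"
        unfolding admissible_def
      proof (intro ballI, clarify)
        fix \<nu> \<gamma> assume mem: "(\<nu>, \<gamma>) \<in> set X'"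
        then have ok: "0 \<le> \<nu>" "ok UNIV ?z (rad ds) \<gamma>" using adm' by (auto simp: admissible_def)
        have D\<gamma>: "gen_points \<gamma> \<subseteq> closure D" using pts[OF mem] closure_subset by blast
        have "ok (closure D) z \<delta> \<gamma>"
        proof (cases \<gamma>)
          case (GF t k y)
          then have t: "t \<in> F" "y \<in> dm t" and lt: "norm (y - ?z t) < rad ds k" using ok(2) by auto
          have k: "k < K" using lt norm_ge_zero[of "y - ?z t"] by (auto simp: rad_def ds_def split: if_splits)
          have "norm (y - z t) \<le> norm (y - ?z t) + \<eta>"
            using norm_triangle_ineq4[of "y - ?z t" "z t - ?z t"] close(2)[OF t(1)] by simp
          then have "norm (y - z t) < \<delta> k" using lt k dq(2)[of k] \<eta>(2) by (simp add: rad_def ds_def)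
          then show ?thesis using GF t D\<gamma> by simp
        qed (use D\<gamma> in simp_all)
        then show "0 \<le> \<nu> \<and> ok (closure D) z \<delta> \<gamma>" using ok(1) by simp
      qed
      have "total z ?r ?m a s w X' \<le> total ?z ?r' ?m a s w X' + (2 * m + 3) * \<eta>"
        by (rule total_perturb[OF adm' _ _ close(4) wt' m0]) (use close \<eta> in \<open>auto simp: abs_minus_commute norm_minus_commute\<close>)
      moreover have "total z ?r ?m a s w X' = total z ?r ?\<mu> a s w X'"
        by (rule total_cong[OF adm]) (rule close(3))
      moreover have "0 \<le> total z ?r ?\<mu> a s w X'"
        by (rule subgradients_along_total_nonneg[OF \<mu> s \<delta>(2) bound sum low adm])
      ultimately show False using tot' m\<eta> by linarith
    qed
    show "\<exists>\<zeta>'. (\<forall>t\<in>F. fsub (dm t) (g t) UNIV (z t) (\<zeta>' t /\<^sub>R ?\<mu> t) \<and> norm (\<zeta>' t) \<le> 3)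
        \<and> (\<forall>u. - (\<Sum>t\<in>F. blinfun_apply (\<zeta>' t) u) \<le> N a u) \<and> blinfun_apply (\<zeta>' s) w \<le> - (c * norm w)"
      by (rule subgradients_exist[OF zdm \<mu> s \<delta>(1) nonneg]; (assumption | blast))
  qed
qed

end

section \<open>Smooth one-variable optimality conditions\<close>

lemma max0_square_upper: "(max 0 (x + h))\<^sup>2 \<le> (max 0 x)\<^sup>2 + 2 * max 0 x * h + h\<^sup>2" for x h :: real
proof (cases "0 \<le> x")
  case True
  have "(max 0 (x + h))\<^sup>2 \<le> (x + h)\<^sup>2" by (simp add: max_def)
  then show ?thesis using True by (simp add: power2_sum)
next
  case False
  have "(max 0 (x + h))\<^sup>2 \<le> h\<^sup>2"
    unfolding abs_le_square_iff[symmetric] using False by (auto simp: max_def)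
  then show ?thesis using False by simp
qed

lemma max0_square_lower: "(max 0 x)\<^sup>2 + 2 * max 0 x * h \<le> (max 0 (x + h))\<^sup>2" for x h :: real
proof (cases "0 \<le> x")
  case True
  show ?thesis
  proof (cases "0 \<le> x + h")
    case True
    then show ?thesis using \<open>0 \<le> x\<close> by (simp add: power2_sum)
  next
    case False
    then have "x * (x + 2 * h) \<le> 0" using True by (intro mult_nonneg_nonpos) auto
    then show ?thesis using True False by (simp add: power2_eq_square algebra_simps max_def)
  qed
qed simp

text \<open>The remainder lies between 0 and \<open>h\<^sup>2\<close>; squaring removes the kink of
  the positive part.\<close>

lemma DERIV_max0_square: "((\<lambda>r. (max 0 (r + b))\<^sup>2) has_real_derivative 2 * max 0 (r + b)) (at r)"
proof -
  have "norm (((max 0 (r + h + b))\<^sup>2 - (max 0 (r + b))\<^sup>2) / h - 2 * max 0 (r + b)) \<le> norm h" if "h \<noteq> 0" for h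
  proof -
    let ?d = "(max 0 (r + h + b))\<^sup>2 - (max 0 (r + b))\<^sup>2 - 2 * max 0 (r + b) * h"
    have "0 \<le> ?d" "?d \<le> h\<^sup>2"
      using max0_square_lower[of "r + b" h] max0_square_upper[of "r + b" h] by (simp_all add: algebra_simps)
    then have "\<bar>?d\<bar> \<le> \<bar>h\<bar> * \<bar>h\<bar>" by (simp add: power2_eq_square)
    then have "\<bar>?d / h\<bar> \<le> \<bar>h\<bar>" using that by (simp add: abs_divide pos_divide_le_eq)
    moreover have "((max 0 (r + h + b))\<^sup>2 - (max 0 (r + b))\<^sup>2) / h - 2 * max 0 (r + b) = ?d / h"
      using that by (simp add: diff_divide_distrib)
    ultimately show ?thesis by simp
  qed
  then have ev: "\<forall>\<^sub>F h in at 0. norm (((max 0 (r + h + b))\<^sup>2 - (max 0 (r + b))\<^sup>2) / h - 2 * max 0 (r + b)) \<le> norm h"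
    unfolding eventually_at_filter by (intro always_eventually) blast
  have "((\<lambda>h. ((max 0 (r + h + b))\<^sup>2 - (max 0 (r + b))\<^sup>2) / h - 2 * max 0 (r + b)) \<longlongrightarrow> 0) (at 0)"
    by (rule Lim_null_comparison[OF ev tendsto_norm_zero[OF tendsto_ident_at]])
  then show ?thesis unfolding DERIV_def by (simp add: LIM_zero_iff)
qed

text \<open>The second difference bounds the increment at \<open>h\<close> by minus the increment at
  \<open>- h\<close>, which the subgradient inequality controls.\<close>

lemma smooth_subgradient_upper:
  fixes \<sigma> :: "'a::real_normed_vector \<Rightarrow>\<^sub>L real"
  assumes sm: "smooth_along Y s x" and sub: "\<And>h. \<sigma> h \<le> s (x + h) - s x" and "0 < \<epsilon>"
  obtains \<delta> where "0 < \<delta>" "\<And>h. h \<in> Y \<Longrightarrow> norm h < \<delta> \<Longrightarrow> s (x + h) - s x \<le> \<sigma> h + \<epsilon> * norm h"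
proof -
  obtain \<delta> where \<delta>: "0 < \<delta>" "\<And>h. h \<in> Y \<Longrightarrow> norm h < \<delta> \<Longrightarrow> s (x + h) + s (x - h) - 2 * s x \<le> \<epsilon> * norm h"
    by (rule smooth_alongD[OF sm \<open>0 < \<epsilon>\<close>]) (rule that)
  have "s (x + h) - s x \<le> \<sigma> h + \<epsilon> * norm h" if "h \<in> Y" "norm h < \<delta>" for h
    using \<delta>(2)[OF that] sub[of "- h"] by (simp add: blinfun.minus_right)
  with \<delta>(1) show thesis by (rule that)
qed

text \<open>If \<open>g y\<close> lay below the predicted value \<open>g z + \<tau>\<close>,
  monotonicity would bound \<open>\<psi> (g y)\<close> by \<open>\<psi> (g z + \<tau>)\<close>,
  where the derivative at \<open>g z\<close> applies and contradicts minimality. The derivative is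
  thus used only at arguments close to \<open>g z\<close>, however low \<open>g y\<close> may
  be.\<close>

lemma fsub_of_smooth_minimum:
  fixes \<sigma> :: "'a::real_normed_vector \<Rightarrow>\<^sub>L real"
  assumes Y: "subspace Y" and z: "z \<in> dm" "z \<in> Y" and sm: "smooth_along Y s z"
    and sub: "\<And>h. \<sigma> h \<le> s (z + h) - s z"
    and mono: "\<And>r r'. r \<le> r' \<Longrightarrow> \<psi> r \<le> \<psi> r'"
    and der: "(\<psi> has_real_derivative \<mu>) (at (g z))" and \<mu>: "0 < \<mu>" and \<rho>: "0 < \<rho>"
    and min: "\<And>y. y \<in> dm \<Longrightarrow> y \<in> Y \<Longrightarrow> norm (y - z) < \<rho> \<Longrightarrow> \<psi> (g z) + s z \<le> \<psi> (g y) + s y"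
  shows "fsub dm g Y z ((- \<sigma>) /\<^sub>R \<mu>)"
  unfolding fsub_def
proof (intro conjI allI impI)
  show "z \<in> dm" by (rule z)
  fix \<epsilon> :: real assume \<epsilon>: "0 < \<epsilon>"
  \<comment> \<open>\<open>K * norm h\<close> bounds the predicted change \<tau>, and
    \<open>e2\<close> makes the derivative error over that range at most
    \<open>\<mu> * \<epsilon> / 4 * norm h\<close>.\<close>
  define K where "K = norm \<sigma> / \<mu> + \<epsilon>"
  have K: "0 < K" using \<epsilon> \<mu> by (simp add: K_def add_nonneg_pos)
  define e2 where "e2 = \<mu> * \<epsilon> / (4 * K)"
  have e2: "0 < e2" using \<epsilon> \<mu> K by (simp add: e2_def)
  have "((\<lambda>h. (\<psi> (g z + h) - \<psi> (g z)) / h) \<longlongrightarrow> \<mu>) (at 0)" using der unfolding DERIV_def .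
  from LIM_D[OF this e2] obtain d2 where d2: "0 < d2"
    "\<And>h. h \<noteq> 0 \<Longrightarrow> norm h < d2 \<Longrightarrow> norm ((\<psi> (g z + h) - \<psi> (g z)) / h - \<mu>) < e2" by auto
  have der_up: "\<psi> (g z + h) \<le> \<psi> (g z) + \<mu> * h + e2 * \<bar>h\<bar>" if "\<bar>h\<bar> < d2" for h
  proof (cases "h = 0")
    case False
    have "\<bar>(\<psi> (g z + h) - \<psi> (g z)) / h - \<mu>\<bar> * \<bar>h\<bar> \<le> e2 * \<bar>h\<bar>"
      using d2(2)[OF False] that by (intro mult_right_mono) auto
    moreover have eq: "\<bar>X / h - \<mu>\<bar> * \<bar>h\<bar> = \<bar>X - \<mu> * h\<bar>" for X
      using False by (simp add: abs_mult[symmetric] left_diff_distrib)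
    ultimately have "\<bar>\<psi> (g z + h) - \<psi> (g z) - \<mu> * h\<bar> \<le> e2 * \<bar>h\<bar>" unfolding eq by simp
    then show ?thesis by linarith
  qed simp
  have "0 < \<mu> * \<epsilon> / 4" using \<epsilon> \<mu> by simp
  then obtain d1 where d1: "0 < d1" "\<And>h. h \<in> Y \<Longrightarrow> norm h < d1 \<Longrightarrow> s (z + h) - s z \<le> \<sigma> h + \<mu> * \<epsilon> / 4 * norm h"
    by (rule smooth_subgradient_upper[OF sm sub]) (rule that)
  show "\<exists>\<delta>>0. \<forall>y\<in>dm \<inter> Y. norm (y - z) < \<delta> \<longrightarrow>
      g z + ((- \<sigma>) /\<^sub>R \<mu>) (y - z) - \<epsilon> * norm (y - z) \<le> g y"
  proof (intro exI[of _ "min (min \<rho> d1) (d2 / K)"] conjI ballI impI)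
    show "0 < min (min \<rho> d1) (d2 / K)" using \<rho> d1(1) d2(1) K by simp
    fix y assume y: "y \<in> dm \<inter> Y" "norm (y - z) < min (min \<rho> d1) (d2 / K)"
    define h where "h = y - z"
    have hY: "h \<in> Y" unfolding h_def using Y y z by (simp add: subspace_diff)
    have nh: "norm h < \<rho>" "norm h < d1" "K * norm h < d2"
      using y(2) K by (auto simp: h_def pos_less_divide_eq mult.commute)
    define \<tau> where "\<tau> = - \<sigma> h / \<mu> - \<epsilon> * norm h"
    have "\<bar>\<sigma> h\<bar> / \<mu> \<le> norm \<sigma> * norm h / \<mu>"
      using norm_blinfun[of \<sigma> h] \<mu> by (intro divide_right_mono) auto
    then have "\<bar>\<tau>\<bar> \<le> norm \<sigma> * norm h / \<mu> + \<epsilon> * norm h"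
      using \<epsilon> \<mu> abs_triangle_ineq4[of "- \<sigma> h / \<mu>" "\<epsilon> * norm h"] by (simp add: \<tau>_def abs_mult)
    also have "\<dots> = K * norm h" by (simp add: K_def algebra_simps)
    finally have \<tau>K: "\<bar>\<tau>\<bar> \<le> K * norm h" .
    have "g z + \<tau> \<le> g y"
    proof (rule ccontr)
      assume "\<not> ?thesis"
      then have lt: "g y < g z + \<tau>" by simp
      have "\<psi> (g z) + s z \<le> \<psi> (g y) + s y" using y nh(1) by (intro min) (auto simp: h_def)
      moreover have "s y - s z \<le> \<sigma> h + \<mu> * \<epsilon> / 4 * norm h" using d1(2)[OF hY nh(2)] by (simp add: h_def)
      moreover have "\<psi> (g y) \<le> \<psi> (g z + \<tau>)" using lt by (intro mono) simp
      moreover have "\<psi> (g z + \<tau>) \<le> \<psi> (g z) + \<mu> * \<tau> + e2 * \<bar>\<tau>\<bar>" using \<tau>K nh(3) by (intro der_up) simp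
      moreover have "e2 * \<bar>\<tau>\<bar> \<le> e2 * (K * norm h)" using \<tau>K e2 by (intro mult_left_mono) auto
      moreover have "e2 * (K * norm h) = \<mu> * \<epsilon> / 4 * norm h" using K by (simp add: e2_def)
      moreover have "\<mu> * \<tau> = - \<sigma> h - \<mu> * \<epsilon> * norm h" using \<mu> by (simp add: \<tau>_def right_diff_distrib)
      ultimately have "\<mu> * \<epsilon> * norm h \<le> \<mu> * \<epsilon> / 4 * norm h + \<mu> * \<epsilon> / 4 * norm h" by linarith
      then have "(\<mu> * \<epsilon>) * norm h \<le> 0" by argo
      then have "h = 0" using \<mu> \<epsilon> by (simp add: mult_le_0_iff)
      then show False using lt by (simp add: h_def \<tau>_def blinfun.zero_right)
    qed
    then show "g z + ((- \<sigma>) /\<^sub>R \<mu>) (y - z) - \<epsilon> * norm (y - z) \<le> g y"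
      by (simp add: \<tau>_def h_def blinfun.scaleR_left blinfun.minus_left divide_inverse mult.commute)
  qed
qed

lemma convex_max0_square:
  assumes p: "convex_on UNIV p"
  shows "convex_on UNIV (\<lambda>y. (max 0 (p y))\<^sup>2)"
proof (rule convex_onI)
  fix t :: real and x y assume t: "0 < t" "t < 1"
  let ?a = "max 0 (p x)" and ?b = "max 0 (p y)"
  have "p ((1 - t) *\<^sub>R x + t *\<^sub>R y) \<le> (1 - t) * p x + t * p y" using convex_onD[OF p, of t x y] t by simp
  also have "\<dots> \<le> (1 - t) * ?a + t * ?b" using t by (intro add_mono mult_left_mono) auto
  finally have "max 0 (p ((1 - t) *\<^sub>R x + t *\<^sub>R y)) \<le> (1 - t) * ?a + t * ?b" using t by simp
  then have "(max 0 (p ((1 - t) *\<^sub>R x + t *\<^sub>R y)))\<^sup>2 \<le> ((1 - t) * ?a + t * ?b)\<^sup>2" by (intro power_mono) auto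
  also have "\<dots> \<le> (1 - t) * ?a\<^sup>2 + t * ?b\<^sup>2"
  proof -
    have "0 \<le> (1 - t) * t * (?a - ?b)\<^sup>2" using t by simp
    also have "\<dots> = (1 - t) * ?a\<^sup>2 + t * ?b\<^sup>2 - ((1 - t) * ?a + t * ?b)\<^sup>2"
      by (simp add: power2_eq_square algebra_simps)
    finally show ?thesis by simp
  qed
  finally show "(max 0 (p ((1 - t) *\<^sub>R x + t *\<^sub>R y)))\<^sup>2 \<le> (1 - t) * ?a\<^sup>2 + t * ?b\<^sup>2" .
qed simp

text \<open>The second difference is at most \<open>2 * max 0 (p x)\<close> times that of
  \<open>p\<close>, up to a remainder that is quadratic in \<open>h\<close> because \<open>p\<close>
  is 1-Lipschitz.\<close>

lemma smooth_along_max0_square: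
  assumes lip: "\<And>x y. p x - p y \<le> norm (x - y)" and sm: "smooth_along Y p x"
  shows "smooth_along Y (\<lambda>y. (max 0 (p y))\<^sup>2) x"
  unfolding smooth_along_def
proof (intro allI impI)
  fix \<epsilon> :: real assume \<epsilon>: "0 < \<epsilon>"
  let ?a = "max 0 (p x)"
  define k where "k = ?a + 1"
  have k: "0 < k" "?a \<le> k" by (simp_all add: k_def add_nonneg_pos)
  define e where "e = \<epsilon> / (4 * k)"
  have e: "0 < e" using \<epsilon> k by (simp add: e_def)
  obtain \<delta> where \<delta>: "0 < \<delta>" "\<And>h. h \<in> Y \<Longrightarrow> norm h < \<delta> \<Longrightarrow> p (x + h) + p (x - h) - 2 * p x \<le> e * norm h"
    by (rule smooth_alongD[OF sm e]) (rule that)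
  show "\<exists>\<delta>>0. \<forall>h\<in>Y. norm h < \<delta> \<longrightarrow> (max 0 (p (x + h)))\<^sup>2 + (max 0 (p (x - h)))\<^sup>2 - 2 * ?a\<^sup>2 \<le> \<epsilon> * norm h"
  proof (intro exI[of _ "min \<delta> (\<epsilon> / 4)"] conjI ballI impI)
    fix h assume h: "h \<in> Y" "norm h < min \<delta> (\<epsilon> / 4)"
    have b: "\<bar>p (x + k) - p x\<bar> \<le> norm k" for k using lip[of "x + k" x] lip[of x "x + k"] by simp
    have sq: "(p (x + k) - p x)\<^sup>2 \<le> (norm k)\<^sup>2" for k
      using b[of k] by (simp add: abs_le_square_iff[symmetric])
    have up: "(max 0 (p (x + k)))\<^sup>2 \<le> ?a\<^sup>2 + 2 * ?a * (p (x + k) - p x) + (norm k)\<^sup>2" for k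
      using max0_square_upper[of "p x" "p (x + k) - p x"] sq[of k] by simp
    have "(max 0 (p (x + h)))\<^sup>2 + (max 0 (p (x - h)))\<^sup>2
        \<le> 2 * ?a\<^sup>2 + 2 * ?a * (p (x + h) + p (x - h) - 2 * p x) + 2 * (norm h)\<^sup>2"
      using up[of h] up[of "- h"] by (simp add: algebra_simps)
    also have "2 * ?a * (p (x + h) + p (x - h) - 2 * p x) \<le> 2 * ?a * (e * norm h)"
      using \<delta>(2)[of h] h by (intro mult_left_mono) auto
    also have "2 * ?a * (e * norm h) \<le> 2 * k * (e * norm h)"
      using e k by (intro mult_right_mono) auto
    also have "2 * k * (e * norm h) = \<epsilon> / 2 * norm h" using k by (simp add: e_def)
    also have "2 * (norm h)\<^sup>2 \<le> \<epsilon> / 2 * norm h"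
      using mult_right_mono[of "norm h" "\<epsilon> / 4" "norm h"] h by (simp add: power2_eq_square)
    finally show "(max 0 (p (x + h)))\<^sup>2 + (max 0 (p (x - h)))\<^sup>2 - 2 * ?a\<^sup>2 \<le> \<epsilon> * norm h" by simp
  qed (use \<delta> \<epsilon> in simp)
qed

text \<open>Scaling \<open>h\<close> into the small ball and dividing by the scale turns a
  first-order estimate at 0 into an exact one.\<close>

lemma blinfun_le_from_small:
  fixes \<xi> :: "'a::real_normed_vector \<Rightarrow>\<^sub>L real"
  assumes Y: "subspace Y" and Q: "\<And>c x. 0 \<le> c \<Longrightarrow> Q (c *\<^sub>R x) = c * Q x"
    and small: "\<And>\<epsilon>. 0 < \<epsilon> \<Longrightarrow> \<exists>\<delta>>0. \<forall>h\<in>Y. norm h < \<delta> \<longrightarrow> \<xi> h \<le> Q h + \<epsilon> * norm h"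
    and h: "h \<in> Y"
  shows "\<xi> h \<le> Q h"
proof (rule field_le_epsilon)
  fix e :: real assume e: "0 < e"
  define \<epsilon> where "\<epsilon> = e / (norm h + 1)"
  have \<epsilon>: "0 < \<epsilon>" using e by (simp add: \<epsilon>_def add_nonneg_pos)
  obtain \<delta> where \<delta>: "0 < \<delta>" "\<And>k. k \<in> Y \<Longrightarrow> norm k < \<delta> \<Longrightarrow> \<xi> k \<le> Q k + \<epsilon> * norm k"
    using small[OF \<epsilon>] by blast
  define n where "n = norm h + 1"
  have n: "0 < n" "norm h \<le> n" by (simp_all add: n_def add_nonneg_pos)
  define t where "t = \<delta> / (2 * n)"
  have t: "0 < t" using \<delta>(1) n by (simp add: t_def)
  have "t * norm h < \<delta>"
  proof -
    have "t * norm h \<le> t * n" using t n by (intro mult_left_mono) auto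
    also have "\<dots> = \<delta> / 2" unfolding t_def using n by simp
    finally show ?thesis using \<delta>(1) by simp
  qed
  then have "\<xi> (t *\<^sub>R h) \<le> Q (t *\<^sub>R h) + \<epsilon> * norm (t *\<^sub>R h)"
    using t h Y by (intro \<delta>(2)) (auto simp: subspace_scale)
  then have "t * \<xi> h \<le> t * (Q h + \<epsilon> * norm h)"
    using t by (simp add: Q blinfun.scaleR_right algebra_simps)
  then have "\<xi> h \<le> Q h + \<epsilon> * norm h" using t by simp
  also have "\<epsilon> * norm h \<le> \<epsilon> * (norm h + 1)" using \<epsilon> by simp
  also have "\<epsilon> * (norm h + 1) = e" using n(1) unfolding \<epsilon>_def n_def by simp
  finally show "\<xi> h \<le> Q h + e" by simp
qed

section \<open>Lower semicontinuity of composite functions\<close>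

text \<open>One index is refined at a time; what was achieved for the earlier ones is inherited by
  subsequences.\<close>

lemma common_subsequence:
  fixes P :: "'t \<Rightarrow> (nat \<Rightarrow> nat) \<Rightarrow> bool"
  assumes "finite F"
    and ex: "\<And>t (r :: nat \<Rightarrow> nat). t \<in> F \<Longrightarrow> strict_mono r \<Longrightarrow> \<exists>s :: nat \<Rightarrow> nat. strict_mono s \<and> P t (r \<circ> s)"
    and sub: "\<And>t r s. P t r \<Longrightarrow> strict_mono s \<Longrightarrow> P t (r \<circ> s)"
  shows "\<exists>r :: nat \<Rightarrow> nat. strict_mono r \<and> (\<forall>t\<in>F. P t r)"
  using assms(1) ex
proof (induction F)
  case empty
  then show ?case using strict_mono_id by blast
next
  case (insert t F)
  then obtain r :: "nat \<Rightarrow> nat" where r: "strict_mono r" "\<And>t. t \<in> F \<Longrightarrow> P t r" by blast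
  obtain s :: "nat \<Rightarrow> nat" where s: "strict_mono s" "P t (r \<circ> s)" using insert.prems[of t r] r(1) by blast
  have "strict_mono (r \<circ> s)" using r(1) s(1) by (rule strict_mono_o)
  moreover have "\<forall>t'\<in>insert t F. P t' (r \<circ> s)" using s sub[OF r(2) s(1)] by blast
  ultimately show ?case by blast
qed

lemma real_common_subsequence:
  fixes r :: "nat \<Rightarrow> 't \<Rightarrow> real"
  assumes "finite F" "\<And>t. t \<in> F \<Longrightarrow> bounded (range (\<lambda>n. r n t))"
  obtains \<phi> \<rho> where "strict_mono \<phi>" "\<And>t. t \<in> F \<Longrightarrow> (\<lambda>n. r (\<phi> n) t) \<longlonglongrightarrow> \<rho> t"
proof -
  have "\<exists>\<phi>. strict_mono \<phi> \<and> (\<forall>t\<in>F. convergent (\<lambda>n. r (\<phi> n) t))"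
  proof (rule common_subsequence[OF assms(1)])
    fix t and \<phi> :: "nat \<Rightarrow> nat" assume t: "t \<in> F" and \<phi>: "strict_mono \<phi>"
    have "bounded (range (\<lambda>n. r (\<phi> n) t))" using assms(2)[OF t] by (rule bounded_subset) auto
    from bounded_imp_convergent_subsequence[OF this]
    show "\<exists>s. strict_mono s \<and> convergent (\<lambda>n. r ((\<phi> \<circ> s) n) t)"
      by (auto simp: convergent_def comp_def)
  next
    fix t and \<phi> s :: "nat \<Rightarrow> nat" assume "convergent (\<lambda>n. r (\<phi> n) t)" "strict_mono s"
    then show "convergent (\<lambda>n. r ((\<phi> \<circ> s) n) t)"
      using convergent_subseq_convergent[of "\<lambda>n. r (\<phi> n) t" s] by (simp add: comp_def)
  qed
  then obtain \<phi> where \<phi>: "strict_mono \<phi>" "\<And>t. t \<in> F \<Longrightarrow> convergent (\<lambda>n. r (\<phi> n) t)" by blast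
  show thesis by (rule that[OF \<phi>(1), of "\<lambda>t. lim (\<lambda>n. r (\<phi> n) t)"]) (use \<phi>(2) convergent_LIMSEQ_iff in blast)
qed

text \<open>Sequential lower semicontinuity of the extension of \<open>g\<close> by \<infinity> off
  \<open>dm\<close>, in the format of \<open>coordinatewise_lsc\<close>.\<close>

definition plsc :: "'a::topological_space set \<Rightarrow> ('a \<Rightarrow> real) \<Rightarrow> bool" where
  "plsc dm g \<longleftrightarrow> (\<forall>xs L x l. (\<forall>n. xs n \<in> dm \<and> g (xs n) \<le> L n) \<and> L \<longlonglongrightarrow> l \<and> xs \<longlonglongrightarrow> x
      \<longrightarrow> x \<in> dm \<and> g x \<le> l)"

lemma plscD:
  assumes "plsc dm g" "\<And>n. xs n \<in> dm" "\<And>n. g (xs n) \<le> L n" "L \<longlonglongrightarrow> l" "xs \<longlonglongrightarrow> x"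
  shows "x \<in> dm" "g x \<le> l"
  using assms(1)[unfolded plsc_def, rule_format, of xs L l x] assms(2-) by auto

text \<open>The function values along the sequence are bounded below by \<open>m\<close> and above
  by coercivity, so a subsequence of them converges to some \<rho>. Lower semicontinuity puts the
  values at the limit below \<rho>, and monotonicity and continuity of \<Psi> do the rest.\<close>

lemma coordinatewise_lsc_composite:
  fixes g :: "'t \<Rightarrow> 'a::metric_space \<Rightarrow> real"
  assumes F: "finite F" "Some ` F \<subseteq> A" and lsc: "\<And>t. t \<in> F \<Longrightarrow> plsc (dm t) (g t)" and C: "closed C"
    and low: "\<And>t y. t \<in> F \<Longrightarrow> y \<in> dm t \<Longrightarrow> y \<in> C \<Longrightarrow> m t \<le> g t y"
    and mono: "\<And>r r' z. (\<And>t. t \<in> F \<Longrightarrow> r t \<le> r' t) \<Longrightarrow> \<Psi> r z \<le> \<Psi> r' z"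
    and cont: "\<And>rs r zs z. (\<And>t. t \<in> F \<Longrightarrow> (\<lambda>n. rs n t) \<longlonglongrightarrow> r t) \<Longrightarrow> (\<And>i. i \<in> A \<Longrightarrow> (\<lambda>n. zs n i) \<longlonglongrightarrow> z i)
        \<Longrightarrow> (\<lambda>n. \<Psi> (rs n) (zs n)) \<longlonglongrightarrow> \<Psi> r z"
    and coercive: "\<And>l. \<exists>b. \<forall>r z. (\<forall>t\<in>F. m t \<le> r t) \<longrightarrow> (\<forall>i\<in>A. z i \<in> C) \<longrightarrow> \<Psi> r z \<le> l \<longrightarrow> (\<forall>t\<in>F. r t \<le> b)"
  shows "coordinatewise_lsc A {z. (\<forall>t\<in>F. z (Some t) \<in> dm t) \<and> (\<forall>i\<in>A. z i \<in> C)}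
      (\<lambda>z. \<Psi> (\<lambda>t. g t (z (Some t))) z)"
  unfolding coordinatewise_lsc_def
proof (intro allI impI, elim conjE)
  fix zs :: "nat \<Rightarrow> 't option \<Rightarrow> 'a" and L z l
  assume zs: "\<forall>n. zs n \<in> {z. (\<forall>t\<in>F. z (Some t) \<in> dm t) \<and> (\<forall>i\<in>A. z i \<in> C)} \<and>
      \<Psi> (\<lambda>t. g t (zs n (Some t))) (zs n) \<le> L n"
    and L: "L \<longlonglongrightarrow> l" and z: "\<forall>i\<in>A. (\<lambda>n. zs n i) \<longlonglongrightarrow> z i"
  define rs where "rs n t = g t (zs n (Some t))" for n t
  have SA: "Some t \<in> A" if "t \<in> F" for t using F(2) that by auto
  have rlow: "m t \<le> rs n t" if "t \<in> F" for n t
    unfolding rs_def using zs that by (intro low) (auto simp: SA)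
  obtain l' where l': "\<And>n. \<bar>L n\<bar> \<le> l'" using convergent_imp_bounded[OF L] unfolding bounded_iff by auto
  have "rs n = (\<lambda>t. g t (zs n (Some t)))" for n by (simp add: rs_def fun_eq_iff)
  then have \<Psi>l: "\<Psi> (rs n) (zs n) \<le> L n" for n using zs by simp
  have "\<Psi> (rs n) (zs n) \<le> l'" for n using \<Psi>l[of n] l'[of n] by linarith
  moreover obtain b where "\<forall>r z. (\<forall>t\<in>F. m t \<le> r t) \<longrightarrow> (\<forall>i\<in>A. z i \<in> C) \<longrightarrow> \<Psi> r z \<le> l' \<longrightarrow> (\<forall>t\<in>F. r t \<le> b)"
    using coercive by blast
  moreover have "\<forall>i\<in>A. zs n i \<in> C" for n using zs by blast
  ultimately have b: "\<And>n t. t \<in> F \<Longrightarrow> rs n t \<le> b" using rlow by blast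
  have bdd: "bounded (range (\<lambda>n. rs n t))" if t: "t \<in> F" for t
  proof -
    have "\<bar>rs n t\<bar> \<le> max \<bar>m t\<bar> \<bar>b\<bar>" for n using rlow[OF t, of n] b[OF t, of n] by linarith
    then show ?thesis unfolding bounded_iff by auto
  qed
  obtain \<phi> \<rho> where \<phi>: "strict_mono \<phi>" "\<And>t. t \<in> F \<Longrightarrow> (\<lambda>n. rs (\<phi> n) t) \<longlonglongrightarrow> \<rho> t"
    by (rule real_common_subsequence[OF F(1) bdd]) (assumption, rule that)
  have zlim: "(\<lambda>n. zs (\<phi> n) i) \<longlonglongrightarrow> z i" if "i \<in> A" for i
    using LIMSEQ_subseq_LIMSEQ[OF _ \<phi>(1), of "\<lambda>n. zs n i" "z i"] z that by (simp add: comp_def)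
  have dm: "z (Some t) \<in> dm t \<and> g t (z (Some t)) \<le> \<rho> t" if t: "t \<in> F" for t
    using plscD[OF lsc[OF t], of "\<lambda>n. zs (\<phi> n) (Some t)" "\<lambda>n. rs (\<phi> n) t" "\<rho> t" "z (Some t)"]
      zs \<phi>(2)[OF t] zlim[OF SA[OF t]] t by (auto simp: rs_def)
  have zC: "z i \<in> C" if "i \<in> A" for i
    by (rule closed_sequentially[OF C, of "\<lambda>n. zs n i"]) (use zs z that in auto)
  have "\<Psi> (\<lambda>t. g t (z (Some t))) z \<le> \<Psi> \<rho> z" by (rule mono) (use dm in blast)
  also have "\<Psi> \<rho> z \<le> l"
  proof (rule LIMSEQ_le)
    show "(\<lambda>n. \<Psi> (rs (\<phi> n)) (zs (\<phi> n))) \<longlonglongrightarrow> \<Psi> \<rho> z" by (rule cont[OF \<phi>(2) zlim])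
    show "(\<lambda>n. L (\<phi> n)) \<longlonglongrightarrow> l" using LIMSEQ_subseq_LIMSEQ[OF L \<phi>(1)] by (simp add: comp_def)
  qed (use \<Psi>l in blast)
  finally show "z \<in> {z. (\<forall>t\<in>F. z (Some t) \<in> dm t) \<and> (\<forall>i\<in>A. z i \<in> C)} \<and> \<Psi> (\<lambda>t. g t (z (Some t))) z \<le> l"
    using dm zC by blast
qed

section \<open>A fuzzy multiplier rule for finite maxima\<close>

lemma norm_like_bounds:
  assumes "norm_like \<kappa> p"
  shows "norm x - \<kappa> \<le> p x" "p x \<le> norm x" "p x - p y \<le> norm (x - y)" "convex_on UNIV p"
  using assms by (auto simp: norm_like_def)

lemma lipschitz_tendsto:
  fixes p :: "'a::real_normed_vector \<Rightarrow> real"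
  assumes "\<And>x y. p x - p y \<le> L * norm (x - y)" "xs \<longlonglongrightarrow> x"
  shows "(\<lambda>n. p (xs n)) \<longlonglongrightarrow> p x"
proof -
  have "\<bar>p (xs n) - p x\<bar> \<le> L * norm (xs n - x)" for n
    using assms(1)[of "xs n" x] assms(1)[of x "xs n"] by (simp add: abs_le_iff norm_minus_commute)
  then have ev: "\<forall>\<^sub>F n in sequentially. norm (p (xs n) - p x) \<le> L * norm (xs n - x)" by simp
  have "(\<lambda>n. L * norm (xs n - x)) \<longlonglongrightarrow> L * norm (x - x)"
    by (rule tendsto_mult[OF tendsto_const tendsto_norm[OF tendsto_diff[OF assms(2) tendsto_const]]])
  then have "(\<lambda>n. L * norm (xs n - x)) \<longlonglongrightarrow> 0" by simp
  from Lim_null_comparison[OF ev this] have "(\<lambda>n. p (xs n) - p x) \<longlonglongrightarrow> 0" .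
  then show ?thesis by (simp add: LIM_zero_iff)
qed

text \<open>In the locale, \<open>J\<close> is the set of active indices at \<open>x\<close>. The inactive functions enter only
  through the squared penalty \<open>pen\<close>, whose derivative vanishes as their values return to the
  values at \<open>x\<close>: this is why their multipliers vanish in the limit.\<close>

locale penalized_minimum =
  fixes F J :: "'t set" and dm :: "'t \<Rightarrow> 'a::banach set" and g :: "'t \<Rightarrow> 'a \<Rightarrow> real"
    and G q :: "'a \<Rightarrow> real" and x :: 'a and M R \<rho> :: real
  assumes finF: "finite F" and JF: "J \<subseteq> F" and J_ne: "J \<noteq> {}"
    and lsc: "\<And>t. t \<in> F \<Longrightarrow> plsc (dm t) (g t)" and xdm: "\<And>t. t \<in> F \<Longrightarrow> x \<in> dm t"
    and q: "sublinear q" and qM: "\<And>h. \<bar>q h\<bar> \<le> M * norm h" and M: "0 \<le> M"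
    and Gq: "\<And>u h. G (u + h) - G u \<le> q h"
    and R: "0 < R" and \<rho>: "0 < \<rho>"
    and low: "\<And>t y. t \<in> F \<Longrightarrow> y \<in> dm t \<Longrightarrow> norm (y - x) \<le> R \<Longrightarrow> g t x - \<rho> \<le> g t y"
    and MR: "M * R \<le> \<rho>" and R\<rho>: "R * (8 * real (Suc (card F))) \<le> \<rho>"
    and locmin: "\<And>u. norm (u - x) \<le> R \<Longrightarrow> (\<And>t. t \<in> F \<Longrightarrow> u \<in> dm t) \<Longrightarrow>
      \<exists>t\<in>J. g t x \<le> g t u + (\<Sum>s\<in>F - J. (max 0 (g s u - g s x))\<^sup>2) + (G u - G x)"
begin

definition m :: real where "m = real (Suc (card F))"

definition idx :: "'t option set" where "idx = insert None (Some ` F)"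

definition pen :: "('t \<Rightarrow> real) \<Rightarrow> real" where
  "pen r = (\<Sum>s\<in>F - J. (max 0 (r s - g s x))\<^sup>2)"

text \<open>The shift \<open>e\<close> makes some active term at least \<open>e\<close> wherever all
  copies agree near \<open>x\<close>; this keeps the square root away from 0.\<close>

definition tm :: "real \<Rightarrow> ('t \<Rightarrow> real) \<Rightarrow> ('t option \<Rightarrow> 'a) \<Rightarrow> 't \<Rightarrow> real" where
  "tm e r z t = r t - g t x + pen r + (G (z None) - G x) + e"

text \<open>Every function gets its own copy \<open>z (Some t)\<close> of the variable, tied to the common point \<open>z None\<close> by the
  second sum, so that the optimality conditions can be read off one coordinate at a time. The real vector
  \<open>r\<close> stands for the function values.\<close>

definition sq :: "('a \<Rightarrow> real) \<Rightarrow> real \<Rightarrow> ('t \<Rightarrow> real) \<Rightarrow> ('t option \<Rightarrow> 'a) \<Rightarrow> real" where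
  "sq p e r z = (\<Sum>t\<in>J. (max 0 (tm e r z t))\<^sup>2) + (\<Sum>t\<in>F. (max 0 (p (z (Some t) - z None)))\<^sup>2)"

text \<open>The \<delta> term gives every function, active or not, a positive multiplier; the
  \<open>c1\<close> term ties the minimizer to the point \<open>z1\<close> of the first
  minimization.\<close>

definition obj :: "('a \<Rightarrow> real) \<Rightarrow> real \<Rightarrow> real \<Rightarrow> real \<Rightarrow> ('t option \<Rightarrow> 'a) \<Rightarrow> ('t \<Rightarrow> real) \<Rightarrow> ('t option \<Rightarrow> 'a) \<Rightarrow> real" where
  "obj p e \<delta> c1 z1 r z = sqrt (sq p e r z) + \<delta> * (\<Sum>t\<in>F. r t) + c1 * (\<Sum>i\<in>idx. p (z i - z1 i))"

definition vals :: "('t option \<Rightarrow> 'a) \<Rightarrow> 't \<Rightarrow> real" where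
  "vals z t = g t (z (Some t))"

definition dom :: "'a set \<Rightarrow> ('t option \<Rightarrow> 'a) set" where
  "dom C = {z. (\<forall>t\<in>F. z (Some t) \<in> dm t) \<and> (\<forall>i\<in>idx. z i \<in> C)}"

section \<open>Bounds and lower semicontinuity of the penalized objective\<close>

lemma fin_idx: "finite idx" and card_idx: "real (card idx) = m"
  using finF by (auto simp: idx_def m_def card_image)

lemma idx_mem: "None \<in> idx" "t \<in> F \<Longrightarrow> Some t \<in> idx"
  by (auto simp: idx_def)

lemma m1: "1 \<le> m"
  by (simp add: m_def)

lemma finJ: "finite J"
  using finF JF by (rule finite_subset[rotated])

lemma card_le_m: "real (card F) \<le> m" "real (card J) \<le> m"
  using card_mono[OF finF JF] by (auto simp: m_def)

lemma G_lip: "G u - G v \<le> M * norm (u - v)"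
  using Gq[of v "u - v"] qM[of "u - v"] by simp

lemma G_near: "norm (u - x) \<le> R \<Longrightarrow> \<bar>G u - G x\<bar> \<le> \<rho>"
  using G_lip[of u x] G_lip[of x u] MR mult_left_mono[of "norm (u - x)" R M] M
  by (simp add: abs_le_iff norm_minus_commute)

lemma pen_nonneg: "0 \<le> pen r"
  unfolding pen_def by (simp add: sum_nonneg)

lemma sq_nonneg: "0 \<le> sq p e r z"
  unfolding sq_def by (simp add: sum_nonneg)

lemma tm_le_sqrt:
  assumes "t \<in> J" shows "max 0 (tm e r z t) \<le> sqrt (sq p e r z)"
proof (rule real_le_rsqrt)
  have "(max 0 (tm e r z t))\<^sup>2 \<le> (\<Sum>t\<in>J. (max 0 (tm e r z t))\<^sup>2)"
    by (rule member_le_sum[OF assms _ finJ]) simp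
  also have "\<dots> \<le> sq p e r z" unfolding sq_def by (simp add: sum_nonneg)
  finally show "(max 0 (tm e r z t))\<^sup>2 \<le> sq p e r z" .
qed

lemma coupling_le_sqrt:
  assumes "t \<in> F" shows "max 0 (p (z (Some t) - z None)) \<le> sqrt (sq p e r z)"
proof (rule real_le_rsqrt)
  have "(max 0 (p (z (Some t) - z None)))\<^sup>2 \<le> (\<Sum>t\<in>F. (max 0 (p (z (Some t) - z None)))\<^sup>2)"
    by (rule member_le_sum[OF assms _ finF]) simp
  also have "\<dots> \<le> sq p e r z" unfolding sq_def by (simp add: sum_nonneg)
  finally show "(max 0 (p (z (Some t) - z None)))\<^sup>2 \<le> sq p e r z" .
qed

lemma pen_mono: "(\<And>t. t \<in> F \<Longrightarrow> r t \<le> r' t) \<Longrightarrow> pen r \<le> pen r'"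
  unfolding pen_def by (intro sum_mono power_mono max.mono) auto

lemma sq_mono:
  assumes "\<And>t. t \<in> F \<Longrightarrow> r t \<le> r' t"
  shows "sq p e r z \<le> sq p e r' z"
proof -
  have "pen r \<le> pen r'" by (rule pen_mono) (rule assms)
  then have "tm e r z t \<le> tm e r' z t" if "t \<in> J" for t
    using assms[of t] JF that by (auto simp: tm_def)
  then show ?thesis unfolding sq_def by (intro add_mono sum_mono power_mono max.mono) auto
qed

lemma obj_mono:
  assumes "0 \<le> \<delta>" "\<And>t. t \<in> F \<Longrightarrow> r t \<le> r' t"
  shows "obj p e \<delta> c1 z1 r z \<le> obj p e \<delta> c1 z1 r' z"
proof -
  have "sqrt (sq p e r z) \<le> sqrt (sq p e r' z)" by (intro real_sqrt_le_mono sq_mono assms(2))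
  moreover have "\<delta> * (\<Sum>t\<in>F. r t) \<le> \<delta> * (\<Sum>t\<in>F. r' t)" by (intro mult_left_mono sum_mono assms)
  ultimately show ?thesis unfolding obj_def by linarith
qed

text \<open>A bound on the root caps the active values because the penalty is nonnegative. Together
  with the lower bound on one active value it caps the penalty, and with it the inactive
  values.\<close>

lemma value_bounds:
  assumes r: "\<And>t. t \<in> F \<Longrightarrow> g t x - \<rho> \<le> r t" and z: "norm (z None - x) \<le> R" and e: "0 \<le> e"
    and l: "sqrt (sq p e r z) \<le> l"
  shows "t \<in> J \<Longrightarrow> r t \<le> g t x + \<rho> + l" "pen r \<le> 2 * \<rho> + l"
    "s \<in> F - J \<Longrightarrow> (max 0 (r s - g s x))\<^sup>2 \<le> 2 * \<rho> + l"
proof -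
  have tm: "tm e r z t \<le> l" if "t \<in> J" for t
    using tm_le_sqrt[OF that, of e r z p] l by simp
  show "r t \<le> g t x + \<rho> + l" if "t \<in> J"
    using tm[OF that] pen_nonneg[of r] G_near[OF z] e by (simp add: tm_def)
  obtain t where t: "t \<in> J" using J_ne by blast
  show pen: "pen r \<le> 2 * \<rho> + l"
    using tm[OF t] r[of t] t JF G_near[OF z] e by (auto simp: tm_def abs_le_iff)
  show "(max 0 (r s - g s x))\<^sup>2 \<le> 2 * \<rho> + l" if "s \<in> F - J"
    using member_le_sum[OF that, of "\<lambda>s. (max 0 (r s - g s x))\<^sup>2"] finF pen by (auto simp: pen_def)
qed

lemma sq_tendsto:
  assumes p: "norm_like \<kappa> p" and r: "\<And>t. t \<in> F \<Longrightarrow> (\<lambda>n. rs n t) \<longlonglongrightarrow> r t"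
    and z: "\<And>i. i \<in> idx \<Longrightarrow> (\<lambda>n. zs n i) \<longlonglongrightarrow> z i"
  shows "(\<lambda>n. sq p e (rs n) (zs n)) \<longlonglongrightarrow> sq p e r z"
proof -
  have G: "(\<lambda>n. G (zs n None)) \<longlonglongrightarrow> G (z None)"
    by (rule lipschitz_tendsto[of G M, OF G_lip z[OF idx_mem(1)]])
  have p: "(\<lambda>n. p (zs n (Some t) - zs n None)) \<longlonglongrightarrow> p (z (Some t) - z None)" if "t \<in> F" for t
    by (rule lipschitz_tendsto[of p 1]) (use norm_like_bounds(3)[OF p] z idx_mem that in \<open>auto intro: tendsto_diff\<close>)
  have pen: "(\<lambda>n. pen (rs n)) \<longlonglongrightarrow> pen r" unfolding pen_def by (intro tendsto_intros r) auto
  show ?thesis unfolding sq_def tm_def using JF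
    by (intro tendsto_intros r G p pen) auto
qed

text \<open>The composite criterion with lower bounds \<open>g t x - \<rho>\<close>. Coercivity
  comes from \<open>value_bounds\<close>, once the \<delta> and \<open>c1\<close> terms, which are
  bounded below, are moved to the other side.\<close>

lemma obj_lsc:
  assumes p: "norm_like \<kappa> p" and "0 \<le> e" "0 \<le> \<delta>" "0 \<le> c1"
    and C: "closed C" "\<And>y. y \<in> C \<Longrightarrow> norm (y - x) \<le> R"
  shows "coordinatewise_lsc idx (dom C) (\<lambda>z. obj p e \<delta> c1 z1 (vals z) z)"
proof -
  have "coordinatewise_lsc idx {z. (\<forall>t\<in>F. z (Some t) \<in> dm t) \<and> (\<forall>i\<in>idx. z i \<in> C)}
      (\<lambda>z. obj p e \<delta> c1 z1 (\<lambda>t. g t (z (Some t))) z)"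
  proof (rule coordinatewise_lsc_composite[where m = "\<lambda>t. g t x - \<rho>"])
    show "g t x - \<rho> \<le> g t y" if "t \<in> F" "y \<in> dm t" "y \<in> C" for t y
      using that C(2) by (intro low) auto
    show "obj p e \<delta> c1 z1 r z \<le> obj p e \<delta> c1 z1 r' z" if "\<And>t. t \<in> F \<Longrightarrow> r t \<le> r' t" for r r' z
      using obj_mono[OF assms(3)] that by blast
    show "(\<lambda>n. obj p e \<delta> c1 z1 (rs n) (zs n)) \<longlonglongrightarrow> obj p e \<delta> c1 z1 r z"
      if rs: "\<And>t. t \<in> F \<Longrightarrow> (\<lambda>n. rs n t) \<longlonglongrightarrow> r t" and zs: "\<And>i. i \<in> idx \<Longrightarrow> (\<lambda>n. zs n i) \<longlonglongrightarrow> z i" for rs r zs z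
    proof -
      have "(\<lambda>n. p (zs n i - z1 i)) \<longlonglongrightarrow> p (z i - z1 i)" if "i \<in> idx" for i
        by (rule lipschitz_tendsto[of p 1]) (use norm_like_bounds(3)[OF p] zs that in \<open>auto intro: tendsto_diff\<close>)
      then show ?thesis unfolding obj_def by (intro tendsto_intros sq_tendsto[OF p] rs zs)
    qed
    fix l
    define l' where "l' = l - \<delta> * (\<Sum>t\<in>F. g t x - \<rho>) + c1 * (m * \<kappa>)"
    show "\<exists>b. \<forall>r z. (\<forall>t\<in>F. g t x - \<rho> \<le> r t) \<longrightarrow> (\<forall>i\<in>idx. z i \<in> C) \<longrightarrow> obj p e \<delta> c1 z1 r z \<le> l \<longrightarrow> (\<forall>t\<in>F. r t \<le> b)"
    proof (intro exI allI impI ballI)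
      fix r z t assume r: "\<forall>t\<in>F. g t x - \<rho> \<le> r t" and z: "\<forall>i\<in>idx. z i \<in> C" and le: "obj p e \<delta> c1 z1 r z \<le> l" and t: "t \<in> F"
      have "\<delta> * (\<Sum>t\<in>F. g t x - \<rho>) \<le> \<delta> * (\<Sum>t\<in>F. r t)" using r assms(3) by (intro mult_left_mono sum_mono) auto
      moreover have "- \<kappa> \<le> p y" for y using norm_like_bounds(1)[OF p, of y] norm_ge_zero[of y] by linarith
      then have "(\<Sum>i\<in>idx. - \<kappa>) \<le> (\<Sum>i\<in>idx. p (z i - z1 i))" by (intro sum_mono)
      then have "c1 * (- (m * \<kappa>)) \<le> c1 * (\<Sum>i\<in>idx. p (z i - z1 i))"
        using assms(4) card_idx by (intro mult_left_mono) auto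
      ultimately have sl: "sqrt (sq p e r z) \<le> l'" using le unfolding obj_def l'_def by simp
      have zN: "norm (z None - x) \<le> R" using z C(2) idx_mem(1) by blast
      have vb1: "t \<in> J \<Longrightarrow> r t \<le> g t x + \<rho> + l'"
        by (rule value_bounds(1)[OF _ zN assms(2) sl]) (use r in auto)
      have vb2: "pen r \<le> 2 * \<rho> + l'"
        by (rule value_bounds(2)[OF _ zN assms(2) sl]) (use r in auto)
      have vb3: "t \<in> F - J \<Longrightarrow> (max 0 (r t - g t x))\<^sup>2 \<le> 2 * \<rho> + l'"
        by (rule value_bounds(3)[OF _ zN assms(2) sl]) (use r in auto)
      show "r t \<le> (\<Sum>t\<in>F. \<bar>g t x\<bar>) + \<rho> + \<bar>l'\<bar> + (2 * \<rho> + l' + 1)"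
      proof -
        have gt: "g t x \<le> (\<Sum>t\<in>F. \<bar>g t x\<bar>)"
          using member_le_sum[OF t _ finF, of "\<lambda>t. \<bar>g t x\<bar>"] by simp
        have "0 \<le> 2 * \<rho> + l'" using pen_nonneg[of r] vb2 by linarith
        show ?thesis
        proof (cases "t \<in> J")
          case True
          then show ?thesis using vb1 gt \<open>0 \<le> 2 * \<rho> + l'\<close> by linarith
        next
          case False
          then have "(max 0 (r t - g t x))\<^sup>2 \<le> 2 * \<rho> + l'" using vb3 t by blast
          moreover have "a \<le> a\<^sup>2 + 1" for a :: real
            using zero_le_power2[of "a - 1/2"] by (simp add: power2_eq_square algebra_simps)
          ultimately have "r t - g t x \<le> 2 * \<rho> + l' + 1" by (meson add_right_mono max.cobounded2 order_trans)
          then show ?thesis using gt \<rho> by linarith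
        qed
      qed
    qed
  qed (use finF lsc C in \<open>auto simp: idx_def\<close>)
  then show ?thesis unfolding dom_def vals_def[abs_def] .
qed

text \<open>At a zero all copies coincide, because the exact norm vanishes only at 0, and no active
  term is positive; but local minimality makes one of them at least \<open>e\<close>.\<close>

lemma sq_norm_pos:
  assumes e: "0 < e" and z: "z \<in> dom (cball x R)"
  shows "0 < sq norm e (vals z) z"
proof (rule ccontr)
  assume "\<not> ?thesis"
  then have 0: "sqrt (sq norm e (vals z) z) = 0" using sq_nonneg[of norm e "vals z" z] by simp
  have same: "z (Some t) = z None" if "t \<in> F" for t
    using coupling_le_sqrt[OF that, of norm z e "vals z"] 0 by simp
  have "norm (z None - x) \<le> R" using z idx_mem(1) by (auto simp: dom_def dist_norm norm_minus_commute)
  moreover have "z None \<in> dm t" if "t \<in> F" for t using z same[OF that] that by (auto simp: dom_def)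
  ultimately obtain t where t: "t \<in> J"
    "g t x \<le> g t (z None) + (\<Sum>s\<in>F - J. (max 0 (g s (z None) - g s x))\<^sup>2) + (G (z None) - G x)"
    using locmin by blast
  have "pen (vals z) = (\<Sum>s\<in>F - J. (max 0 (g s (z None) - g s x))\<^sup>2)"
    unfolding pen_def vals_def using same by (intro sum.cong) auto
  then have "e \<le> tm e (vals z) z t"
    using t JF same[of t] by (auto simp: tm_def vals_def)
  then show False using tm_le_sqrt[OF t(1), of e "vals z" z norm] 0 e by simp
qed

text \<open>The constant tuple \<open>x\<close> has root at most \<open>m * e\<close>, hence is
  within \<open>m * e\<close> of the infimum, the root being nonnegative. Ekeland's principle then
  moves by at most \<open>8 * (m * e) / c1\<close>, which is at most \<open>R / 4\<close>.\<close>

lemma first_phase: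
  assumes e: "0 < e" and c1: "0 < c1" "c1 \<le> 1" and er: "e * m * 32 \<le> c1 * R" and e\<rho>: "2 * e * m \<le> \<rho>"
  obtains z1 where "z1 \<in> dom (cball x R)" "\<And>i. i \<in> idx \<Longrightarrow> norm (z1 i - x) \<le> R / 4"
    "sqrt (sq norm e (vals z1) z1) \<le> 5 / 8 * \<rho>"
    "\<And>y. y \<in> dom (cball x R) \<Longrightarrow>
      sqrt (sq norm e (vals z1) z1) \<le> sqrt (sq norm e (vals y) y) + c1 * (\<Sum>i\<in>idx. norm (y i - z1 i))"
proof -
  let ?\<Theta> = "\<lambda>z. sqrt (sq norm e (vals z) z)"
  let ?z0 = "\<lambda>_. x"
  have nl: "norm_like 0 (norm :: 'a \<Rightarrow> real)" by (rule norm_like_norm)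
  have l: "coordinatewise_lsc idx (dom (cball x R)) ?\<Theta>"
    using obj_lsc[OF nl less_imp_le[OF e] order_refl order_refl, of "cball x R" ?z0]
    by (simp add: obj_def dist_norm norm_minus_commute)
  have z0: "?z0 \<in> dom (cball x R)" using xdm R by (auto simp: dom_def)
  have "pen (vals ?z0) = 0" by (simp add: pen_def vals_def)
  then have "sq norm e (vals ?z0) ?z0 = real (card J) * e\<^sup>2"
    using e by (simp add: sq_def tm_def vals_def)
  also have "\<dots> \<le> m\<^sup>2 * e\<^sup>2"
    using card_le_m(2) m1 by (intro mult_right_mono) (auto simp: power2_eq_square intro: order_trans[OF _ mult_left_mono[of 1 m m]])
  finally have z0v: "?\<Theta> ?z0 \<le> m * e"
    using m1 e by (intro real_le_lsqrt) (auto simp: power_mult_distrib)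
  have near: "?\<Theta> ?z0 \<le> ?\<Theta> z + m * e" for z
    using z0v real_sqrt_ge_zero[OF sq_nonneg[of norm e "vals z" z]] by linarith
  have me: "0 < m * e" using m1 e by simp
  obtain z1 where z1: "z1 \<in> dom (cball x R)" "\<And>i. i \<in> idx \<Longrightarrow> norm (z1 i - x) \<le> 8 * (m * e) / c1"
    "\<And>y. y \<in> dom (cball x R) \<Longrightarrow> ?\<Theta> z1 \<le> ?\<Theta> y + c1 * (\<Sum>i\<in>idx. norm (y i - z1 i))"
    using ekeland_variational_principle[OF fin_idx l, of 0 ?z0 "m * e" c1] z0 near me c1 sq_nonneg
    by auto
  have d: "norm (z1 i - x) \<le> R / 4" if "i \<in> idx" for i
  proof -
    have "8 * (m * e) / c1 \<le> R / 4" using er c1(1) by (simp add: pos_divide_le_eq mult.commute mult.left_commute)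
    then show ?thesis using z1(2)[OF that] by simp
  qed
  have "c1 * (\<Sum>i\<in>idx. norm (x - z1 i)) \<le> 1 * (\<Sum>i\<in>idx. R / 4)"
    using c1 d by (intro mult_mono sum_mono) (auto simp: norm_minus_commute intro: sum_nonneg)
  also have "\<dots> = m * (R / 4)" using card_idx by simp
  also have "\<dots> \<le> \<rho> / 8" using R\<rho> \<rho> unfolding m_def[symmetric] by (simp add: mult.commute)
  finally have "?\<Theta> z1 \<le> 5 / 8 * \<rho>" using z1(3)[OF z0] z0v e\<rho> by (simp add: mult.commute mult.left_commute)
  then show thesis using that[OF z1(1) d _ z1(3)] by blast
qed

lemma sqrt_sq_le_norm:
  assumes "norm_like \<kappa> p" shows "sqrt (sq p e r z) \<le> sqrt (sq norm e r z)"
  unfolding sq_def using norm_like_bounds(2)[OF assms]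
  by (intro real_sqrt_le_mono add_mono order_refl sum_mono power_mono max.mono) auto

text \<open>Each coupling term grows by at most \<kappa> before squaring, and the sum of squares is
  completed to the square of the right side.\<close>

lemma sqrt_sq_norm_le:
  assumes p: "norm_like \<kappa> p" and \<kappa>: "0 \<le> \<kappa>"
  shows "sqrt (sq norm e r z) \<le> sqrt (sq p e r z) + m * \<kappa>"
proof (rule real_le_lsqrt)
  define w where "w t = z (Some t) - z None" for t
  define b where "b t = max 0 (p (w t))" for t
  define S where "S = sqrt (sq p e r z)"
  have S0: "0 \<le> S" "S\<^sup>2 = sq p e r z" using sq_nonneg[of p e r z] by (auto simp: S_def)
  show "0 \<le> sqrt (sq p e r z) + m * \<kappa>" using S0 \<kappa> m1 by (simp add: S_def)
  have bS: "b t \<le> S" if "t \<in> F" for t using coupling_le_sqrt[OF that, of p z e r] by (simp add: b_def w_def S_def)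
  have "(max 0 (norm (w t)))\<^sup>2 \<le> (b t)\<^sup>2 + (2 * \<kappa> * S + \<kappa>\<^sup>2)" if "t \<in> F" for t
  proof -
    have "max 0 (norm (w t)) \<le> b t + \<kappa>" using norm_like_bounds(1)[OF p, of "w t"] \<kappa> by (simp add: b_def)
    then have "(max 0 (norm (w t)))\<^sup>2 \<le> (b t + \<kappa>)\<^sup>2" by (intro power_mono) auto
    also have "\<dots> = (b t)\<^sup>2 + 2 * \<kappa> * b t + \<kappa>\<^sup>2" by (simp add: power2_sum)
    also have "2 * \<kappa> * b t \<le> 2 * \<kappa> * S" using bS[OF that] \<kappa> by (intro mult_left_mono) auto
    finally show ?thesis by simp
  qed
  then have "(\<Sum>t\<in>F. (max 0 (norm (w t)))\<^sup>2) \<le> (\<Sum>t\<in>F. (b t)\<^sup>2 + (2 * \<kappa> * S + \<kappa>\<^sup>2))" by (rule sum_mono)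
  also have "\<dots> = (\<Sum>t\<in>F. (b t)\<^sup>2) + real (card F) * (2 * \<kappa> * S + \<kappa>\<^sup>2)" by (simp add: sum.distrib)
  also have "real (card F) * (2 * \<kappa> * S + \<kappa>\<^sup>2) \<le> m * (2 * \<kappa> * S + \<kappa>\<^sup>2)"
    using card_le_m(1) \<kappa> S0 by (intro mult_right_mono) auto
  finally have "sq norm e r z \<le> sq p e r z + m * (2 * \<kappa> * S + \<kappa>\<^sup>2)"
    by (simp add: sq_def w_def b_def)
  also have "\<dots> \<le> S\<^sup>2 + 2 * S * (m * \<kappa>) + (m * \<kappa>)\<^sup>2"
  proof -
    have "m * \<kappa>\<^sup>2 \<le> m * (m * \<kappa>\<^sup>2)" using m1 by (intro mult_left_mono) (auto simp: mult_le_cancel_right1)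
    then show ?thesis using S0(2) by (simp add: algebra_simps power2_eq_square)
  qed
  also have "\<dots> = (S + m * \<kappa>)\<^sup>2" by (simp add: power2_sum)
  finally show "sq norm e r z \<le> (sqrt (sq p e r z) + m * \<kappa>)\<^sup>2" by (simp add: S_def)
qed

text \<open>The parameters are fixed in the order \<open>d\<close>, \<sigma>, \<kappa>, \<delta>:
  the positive value of the root, the displacement it tolerates, the accuracy of the smooth norm and
  the slope in the function values. The root then stays at least \<open>d / 2\<close> after the
  exact norm is replaced.\<close>

lemma second_phase:
  assumes e: "0 < e" and c1: "0 < c1" "c1 \<le> 1" and \<delta>0: "0 < \<delta>0"
    and Y: "closed Y" and smoothY: "\<And>\<kappa>. 0 < \<kappa> \<Longrightarrow> \<exists>p. norm_like \<kappa> p \<and> (\<forall>y. smooth_along Y p y)"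
    and z1: "z1 \<in> dom (cball x R)" "\<And>i. i \<in> idx \<Longrightarrow> norm (z1 i - x) \<le> R / 4" "\<And>i. i \<in> idx \<Longrightarrow> z1 i \<in> Y"
    and d\<rho>: "sqrt (sq norm e (vals z1) z1) \<le> 5 / 8 * \<rho>"
    and ek: "\<And>y. y \<in> dom (cball x R) \<Longrightarrow>
      sqrt (sq norm e (vals z1) z1) \<le> sqrt (sq norm e (vals y) y) + c1 * (\<Sum>i\<in>idx. norm (y i - z1 i))"
  obtains z \<delta> \<kappa> p D0 S where "z \<in> dom (Y \<inter> cball x R)" "\<And>i. i \<in> idx \<Longrightarrow> norm (z i - x) \<le> R / 2"
    "0 < \<delta>" "\<delta> \<le> \<delta>0" "0 < \<kappa>" "norm_like \<kappa> p" "\<And>y. smooth_along Y p y"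
    "D0 = sqrt (sq p e (vals z) z)" "0 < D0" "D0 \<le> \<rho>" "2 * m * \<kappa> \<le> D0"
    "\<And>i. i \<in> idx \<Longrightarrow> convex_on UNIV (S i)"
    "\<And>i u v. i \<in> idx \<Longrightarrow> S i u - S i v \<le> 2 * c1 * norm (u - v)"
    "\<And>i y. i \<in> idx \<Longrightarrow> smooth_along Y (S i) y"
    "\<And>y. y \<in> dom (Y \<inter> cball x R) \<Longrightarrow> D0 + \<delta> * (\<Sum>t\<in>F. vals z t) + (\<Sum>i\<in>idx. S i (z i))
        \<le> sqrt (sq p e (vals y) y) + \<delta> * (\<Sum>t\<in>F. vals y t) + (\<Sum>i\<in>idx. S i (y i))"
proof -
  define d where "d = sqrt (sq norm e (vals z1) z1)"
  have d: "0 < d" using sq_norm_pos[OF e z1(1)] by (simp add: d_def)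
  have m: "0 < m" using m1 by simp
  define \<sigma> where "\<sigma> = min (R / 4) (min (d / (4 * m)) (\<rho> / (8 * m)))"
  have \<sigma>: "0 < \<sigma>" "\<sigma> \<le> R / 4" "m * \<sigma> \<le> d / 4" "m * \<sigma> \<le> \<rho> / 8"
  proof -
    show "0 < \<sigma>" "\<sigma> \<le> R / 4" using R d \<rho> m by (auto simp: \<sigma>_def)
    have "\<sigma> \<le> d / (4 * m)" "\<sigma> \<le> \<rho> / (8 * m)" by (auto simp: \<sigma>_def)
    then show "m * \<sigma> \<le> d / 4" "m * \<sigma> \<le> \<rho> / 8" using m by (auto simp: pos_le_divide_eq mult.commute mult.left_commute)
  qed
  \<comment> \<open>The variational principle below moves by at most
    \<open>2 * (m * \<kappa> + 12 * m * \<kappa> / c1)\<close>. As \<open>c1 \<le> 1\<close>, this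
    is at most \<sigma> when \<open>26 * m * \<kappa> \<le> c1 * \<sigma>\<close>.\<close>
  define \<kappa> where "\<kappa> = min (c1 * \<sigma> / (26 * m)) (min (d / (4 * m)) (\<rho> / (8 * m)))"
  have \<kappa>: "0 < \<kappa>" "26 * m * \<kappa> \<le> c1 * \<sigma>" "m * \<kappa> \<le> d / 4" "m * \<kappa> \<le> \<rho> / 8"
  proof -
    show "0 < \<kappa>" using c1 \<sigma> d \<rho> m by (auto simp: \<kappa>_def)
    have "\<kappa> \<le> c1 * \<sigma> / (26 * m)" "\<kappa> \<le> d / (4 * m)" "\<kappa> \<le> \<rho> / (8 * m)" by (auto simp: \<kappa>_def)
    then show "26 * m * \<kappa> \<le> c1 * \<sigma>" "m * \<kappa> \<le> d / 4" "m * \<kappa> \<le> \<rho> / 8"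
      using m by (auto simp: pos_le_divide_eq mult.commute mult.left_commute)
  qed
  have \<kappa>m: "\<kappa> \<le> m * \<kappa>" using m1 \<kappa>(1) by simp
  have "\<exists>p. norm_like (\<kappa> / 2 ^ k) p \<and> (\<forall>y. smooth_along Y p y)" for k :: nat
    using smoothY[of "\<kappa> / 2 ^ k"] \<kappa>(1) by simp
  then obtain pk where pk: "\<And>k. norm_like (\<kappa> / 2 ^ k) (pk k)" "\<And>k y. smooth_along Y (pk k) y" by metis
  define p where "p = pk 0"
  have p: "norm_like \<kappa> p" "\<And>y. smooth_along Y p y" using pk(1)[of 0] pk(2)[of 0] by (auto simp: p_def)
  note pb = norm_like_bounds[OF p(1)]
  define C where "C = Y \<inter> cball x R"
  have C: "closed C" "\<And>y. y \<in> C \<Longrightarrow> norm (y - x) \<le> R" and CX: "dom C \<subseteq> dom (cball x R)"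
    using Y by (auto simp: C_def dom_def dist_norm norm_minus_commute)
  have z1C: "z1 \<in> dom C" using z1 by (auto simp: dom_def C_def)
  have vlow: "g t x - \<rho> \<le> vals y t" if "y \<in> dom (cball x R)" "t \<in> F" for y t
    using that idx_mem(2) unfolding vals_def by (intro low) (auto simp: dom_def dist_norm norm_minus_commute)
  \<comment> \<open>An upper bound for the drop of the summed values from \<open>z1\<close>;
    \<delta> makes its contribution at most \<kappa>.\<close>
  define B where "B = (\<Sum>t\<in>F. vals z1 t) - (\<Sum>t\<in>F. g t x - \<rho>)"
  have B: "0 \<le> B" unfolding B_def using vlow[OF z1(1)] by (simp add: sum_mono)
  define \<delta> where "\<delta> = min \<delta>0 (\<kappa> / (B + 1))"
  have \<delta>: "0 < \<delta>" "\<delta> \<le> \<delta>0" using \<delta>0 \<kappa>(1) B by (auto simp: \<delta>_def)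
  have \<delta>B: "\<delta> * B \<le> \<kappa>"
  proof -
    have "\<delta> * B \<le> \<delta> * (B + 1)" using \<delta>(1) by simp
    also have "\<dots> \<le> \<kappa> / (B + 1) * (B + 1)" using B by (intro mult_right_mono) (auto simp: \<delta>_def)
    also have "\<dots> = \<kappa>" using B by simp
    finally show ?thesis .
  qed
  have \<delta>vals: "\<delta> * (\<Sum>t\<in>F. vals z1 t) - \<delta> * (\<Sum>t\<in>F. vals y t) \<le> \<kappa>" if "y \<in> dom (cball x R)" for y
  proof -
    have "(\<Sum>t\<in>F. g t x - \<rho>) \<le> (\<Sum>t\<in>F. vals y t)" using vlow[OF that] by (rule sum_mono)
    then have "\<delta> * ((\<Sum>t\<in>F. vals z1 t) - (\<Sum>t\<in>F. vals y t)) \<le> \<delta> * B"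
      using \<delta>(1) by (intro mult_left_mono) (auto simp: B_def)
    then show ?thesis using \<delta>B by (simp add: right_diff_distrib)
  qed
  let ?\<Theta> = "\<lambda>z. obj p e \<delta> c1 z1 (vals z) z"
  have lscO: "coordinatewise_lsc idx (dom C) ?\<Theta>"
    by (rule obj_lsc[OF p(1) _ _ _ C]) (use e \<delta> c1 in auto)
  have psum: "- (m * \<kappa>) \<le> c1 * (\<Sum>i\<in>idx. p (y i - z1 i))" for y
  proof -
    have "- \<kappa> \<le> p u" for u using pb(1)[of u] norm_ge_zero[of u] by linarith
    then have "(\<Sum>i\<in>idx. - \<kappa>) \<le> (\<Sum>i\<in>idx. p (y i - z1 i))" by (intro sum_mono)
    then have "c1 * - (m * \<kappa>) \<le> c1 * (\<Sum>i\<in>idx. p (y i - z1 i))"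
      using c1 card_idx by (intro mult_left_mono) auto
    moreover have "c1 * (m * \<kappa>) \<le> 1 * (m * \<kappa>)" using c1 m \<kappa>(1) by (intro mult_right_mono) auto
    ultimately show ?thesis by simp
  qed
  have z1top: "?\<Theta> z1 \<le> d + \<delta> * (\<Sum>t\<in>F. vals z1 t)"
  proof -
    have "(\<Sum>i\<in>idx. p (z1 i - z1 i)) \<le> 0" using pb(2)[of 0] by (intro sum_nonpos) auto
    then have "c1 * (\<Sum>i\<in>idx. p (z1 i - z1 i)) \<le> 0" using c1 by (intro mult_nonneg_nonpos) auto
    then show ?thesis unfolding obj_def d_def using sqrt_sq_le_norm[OF p(1), of e "vals z1" z1] by linarith
  qed
  have bottom: "d + \<delta> * (\<Sum>t\<in>F. vals y t) - 2 * m * \<kappa> \<le> ?\<Theta> y" if y: "y \<in> dom (cball x R)" for y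
  proof -
    have "(\<Sum>i\<in>idx. norm (y i - z1 i) - \<kappa>) \<le> (\<Sum>i\<in>idx. p (y i - z1 i))" by (intro sum_mono pb(1))
    then have "c1 * ((\<Sum>i\<in>idx. norm (y i - z1 i)) - m * \<kappa>) \<le> c1 * (\<Sum>i\<in>idx. p (y i - z1 i))"
      using c1 card_idx by (intro mult_left_mono) (auto simp: sum_subtractf)
    moreover have "c1 * (m * \<kappa>) \<le> 1 * (m * \<kappa>)" using c1 m \<kappa>(1) by (intro mult_right_mono) auto
    ultimately show ?thesis
      using ek[OF y] sqrt_sq_norm_le[OF p(1), of e "vals y" y] \<kappa>(1) unfolding obj_def d_def right_diff_distrib by linarith
  qed
  \<comment> \<open>Two of the three units \<open>m * \<kappa>\<close> come from the change of norm,
    in the root and in the \<open>c1\<close> term; the third covers the \<delta> term.\<close>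
  have near: "?\<Theta> z1 \<le> ?\<Theta> y + 3 * m * \<kappa>" if "y \<in> dom C" for y
    using z1top bottom[of y] \<delta>vals[of y] that CX \<kappa>m by (auto simp: subset_iff)
  have below: "(\<Sum>t\<in>F. \<delta> * (g t x - \<rho>)) - m * \<kappa> \<le> ?\<Theta> y" if "y \<in> dom C" for y
  proof -
    have "(\<Sum>t\<in>F. \<delta> * (g t x - \<rho>)) \<le> \<delta> * (\<Sum>t\<in>F. vals y t)"
      unfolding sum_distrib_left using vlow[of y] that CX \<delta>(1) by (intro sum_mono mult_left_mono) auto
    then show ?thesis
      unfolding obj_def using psum[of y] real_sqrt_ge_zero[OF sq_nonneg[of p e "vals y" y]] by linarith
  qed
  have \<tau>: "0 < 3 * m * \<kappa>" using m \<kappa>(1) by simp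
  obtain z a where z: "z \<in> dom C" "\<And>i. i \<in> idx \<Longrightarrow> norm (z i - z1 i) \<le> 2 * (card idx * \<kappa> + 4 * (3 * m * \<kappa>) / c1)"
    "\<And>i. i \<in> idx \<Longrightarrow> bounded (range (a i))"
    "\<And>y. y \<in> dom C \<Longrightarrow> ?\<Theta> z + (\<Sum>i\<in>idx. pert c1 pk (a i) (z i)) \<le> ?\<Theta> y + (\<Sum>i\<in>idx. pert c1 pk (a i) (y i))"
    by (rule smooth_variational_principle[OF fin_idx lscO below z1C near \<tau> c1(1) less_imp_le[OF \<kappa>(1)] pk(1)])
      (assumption, assumption, rule that)
  have pt: "perturbation c1 \<kappa> pk (a i)" if "i \<in> idx" for i
    by unfold_locales (use c1 \<kappa>(1) pk(1) z(3)[OF that] in auto)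
  have zz1: "norm (z i - z1 i) \<le> \<sigma>" if "i \<in> idx" for i
  proof -
    have "2 * (card idx * \<kappa> + 4 * (3 * m * \<kappa>) / c1) * c1 = 2 * (m * \<kappa>) * c1 + 24 * (m * \<kappa>)"
      using c1(1) card_idx by (simp add: field_simps)
    also have "\<dots> \<le> 2 * (m * \<kappa>) * 1 + 24 * (m * \<kappa>)" using c1 m \<kappa>(1) by (intro add_mono mult_left_mono) auto
    also have "\<dots> \<le> \<sigma> * c1" using \<kappa>(2) by (simp add: mult.commute mult.left_commute)
    finally have "2 * (card idx * \<kappa> + 4 * (3 * m * \<kappa>) / c1) \<le> \<sigma>" using c1(1) by (rule mult_right_le_imp_le)
    then show ?thesis using z(2)[OF that] by simp
  qed
  have zz1s: "c1 * (\<Sum>i\<in>idx. norm (z i - z1 i)) \<le> m * \<sigma>"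
  proof -
    have "c1 * (\<Sum>i\<in>idx. norm (z i - z1 i)) \<le> 1 * (\<Sum>i\<in>idx. \<sigma>)"
      using c1 zz1 by (intro mult_mono sum_mono) (auto intro: sum_nonneg)
    then show ?thesis using card_idx by simp
  qed
  define S where "S i y = c1 * p (y - z1 i) + pert c1 pk (a i) y" for i y
  define D0 where "D0 = sqrt (sq p e (vals z) z)"
  have zX: "z \<in> dom (cball x R)" using z(1) CX by blast
  have D0d: "d / 2 \<le> D0"
    using ek[OF zX] zz1s sqrt_sq_norm_le[OF p(1), of e "vals z" z] \<kappa> \<sigma>(3) by (simp add: D0_def d_def[symmetric])
  have D0\<rho>: "D0 \<le> \<rho>"
  proof -
    have "pert c1 pk (a i) (z1 i) - pert c1 pk (a i) (z i) \<le> c1 * norm (z i - z1 i)" if "i \<in> idx" for i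
      using perturbation.pert_lipschitz[OF pt[OF that], of "z1 i" "z i"] by (simp add: norm_minus_commute)
    then have "(\<Sum>i\<in>idx. pert c1 pk (a i) (z1 i) - pert c1 pk (a i) (z i)) \<le> (\<Sum>i\<in>idx. c1 * norm (z i - z1 i))"
      by (rule sum_mono)
    then have "(\<Sum>i\<in>idx. pert c1 pk (a i) (z1 i)) - (\<Sum>i\<in>idx. pert c1 pk (a i) (z i)) \<le> m * \<sigma>"
      using zz1s by (simp add: sum_subtractf sum_distrib_left)
    moreover have "D0 + \<delta> * (\<Sum>t\<in>F. vals z t) - m * \<kappa> \<le> ?\<Theta> z" using psum[of z] by (simp add: obj_def D0_def)
    ultimately have "D0 \<le> d + \<kappa> + m * \<kappa> + m * \<sigma>"
      using z(4)[OF z1C] z1top \<delta>vals[OF zX] by linarith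
    then show ?thesis using d\<rho> \<kappa>(4) \<kappa>m \<sigma>(4) by (simp add: d_def)
  qed
  have Ssum: "?\<Theta> y + (\<Sum>i\<in>idx. pert c1 pk (a i) (y i))
      = sqrt (sq p e (vals y) y) + \<delta> * (\<Sum>t\<in>F. vals y t) + (\<Sum>i\<in>idx. S i (y i))" for y
    by (simp add: obj_def S_def sum.distrib sum_distrib_left)
  show thesis
  proof (rule that[of z \<delta> \<kappa> p D0 S])
    show "z \<in> dom (Y \<inter> cball x R)" using z(1) by (simp add: C_def)
    show "norm (z i - x) \<le> R / 2" if "i \<in> idx" for i
      using norm_triangle_ineq[of "z i - z1 i" "z1 i - x"] zz1[OF that] z1(2)[OF that] \<sigma>(2) by simp
    show "2 * m * \<kappa> \<le> D0" using D0d \<kappa>(3) by simp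
    show "0 < D0" using D0d d by simp
    show "convex_on UNIV (S i)" if "i \<in> idx" for i
      unfolding S_def using c1
      by (intro convex_on_add convex_on_cmul convex_on_translate pb(4) perturbation.pert_convex[OF pt[OF that]]) auto
    show "S i u - S i v \<le> 2 * c1 * norm (u - v)" if "i \<in> idx" for i u v
    proof -
      have "c1 * (p (u - z1 i) - p (v - z1 i)) \<le> c1 * norm (u - v)"
        using pb(3)[of "u - z1 i" "v - z1 i"] c1 by (intro mult_left_mono) auto
      then show ?thesis using perturbation.pert_lipschitz[OF pt[OF that], of u v]
        by (simp add: S_def right_diff_distrib)
    qed
    show "smooth_along Y (S i) y" if "i \<in> idx" for i y
      unfolding S_def using c1
      by (intro smooth_along_add smooth_along_cmult smooth_along_translate p perturbation.pert_smooth[OF pt[OF that] pk(2)]) auto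
    show "D0 + \<delta> * (\<Sum>t\<in>F. vals z t) + (\<Sum>i\<in>idx. S i (z i))
        \<le> sqrt (sq p e (vals y) y) + \<delta> * (\<Sum>t\<in>F. vals y t) + (\<Sum>i\<in>idx. S i (y i))"
      if "y \<in> dom (Y \<inter> cball x R)" for y
      using z(4)[of y] that unfolding Ssum C_def[symmetric] D0_def by blast
  qed (use \<delta> \<kappa>(1) p D0\<rho> D0_def in auto)
qed

end

section \<open>Optimality conditions at the minimizer\<close>

lemma sqrt_le_tangent:
  assumes "0 < d" "0 \<le> X" shows "sqrt X \<le> d + (X - d\<^sup>2) / (2 * d)"
proof -
  have "0 \<le> (sqrt X - d)\<^sup>2" by simp
  then have "2 * d * sqrt X \<le> X + d\<^sup>2" using assms(2) by (simp add: power2_diff algebra_simps)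
  then have "sqrt X \<le> (X + d\<^sup>2) / (2 * d)" using assms(1) by (simp add: pos_le_divide_eq mult.commute)
  also have "\<dots> = d + (X - d\<^sup>2) / (2 * d)" using assms(1) by (simp add: field_simps power2_eq_square)
  finally show ?thesis .
qed

text \<open>The increments of the 1-Lipschitz \<open>p\<close> enter with the factor
  \<open>max 0 (p w) / D\<close>, which is at most 1. This bounds the subgradient by the norm to
  first order, hence exactly.\<close>

lemma coupling_subgradient:
  fixes p :: "'a::real_normed_vector \<Rightarrow> real"
  assumes p: "norm_like \<kappa> p" and D: "0 < D" "max 0 (p w) \<le> D"
  obtains s :: "'a \<Rightarrow>\<^sub>L real" where "\<And>h. s h \<le> (max 0 (p (w + h)))\<^sup>2 / (2 * D) - (max 0 (p w))\<^sup>2 / (2 * D)" "norm s \<le> 1"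
proof -
  note pb = norm_like_bounds[OF p]
  define k where "k y = inverse (2 * D) * (max 0 (p y))\<^sup>2" for y
  have conv: "convex_on UNIV k" unfolding k_def
    using D by (intro convex_on_cmul convex_max0_square pb(4)) auto
  have diff: "\<bar>p (w + h) - p w\<bar> \<le> norm h" for h using pb(3)[of "w + h" w] pb(3)[of w "w + h"] by simp
  have down: "k w - k (w + h) \<le> 1 * norm h" for h
  proof -
    have "(max 0 (p w))\<^sup>2 - (max 0 (p (w + h)))\<^sup>2 \<le> 2 * max 0 (p w) * (- (p (w + h) - p w))"
      using max0_square_lower[of "p w" "p (w + h) - p w"] unfolding mult_minus_right by (simp add: algebra_simps)
    also have "\<dots> \<le> 2 * max 0 (p w) * norm h" using diff[of h] by (intro mult_left_mono) auto
    also have "\<dots> \<le> 2 * D * norm h" using D(2) by (intro mult_right_mono mult_left_mono) auto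
    finally have "inverse (2 * D) * ((max 0 (p w))\<^sup>2 - (max 0 (p (w + h)))\<^sup>2) \<le> inverse (2 * D) * (2 * D * norm h)"
      using D(1) by (intro mult_left_mono) auto
    also have "inverse (2 * D) * (2 * D * norm h) = norm h" using D(1) by simp
    finally show ?thesis by (simp add: k_def right_diff_distrib)
  qed
  obtain s :: "'a \<Rightarrow>\<^sub>L real" where s: "\<And>h. s h \<le> k (w + h) - k w"
    by (rule convex_subgradient[OF conv down]) (simp, rule that)
  have "s h \<le> norm h" for h
  proof (rule blinfun_le_from_small[OF subspace_UNIV, where Q = norm])
    show "\<exists>\<delta>>0. \<forall>h\<in>UNIV. norm h < \<delta> \<longrightarrow> s h \<le> norm h + \<epsilon> * norm h" if "0 < \<epsilon>" for \<epsilon>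
    proof (intro exI[of _ "2 * D * \<epsilon>"] conjI ballI impI)
      show "0 < 2 * D * \<epsilon>" using D(1) that by simp
      fix h :: 'a assume h: "norm h < 2 * D * \<epsilon>"
      have "(p (w + h) - p w)\<^sup>2 \<le> (norm h)\<^sup>2" using diff[of h] by (simp add: abs_le_square_iff[symmetric])
      moreover have "2 * max 0 (p w) * (p (w + h) - p w) \<le> 2 * D * norm h"
      proof -
        have "2 * max 0 (p w) * (p (w + h) - p w) \<le> 2 * max 0 (p w) * norm h" using diff[of h] by (intro mult_left_mono) auto
        also have "\<dots> \<le> 2 * D * norm h" using D(2) by (intro mult_right_mono mult_left_mono) auto
        finally show ?thesis .
      qed
      ultimately have "(max 0 (p (w + h)))\<^sup>2 - (max 0 (p w))\<^sup>2 \<le> 2 * D * norm h + (norm h)\<^sup>2"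
        using max0_square_upper[of "p w" "p (w + h) - p w"] by simp
      also have "(norm h)\<^sup>2 \<le> 2 * D * \<epsilon> * norm h"
        using mult_right_mono[OF less_imp_le[OF h], of "norm h"] by (simp add: power2_eq_square)
      finally have "inverse (2 * D) * ((max 0 (p (w + h)))\<^sup>2 - (max 0 (p w))\<^sup>2)
          \<le> inverse (2 * D) * (2 * D * norm h + 2 * D * \<epsilon> * norm h)"
        using D(1) by (intro mult_left_mono) auto
      also have "\<dots> = norm h + \<epsilon> * norm h" using D(1) by (simp add: field_simps)
      finally show "s h \<le> norm h + \<epsilon> * norm h" using s[of h] by (simp add: k_def right_diff_distrib)
    qed
  qed auto
  then have "norm s \<le> 1" by (intro blinfun_norm_le) auto
  moreover have "s h \<le> (max 0 (p (w + h)))\<^sup>2 / (2 * D) - (max 0 (p w))\<^sup>2 / (2 * D)" for h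
    using s[of h] unfolding k_def divide_inverse by (simp only: mult.commute)
  ultimately show thesis by (rule that[rotated])
qed

context penalized_minimum
begin

definition slack :: "real \<Rightarrow> ('t \<Rightarrow> real) \<Rightarrow> ('t option \<Rightarrow> 'a) \<Rightarrow> real" where
  "slack e r z = (\<Sum>j\<in>J. (max 0 (tm e r z j))\<^sup>2)"

lemma sq_slack: "sq p e r z = slack e r z + (\<Sum>t\<in>F. (max 0 (p (z (Some t) - z None)))\<^sup>2)"
  by (simp add: sq_def slack_def)

lemma slack_mono: "(\<And>t. t \<in> F \<Longrightarrow> r t \<le> r' t) \<Longrightarrow> slack e r z \<le> slack e r' z"
proof -
  assume r: "\<And>t. t \<in> F \<Longrightarrow> r t \<le> r' t"
  then have "pen r \<le> pen r'" by (rule pen_mono)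
  then have "tm e r z t \<le> tm e r' z t" if "t \<in> J" for t
    using r[of t] JF that by (auto simp: tm_def)
  then show ?thesis unfolding slack_def by (intro sum_mono power_mono max.mono) auto
qed

lemma DERIV_slack_active:
  assumes t: "t \<in> J"
  shows "((\<lambda>\<rho>. slack e (r(t := \<rho>)) z) has_real_derivative 2 * max 0 (tm e r z t)) (at (r t))"
proof -
  define \<beta> where "\<beta> = tm e r z t - r t"
  have pen: "pen (r(t := \<rho>)) = pen r" for \<rho>
    unfolding pen_def using t by (intro sum.cong) auto
  have "slack e (r(t := \<rho>)) z = (max 0 (\<rho> + \<beta>))\<^sup>2 + (\<Sum>j\<in>J - {t}. (max 0 (tm e r z j))\<^sup>2)" for \<rho>
  proof -
    have "slack e (r(t := \<rho>)) z = (max 0 (tm e (r(t := \<rho>)) z t))\<^sup>2 + (\<Sum>j\<in>J - {t}. (max 0 (tm e (r(t := \<rho>)) z j))\<^sup>2)"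
      unfolding slack_def by (rule sum.remove[OF finJ t])
    also have "(\<Sum>j\<in>J - {t}. (max 0 (tm e (r(t := \<rho>)) z j))\<^sup>2) = (\<Sum>j\<in>J - {t}. (max 0 (tm e r z j))\<^sup>2)"
      by (intro sum.cong) (auto simp: tm_def pen)
    also have "tm e (r(t := \<rho>)) z t = \<rho> + \<beta>" by (simp add: tm_def pen \<beta>_def)
    finally show ?thesis .
  qed
  moreover have "((\<lambda>\<rho>. (max 0 (\<rho> + \<beta>))\<^sup>2 + (\<Sum>j\<in>J - {t}. (max 0 (tm e r z j))\<^sup>2))
      has_real_derivative 2 * max 0 (r t + \<beta>) + 0) (at (r t))"
    by (intro DERIV_add DERIV_max0_square DERIV_const)
  ultimately show ?thesis by (simp add: \<beta>_def)
qed

text \<open>Through \<open>pen\<close> an inactive value enters every active term, hence the sum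
  over \<open>J\<close>; the factor \<open>max 0 (r t - g t x)\<close> is what later makes the
  multiplier small.\<close>

lemma DERIV_slack_inactive:
  assumes t: "t \<in> F - J"
  shows "((\<lambda>\<rho>. slack e (r(t := \<rho>)) z) has_real_derivative
      (\<Sum>j\<in>J. 2 * max 0 (tm e r z j) * (2 * max 0 (r t - g t x)))) (at (r t))"
proof -
  define \<beta> where "\<beta> j = tm e r z j - (max 0 (r t - g t x))\<^sup>2" for j
  have pen: "pen (r(t := \<rho>)) = (max 0 (\<rho> - g t x))\<^sup>2 + (\<Sum>s\<in>F - J - {t}. (max 0 (r s - g s x))\<^sup>2)" for \<rho>
  proof -
    have "pen (r(t := \<rho>)) = (max 0 ((r(t := \<rho>)) t - g t x))\<^sup>2 + (\<Sum>s\<in>F - J - {t}. (max 0 ((r(t := \<rho>)) s - g s x))\<^sup>2)"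
      unfolding pen_def by (rule sum.remove[OF _ t]) (use finF in simp)
    also have "(\<Sum>s\<in>F - J - {t}. (max 0 ((r(t := \<rho>)) s - g s x))\<^sup>2) = (\<Sum>s\<in>F - J - {t}. (max 0 (r s - g s x))\<^sup>2)"
      by (intro sum.cong) auto
    finally show ?thesis by (simp only: fun_upd_same)
  qed
  have pen': "pen (r(t := \<rho>)) = pen r + (max 0 (\<rho> - g t x))\<^sup>2 - (max 0 (r t - g t x))\<^sup>2" for \<rho>
    using pen[of \<rho>] pen[of "r t"] by simp
  have "tm e (r(t := \<rho>)) z j = (max 0 (\<rho> + - g t x))\<^sup>2 + \<beta> j" if "j \<in> J" for j \<rho>
    using that t by (auto simp: tm_def \<beta>_def pen')
  then have "slack e (r(t := \<rho>)) z = (\<Sum>j\<in>J. (max 0 ((max 0 (\<rho> + - g t x))\<^sup>2 + \<beta> j))\<^sup>2)" for \<rho>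
    unfolding slack_def by (intro sum.cong) auto
  moreover have "((\<lambda>\<rho>. \<Sum>j\<in>J. (max 0 ((max 0 (\<rho> + - g t x))\<^sup>2 + \<beta> j))\<^sup>2) has_real_derivative
      (\<Sum>j\<in>J. 2 * max 0 ((max 0 (r t + - g t x))\<^sup>2 + \<beta> j) * (2 * max 0 (r t + - g t x)))) (at (r t))"
    by (intro DERIV_sum DERIV_chain2[OF DERIV_max0_square DERIV_max0_square])
  ultimately show ?thesis by (simp add: \<beta>_def)
qed

lemma sum_idx: "(\<Sum>i\<in>idx. f i) = f None + (\<Sum>t\<in>F. f (Some t))"
  using finF by (simp add: idx_def sum.reindex)

text \<open>Varying the copy of \<open>t\<close> alone yields a Frechet subgradient of
  \<open>g t\<close>; varying the common point yields the sum inequality. The terms under the root,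
  divided by \<open>D0\<close>, have squares adding up to 1. So either the active ones sum to at
  least 1/2, or one coupling term is large; then that copy lies away from the common point, and its
  functional is quantitatively negative along the connecting vector.\<close>

lemma subgradients_at_minimum:
  assumes Y: "subspace Y" and z: "z \<in> dom (Y \<inter> cball x R)" "\<And>i. i \<in> idx \<Longrightarrow> norm (z i - x) \<le> R / 2"
    and \<delta>: "0 < \<delta>" and p: "norm_like \<kappa> p" "\<And>y. smooth_along Y p y"
    and D0: "D0 = sqrt (sq p e (vals z) z)" "0 < D0" "2 * m * \<kappa> \<le> D0"
    and S: "\<And>i. i \<in> idx \<Longrightarrow> convex_on UNIV (S i)" and L: "0 \<le> L"
    and Slip: "\<And>i u v. i \<in> idx \<Longrightarrow> S i u - S i v \<le> L * norm (u - v)"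
    and Ssm: "\<And>i y. i \<in> idx \<Longrightarrow> smooth_along Y (S i) y"
    and min: "\<And>y. y \<in> dom (Y \<inter> cball x R) \<Longrightarrow> D0 + \<delta> * (\<Sum>t\<in>F. vals z t) + (\<Sum>i\<in>idx. S i (z i))
        \<le> sqrt (sq p e (vals y) y) + \<delta> * (\<Sum>t\<in>F. vals y t) + (\<Sum>i\<in>idx. S i (y i))"
  obtains \<zeta> \<mu> a s w where "\<And>t. t \<in> F \<Longrightarrow> 0 < \<mu> t"
    "\<And>t. t \<in> F \<Longrightarrow> fsub (dm t) (g t) Y (z (Some t)) (\<zeta> t /\<^sub>R \<mu> t)"
    "\<And>t. t \<in> F \<Longrightarrow> norm (\<zeta> t) \<le> 1 + L" "0 \<le> a"
    "\<And>h. h \<in> Y \<Longrightarrow> - (\<Sum>t\<in>F. blinfun_apply (\<zeta> t) h) \<le> a * q h + m * L * norm h"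
    "\<bar>a - (\<Sum>t\<in>J. \<mu> t)\<bar> \<le> m * \<delta>" "\<And>t. t \<in> J \<Longrightarrow> \<mu> t \<le> 1 + \<delta>"
    "\<And>t. t \<in> F - J \<Longrightarrow> \<mu> t \<le> m * (2 * max 0 (vals z t - g t x)) + \<delta>"
    "s \<in> F" "w \<in> Y" "blinfun_apply (\<zeta> s) w \<le> - (1 / (8 * m) - L) * norm w" "1 / 2 \<le> a \<or> w \<noteq> 0"
proof -
  note pb = norm_like_bounds[OF p(1)]
  have m: "0 < m" using m1 by simp
  define r where "r = vals z"
  define u where "u = z None"
  define w where "w t = z (Some t) - u" for t
  define b where "b t = max 0 (p (w t)) / D0" for t
  define \<alpha> where "\<alpha> j = max 0 (tm e r z j) / D0" for j
  have zdm: "z (Some t) \<in> dm t" and zY: "z (Some t) \<in> Y" if "t \<in> F" for t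
    using z(1) idx_mem(2)[OF that] that by (auto simp: dom_def)
  have uY: "u \<in> Y" using z(1) idx_mem(1) by (auto simp: dom_def u_def)
  have wY: "w t \<in> Y" if "t \<in> F" for t using zY[OF that] uY Y by (simp add: w_def subspace_diff)
  have inv: "inverse (2 * D0) * X = X / (2 * D0)" for X by (simp only: divide_inverse mult.commute)
  have D0sq: "sq p e r z = D0\<^sup>2" using sq_nonneg[of p e r z] by (simp add: D0(1) r_def)
  have \<alpha>: "0 \<le> \<alpha> j" "\<alpha> j \<le> 1" if "j \<in> J" for j
    using tm_le_sqrt[OF that, of e r z p] D0 by (auto simp: \<alpha>_def r_def)
  have pw: "max 0 (p (w t)) \<le> D0" if "t \<in> F" for t
    using coupling_le_sqrt[OF that, of p z e r] D0 by (simp add: w_def u_def r_def)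
  text \<open>By concavity of the square root, \<open>z\<close> also minimizes the separable linearization.\<close>
  have lin: "sq p e r z / (2 * D0) + \<delta> * (\<Sum>t\<in>F. r t) + (\<Sum>i\<in>idx. S i (z i))
        \<le> sq p e (vals y) y / (2 * D0) + \<delta> * (\<Sum>t\<in>F. vals y t) + (\<Sum>i\<in>idx. S i (y i))"
    if "y \<in> dom (Y \<inter> cball x R)" for y
    using min[OF that] sqrt_le_tangent[OF D0(2) sq_nonneg, of p e "vals y" y] D0sq
    by (simp add: r_def diff_divide_distrib)
  have "\<exists>s :: 'a \<Rightarrow>\<^sub>L real. (\<forall>h. blinfun_apply s h \<le> (max 0 (p (w t + h)))\<^sup>2 / (2 * D0) - (max 0 (p (w t)))\<^sup>2 / (2 * D0)) \<and> norm s \<le> 1"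
    if "t \<in> F" for t
    by (rule coupling_subgradient[OF p(1) D0(2) pw[OF that]]) blast
  then obtain s :: "'t \<Rightarrow> 'a \<Rightarrow>\<^sub>L real" where
    s: "\<And>t h. t \<in> F \<Longrightarrow> s t h \<le> (max 0 (p (w t + h)))\<^sup>2 / (2 * D0) - (max 0 (p (w t)))\<^sup>2 / (2 * D0)"
    and s1: "\<And>t. t \<in> F \<Longrightarrow> norm (s t) \<le> 1" by metis
  have "\<exists>\<pi> :: 'a \<Rightarrow>\<^sub>L real. \<forall>h. \<pi> h \<le> S (Some t) (z (Some t) + h) - S (Some t) (z (Some t))" if "t \<in> F" for t
  proof -
    have "S (Some t) (z (Some t)) - S (Some t) (z (Some t) + h) \<le> L * norm h" for h
      using Slip[OF idx_mem(2)[OF that], of "z (Some t)" "z (Some t) + h"] by simp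
    from convex_subgradient[OF S[OF idx_mem(2)[OF that]] this L] show ?thesis by blast
  qed
  then obtain \<pi> :: "'t \<Rightarrow> 'a \<Rightarrow>\<^sub>L real" where
    \<pi>: "\<And>t h. t \<in> F \<Longrightarrow> \<pi> t h \<le> S (Some t) (z (Some t) + h) - S (Some t) (z (Some t))" by metis
  have \<pi>le: "\<pi> t h \<le> L * norm h" if "t \<in> F" for t h
    using \<pi>[OF that, of h] Slip[OF idx_mem(2)[OF that], of "z (Some t) + h" "z (Some t)"] by simp
  have \<pi>L: "norm (\<pi> t) \<le> L" if "t \<in> F" for t
    by (rule blinfun_norm_le[OF L \<pi>le[OF that]])
  \<comment> \<open>The derivative of the linearized objective in the value of \<open>t\<close>; for
    inactive \<open>t\<close> it passes through \<open>pen\<close>.\<close>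
  define \<mu> where "\<mu> t = (if t \<in> J then \<alpha> t else (\<Sum>j\<in>J. \<alpha> j) * (2 * max 0 (r t - g t x))) + \<delta>" for t
  have \<alpha>sum: "0 \<le> (\<Sum>j\<in>J. \<alpha> j)" using \<alpha>(1) by (rule sum_nonneg)
  have \<mu>: "0 < \<mu> t" for t using \<alpha>(1)[of t] \<alpha>sum \<delta> by (simp add: \<mu>_def add_nonneg_pos)
  define \<zeta> where "\<zeta> t = - (s t + \<pi> t)" for t
  have fs: "fsub (dm t) (g t) Y (z (Some t)) (\<zeta> t /\<^sub>R \<mu> t)" if t: "t \<in> F" for t
  proof -
    define \<psi> where "\<psi> \<rho> = slack e (r(t := \<rho>)) z / (2 * D0) + \<delta> * \<rho>" for \<rho>
    define T where "T y = inverse (2 * D0) * (max 0 (p (y - u)))\<^sup>2 + S (Some t) y" for y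
    have rt: "g t (z (Some t)) = r t" by (simp add: r_def vals_def)
    show ?thesis unfolding \<zeta>_def
    proof (rule fsub_of_smooth_minimum[where s = T and \<psi> = \<psi> and \<rho> = "R / 2"])
      have sm1: "smooth_along Y (\<lambda>y. (max 0 (p y))\<^sup>2) (z (Some t) - u)"
        by (rule smooth_along_max0_square[OF pb(3) p(2)])
      have pos: "0 < inverse (2 * D0)" using D0(2) by simp
      note sm2 = smooth_along_cmult[OF smooth_along_translate[OF sm1] pos]
      show "smooth_along Y T (z (Some t))" unfolding T_def
        using smooth_along_add[OF sm2 Ssm[OF idx_mem(2)[OF t]]] .
      show "(s t + \<pi> t) h \<le> T (z (Some t) + h) - T (z (Some t))" for h
      proof -
        have eq: "z (Some t) + h - u = w t + h" "z (Some t) - u = w t" by (simp_all add: w_def)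
        show ?thesis using s[OF t, of h] \<pi>[OF t, of h]
          unfolding T_def blinfun.add_left divide_inverse eq by (simp add: mult.commute)
      qed
      show "\<psi> \<rho> \<le> \<psi> \<rho>'" if "\<rho> \<le> \<rho>'" for \<rho> \<rho>'
        unfolding \<psi>_def using that \<delta> D0(2)
        by (intro add_mono divide_right_mono slack_mono mult_left_mono) auto
      show "(\<psi> has_real_derivative \<mu> t) (at (g t (z (Some t))))"
      proof (cases "t \<in> J")
        case True
        have "(\<psi> has_real_derivative 2 * max 0 (tm e r z t) / (2 * D0) + \<delta> * 1) (at (r t))"
          unfolding \<psi>_def by (intro DERIV_add DERIV_cdivide DERIV_slack_active[OF True] DERIV_cmult DERIV_ident)
        then show ?thesis using True by (simp add: rt \<mu>_def \<alpha>_def)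
      next
        case False
        have "(\<psi> has_real_derivative (\<Sum>j\<in>J. 2 * max 0 (tm e r z j) * (2 * max 0 (r t - g t x))) / (2 * D0) + \<delta> * 1) (at (r t))"
          unfolding \<psi>_def using t False
          by (intro DERIV_add DERIV_cdivide DERIV_slack_inactive DERIV_cmult DERIV_ident) auto
        moreover have "(\<Sum>j\<in>J. 2 * max 0 (tm e r z j) * (2 * max 0 (r t - g t x))) / (2 * D0)
            = (\<Sum>j\<in>J. \<alpha> j) * (2 * max 0 (r t - g t x))"
          unfolding sum_divide_distrib sum_distrib_right
          by (intro sum.cong refl) (use D0(2) in \<open>simp add: \<alpha>_def field_simps\<close>)
        ultimately show ?thesis using False by (simp add: rt \<mu>_def)
      qed
      show "\<psi> (g t (z (Some t))) + T (z (Some t)) \<le> \<psi> (g t y) + T y"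
        if y: "y \<in> dm t" "y \<in> Y" "norm (y - z (Some t)) < R / 2" for y
      proof -
        define y' where "y' = z(Some t := y)"
        have "norm (y - x) \<le> R"
          using norm_triangle_ineq[of "y - z (Some t)" "z (Some t) - x"] y(3) z(2)[OF idx_mem(2)[OF t]] by simp
        then have y'dom: "y' \<in> dom (Y \<inter> cball x R)"
          using z(1) y by (auto simp: y'_def dom_def dist_norm norm_minus_commute)
        have vals': "vals y' = r(t := g t y)" by (auto simp: vals_def y'_def r_def)
        have sl: "slack e (vals y') y' = slack e (r(t := g t y)) z"
          unfolding slack_def tm_def vals' by (simp add: y'_def)
        have cp: "(\<Sum>t\<in>F. (max 0 (p (y' (Some t) - y' None)))\<^sup>2)
            = (max 0 (p (y - u)))\<^sup>2 + (\<Sum>t\<in>F - {t}. (max 0 (p (w t)))\<^sup>2)"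
          unfolding sum.remove[OF finF t] by (auto simp: y'_def w_def u_def intro!: sum.cong)
        have cp0: "(\<Sum>t\<in>F. (max 0 (p (z (Some t) - z None)))\<^sup>2)
            = (max 0 (p (z (Some t) - u)))\<^sup>2 + (\<Sum>t\<in>F - {t}. (max 0 (p (w t)))\<^sup>2)"
          unfolding sum.remove[OF finF t] by (auto simp: w_def u_def intro!: sum.cong)
        have v: "(\<Sum>t\<in>F. vals y' t) = g t y + (\<Sum>t\<in>F - {t}. r t)" "(\<Sum>t\<in>F. r t) = r t + (\<Sum>t\<in>F - {t}. r t)"
          unfolding sum.remove[OF finF t] by (auto simp: vals' intro!: sum.cong)
        have Sx: "(\<Sum>i\<in>idx. S i (y' i)) = S (Some t) y + (\<Sum>i\<in>idx - {Some t}. S i (z i))"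
          "(\<Sum>i\<in>idx. S i (z i)) = S (Some t) (z (Some t)) + (\<Sum>i\<in>idx - {Some t}. S i (z i))"
          unfolding sum.remove[OF fin_idx idx_mem(2)[OF t]] by (auto simp: y'_def intro!: sum.cong)
        show ?thesis using lin[OF y'dom]
          unfolding sq_slack cp cp0 v Sx sl \<psi>_def T_def rt inv add_divide_distrib distrib_left fun_upd_triv
          by linarith
      qed
    qed (use Y zdm[OF t] zY[OF t] \<mu> R in auto)
  qed
  have szsum: "(\<Sum>t\<in>F. s t) h \<le> (\<Sum>j\<in>J. \<alpha> j) * q h + L * norm h" if "h \<in> Y" for h
  proof (rule blinfun_le_from_small[OF Y, where Q = "\<lambda>h. (\<Sum>j\<in>J. \<alpha> j) * q h + L * norm h"])
    show "(\<Sum>j\<in>J. \<alpha> j) * q (c *\<^sub>R h) + L * norm (c *\<^sub>R h) = c * ((\<Sum>j\<in>J. \<alpha> j) * q h + L * norm h)"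
      if "0 \<le> c" for c h using sublinear_scaleR[OF q that, of h] that by (simp add: algebra_simps)
    fix \<epsilon> :: real assume \<epsilon>: "0 < \<epsilon>"
    define \<epsilon>1 where "\<epsilon>1 = \<epsilon> / (2 * m)"
    have \<epsilon>1: "0 < \<epsilon>1" using \<epsilon> m by (simp add: \<epsilon>1_def)
    have "\<exists>d>0. \<forall>h\<in>Y. norm h < d \<longrightarrow>
        (max 0 (p (w t + h)))\<^sup>2 / (2 * D0) - (max 0 (p (w t)))\<^sup>2 / (2 * D0) \<le> s t h + \<epsilon>1 * norm h" if t: "t \<in> F" for t
    proof -
      have sm: "smooth_along Y (\<lambda>y. inverse (2 * D0) * (max 0 (p y))\<^sup>2) (w t)"
        using D0(2) by (intro smooth_along_cmult smooth_along_max0_square[OF pb(3) p(2)]) auto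
      have sub: "s t h \<le> inverse (2 * D0) * (max 0 (p (w t + h)))\<^sup>2 - inverse (2 * D0) * (max 0 (p (w t)))\<^sup>2" for h
        unfolding inv by (rule s[OF t])
      obtain d where "0 < d" "\<And>h. h \<in> Y \<Longrightarrow> norm h < d \<Longrightarrow>
          inverse (2 * D0) * (max 0 (p (w t + h)))\<^sup>2 - inverse (2 * D0) * (max 0 (p (w t)))\<^sup>2 \<le> s t h + \<epsilon>1 * norm h"
        by (rule smooth_subgradient_upper[OF sm sub \<epsilon>1]) (rule that)
      then show ?thesis unfolding inv by blast
    qed
    then obtain d where d: "\<And>t. t \<in> F \<Longrightarrow> 0 < d t" "\<And>t h. t \<in> F \<Longrightarrow> h \<in> Y \<Longrightarrow> norm h < d t \<Longrightarrow>
        (max 0 (p (w t + h)))\<^sup>2 / (2 * D0) - (max 0 (p (w t)))\<^sup>2 / (2 * D0) \<le> s t h + \<epsilon>1 * norm h" by metis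
    define d0 where "d0 = Min (insert (R / 2) (d ` F))"
    have d0_le: "d0 \<le> v" if "v \<in> insert (R / 2) (d ` F)" for v
      unfolding d0_def by (rule Min_le[OF _ that]) (use finF in simp)
    have d0_pos: "0 < d0" using d(1) R finF by (auto simp: d0_def)
    have d0: "0 < d0" "d0 \<le> R / 2" "t \<in> F \<Longrightarrow> d0 \<le> d t" for t
      using d0_pos d0_le[of "R / 2"] d0_le[of "d t"] by simp_all
    \<comment> \<open>Coefficient of the quadratic remainder of \<open>slack\<close>, increased by 1
      so that it can be divided by.\<close>
    define K where "K = m * M\<^sup>2 / (2 * D0) + 1"
    have K: "0 < K" using m D0(2) by (simp add: K_def add_nonneg_pos)
    show "\<exists>d>0. \<forall>h\<in>Y. norm h < d \<longrightarrow>
       (\<Sum>t\<in>F. s t) h \<le> (\<Sum>j\<in>J. \<alpha> j) * q h + L * norm h + \<epsilon> * norm h"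
    proof (intro exI[of _ "min d0 (\<epsilon> / (2 * K))"] conjI ballI impI)
      show "0 < min d0 (\<epsilon> / (2 * K))" using d0 \<epsilon> K by simp
      fix h assume h: "h \<in> Y" "norm h < min d0 (\<epsilon> / (2 * K))"
      define y where "y = z(None := u + h)"
      have "norm (u + h - x) \<le> R"
        using norm_triangle_ineq[of h "u - x"] h(2) d0(2) z(2)[OF idx_mem(1)] by (simp add: u_def add_diff_eq add.commute)
      then have ydom: "y \<in> dom (Y \<inter> cball x R)"
        using z(1) uY h(1) Y by (auto simp: y_def dom_def dist_norm norm_minus_commute subspace_add)
      have valsy: "vals y = r" by (auto simp: vals_def y_def r_def)
      have "(max 0 (tm e r y j))\<^sup>2 \<le> (max 0 (tm e r z j))\<^sup>2 + 2 * max 0 (tm e r z j) * q h + (M * norm h)\<^sup>2" for j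
      proof -
        have "tm e r y j \<le> tm e r z j + q h" using Gq[of u h] by (simp add: tm_def y_def u_def)
        then have "(max 0 (tm e r y j))\<^sup>2 \<le> (max 0 (tm e r z j + q h))\<^sup>2" by (intro power_mono) auto
        moreover have "(q h)\<^sup>2 \<le> (M * norm h)\<^sup>2" using qM[of h] M by (simp add: abs_le_square_iff[symmetric])
        ultimately show ?thesis using max0_square_upper[of "tm e r z j" "q h"] by linarith
      qed
      then have "slack e r y \<le> (\<Sum>j\<in>J. (max 0 (tm e r z j))\<^sup>2 + 2 * max 0 (tm e r z j) * q h + (M * norm h)\<^sup>2)"
        unfolding slack_def by (rule sum_mono)
      also have "\<dots> = slack e r z + (\<Sum>j\<in>J. 2 * max 0 (tm e r z j) * q h) + real (card J) * (M * norm h)\<^sup>2"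
        by (simp add: slack_def sum.distrib)
      also have "real (card J) * (M * norm h)\<^sup>2 \<le> m * (M * norm h)\<^sup>2"
        using card_le_m(2) by (intro mult_right_mono) auto
      finally have "slack e r y / (2 * D0) \<le> (slack e r z + (\<Sum>j\<in>J. 2 * max 0 (tm e r z j) * q h) + m * (M * norm h)\<^sup>2) / (2 * D0)"
        using D0(2) by (intro divide_right_mono) auto
      also have "\<dots> = slack e r z / (2 * D0) + (\<Sum>j\<in>J. \<alpha> j) * q h + (K - 1) * (norm h)\<^sup>2"
        by (simp add: add_divide_distrib \<alpha>_def sum_divide_distrib sum_distrib_right K_def power_mult_distrib)
      also have "(K - 1) * (norm h)\<^sup>2 \<le> K * (norm h)\<^sup>2" by (intro mult_right_mono) auto
      also have "K * (norm h)\<^sup>2 \<le> \<epsilon> / 2 * norm h"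
      proof -
        have "norm h * (2 * K) < \<epsilon>" using h(2) K by (simp add: pos_less_divide_eq)
        then have "K * norm h \<le> \<epsilon> / 2" by (simp add: mult.commute mult.left_commute)
        from mult_right_mono[OF this, of "norm h"] show ?thesis by (simp add: power2_eq_square)
      qed
      finally have slk: "slack e r y / (2 * D0) \<le> slack e r z / (2 * D0) + (\<Sum>j\<in>J. \<alpha> j) * q h + \<epsilon> / 2 * norm h" by simp
      have cpl: "(\<Sum>t\<in>F. (max 0 (p (y (Some t) - y None)))\<^sup>2) / (2 * D0)
          \<le> (\<Sum>t\<in>F. (max 0 (p (z (Some t) - z None)))\<^sup>2) / (2 * D0) - (\<Sum>t\<in>F. s t h) + \<epsilon> / 2 * norm h"
      proof -
        have "(max 0 (p (w t - h)))\<^sup>2 / (2 * D0) \<le> (max 0 (p (w t)))\<^sup>2 / (2 * D0) - s t h + \<epsilon>1 * norm h" if t: "t \<in> F" for t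
          using d(2)[OF t, of "- h"] h d0(3)[OF t] Y by (simp add: blinfun.minus_right subspace_neg)
        then have "(\<Sum>t\<in>F. (max 0 (p (w t - h)))\<^sup>2 / (2 * D0)) \<le> (\<Sum>t\<in>F. (max 0 (p (w t)))\<^sup>2 / (2 * D0) - s t h + \<epsilon>1 * norm h)"
          by (rule sum_mono)
        also have "\<dots> = (\<Sum>t\<in>F. (max 0 (p (w t)))\<^sup>2 / (2 * D0)) - (\<Sum>t\<in>F. s t h) + real (card F) * (\<epsilon>1 * norm h)"
          by (simp add: sum.distrib sum_subtractf)
        also have "real (card F) * (\<epsilon>1 * norm h) \<le> m * (\<epsilon>1 * norm h)"
          using card_le_m(1) \<epsilon>1 by (intro mult_right_mono) auto
        also have "m * (\<epsilon>1 * norm h) = \<epsilon> / 2 * norm h" using m by (simp add: \<epsilon>1_def)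
        finally show ?thesis by (simp add: y_def w_def u_def sum_divide_distrib diff_diff_eq)
      qed
      have Sn: "(\<Sum>i\<in>idx. S i (y i)) \<le> (\<Sum>i\<in>idx. S i (z i)) + L * norm h"
        using Slip[OF idx_mem(1), of "u + h" u] by (simp add: sum_idx y_def u_def)
      show "(\<Sum>t\<in>F. s t) h \<le> (\<Sum>j\<in>J. \<alpha> j) * q h + L * norm h + \<epsilon> * norm h"
        using lin[OF ydom] slk cpl Sn unfolding valsy sq_slack add_divide_distrib blinfun.sum_left
        by linarith
    qed
  qed (rule that)
  have sumle: "- (\<Sum>t\<in>F. blinfun_apply (\<zeta> t) h) \<le> (\<Sum>j\<in>J. \<alpha> j) * q h + m * L * norm h" if "h \<in> Y" for h
  proof -
    have "- (\<Sum>t\<in>F. \<zeta> t h) = (\<Sum>t\<in>F. s t) h + (\<Sum>t\<in>F. \<pi> t h)"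
      by (simp add: \<zeta>_def blinfun.minus_left blinfun.diff_left blinfun.sum_left sum_negf sum_subtractf)
    moreover have "(\<Sum>t\<in>F. \<pi> t h) \<le> real (card F) * (L * norm h)"
      using sum_mono[of F "\<lambda>t. \<pi> t h" "\<lambda>_. L * norm h"] \<pi>le by simp
    ultimately show ?thesis using szsum[OF that] by (simp add: m_def algebra_simps)
  qed
  have wit: "\<exists>t\<in>F. \<exists>v\<in>Y. \<zeta> t v \<le> - (1 / (8 * m) - L) * norm v \<and> (1 / 2 \<le> (\<Sum>j\<in>J. \<alpha> j) \<or> v \<noteq> 0)"
  proof (cases "1 / 2 \<le> (\<Sum>j\<in>J. \<alpha> j)")
    case True
    obtain t where "t \<in> F" using J_ne JF by blast
    then show ?thesis using True subspace_0[OF Y] by (intro bexI[of _ t] bexI[of _ 0]) auto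
  next
    case False
    have "(\<Sum>j\<in>J. (\<alpha> j)\<^sup>2) + (\<Sum>t\<in>F. (b t)\<^sup>2) = 1"
      using D0sq D0(2) by (simp add: \<alpha>_def b_def power_divide sum_divide_distrib[symmetric] add_divide_distrib[symmetric] sq_def w_def u_def)
    moreover have "(\<Sum>j\<in>J. (\<alpha> j)\<^sup>2) \<le> (\<Sum>j\<in>J. \<alpha> j)"
      using \<alpha> by (intro sum_mono) (auto simp: power2_eq_square mult_left_le)
    ultimately have big: "1 / 2 < (\<Sum>t\<in>F. (b t)\<^sup>2)" using False by simp
    have "\<exists>t\<in>F. 1 / (2 * m) < (b t)\<^sup>2"
    proof (rule ccontr)
      assume "\<not> ?thesis"
      then have "(\<Sum>t\<in>F. (b t)\<^sup>2) \<le> (\<Sum>t\<in>F. 1 / (2 * m))" by (intro sum_mono) auto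
      also have "\<dots> \<le> m * (1 / (2 * m))" using card_le_m(1) m by (simp add: divide_right_mono)
      finally show False using big m by simp
    qed
    then obtain t where t: "t \<in> F" "1 / (2 * m) < (b t)\<^sup>2" by blast
    have b01: "0 \<le> b t" "b t \<le> 1" using pw[OF t(1)] D0(2) by (auto simp: b_def)
    have "(b t)\<^sup>2 \<le> b t" using b01 by (simp add: power2_eq_square mult_left_le)
    then have bt: "1 / (2 * m) < b t" using t(2) by simp
    have b0: "0 < b t" using bt m by (smt (verit) divide_pos_pos)
    then have pw0: "0 < p (w t)" "b t = p (w t) / D0" using D0(2) by (auto simp: b_def zero_less_divide_iff max_def split: if_splits)
    \<comment> \<open>By \<open>2 * m * \<kappa> \<le> D0\<close> the error \<kappa> is at most
      \<open>p (w t)\<close>, so the norm of \<open>w t\<close> is at most twice its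
      approximation.\<close>
    have "\<kappa> \<le> p (w t)"
    proof -
      have "\<kappa> \<le> D0 * (1 / (2 * m))" using D0(3) m by (simp add: pos_le_divide_eq mult.commute mult.left_commute)
      also have "\<dots> \<le> D0 * b t" using bt D0(2) by (intro mult_left_mono) auto
      finally show ?thesis using pw0 D0(2) by simp
    qed
    then have nw: "norm (w t) \<le> 2 * p (w t)" using pb(1)[of "w t"] by simp
    \<comment> \<open>The increment \<open>- w t\<close> returns to the common point, where the
      coupling term vanishes.\<close>
    have "s t (- w t) \<le> - ((p (w t))\<^sup>2 / (2 * D0))"
    proof -
      have "max 0 (p (0::'a)) = 0" using pb(2)[of 0] by simp
      then show ?thesis using s[OF t(1), of "- w t"] pw0 by simp
    qed
    then have "b t * p (w t) / 2 \<le> s t (w t)" using pw0(2) by (simp add: blinfun.minus_right power2_eq_square)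
    moreover have "1 / (8 * m) * norm (w t) \<le> b t * p (w t) / 2"
    proof -
      have "1 / (2 * m) * (norm (w t) / 2) \<le> b t * p (w t)"
        using bt nw m b0 by (intro mult_mono) auto
      then show ?thesis by simp
    qed
    moreover have "- \<pi> t (w t) \<le> L * norm (w t)" using \<pi>le[OF t(1), of "- w t"] by (simp add: blinfun.minus_right)
    ultimately have "\<zeta> t (w t) \<le> - (1 / (8 * m) - L) * norm (w t)"
      by (simp add: \<zeta>_def blinfun.minus_left blinfun.diff_left left_diff_distrib)
    moreover have "w t \<noteq> 0" using pw0(1) pb(2)[of 0] by auto
    ultimately show ?thesis using t(1) wY[OF t(1)] by blast
  qed
  have a\<mu>: "\<bar>(\<Sum>j\<in>J. \<alpha> j) - (\<Sum>t\<in>J. \<mu> t)\<bar> \<le> m * \<delta>"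
  proof -
    have "(\<Sum>t\<in>J. \<mu> t) = (\<Sum>j\<in>J. \<alpha> j) + real (card J) * \<delta>" by (simp add: \<mu>_def sum.distrib)
    then show ?thesis using card_le_m(2) \<delta> by (simp add: mult_right_mono)
  qed
  have \<mu>I: "\<mu> t \<le> m * (2 * max 0 (vals z t - g t x)) + \<delta>" if "t \<in> F - J" for t
  proof -
    have "(\<Sum>j\<in>J. \<alpha> j) \<le> real (card J) * 1" using sum_mono[of J \<alpha> "\<lambda>_. 1"] \<alpha>(2) by simp
    then have "(\<Sum>j\<in>J. \<alpha> j) \<le> m" using card_le_m(2) by simp
    then show ?thesis using that by (auto simp: \<mu>_def r_def intro!: mult_right_mono)
  qed
  obtain s' v where sv: "s' \<in> F" "v \<in> Y" "\<zeta> s' v \<le> - (1 / (8 * m) - L) * norm v"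
    "1 / 2 \<le> (\<Sum>j\<in>J. \<alpha> j) \<or> v \<noteq> 0" using wit by blast
  have \<zeta>n: "norm (\<zeta> t) \<le> 1 + L" if "t \<in> F" for t
    using norm_triangle_ineq[of "s t" "\<pi> t"] s1[OF that] \<pi>L[OF that]
    unfolding \<zeta>_def norm_minus_cancel by simp
  show thesis
    by (rule that[of \<mu> \<zeta> "\<Sum>j\<in>J. \<alpha> j" s' v])
      (use \<mu> fs \<zeta>n \<alpha>sum sumle a\<mu> \<mu>I sv \<alpha>(2) in \<open>auto simp: \<mu>_def\<close>)
qed

end

section \<open>Transfer to the whole space\<close>

lemma rational_between:
  fixes a b :: real
  assumes "a < b" obtains q :: rat where "a < real_of_rat q" "real_of_rat q < b"
  using of_rat_dense[OF assms] by blast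

context penalized_minimum
begin

text \<open>The exact-norm minimizer is found in the whole space, so that the separable subspace can
  be made to contain it. Multipliers are rounded to rationals, with the functionals rescaled
  accordingly, before the reduction is applied. The bound on \<rho> is quadratic in \<epsilon>
  because the penalty controls squares of the excess of inactive values.\<close>

theorem fuzzy_multiplier_rule:
  assumes asp: "asplund_space TYPE('a)" and \<epsilon>: "0 < \<epsilon>" "\<epsilon> \<le> 1" and \<rho>\<epsilon>: "\<rho> \<le> (\<epsilon> / (16 * m))\<^sup>2"
  obtains z \<zeta> \<mu> a s where "\<And>t. t \<in> F \<Longrightarrow> fsub (dm t) (g t) UNIV (z t) (\<zeta> t /\<^sub>R \<mu> t)"
    "\<And>t. t \<in> F \<Longrightarrow> 0 < \<mu> t" "\<And>t. t \<in> F \<Longrightarrow> norm (z t - x) \<le> \<epsilon>"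
    "\<And>t. t \<in> F \<Longrightarrow> \<bar>g t (z t) - g t x\<bar> \<le> \<epsilon>" "\<And>t. t \<in> F \<Longrightarrow> norm (\<zeta> t) \<le> 3"
    "0 \<le> a" "\<And>h. - (\<Sum>t\<in>F. blinfun_apply (\<zeta> t) h) \<le> a * q h + \<epsilon> * norm h"
    "\<bar>a - (\<Sum>t\<in>J. \<mu> t)\<bar> \<le> \<epsilon>" "\<And>t. t \<in> F - J \<Longrightarrow> \<mu> t \<le> \<epsilon>" "\<And>t. t \<in> F \<Longrightarrow> \<mu> t \<le> 4"
    "s \<in> F" "1 / 2 \<le> a \<or> 1 / (32 * m) \<le> norm (\<zeta> s)"
proof -
  have m: "0 < m" using m1 by simp
  \<comment> \<open>Twice \<open>c1\<close> is the Lipschitz constant \<open>L\<close> of the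
    perturbations: \<open>m * L\<close> must fit into the \<epsilon> of the sum inequality, and
    \<open>L\<close> must stay well below the witness constant \<open>1 / (8 * m)\<close>.\<close>
  define c1 where "c1 = min (\<epsilon> / (8 * m)) (1 / (64 * m))"
  have c1: "0 < c1" "c1 \<le> \<epsilon> / (8 * m)" "c1 \<le> 1 / (64 * m)" using \<epsilon> m by (auto simp: c1_def)
  have c1': "c1 \<le> 1" "m * c1 \<le> \<epsilon> / 8"
    using c1 m m1 by (auto simp: pos_le_divide_eq mult.commute mult.left_commute intro: order_trans[OF c1(3)])
  have "1 / (64 * m) \<le> 1 / 64" using m1 by (intro divide_left_mono) auto
  then have c1_64: "c1 \<le> 1 / 64" using c1(3) by simp
  define e where "e = min (c1 * R / (32 * m)) (\<rho> / (2 * m))"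
  have e0: "0 < e" using c1 R m \<rho> by (auto simp: e_def)
  have "e \<le> c1 * R / (32 * m)" "e \<le> \<rho> / (2 * m)" by (auto simp: e_def)
  then have e: "e * m * 32 \<le> c1 * R" "2 * e * m \<le> \<rho>"
    using m by (auto simp: pos_le_divide_eq mult.commute mult.left_commute)
  obtain z1 where z1: "z1 \<in> dom (cball x R)" "\<And>i. i \<in> idx \<Longrightarrow> norm (z1 i - x) \<le> R / 4"
    "sqrt (sq norm e (vals z1) z1) \<le> 5 / 8 * \<rho>"
    "\<And>y. y \<in> dom (cball x R) \<Longrightarrow>
      sqrt (sq norm e (vals z1) z1) \<le> sqrt (sq norm e (vals y) y) + c1 * (\<Sum>i\<in>idx. norm (y i - z1 i))"
    by (rule first_phase[OF e0 c1(1) c1'(1) e]) (rule that)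
  \<comment> \<open>0 is included for the case that the witness vector is 0.\<close>
  define E where "E = insert 0 (z1 ` idx)"
  have "countable E" unfolding E_def using fin_idx by (simp add: countable_finite)
  interpret sys: subgradient_system F dm g "\<lambda>a u. real_of_rat a * q u + \<epsilon> * norm u" "1 / (32 * m)"
    by unfold_locales (rule finF)
  show thesis
  proof (rule sys.separable_reduction[OF \<open>countable E\<close>])
    fix D
    assume D: "countable D" "E \<subseteq> D" "rational_subspace D" and
      red: "\<And>z \<mu> a s w \<zeta>. (\<And>t. t \<in> F \<Longrightarrow> z t \<in> closure D) \<Longrightarrow> (\<And>t. t \<in> F \<Longrightarrow> 0 < real_of_rat (\<mu> t)) \<Longrightarrow>
        s \<in> F \<Longrightarrow> w \<in> D \<Longrightarrow>
        (\<And>t. t \<in> F \<Longrightarrow> fsub (dm t) (g t) (closure D) (z t) (\<zeta> t /\<^sub>R real_of_rat (\<mu> t))) \<Longrightarrow>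
        (\<And>t. t \<in> F \<Longrightarrow> norm (\<zeta> t) \<le> 3) \<Longrightarrow>
        (\<And>u. u \<in> closure D \<Longrightarrow> - (\<Sum>t\<in>F. blinfun_apply (\<zeta> t) u) \<le> real_of_rat a * q u + \<epsilon> * norm u) \<Longrightarrow>
        blinfun_apply (\<zeta> s) w \<le> - (1 / (32 * m) * norm w) \<Longrightarrow>
        \<exists>\<zeta>'. (\<forall>t\<in>F. fsub (dm t) (g t) UNIV (z t) (\<zeta>' t /\<^sub>R real_of_rat (\<mu> t)) \<and> norm (\<zeta>' t) \<le> 3)
          \<and> (\<forall>u. - (\<Sum>t\<in>F. blinfun_apply (\<zeta>' t) u) \<le> real_of_rat a * q u + \<epsilon> * norm u)
          \<and> blinfun_apply (\<zeta>' s) w \<le> - (1 / (32 * m) * norm w)"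
    let ?Y = "closure D"
    have Y: "subspace ?Y" by (rule subspace_closure_rational[OF D(3)])
    have sd: "separable_dual ?Y"
      using asp Y separable_closure[OF D(1)] unfolding asplund_space_def by blast
    have smoothY: "\<exists>p. norm_like \<kappa> p \<and> (\<forall>y. smooth_along ?Y p y)" if \<kappa>: "0 < \<kappa>" for \<kappa>
    proof -
      obtain p where "convex_on UNIV p" "\<And>x. norm x - \<kappa> \<le> p x" "\<And>x. p x \<le> norm x"
        "\<And>x y. p x - p y \<le> norm (x - y)" "\<And>x. smooth_along ?Y p x"
        by (rule smooth_norm_approximation[OF asp Y sd \<kappa>]) (rule that)
      then show ?thesis by (intro exI[of _ p]) (simp add: norm_like_def)
    qed
    have z1Y: "z1 i \<in> ?Y" if "i \<in> idx" for i
      using D(2) closure_subset[of D] that by (auto simp: E_def)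
    have \<delta>0: "0 < \<epsilon> / (8 * m)" using \<epsilon> m by simp
    obtain z \<delta> \<kappa> p D0 S where z: "z \<in> dom (?Y \<inter> cball x R)" "\<And>i. i \<in> idx \<Longrightarrow> norm (z i - x) \<le> R / 2"
      and \<delta>: "0 < \<delta>" "\<delta> \<le> \<epsilon> / (8 * m)" and \<kappa>: "0 < \<kappa>" and p: "norm_like \<kappa> p" "\<And>y. smooth_along ?Y p y"
      and D0: "D0 = sqrt (sq p e (vals z) z)" "0 < D0" "D0 \<le> \<rho>" "2 * m * \<kappa> \<le> D0"
      and S: "\<And>i. i \<in> idx \<Longrightarrow> convex_on UNIV (S i)"
      "\<And>i u v. i \<in> idx \<Longrightarrow> S i u - S i v \<le> 2 * c1 * norm (u - v)"
      "\<And>i y. i \<in> idx \<Longrightarrow> smooth_along ?Y (S i) y"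
      and zmin: "\<And>y. y \<in> dom (?Y \<inter> cball x R) \<Longrightarrow> D0 + \<delta> * (\<Sum>t\<in>F. vals z t) + (\<Sum>i\<in>idx. S i (z i))
          \<le> sqrt (sq p e (vals y) y) + \<delta> * (\<Sum>t\<in>F. vals y t) + (\<Sum>i\<in>idx. S i (y i))"
      by (rule second_phase[OF e0 c1(1) c1'(1) \<delta>0 closed_closure[of D] smoothY z1(1,2) z1Y z1(3,4)]; (assumption | rule that))
    define L where "L = 2 * c1"
    have L: "0 \<le> L" "L \<le> 1" "L \<le> 1 / (32 * m)" "m * L \<le> \<epsilon> / 4" using c1 c1' c1_64 m1
      by (auto simp: L_def pos_le_divide_eq)
    obtain \<zeta>0 \<mu>0 a0 s w where \<mu>0: "\<And>t. t \<in> F \<Longrightarrow> 0 < \<mu>0 t"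
      and fs: "\<And>t. t \<in> F \<Longrightarrow> fsub (dm t) (g t) ?Y (z (Some t)) (\<zeta>0 t /\<^sub>R \<mu>0 t)"
      and \<zeta>0: "\<And>t. t \<in> F \<Longrightarrow> norm (\<zeta>0 t) \<le> 1 + L" and a0: "0 \<le> a0"
      and sum0: "\<And>h. h \<in> ?Y \<Longrightarrow> - (\<Sum>t\<in>F. blinfun_apply (\<zeta>0 t) h) \<le> a0 * q h + m * L * norm h"
      and a\<mu>: "\<bar>a0 - (\<Sum>t\<in>J. \<mu>0 t)\<bar> \<le> m * \<delta>" and \<mu>J: "\<And>t. t \<in> J \<Longrightarrow> \<mu>0 t \<le> 1 + \<delta>"
      and \<mu>I: "\<And>t. t \<in> F - J \<Longrightarrow> \<mu>0 t \<le> m * (2 * max 0 (vals z t - g t x)) + \<delta>"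
      and s: "s \<in> F" and w: "w \<in> ?Y" "blinfun_apply (\<zeta>0 s) w \<le> - (1 / (8 * m) - L) * norm w" "1 / 2 \<le> a0 \<or> w \<noteq> 0"
      by (rule subgradients_at_minimum[OF Y z \<delta>(1) p D0(1,2,4) S(1) L(1) S(2)[folded L_def] S(3) zmin]; (assumption | rule that))
    \<comment> \<open>The relative rounding error. The witness loses
      \<open>5 * \<theta> * norm w\<close>, whence 160 as 5 times 32; the other bound fits the
      rounding into \<epsilon>.\<close>
    define \<theta> where "\<theta> = min (1 / (160 * m)) (\<epsilon> / (16 * m * (M + 1)))"
    have "\<theta> \<le> 1 / (160 * m)" "\<theta> \<le> \<epsilon> / (16 * m * (M + 1))" by (auto simp: \<theta>_def)
    moreover have \<theta>0: "0 < \<theta>" using m \<epsilon> M by (auto simp: \<theta>_def)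
    moreover have "0 < 160 * m" "0 < 16 * m * (M + 1)" using m M by auto
    ultimately have "\<theta> * (160 * m) \<le> 1" "\<theta> * (16 * m * (M + 1)) \<le> \<epsilon>"
      by (simp_all only: pos_le_divide_eq)
    then have \<theta>': "160 * (m * \<theta>) \<le> 1" "16 * (m * \<theta>) * (M + 1) \<le> \<epsilon>"
      by (simp_all only: mult_ac)
    have m\<theta>: "\<theta> \<le> m * \<theta>" using m1 \<theta>0 by simp
    have \<theta>M: "16 * (m * \<theta>) \<le> \<epsilon>" "16 * (\<theta> * M) \<le> \<epsilon>"
    proof -
      have "0 \<le> (m * \<theta>) * M" using m \<theta>0 M by simp
      then show "16 * (m * \<theta>) \<le> \<epsilon>" using \<theta>'(2) by (simp add: distrib_left)
      have "\<theta> * M \<le> (m * \<theta>) * M" using m\<theta> M by (rule mult_right_mono)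
      moreover have "0 \<le> m * \<theta>" using m \<theta>0 by simp
      ultimately show "16 * (\<theta> * M) \<le> \<epsilon>" using \<theta>'(2) by (simp add: distrib_left)
    qed
    have "\<exists>q. \<mu>0 t < real_of_rat q \<and> real_of_rat q < (1 + \<theta>) * \<mu>0 t" if "t \<in> F" for t
    proof -
      have "\<mu>0 t < (1 + \<theta>) * \<mu>0 t" using \<mu>0[OF that] \<theta>0 by (simp add: distrib_right)
      then show ?thesis by (rule of_rat_dense)
    qed
    then obtain \<mu> where \<mu>: "\<And>t. t \<in> F \<Longrightarrow> \<mu>0 t < real_of_rat (\<mu> t)" "\<And>t. t \<in> F \<Longrightarrow> real_of_rat (\<mu> t) < (1 + \<theta>) * \<mu>0 t" by metis
    obtain a where a: "a0 < real_of_rat a" "real_of_rat a < a0 + \<theta>" by (rule rational_between[of a0 "a0 + \<theta>"]) (use \<theta>0 in auto)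
    \<comment> \<open>Rescaling \<zeta>0 by the same factor as \<mu>0 leaves the quotient, and with
      it the Frechet subgradient, unchanged.\<close>
    define k where "k t = real_of_rat (\<mu> t) / \<mu>0 t" for t
    have k: "1 \<le> k t" "k t \<le> 1 + \<theta>" if "t \<in> F" for t
      using \<mu>[OF that] \<mu>0[OF that] by (auto simp: k_def pos_le_divide_eq pos_divide_le_eq)
    define \<zeta> where "\<zeta> t = k t *\<^sub>R \<zeta>0 t" for t
    have \<mu>pos: "0 < real_of_rat (\<mu> t)" if "t \<in> F" for t using \<mu>(1)[OF that] \<mu>0[OF that] by linarith
    have same: "\<zeta> t /\<^sub>R real_of_rat (\<mu> t) = \<zeta>0 t /\<^sub>R \<mu>0 t" if "t \<in> F" for t
      using \<mu>pos[OF that] \<mu>0[OF that] by (simp add: \<zeta>_def k_def field_simps)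
    have diff: "norm (\<zeta> t - \<zeta>0 t) \<le> 2 * \<theta>" if t: "t \<in> F" for t
    proof -
      have "\<zeta> t - \<zeta>0 t = (k t - 1) *\<^sub>R \<zeta>0 t" by (simp add: \<zeta>_def scaleR_left_diff_distrib)
      then have "norm (\<zeta> t - \<zeta>0 t) = (k t - 1) * norm (\<zeta>0 t)" using k(1)[OF t] by simp
      also have "\<dots> \<le> \<theta> * 2" using k[OF t] \<zeta>0[OF t] L(2) by (intro mult_mono) auto
      finally show ?thesis by simp
    qed
    have \<theta>1: "160 * \<theta> \<le> 1" using m\<theta> \<theta>'(1) by linarith
    have \<zeta>3: "norm (\<zeta> t) \<le> 3" if t: "t \<in> F" for t
      using norm_triangle_ineq[of "\<zeta>0 t" "\<zeta> t - \<zeta>0 t"] diff[OF t] \<zeta>0[OF t] L(2) \<theta>1 by simp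
    have sum: "- (\<Sum>t\<in>F. blinfun_apply (\<zeta> t) h) \<le> real_of_rat a * q h + \<epsilon> * norm h" if h: "h \<in> ?Y" for h
    proof -
      have "- \<zeta> t h \<le> - \<zeta>0 t h + 2 * \<theta> * norm h" if "t \<in> F" for t
        using norm_blinfun[of "\<zeta> t - \<zeta>0 t" h] mult_right_mono[OF diff[OF that], of "norm h"]
        by (simp add: blinfun.diff_left)
      then have "(\<Sum>t\<in>F. - \<zeta> t h) \<le> (\<Sum>t\<in>F. - \<zeta>0 t h + 2 * \<theta> * norm h)" by (rule sum_mono)
      also have "\<dots> = - (\<Sum>t\<in>F. \<zeta>0 t h) + real (card F) * (2 * \<theta> * norm h)" by (simp add: sum.distrib sum_negf sum_subtractf)
      also have "real (card F) * (2 * \<theta> * norm h) \<le> m * (2 * \<theta> * norm h)"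
        using card_le_m(1) \<theta>0 by (intro mult_right_mono) auto
      finally have "- (\<Sum>t\<in>F. \<zeta> t h) \<le> a0 * q h + m * L * norm h + 2 * (m * \<theta>) * norm h"
        using sum0[OF h] by (simp add: sum_negf)
      moreover have "a0 * q h \<le> real_of_rat a * q h + \<theta> * M * norm h"
      proof -
        have "(a0 - real_of_rat a) * q h \<le> \<bar>a0 - real_of_rat a\<bar> * \<bar>q h\<bar>" by (simp add: abs_mult[symmetric])
        also have "\<dots> \<le> \<theta> * (M * norm h)" using a qM[of h] by (intro mult_mono) auto
        finally show ?thesis by (simp add: algebra_simps)
      qed
      moreover have "m * L * norm h + 2 * (m * \<theta>) * norm h + \<theta> * M * norm h \<le> \<epsilon> * norm h"
        unfolding distrib_right[symmetric] using L(4) \<theta>M \<epsilon>(1) by (intro mult_right_mono) auto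
      ultimately show ?thesis by linarith
    qed
    have "0 \<in> D" using D(2) by (simp add: E_def)
    \<comment> \<open>The error is relative to \<open>norm w\<close>, so that a nonzero
      \<open>w\<close> is replaced by a nonzero \<open>w'\<close>.\<close>
    have "\<exists>w'\<in>D. norm (w - w') \<le> \<theta> * norm w"
    proof (cases "w = 0")
      case True then show ?thesis using \<open>0 \<in> D\<close> by (intro bexI[of _ 0]) auto
    next
      case False
      then have "0 < \<theta> * norm w" using \<theta>0 by simp
      then obtain w' where "w' \<in> D" "dist w' w < \<theta> * norm w" using w(1) unfolding closure_approachable by blast
      then show ?thesis by (intro bexI[of _ w']) (auto simp: dist_norm norm_minus_commute)
    qed
    then obtain w' where w': "w' \<in> D" "norm (w - w') \<le> \<theta> * norm w" by blast
    have low\<zeta>: "blinfun_apply (\<zeta> s) w' \<le> - (1 / (32 * m) * norm w')"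
    proof -
      have "\<zeta> s w' = \<zeta>0 s w + (\<zeta> s - \<zeta>0 s) w + \<zeta> s (w' - w)"
        by (simp add: blinfun.diff_left blinfun.diff_right)
      moreover have "(\<zeta> s - \<zeta>0 s) w \<le> 2 * \<theta> * norm w"
        using blinfun_le_norm[of "\<zeta> s - \<zeta>0 s" w] mult_right_mono[OF diff[OF s], of "norm w"] by simp
      moreover have "\<zeta> s (w' - w) \<le> 3 * (\<theta> * norm w)"
        using blinfun_le_norm[of "\<zeta> s" "w' - w"] mult_mono[OF \<zeta>3[OF s] w'(2)] by (simp add: norm_minus_commute)
      \<comment> \<open>Three units \<open>1 / (32 * m)\<close> are available: one absorbs the
        rounding, and two are kept because \<open>norm w'\<close> may be twice
        \<open>norm w\<close>.\<close>
      moreover have "\<zeta>0 s w \<le> - (3 / (32 * m)) * norm w"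
      proof -
        have "3 / (32 * m) \<le> 1 / (8 * m) - L"
        proof -
          have "1 / (8 * m) = 4 / (32 * m)" using m by simp
          moreover have "4 / (32 * m) = 3 / (32 * m) + 1 / (32 * m)" by (simp add: add_divide_distrib[symmetric])
          ultimately show ?thesis using L(3) by linarith
        qed
        then have "- (1 / (8 * m) - L) \<le> - (3 / (32 * m))" by linarith
        then have "- (1 / (8 * m) - L) * norm w \<le> - (3 / (32 * m)) * norm w" by (rule mult_right_mono) simp
        then show ?thesis using w(2) by (rule order_trans[rotated])
      qed
      moreover have "5 * \<theta> * norm w \<le> 1 / (32 * m) * norm w"
      proof (rule mult_right_mono)
        show "5 * \<theta> \<le> 1 / (32 * m)" using \<theta>'(1) m by (simp add: pos_le_divide_eq mult.commute mult.left_commute)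
      qed simp
      moreover have "1 / (32 * m) * norm w' \<le> 1 / (32 * m) * (2 * norm w)"
      proof (rule mult_left_mono)
        have "norm w' \<le> norm w + \<theta> * norm w" using w'(2) norm_triangle_ineq4[of w "w - w'"] by simp
        moreover have "\<theta> * norm w \<le> 1 * norm w" using \<theta>1 \<theta>0 by (intro mult_right_mono) auto
        ultimately show "norm w' \<le> 2 * norm w" by simp
      qed (use m in simp)
      ultimately show ?thesis by (simp add: algebra_simps)
    qed
    have zD: "z (Some t) \<in> ?Y" if "t \<in> F" for t using z(1) idx_mem(2)[OF that] by (auto simp: dom_def)
    have "\<exists>\<zeta>'. (\<forall>t\<in>F. fsub (dm t) (g t) UNIV (z (Some t)) (\<zeta>' t /\<^sub>R real_of_rat (\<mu> t)) \<and> norm (\<zeta>' t) \<le> 3)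
          \<and> (\<forall>u. - (\<Sum>t\<in>F. blinfun_apply (\<zeta>' t) u) \<le> real_of_rat a * q u + \<epsilon> * norm u)
          \<and> blinfun_apply (\<zeta>' s) w' \<le> - (1 / (32 * m) * norm w')"
      by (rule red[where \<zeta> = \<zeta>]) (use zD \<mu>pos s w'(1) fs same \<zeta>3 sum low\<zeta> in auto)
    then obtain \<zeta>' where \<zeta>': "\<And>t. t \<in> F \<Longrightarrow> fsub (dm t) (g t) UNIV (z (Some t)) (\<zeta>' t /\<^sub>R real_of_rat (\<mu> t))"
      "\<And>t. t \<in> F \<Longrightarrow> norm (\<zeta>' t) \<le> 3" "\<And>u. - (\<Sum>t\<in>F. blinfun_apply (\<zeta>' t) u) \<le> real_of_rat a * q u + \<epsilon> * norm u"
      "blinfun_apply (\<zeta>' s) w' \<le> - (1 / (32 * m) * norm w')" by blast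
    have zR: "norm (z i - x) \<le> R" if "i \<in> idx" for i using z(2)[OF that] R by simp
    have vlow: "g t x - \<rho> \<le> vals z t" if "t \<in> F" for t
    proof -
      have "z (Some t) \<in> dm t" using z(1) that by (auto simp: dom_def)
      then show ?thesis unfolding vals_def by (rule low[OF that _ zR[OF idx_mem(2)[OF that]]])
    qed
    have D0\<rho>: "sqrt (sq p e (vals z) z) \<le> \<rho>" using D0 by simp
    have vJ: "vals z t \<le> g t x + 2 * \<rho>" if "t \<in> J" for t
      using value_bounds(1)[of "vals z" z e p \<rho> t] vlow zR[OF idx_mem(1)] e0 D0\<rho> that by simp
    have vI: "max 0 (vals z t - g t x) \<le> \<epsilon> / (8 * m)" if "t \<in> F - J" for t
    proof -
      have "(max 0 (vals z t - g t x))\<^sup>2 \<le> 2 * \<rho> + \<rho>"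
        by (rule value_bounds(3)[of "vals z" z e p \<rho> t]) (use vlow zR[OF idx_mem(1)] e0 D0\<rho> that in auto)
      also have "\<dots> \<le> 4 * (\<epsilon> / (16 * m))\<^sup>2" using \<rho>\<epsilon> \<rho> by simp
      also have "\<dots> = (\<epsilon> / (8 * m))\<^sup>2" by (simp add: power2_eq_square)
      finally show ?thesis by (rule power2_le_imp_le) (use \<epsilon> m in simp)
    qed
    have \<rho>s: "\<rho> \<le> \<epsilon> / 16"
    proof -
      have "\<epsilon> / (16 * m) \<le> \<epsilon> / 16" using \<epsilon> m m1 by (intro divide_left_mono) auto
      moreover have "\<epsilon> / (16 * m) \<le> 1" using \<epsilon> m m1 by (simp add: pos_divide_le_eq)
      ultimately have "(\<epsilon> / (16 * m))\<^sup>2 \<le> \<epsilon> / 16 * 1"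
        unfolding power2_eq_square using \<epsilon> m by (intro mult_mono) auto
      then show ?thesis using \<rho>\<epsilon> by simp
    qed
    have \<epsilon>8: "\<epsilon> / (8 * m) \<le> \<epsilon> / 8" using \<epsilon> m m1 by (intro divide_left_mono) auto
    have R\<epsilon>: "R \<le> \<epsilon>"
    proof -
      have "R * 1 \<le> R * (8 * m)" using R m1 by (intro mult_left_mono) auto
      then show ?thesis using R\<rho> \<rho>s \<epsilon> by (simp add: m_def)
    qed
    have \<mu>le: "real_of_rat (\<mu> t) \<le> 2 * \<mu>0 t" if "t \<in> F" for t
    proof -
      have "(1 + \<theta>) * \<mu>0 t \<le> 2 * \<mu>0 t" using \<theta>1 \<mu>0[OF that] by (intro mult_right_mono) auto
      then show ?thesis using \<mu>(2)[OF that] by simp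
    qed
    have "\<delta> \<le> 1" using \<delta>(2) \<epsilon>8 \<epsilon> by linarith
    moreover have "m * \<delta> \<le> \<epsilon> / 8" using \<delta>(2) m by (simp add: pos_le_divide_eq mult.commute mult.left_commute)
    ultimately have \<delta>1: "\<delta> \<le> 1" "m * \<delta> \<le> \<epsilon> / 8" by auto
    have \<mu>I': "real_of_rat (\<mu> t) \<le> \<epsilon>" if t: "t \<in> F - J" for t
    proof -
      have "m * (2 * max 0 (vals z t - g t x)) \<le> m * (2 * (\<epsilon> / (8 * m)))" using vI[OF t] m by (intro mult_left_mono) auto
      also have "\<dots> = \<epsilon> / 4" using m by simp
      finally have "\<mu>0 t \<le> \<epsilon> / 4 + \<epsilon> / 8" using \<mu>I[OF t] \<delta>(2) \<epsilon>8 by linarith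
      then show ?thesis using \<mu>le[of t] t \<epsilon> by auto
    qed
    have a\<mu>': "\<bar>real_of_rat a - (\<Sum>t\<in>J. real_of_rat (\<mu> t))\<bar> \<le> \<epsilon>"
    proof -
      have "\<bar>real_of_rat (\<mu> t) - \<mu>0 t\<bar> \<le> 2 * \<theta>" if t: "t \<in> J" for t
      proof -
        have "t \<in> F" using JF t by blast
        have "\<theta> * \<mu>0 t \<le> \<theta> * 2" using \<mu>J[OF t] \<delta>1 \<theta>0 by (intro mult_left_mono) auto
        then show ?thesis using \<mu>[OF \<open>t \<in> F\<close>] by (simp add: distrib_right)
      qed
      then have "(\<Sum>t\<in>J. \<bar>real_of_rat (\<mu> t) - \<mu>0 t\<bar>) \<le> (\<Sum>t\<in>J. 2 * \<theta>)" by (rule sum_mono)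
      also have "\<dots> \<le> m * (2 * \<theta>)" using card_le_m(2) \<theta>0 by simp
      finally have "\<bar>(\<Sum>t\<in>J. real_of_rat (\<mu> t)) - (\<Sum>t\<in>J. \<mu>0 t)\<bar> \<le> m * (2 * \<theta>)"
        unfolding sum_subtractf[symmetric] by (rule order_trans[OF sum_abs])
      moreover have "\<bar>real_of_rat a - a0\<bar> \<le> \<theta>" using a by simp
      ultimately show ?thesis using a\<mu> \<delta>1(2) \<theta>M(1) m\<theta> \<epsilon> by linarith
    qed
    have last: "1 / 2 \<le> real_of_rat a \<or> 1 / (32 * m) \<le> norm (\<zeta>' s)"
    proof (cases "1 / 2 \<le> a0")
      case True then show ?thesis using a by simp
    next
      case False
      then have "0 < norm w" using w(3) by simp
      then have "\<theta> * norm w < norm w" using \<theta>1 \<theta>0 by simp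
      then have "w' \<noteq> 0" using w'(2) by auto
      then have nw: "0 < norm w'" by simp
      have "1 / (32 * m) * norm w' \<le> norm (\<zeta>' s) * norm w'"
        using \<zeta>'(4) norm_blinfun[of "\<zeta>' s" w'] by simp
      then have "1 / (32 * m) \<le> norm (\<zeta>' s)" using nw by (simp only: mult_le_cancel_right_pos)
      then show ?thesis ..
    qed
    show thesis
    proof (rule that[of "\<lambda>t. z (Some t)" "\<lambda>t. real_of_rat (\<mu> t)" \<zeta>' "real_of_rat a" s])
      show "norm (z (Some t) - x) \<le> \<epsilon>" if "t \<in> F" for t using zR[OF idx_mem(2)[OF that]] R\<epsilon> by simp
      show "\<bar>g t (z (Some t)) - g t x\<bar> \<le> \<epsilon>" if "t \<in> F" for t
        using vlow[OF that] vJ[of t] vI[of t] that \<rho>s \<epsilon>8 \<epsilon> \<rho> by (cases "t \<in> J") (auto simp: vals_def abs_le_iff)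
      show "0 \<le> real_of_rat a" using a0 a(1) by linarith
      show "real_of_rat (\<mu> t) \<le> 4" if "t \<in> F" for t
        using \<mu>le[OF that] \<mu>J[of t] \<mu>I'[of t] that \<delta>1(1) \<epsilon> by (cases "t \<in> J") auto
    qed (use \<zeta>' \<mu>pos a0 a a\<mu>' \<mu>I' s last in auto)
  qed
qed

end

section \<open>Extended-real functions and their finite parts\<close>

definition dom_of :: "('a \<Rightarrow> ereal) \<Rightarrow> 'a set" where
  "dom_of h = {x. h x \<noteq> \<infinity>}"

text \<open>At infinite values this is the default 0, so it is meaningful only together with
  \<open>dom_of h\<close>.\<close>

definition rl :: "('a \<Rightarrow> ereal) \<Rightarrow> 'a \<Rightarrow> real" where
  "rl h x = real_of_ereal (h x)"

lemma ereal_rl: "h x \<noteq> - \<infinity> \<Longrightarrow> x \<in> dom_of h \<Longrightarrow> h x = ereal (rl h x)"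
  by (cases "h x") (auto simp: rl_def dom_of_def)

lemma lsc_eventually:
  assumes "lsc h" "c < h x"
  shows "eventually (\<lambda>y. c < h y) (nhds x)"
proof -
  have "c < Liminf (at x) h" using assms by (auto simp: lsc_def intro: less_le_trans)
  then have "eventually (\<lambda>y. c < h y) (at x)" by (rule less_LiminfD)
  then show ?thesis unfolding eventually_at_filter by (rule eventually_mono) (use assms(2) in auto)
qed

lemma lsc_plsc:
  fixes h :: "'a::topological_space \<Rightarrow> ereal"
  assumes h: "lsc h" and nm: "\<And>x. h x \<noteq> - \<infinity>"
  shows "plsc (dom_of h) (rl h)"
  unfolding plsc_def
proof (intro allI impI, elim conjE)
  fix xs L x l assume xs: "\<forall>n. xs n \<in> dom_of h \<and> rl h (xs n) \<le> L n" and L: "L \<longlonglongrightarrow> l" and x: "xs \<longlonglongrightarrow> x"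
  have "h x \<le> ereal l"
  proof (rule ccontr)
    assume "\<not> ?thesis"
    then have "ereal l < h x" by simp
    from ereal_dense2[OF this] obtain c where c: "ereal l < ereal c" "ereal c < h x" by blast
    have "eventually (\<lambda>n. ereal c < h (xs n)) sequentially"
      by (rule eventually_compose_filterlim[OF lsc_eventually[OF h c(2)] x])
    moreover have "eventually (\<lambda>n. L n < c) sequentially" using order_tendstoD(2)[OF L] c(1) by simp
    ultimately have "eventually (\<lambda>n. ereal c < h (xs n) \<and> L n < c) sequentially" by (rule eventually_conj)
    then obtain n where n: "ereal c < h (xs n)" "L n < c" by (auto simp: eventually_sequentially)
    have "h (xs n) = ereal (rl h (xs n))" using xs nm by (intro ereal_rl) auto
    then have "c < rl h (xs n)" using n(1) by simp
    moreover have "rl h (xs n) \<le> L n" using xs by blast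
    ultimately show False using n(2) by linarith
  qed
  moreover from this have "x \<in> dom_of h" by (auto simp: dom_of_def)
  ultimately show "x \<in> dom_of h \<and> rl h x \<le> l" using ereal_rl[of h x] nm[of x] by simp
qed

text \<open>Off the domain the difference quotient is \<infinity> and imposes nothing; on it, a
  lower limit of at least 0 means that every \<open>- \<epsilon>\<close> eventually lies below the
  quotient.\<close>

lemma frechet_subdiff_iff_fsub:
  fixes h :: "'a::real_normed_vector \<Rightarrow> ereal"
  assumes nm: "\<And>x. h x \<noteq> - \<infinity>"
  shows "\<xi> \<in> frechet_subdiff h z \<longleftrightarrow> fsub (dom_of h) (rl h) UNIV z \<xi>"
proof (cases "z \<in> dom_of h")
  case False
  then show ?thesis by (auto simp: frechet_subdiff_def fsub_def dom_of_def)
next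
  case zd: True
  define Q where "Q k = (h (z + k) - h z - ereal (blinfun_apply \<xi> k)) / ereal (norm k)" for k
  have hz: "h z = ereal (rl h z)" by (rule ereal_rl[OF nm zd])
  have Qreal: "Q k = ereal ((rl h (z + k) - rl h z - \<xi> k) / norm k)" if "z + k \<in> dom_of h" "k \<noteq> 0" for k
    unfolding Q_def hz ereal_rl[OF nm that(1)] using that(2) by simp
  have Qinf: "Q k = \<infinity>" if "z + k \<notin> dom_of h" "k \<noteq> 0" for k
    using that by (simp add: Q_def hz dom_of_def)
  have "\<xi> \<in> frechet_subdiff h z \<longleftrightarrow> (\<forall>y<0. eventually (\<lambda>k. y < Q k) (at 0))"
    using hz by (simp add: frechet_subdiff_def Q_def le_Liminf_iff)
  also have "\<dots> \<longleftrightarrow> (\<forall>\<epsilon>>0. eventually (\<lambda>k. ereal (- \<epsilon>) < Q k) (at 0))"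
  proof (intro iffI allI impI)
    fix \<epsilon> :: real assume "\<forall>y<0. eventually (\<lambda>k. y < Q k) (at 0)" "0 < \<epsilon>"
    then show "eventually (\<lambda>k. ereal (- \<epsilon>) < Q k) (at 0)" by auto
  next
    fix y :: ereal assume ev: "\<forall>\<epsilon>>0. eventually (\<lambda>k. ereal (- \<epsilon>) < Q k) (at 0)" and "y < 0"
    from ereal_dense2[OF \<open>y < 0\<close>] obtain c where c: "y < ereal c" "ereal c < 0" by blast
    then have "eventually (\<lambda>k. ereal (- (- c)) < Q k) (at 0)" using ev[rule_format, of "- c"] by simp
    then show "eventually (\<lambda>k. y < Q k) (at 0)" by (rule eventually_mono) (use c(1) in auto)
  qed
  also have "\<dots> \<longleftrightarrow> fsub (dom_of h) (rl h) UNIV z \<xi>"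
  proof
    assume ev: "\<forall>\<epsilon>>0. eventually (\<lambda>k. ereal (- \<epsilon>) < Q k) (at 0)"
    show "fsub (dom_of h) (rl h) UNIV z \<xi>" unfolding fsub_def
    proof (intro conjI allI impI zd)
      fix \<epsilon> :: real assume "0 < \<epsilon>"
      then have "eventually (\<lambda>k. ereal (- \<epsilon>) < Q k) (at 0)" using ev by blast
      then obtain d where d: "0 < d" "\<And>k. k \<noteq> 0 \<Longrightarrow> norm k < d \<Longrightarrow> ereal (- \<epsilon>) < Q k"
        by (auto simp: eventually_at)
      have "rl h z + \<xi> (y - z) - \<epsilon> * norm (y - z) \<le> rl h y" if y: "y \<in> dom_of h" "norm (y - z) < d" for y
      proof (cases "y = z")
        case False
        then have "ereal (- \<epsilon>) < Q (y - z)" using d(2)[of "y - z"] y(2) by simp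
        then have "- \<epsilon> < (rl h y - rl h z - \<xi> (y - z)) / norm (y - z)"
          using Qreal[of "y - z"] y(1) False by simp
        then show ?thesis using False by (simp add: pos_less_divide_eq)
      qed (simp add: blinfun.zero_right)
      then show "\<exists>\<delta>>0. \<forall>y\<in>dom_of h \<inter> UNIV. norm (y - z) < \<delta> \<longrightarrow>
          rl h z + \<xi> (y - z) - \<epsilon> * norm (y - z) \<le> rl h y" using d(1) by blast
    qed
  next
    assume fs: "fsub (dom_of h) (rl h) UNIV z \<xi>"
    show "\<forall>\<epsilon>>0. eventually (\<lambda>k. ereal (- \<epsilon>) < Q k) (at 0)"
    proof (intro allI impI)
      fix \<epsilon> :: real assume "0 < \<epsilon>"
      then have "0 < \<epsilon> / 2" by simp
      then obtain d where d: "0 < d" "\<And>y. y \<in> dom_of h \<Longrightarrow> norm (y - z) < d \<Longrightarrow>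
          rl h z + \<xi> (y - z) - \<epsilon> / 2 * norm (y - z) \<le> rl h y"
        using fs unfolding fsub_def by blast
      have "ereal (- \<epsilon>) < Q k" if k: "k \<noteq> 0" "norm k < d" for k
      proof (cases "z + k \<in> dom_of h")
        case True
        have "- (\<epsilon> / 2) * norm k \<le> rl h (z + k) - rl h z - \<xi> k" using d(2)[OF True] k(2) by simp
        then have "- (\<epsilon> / 2) \<le> (rl h (z + k) - rl h z - \<xi> k) / norm k"
          using k(1) by (simp add: pos_le_divide_eq)
        then show ?thesis using Qreal[OF True k(1)] \<open>0 < \<epsilon>\<close> by simp
      qed (use Qinf k(1) in simp)
      then show "eventually (\<lambda>k. ereal (- \<epsilon>) < Q k) (at 0)"
        unfolding eventually_at using d(1) by (intro exI[of _ d]) auto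
    qed
  qed
  finally show ?thesis .
qed

section \<open>The exact multiplier rule\<close>

text \<open>If the function supplied by local minimality at \<open>u\<close> is inactive at
  \<open>x\<close>, its value has risen by at least \<open>gap / 2\<close>, and its squared excess
  alone outweighs the possible drop \<open>2 * \<rho>\<close> of an active value and
  \<open>G\<close>. So the penalty may stand in for the inactive functions.\<close>

lemma penalized_minimum_of_local_minimum:
  fixes dm :: "'t \<Rightarrow> 'a::banach set" and g :: "'t \<Rightarrow> 'a \<Rightarrow> real"
  assumes F: "finite F" "F \<noteq> {}" and lsc: "\<And>t. t \<in> F \<Longrightarrow> plsc (dm t) (g t)"
    and xdm: "\<And>t. t \<in> F \<Longrightarrow> x \<in> dm t"
    and q: "sublinear q" and qM: "\<And>h. \<bar>q h\<bar> \<le> M * norm h" and M: "0 \<le> M"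
    and Gq: "\<And>u h. G (u + h) - G u \<le> q h"
    and R0: "0 < R0" and \<rho>0: "0 < \<rho>0"
    and J: "J = {t \<in> F. g t x = c}" "J \<noteq> {}" and c: "\<And>t. t \<in> F \<Longrightarrow> g t x \<le> c"
    and min: "\<And>u. norm (u - x) \<le> R0 \<Longrightarrow> (\<And>t. t \<in> F \<Longrightarrow> u \<in> dm t) \<Longrightarrow> \<exists>t\<in>F. c \<le> g t u + (G u - G x)"
  obtains R \<rho> where "\<rho> \<le> \<rho>0" "penalized_minimum F J dm g G q x M R \<rho>"
proof -
  define gap where "gap = Min (insert 1 ((\<lambda>t. c - g t x) ` (F - J)))"
  have "0 < c - g t x" if "t \<in> F - J" for t using c[of t] that J(1) by force
  then have gap: "0 < gap" unfolding gap_def using F(1) by (subst Min_gr_iff) auto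
  have gap_le: "gap \<le> c - g t x" if "t \<in> F - J" for t
    unfolding gap_def using F(1) that by (intro Min_le) auto
  \<comment> \<open>The bound \<open>gap / 2\<close> absorbs the variation of \<open>G\<close>, and
    \<open>gap\<^sup>2 / 8\<close> puts \<open>2 * \<rho>\<close> below the penalty
    \<open>gap\<^sup>2 / 4\<close>.\<close>
  define \<rho> where "\<rho> = min \<rho>0 (min (gap / 2) (gap\<^sup>2 / 8))"
  have \<rho>: "0 < \<rho>" "\<rho> \<le> \<rho>0" "\<rho> \<le> gap / 2" "\<rho> \<le> gap\<^sup>2 / 8"
    using \<rho>0 gap by (auto simp: \<rho>_def min_def)
  have "\<exists>d>0. \<forall>y\<in>dm t. norm (y - x) < d \<longrightarrow> g t x - \<rho> \<le> g t y" if t: "t \<in> F" for t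
  proof (rule ccontr)
    assume "\<not> ?thesis"
    then have neg: "\<forall>d>0. \<exists>y\<in>dm t. norm (y - x) < d \<and> g t y < g t x - \<rho>" by (auto simp: not_le)
    have "\<exists>y. y \<in> dm t \<and> norm (y - x) < inverse (real (Suc n)) \<and> g t y < g t x - \<rho>" for n
      using neg[rule_format, of "inverse (real (Suc n))"] by auto
    then obtain y where y: "\<And>n. y n \<in> dm t" "\<And>n. norm (y n - x) < inverse (real (Suc n))"
      "\<And>n. g t (y n) < g t x - \<rho>" by metis
    have "(\<lambda>n. norm (y n - x)) \<longlonglongrightarrow> 0"
      by (rule tendsto_sandwich[OF _ _ tendsto_const LIMSEQ_inverse_real_of_nat])
        (use y(2) in \<open>auto intro!: always_eventually less_imp_le\<close>)
    then have "y \<longlonglongrightarrow> x" by (simp add: LIM_zero_iff tendsto_norm_zero_iff)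
    then have "g t x \<le> g t x - \<rho>"
      using plscD(2)[where L = "\<lambda>_. g t x - \<rho>" and xs = y, OF lsc[OF t] y(1) less_imp_le[OF y(3)] tendsto_const] by blast
    then show False using \<rho>(1) by simp
  qed
  then obtain d where d: "\<And>t. t \<in> F \<Longrightarrow> 0 < d t" "\<And>t y. t \<in> F \<Longrightarrow> y \<in> dm t \<Longrightarrow> norm (y - x) < d t \<Longrightarrow> g t x - \<rho> \<le> g t y"
    by metis
  define d0 where "d0 = Min (insert 1 (d ` F))"
  have d0: "0 < d0" using d(1) F(1) by (auto simp: d0_def)
  have d0_le: "d0 \<le> d t" if "t \<in> F" for t unfolding d0_def using F(1) that by (intro Min_le) auto
  define m where "m = real (Suc (card F))"
  define R where "R = min (min R0 (d0 / 2)) (min (\<rho> / (M + 1)) (\<rho> / (8 * m)))"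
  have m: "0 < m" by (simp add: m_def)
  have Rpos: "0 < R" using R0 d0 \<rho> M m by (auto simp: R_def)
  have R_le: "R \<le> R0" "R \<le> d0 / 2" "R \<le> \<rho> / (M + 1)" "R \<le> \<rho> / (8 * m)" unfolding R_def by linarith+
  have R2: "R < d0" using R_le(2) d0 by simp
  have MR: "M * R \<le> \<rho>"
  proof -
    have "R * (M + 1) \<le> \<rho>" using R_le(3) M by (simp add: pos_le_divide_eq)
    then show ?thesis using Rpos by (simp add: algebra_simps)
  qed
  have R8: "R * (8 * real (Suc (card F))) \<le> \<rho>"
    using R_le(4) m unfolding m_def by (simp add: pos_le_divide_eq)
  have low: "g t x - \<rho> \<le> g t y" if "t \<in> F" "y \<in> dm t" "norm (y - x) \<le> R" for t y
    using d(2)[OF that(1,2)] d0_le[OF that(1)] that(3) R2 by linarith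
  have Gnear: "\<bar>G u - G x\<bar> \<le> \<rho>" if "norm (u - x) \<le> R" for u
  proof -
    have "G u - G x \<le> M * norm (u - x)" using Gq[of x "u - x"] qM[of "u - x"] by simp
    moreover have "G x - G u \<le> M * norm (u - x)"
      using Gq[of u "x - u"] qM[of "x - u"] by (simp add: norm_minus_commute)
    moreover have "M * norm (u - x) \<le> M * R" using that M by (rule mult_left_mono)
    ultimately show ?thesis using MR by (simp add: abs_le_iff)
  qed
  have "penalized_minimum F J dm g G q x M R \<rho>"
  proof
    show "\<exists>t\<in>J. g t x \<le> g t u + (\<Sum>s\<in>F - J. (max 0 (g s u - g s x))\<^sup>2) + (G u - G x)"
      if u: "norm (u - x) \<le> R" "\<And>t. t \<in> F \<Longrightarrow> u \<in> dm t" for u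
    proof -
      let ?pen = "\<Sum>s\<in>F - J. (max 0 (g s u - g s x))\<^sup>2"
      have pen0: "0 \<le> ?pen" by (simp add: sum_nonneg)
      obtain t where t: "t \<in> F" "c \<le> g t u + (G u - G x)" using min[of u] u R_le(1) by auto
      show ?thesis
      proof (cases "t \<in> J")
        case True
        then show ?thesis using t pen0 J(1) by (intro bexI[of _ t]) auto
      next
        case False
        then have tI: "t \<in> F - J" using t(1) by blast
        have "gap / 2 \<le> g t u - g t x" using t(2) gap_le[OF tI] Gnear[OF u(1)] \<rho>(3) by linarith
        then have "(gap / 2)\<^sup>2 \<le> (max 0 (g t u - g t x))\<^sup>2" using gap by (intro power_mono) auto
        also have "\<dots> \<le> ?pen" by (rule member_le_sum[OF tI]) (use F(1) in auto)
        finally have pen: "gap\<^sup>2 / 4 \<le> ?pen" by (simp add: power_divide)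
        obtain j where j: "j \<in> J" using J(2) by blast
        then have jF: "j \<in> F" using J(1) by blast
        show ?thesis
          by (rule bexI[OF _ j]) (use low[OF jF u(2)[OF jF] u(1)] Gnear[OF u(1)] pen \<rho>(4) in linarith)
      qed
    qed
  qed (use F J xdm lsc q qM M Gq Rpos \<rho>(1) low MR R8 in auto)
  with \<rho>(2) show thesis by (rule that)
qed

lemma g_converges_rl:
  assumes nm: "\<And>x. h x \<noteq> - \<infinity>" and dm: "\<And>n. xs n \<in> dom_of h" "x \<in> dom_of h"
    and xs: "xs \<longlonglongrightarrow> x" "(\<lambda>n. rl h (xs n)) \<longlonglongrightarrow> rl h x"
  shows "g_converges h xs x"
  unfolding g_converges_def ereal_rl[OF nm dm(1)] ereal_rl[OF nm dm(2)] using xs by simp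

text \<open>Along a subsequence the multipliers and functionals of the fuzzy rules converge. If the
  total active multiplier has a limit \<open>A > 0\<close>, division by \<open>A\<close> gives the
  rule. If \<open>A = 0\<close>, the limits are singular subgradients with sum 0, hence all 0; SNEC
  makes all functionals but at most one converge in norm, the sum inequality adds the last, and this
  contradicts the recorded nontriviality.\<close>

theorem exact_multiplier_rule:
  fixes f :: "'t \<Rightarrow> 'a::banach \<Rightarrow> ereal"
  assumes asp: "asplund_space TYPE('a)" and F: "finite F" "F \<noteq> {}"
    and nm: "\<And>t y. t \<in> F \<Longrightarrow> f t y \<noteq> - \<infinity>" and lsc: "\<And>t. t \<in> F \<Longrightarrow> lsc (f t)"
    and xdm: "\<And>t. t \<in> F \<Longrightarrow> x \<in> dom_of (f t)"
    and q: "sublinear q" and qM: "\<And>h. \<bar>q h\<bar> \<le> M * norm h" and M: "0 \<le> M"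
    and Gq: "\<And>u h. G (u + h) - G u \<le> q h" and R0: "0 < R0"
    and c: "c \<in> (\<lambda>t. rl (f t) x) ` F" "\<And>t. t \<in> F \<Longrightarrow> rl (f t) x \<le> c"
    and min: "\<And>u. norm (u - x) \<le> R0 \<Longrightarrow> (\<And>t. t \<in> F \<Longrightarrow> u \<in> dom_of (f t)) \<Longrightarrow>
      \<exists>t\<in>F. c \<le> rl (f t) u + (G u - G x)"
    and qualification: "\<And>w. (\<And>t. t \<in> F \<Longrightarrow> w t \<in> singular_subdiff (f t) x) \<Longrightarrow> (\<Sum>t\<in>F. w t) = 0 \<Longrightarrow>
      \<forall>t\<in>F. w t = 0"
    and snec: "\<And>t t'. t \<in> F \<Longrightarrow> t' \<in> F \<Longrightarrow> \<not> snec_at (f t) x \<Longrightarrow> \<not> snec_at (f t') x \<Longrightarrow> t = t'"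
  obtains l w where "l \<in> simplex_on F" "\<And>t. t \<in> F \<Longrightarrow> l t \<noteq> 0 \<Longrightarrow> rl (f t) x = c"
    "\<And>t. t \<in> F \<Longrightarrow> w t \<in> circ_subdiff (l t) (f t) x" "\<And>h. - blinfun_apply (\<Sum>t\<in>F. w t) h \<le> q h"
proof -
  define dm where "dm t = dom_of (f t)" for t
  define g where "g t = rl (f t)" for t
  define J where "J = {t \<in> F. g t x = c}"
  have J: "J \<noteq> {}" "J \<subseteq> F" using c(1) by (auto simp: J_def g_def)
  have finJ: "finite J" using F(1) J(2) by (rule finite_subset[rotated])
  define m where "m = real (Suc (card F))"
  note m_eq = m_def
  have m: "0 < m" by (simp add: m_def)
  \<comment> \<open>The fuzzy rule with \<open>\<epsilon> = 1 / (n + 1)\<close>. The witness index,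
    which could vary with \<open>n\<close>, is removed by summing the norms.\<close>
  define Q where "Q n z \<zeta> \<mu> a \<longleftrightarrow>
     (\<forall>t\<in>F. fsub (dm t) (g t) UNIV (z t) (\<zeta> t /\<^sub>R \<mu> t) \<and> 0 < \<mu> t \<and> norm (z t - x) \<le> inverse (real (Suc n))
        \<and> \<bar>g t (z t) - g t x\<bar> \<le> inverse (real (Suc n)) \<and> norm (\<zeta> t) \<le> 3 \<and> \<mu> t \<le> 4)
     \<and> 0 \<le> a \<and> (\<forall>h. - (\<Sum>t\<in>F. blinfun_apply (\<zeta> t) h) \<le> a * q h + inverse (real (Suc n)) * norm h)
     \<and> \<bar>a - (\<Sum>t\<in>J. \<mu> t)\<bar> \<le> inverse (real (Suc n)) \<and> (\<forall>t\<in>F - J. \<mu> t \<le> inverse (real (Suc n)))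
     \<and> (1 / 2 \<le> a \<or> 1 / (32 * m) \<le> (\<Sum>t\<in>F. norm (\<zeta> t)))"
    for n :: nat and z :: "'t \<Rightarrow> 'a" and \<zeta> :: "'t \<Rightarrow> 'a \<Rightarrow>\<^sub>L real" and \<mu> :: "'t \<Rightarrow> real" and a :: real
  have "\<exists>z \<zeta> \<mu> a. Q n z \<zeta> \<mu> a" for n
  proof -
    let ?\<epsilon> = "inverse (real (Suc n))"
    have \<epsilon>: "0 < ?\<epsilon>" "?\<epsilon> \<le> 1" by (auto simp: inverse_le_1_iff)
    have \<rho>0: "0 < (?\<epsilon> / (16 * m))\<^sup>2" using \<epsilon>(1) m by simp
    obtain R \<rho> where R: "\<rho> \<le> (?\<epsilon> / (16 * m))\<^sup>2" "penalized_minimum F J dm g G q x M R \<rho>"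
    proof (rule penalized_minimum_of_local_minimum[where dm = dm and g = g and G = G and q = q and x = x
          and c = c and J = J, OF F _ _ q qM M _ R0 \<rho>0 J_def J(1)])
      show "plsc (dm t) (g t)" if "t \<in> F" for t
        unfolding dm_def g_def by (rule lsc_plsc[OF lsc[OF that] nm[OF that]])
    qed (use xdm c(2) min Gq that in \<open>auto simp: dm_def g_def\<close>)
    note R_small = R(1)
    interpret penalized_minimum F J dm g G q x M R \<rho> by (rule R(2))
    have meq: "penalized_minimum.m F = m" by (simp only: m_def m_eq)
    show ?thesis
    proof (rule fuzzy_multiplier_rule[OF asp \<epsilon>])
      show "\<rho> \<le> (?\<epsilon> / (16 * penalized_minimum.m F))\<^sup>2" using R_small by (simp add: meq)
      fix z \<mu> \<zeta> a s
      assume "\<And>t. t \<in> F \<Longrightarrow> fsub (dm t) (g t) UNIV (z t) (\<zeta> t /\<^sub>R \<mu> t)"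
        "\<And>t. t \<in> F \<Longrightarrow> 0 < \<mu> t" "\<And>t. t \<in> F \<Longrightarrow> norm (z t - x) \<le> ?\<epsilon>"
        "\<And>t. t \<in> F \<Longrightarrow> \<bar>g t (z t) - g t x\<bar> \<le> ?\<epsilon>" "\<And>t. t \<in> F \<Longrightarrow> norm (\<zeta> t) \<le> 3"
        "0 \<le> a" "\<And>h. - (\<Sum>t\<in>F. blinfun_apply (\<zeta> t) h) \<le> a * q h + ?\<epsilon> * norm h"
        "\<bar>a - (\<Sum>t\<in>J. \<mu> t)\<bar> \<le> ?\<epsilon>" "\<And>t. t \<in> F - J \<Longrightarrow> \<mu> t \<le> ?\<epsilon>" "\<And>t. t \<in> F \<Longrightarrow> \<mu> t \<le> 4"
        and s: "s \<in> F" "1 / 2 \<le> a \<or> 1 / (32 * penalized_minimum.m F) \<le> norm (\<zeta> s)"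
      moreover have "norm (\<zeta> s) \<le> (\<Sum>t\<in>F. norm (\<zeta> t))"
        by (rule member_le_sum[OF s(1) _ F(1)]) simp
      ultimately have "Q n z \<zeta> \<mu> a" unfolding Q_def meq by auto
      then show ?thesis by blast
    qed
  qed
  then obtain z \<zeta> \<mu> a where Q: "\<And>n. Q n (z n) (\<zeta> n) (\<mu> n) (a n)" by metis
  note Qn = Q[unfolded Q_def]
  define e where "e n = inverse (real (Suc n))" for n
  have zd: "z n t \<in> dm t" if "t \<in> F" for n t using Qn[of n] that by (auto simp: fsub_def)
  have \<mu>0: "0 < \<mu> n t" and \<mu>4: "\<mu> n t \<le> 4" and \<zeta>3: "norm (\<zeta> n t) \<le> 3"
    and zx: "norm (z n t - x) \<le> e n" and gx: "\<bar>g t (z n t) - g t x\<bar> \<le> e n" if "t \<in> F" for n t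
    using Qn[of n] that by (auto simp: e_def)
  have fd: "\<zeta> n t /\<^sub>R \<mu> n t \<in> frechet_subdiff (f t) (z n t)" if "t \<in> F" for n t
    using Qn[of n] that by (simp add: frechet_subdiff_iff_fsub[OF nm[OF that]] dm_def g_def)
  have a0: "0 \<le> a n" and sumQ: "- (\<Sum>t\<in>F. blinfun_apply (\<zeta> n t) h) \<le> a n * q h + e n * norm h"
    and a\<mu>: "\<bar>a n - (\<Sum>t\<in>J. \<mu> n t)\<bar> \<le> e n"
    and big: "1 / 2 \<le> a n \<or> 1 / (32 * m) \<le> (\<Sum>t\<in>F. norm (\<zeta> n t))" for n h
    using Qn[of n] by (auto simp: e_def)
  have \<mu>I: "\<mu> n t \<le> e n" if "t \<in> F - J" for n t using Qn[of n] that by (auto simp: e_def)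
  have e: "e \<longlonglongrightarrow> 0" unfolding e_def by (rule LIMSEQ_inverse_real_of_nat)
  \<comment> \<open>Phrased for a subsequence \<open>r\<close>, the property is inherited by further
    subsequences, as \<open>common_subsequence\<close> demands.\<close>
  define P where "P t r \<longleftrightarrow> convergent (\<lambda>n. \<mu> (r n) t) \<and> (\<exists>\<eta> :: 'a \<Rightarrow>\<^sub>L real. \<forall>v. (\<lambda>n. \<zeta> (r n) t v) \<longlonglongrightarrow> \<eta> v)"
    for t and r :: "nat \<Rightarrow> nat"
  have "\<exists>r :: nat \<Rightarrow> nat. strict_mono r \<and> (\<forall>t\<in>F. P t r)"
  proof (rule common_subsequence[OF F(1)])
    fix t and r :: "nat \<Rightarrow> nat" assume t: "t \<in> F" and r: "strict_mono r"
    obtain \<eta> :: "'a \<Rightarrow>\<^sub>L real" and s1 where s1: "strict_mono s1" "\<And>v. (\<lambda>n. \<zeta> (r (s1 n)) t v) \<longlonglongrightarrow> \<eta> v"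
      by (rule weak_star_sequentially_compact[OF asp \<zeta>3[OF t], of "\<lambda>n. r n"]) (rule that)
    have "\<bar>\<mu> (r (s1 n)) t\<bar> \<le> 4" for n using \<mu>0[OF t, of "r (s1 n)"] \<mu>4[OF t, of "r (s1 n)"] by simp
    then have "bounded (range (\<lambda>n. \<mu> (r (s1 n)) t))" unfolding bounded_iff by auto
    from bounded_imp_convergent_subsequence[OF this] obtain l s2
      where s2: "strict_mono s2" "((\<lambda>n. \<mu> (r (s1 n)) t) \<circ> s2) \<longlonglongrightarrow> l" by blast
    have "(\<lambda>n. \<zeta> (r (s1 (s2 n))) t v) \<longlonglongrightarrow> \<eta> v" for v
      using LIMSEQ_subseq_LIMSEQ[OF s1(2)[of v] s2(1)] by (simp add: comp_def)
    then have "P t (r \<circ> (s1 \<circ> s2))" using s2(2) unfolding P_def convergent_def comp_def by blast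
    then show "\<exists>s :: nat \<Rightarrow> nat. strict_mono s \<and> P t (r \<circ> s)" using strict_mono_o[OF s1(1) s2(1)] by blast
  next
    fix t and r s :: "nat \<Rightarrow> nat" assume P: "P t r" and s: "strict_mono s"
    obtain l and \<eta> :: "'a \<Rightarrow>\<^sub>L real" where l: "(\<lambda>n. \<mu> (r n) t) \<longlonglongrightarrow> l" "\<And>v. (\<lambda>n. \<zeta> (r n) t v) \<longlonglongrightarrow> \<eta> v"
      using P unfolding P_def convergent_def by blast
    have "(\<lambda>n. \<mu> (r (s n)) t) \<longlonglongrightarrow> l" "\<And>v. (\<lambda>n. \<zeta> (r (s n)) t v) \<longlonglongrightarrow> \<eta> v"
      using LIMSEQ_subseq_LIMSEQ[OF l(1) s] LIMSEQ_subseq_LIMSEQ[OF l(2) s] by (simp_all add: comp_def)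
    then show "P t (r \<circ> s)" unfolding P_def convergent_def comp_def by blast
  qed
  then obtain r :: "nat \<Rightarrow> nat" where r: "strict_mono r" "\<And>t. t \<in> F \<Longrightarrow> P t r" by blast
  have "\<exists>l \<eta>. (\<lambda>n. \<mu> (r n) t) \<longlonglongrightarrow> l \<and> (\<forall>v. (\<lambda>n. \<zeta> (r n) t v) \<longlonglongrightarrow> blinfun_apply \<eta> v)" if "t \<in> F" for t
    using r(2)[OF that] unfolding P_def convergent_def by blast
  then obtain \<mu>' w where \<mu>': "\<And>t. t \<in> F \<Longrightarrow> (\<lambda>n. \<mu> (r n) t) \<longlonglongrightarrow> \<mu>' t"
    and w: "\<And>t v. t \<in> F \<Longrightarrow> (\<lambda>n. \<zeta> (r n) t v) \<longlonglongrightarrow> blinfun_apply (w t) v" by metis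
  have er: "(\<lambda>n. e (r n)) \<longlonglongrightarrow> 0" using LIMSEQ_subseq_LIMSEQ[OF e r(1)] by (simp add: comp_def)
  have null: "xs \<longlonglongrightarrow> 0" if "\<And>n. norm (xs n) \<le> e (r n)" for xs :: "nat \<Rightarrow> 'b::real_normed_vector"
    by (rule Lim_null_comparison[OF _ er]) (use that in simp)
  have conv: "g_converges (f t) (\<lambda>n. z (r n) t) x" if t: "t \<in> F" for t
  proof (rule g_converges_rl[OF nm[OF t]])
    have "(\<lambda>n. z (r n) t - x) \<longlonglongrightarrow> 0" by (rule null) (rule zx[OF t])
    then show "(\<lambda>n. z (r n) t) \<longlonglongrightarrow> x" by (simp add: LIM_zero_iff)
    have "(\<lambda>n. g t (z (r n) t) - g t x) \<longlonglongrightarrow> 0" by (rule null) (use gx[OF t] in simp)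
    then show "(\<lambda>n. rl (f t) (z (r n) t)) \<longlonglongrightarrow> rl (f t) x" by (simp add: LIM_zero_iff g_def)
  qed (use zd[OF t] xdm[OF t] in \<open>auto simp: dm_def\<close>)
  have finx: "\<bar>f t x\<bar> \<noteq> \<infinity>" if "t \<in> F" for t using ereal_rl[OF nm[OF that] xdm[OF that]] by (cases "f t x") auto
  define A where "A = (\<Sum>t\<in>J. \<mu>' t)"
  have aA: "(\<lambda>n. a (r n)) \<longlonglongrightarrow> A"
  proof -
    have "(\<lambda>n. a (r n) - (\<Sum>t\<in>J. \<mu> (r n) t)) \<longlonglongrightarrow> 0" by (rule null) (use a\<mu> in simp)
    moreover have "(\<lambda>n. \<Sum>t\<in>J. \<mu> (r n) t) \<longlonglongrightarrow> A" unfolding A_def using J(2) by (intro tendsto_sum \<mu>') auto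
    ultimately have "(\<lambda>n. (a (r n) - (\<Sum>t\<in>J. \<mu> (r n) t)) + (\<Sum>t\<in>J. \<mu> (r n) t)) \<longlonglongrightarrow> 0 + A" by (rule tendsto_add)
    then show ?thesis by simp
  qed
  have A0: "0 \<le> A" by (rule LIMSEQ_le_const[OF aA]) (use a0 in auto)
  have \<mu>'0: "0 \<le> \<mu>' t" if "t \<in> F" for t
    by (rule LIMSEQ_le_const[OF \<mu>'[OF that]]) (use \<mu>0[OF that] in \<open>auto intro: less_imp_le\<close>)
  have \<mu>'I: "\<mu>' t = 0" if t: "t \<in> F - J" for t
  proof -
    have "(\<lambda>n. \<mu> (r n) t) \<longlonglongrightarrow> 0" by (rule null) (use \<mu>I[OF t] \<mu>0[of t] t in \<open>auto simp: less_imp_le\<close>)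
    moreover have "t \<in> F" using t by blast
    ultimately show ?thesis using LIMSEQ_unique[OF \<mu>'] by blast
  qed
  have sumA: "- (\<Sum>t\<in>F. blinfun_apply (w t) h) \<le> A * q h" for h
  proof (rule LIMSEQ_le)
    show "(\<lambda>n. - (\<Sum>t\<in>F. \<zeta> (r n) t h)) \<longlonglongrightarrow> - (\<Sum>t\<in>F. w t h)" by (intro tendsto_minus tendsto_sum w)
    have "(\<lambda>n. a (r n) * q h + e (r n) * norm h) \<longlonglongrightarrow> A * q h + 0 * norm h"
      by (intro tendsto_add tendsto_mult tendsto_const aA er)
    then show "(\<lambda>n. a (r n) * q h + e (r n) * norm h) \<longlonglongrightarrow> A * q h" by simp
    show "\<exists>N. \<forall>n\<ge>N. - (\<Sum>t\<in>F. \<zeta> (r n) t h) \<le> a (r n) * q h + e (r n) * norm h" using sumQ by blast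
  qed
  \<comment> \<open>The factor \<open>b\<close> is absorbed into the vanishing multipliers; it is 1
    when \<open>A = 0\<close> and \<open>inverse A\<close> otherwise.\<close>
  have sing: "b *\<^sub>R w t \<in> singular_subdiff (f t) x" if t: "t \<in> F" and b: "0 < b" and 0: "\<mu>' t = 0" for t b
    unfolding singular_subdiff_def mem_Collect_eq limitin_weak_star_iff
  proof (intro conjI exI allI)
    show "g_converges (f t) (\<lambda>n. z (r n) t) x" by (rule conv[OF t])
    show "\<zeta> (r n) t /\<^sub>R \<mu> (r n) t \<in> frechet_subdiff (f t) (z (r n) t)" for n by (rule fd[OF t])
    show "0 < b * \<mu> (r n) t" for n using b \<mu>0[OF t] by simp
    have "(\<lambda>n. b * \<mu> (r n) t) \<longlonglongrightarrow> b * \<mu>' t" by (intro tendsto_mult tendsto_const \<mu>' t)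
    then show "(\<lambda>n. b * \<mu> (r n) t) \<longlonglongrightarrow> 0" using 0 by simp
    show "(\<lambda>n. blinfun_apply ((b * \<mu> (r n) t) *\<^sub>R (\<zeta> (r n) t /\<^sub>R \<mu> (r n) t)) v) \<longlonglongrightarrow> blinfun_apply (b *\<^sub>R w t) v" for v
    proof -
      have "(\<lambda>n. b * \<zeta> (r n) t v) \<longlonglongrightarrow> b * w t v" by (intro tendsto_mult tendsto_const w t)
      moreover have "blinfun_apply ((b * \<mu> (r n) t) *\<^sub>R (\<zeta> (r n) t /\<^sub>R \<mu> (r n) t)) v = b * \<zeta> (r n) t v" for n
        using \<mu>0[OF t, of "r n"] by (simp add: blinfun.scaleR_left)
      ultimately show ?thesis by (simp only: blinfun.scaleR_left real_scaleR_def)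
    qed
  qed (rule finx[OF t])
  show thesis
  proof (cases "A = 0")
    case False
    then have Apos: "0 < A" using A0 by simp
    show thesis
    proof (rule that[of "\<lambda>t. \<mu>' t / A" "\<lambda>t. inverse A *\<^sub>R w t"])
      have "(\<Sum>t\<in>F. \<mu>' t) = A" unfolding A_def
        by (rule sum.mono_neutral_right[OF F(1) J(2)]) (use \<mu>'I in blast)
      then have "(\<Sum>t\<in>F. \<mu>' t / A) = 1" using False by (simp add: sum_divide_distrib[symmetric])
      then show "(\<lambda>t. \<mu>' t / A) \<in> simplex_on F" using \<mu>'0 Apos by (simp add: simplex_on_def)
      show "rl (f t) x = c" if "t \<in> F" "\<mu>' t / A \<noteq> 0" for t
      proof -
        have "t \<in> J" using that \<mu>'I[of t] by auto
        then show ?thesis by (simp add: J_def g_def)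
      qed
      show "inverse A *\<^sub>R w t \<in> circ_subdiff (\<mu>' t / A) (f t) x" if t: "t \<in> F" for t
      proof (cases "\<mu>' t = 0")
        case True
        then show ?thesis using sing[OF t _ True, of "inverse A"] Apos by (simp add: circ_subdiff_def)
      next
        case False
        then have pos: "0 < \<mu>' t" using \<mu>'0[OF t] by simp
        have "w t /\<^sub>R \<mu>' t \<in> limiting_subdiff (f t) x"
          unfolding limiting_subdiff_def mem_Collect_eq limitin_weak_star_iff
        proof (intro conjI exI allI)
          show "g_converges (f t) (\<lambda>n. z (r n) t) x" by (rule conv[OF t])
          show "\<zeta> (r n) t /\<^sub>R \<mu> (r n) t \<in> frechet_subdiff (f t) (z (r n) t)" for n by (rule fd[OF t])
          show "(\<lambda>n. blinfun_apply (\<zeta> (r n) t /\<^sub>R \<mu> (r n) t) v) \<longlonglongrightarrow> blinfun_apply (w t /\<^sub>R \<mu>' t) v" for v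
            unfolding blinfun.scaleR_left real_scaleR_def
            by (intro tendsto_mult tendsto_inverse \<mu>' w t False)
        qed (rule finx[OF t])
        moreover have "inverse A *\<^sub>R w t = (\<mu>' t / A) *\<^sub>R (w t /\<^sub>R \<mu>' t)" using False by (simp add: divide_inverse)
        moreover have "0 < \<mu>' t / A" using pos Apos by simp
        ultimately show ?thesis unfolding circ_subdiff_def by (simp only: if_True) (rule imageI)
      qed
      show "- blinfun_apply (\<Sum>t\<in>F. inverse A *\<^sub>R w t) h \<le> q h" for h
      proof -
        have "inverse A * (- (\<Sum>t\<in>F. w t h)) \<le> inverse A * (A * q h)"
          using sumA[of h] Apos by (intro mult_left_mono) auto
        moreover have "inverse A * (A * q h) = q h" using False by simp
        ultimately show ?thesis
          by (simp add: blinfun.sum_left blinfun.scaleR_left sum_distrib_left)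
      qed
    qed
  next
    case True
    have \<mu>'Z: "\<mu>' t = 0" if t: "t \<in> F" for t
    proof (cases "t \<in> J")
      case tJ: True
      then show ?thesis using True \<mu>'0 J(2) sum_nonneg_eq_0_iff[OF finJ, of \<mu>'] unfolding A_def by blast
    qed (use \<mu>'I t in blast)
    have "(\<Sum>t\<in>F. w t) = 0"
    proof (rule blinfun_eqI)
      fix h
      have "- (\<Sum>t\<in>F. w t h) \<le> 0" "- (\<Sum>t\<in>F. w t (- h)) \<le> 0" using sumA[of h] sumA[of "- h"] True by auto
      then show "blinfun_apply (\<Sum>t\<in>F. w t) h = blinfun_apply 0 h"
        by (simp add: blinfun.sum_left blinfun.minus_right sum_negf)
    qed
    then have w0: "w t = 0" if "t \<in> F" for t
      using qualification[of w] sing[OF _ _ \<mu>'Z, of _ 1] that by simp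
    have small: "(\<lambda>n. norm (\<zeta> (r n) t)) \<longlonglongrightarrow> 0" if t: "t \<in> F" "snec_at (f t) x" for t
    proof -
      have "(\<lambda>n. norm (\<mu> (r n) t *\<^sub>R (\<zeta> (r n) t /\<^sub>R \<mu> (r n) t))) \<longlonglongrightarrow> 0"
      proof (rule t(2)[unfolded snec_at_def, rule_format], intro conjI allI)
        show "0 \<le> \<mu> (r n) t" for n using \<mu>0[OF t(1), of "r n"] by simp
        show "(\<lambda>n. \<mu> (r n) t) \<longlonglongrightarrow> 0" using \<mu>'[OF t(1)] \<mu>'Z[OF t(1)] by simp
        show "g_converges (f t) (\<lambda>n. z (r n) t) x" by (rule conv[OF t(1)])
        show "\<zeta> (r n) t /\<^sub>R \<mu> (r n) t \<in> frechet_subdiff (f t) (z (r n) t)" for n by (rule fd[OF t(1)])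
        have "\<mu> (r n) t *\<^sub>R (\<zeta> (r n) t /\<^sub>R \<mu> (r n) t) = \<zeta> (r n) t" for n using \<mu>0[OF t(1), of "r n"] by simp
        then show "limitin weak_star (\<lambda>n. \<mu> (r n) t *\<^sub>R (\<zeta> (r n) t /\<^sub>R \<mu> (r n) t)) 0 sequentially"
          unfolding limitin_weak_star_iff using w[OF t(1)] w0[OF t(1)] by (auto simp only: blinfun.zero_left)
      qed
      moreover have "\<mu> (r n) t *\<^sub>R (\<zeta> (r n) t /\<^sub>R \<mu> (r n) t) = \<zeta> (r n) t" for n using \<mu>0[OF t(1), of "r n"] by simp
      ultimately show ?thesis by (simp only:)
    qed
    \<comment> \<open>As \<open>a\<close> tends to 0 along the subsequence, the sum inequality
      bounds the sum in norm; weak* convergence alone would not.\<close>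
    have total: "(\<lambda>n. norm (\<Sum>t\<in>F. \<zeta> (r n) t)) \<longlonglongrightarrow> 0"
    proof (rule tendsto_sandwich[OF _ _ tendsto_const])
      have "norm (- (\<Sum>t\<in>F. \<zeta> (r n) t)) \<le> a (r n) * M + e (r n)" for n
      proof (rule blinfun_norm_le)
        show "0 \<le> a (r n) * M + e (r n)" using a0 M by (simp add: e_def)
        fix h
        have "a (r n) * q h \<le> a (r n) * (M * norm h)" using a0 qM[of h] by (intro mult_left_mono) auto
        then show "blinfun_apply (- (\<Sum>t\<in>F. \<zeta> (r n) t)) h \<le> (a (r n) * M + e (r n)) * norm h"
          using sumQ[of "r n" h] by (simp add: blinfun.minus_left blinfun.sum_left algebra_simps)
      qed
      then show "\<forall>\<^sub>F n in sequentially. norm (\<Sum>t\<in>F. \<zeta> (r n) t) \<le> a (r n) * M + e (r n)" by simp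
      have "(\<lambda>n. a (r n) * M + e (r n)) \<longlonglongrightarrow> A * M + 0" by (intro tendsto_add tendsto_mult tendsto_const aA er)
      then show "(\<lambda>n. a (r n) * M + e (r n)) \<longlonglongrightarrow> 0" using True by simp
    qed simp
    have all: "(\<lambda>n. norm (\<zeta> (r n) t)) \<longlonglongrightarrow> 0" if t: "t \<in> F" for t
    proof (cases "snec_at (f t) x")
      case False
      have others: "(\<lambda>n. norm (\<zeta> (r n) s)) \<longlonglongrightarrow> 0" if "s \<in> F - {t}" for s
        using small[of s] snec[of s t] t that False by blast
      have le: "norm (\<zeta> (r n) t) \<le> norm (\<Sum>t\<in>F. \<zeta> (r n) t) + (\<Sum>s\<in>F - {t}. norm (\<zeta> (r n) s))" for n
      proof -
        have "\<zeta> (r n) t = (\<Sum>t\<in>F. \<zeta> (r n) t) - (\<Sum>s\<in>F - {t}. \<zeta> (r n) s)"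
          using sum.remove[OF F(1) t, of "\<zeta> (r n)"] by simp
        then have "norm (\<zeta> (r n) t) \<le> norm (\<Sum>t\<in>F. \<zeta> (r n) t) + norm (\<Sum>s\<in>F - {t}. \<zeta> (r n) s)"
          using norm_triangle_ineq4 by simp
        also have "norm (\<Sum>s\<in>F - {t}. \<zeta> (r n) s) \<le> (\<Sum>s\<in>F - {t}. norm (\<zeta> (r n) s))" by (rule norm_sum)
        finally show ?thesis by simp
      qed
      have "(\<lambda>n. norm (\<Sum>t\<in>F. \<zeta> (r n) t) + (\<Sum>s\<in>F - {t}. norm (\<zeta> (r n) s))) \<longlonglongrightarrow> 0 + (\<Sum>s\<in>F - {t}. 0)"
        by (intro tendsto_add total tendsto_sum others)
      then have lim: "(\<lambda>n. norm (\<Sum>t\<in>F. \<zeta> (r n) t) + (\<Sum>s\<in>F - {t}. norm (\<zeta> (r n) s))) \<longlonglongrightarrow> 0" by simp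
      show ?thesis by (rule tendsto_sandwich[OF _ _ tendsto_const lim]) (use le in auto)
    qed (rule small[OF t])
    have "(\<lambda>n. \<Sum>t\<in>F. norm (\<zeta> (r n) t)) \<longlonglongrightarrow> (\<Sum>t\<in>F. 0)" by (intro tendsto_sum all)
    then have "eventually (\<lambda>n. (\<Sum>t\<in>F. norm (\<zeta> (r n) t)) < 1 / (32 * m)) sequentially"
      using m by (intro order_tendstoD(2)) auto
    moreover have "eventually (\<lambda>n. a (r n) < 1 / 2) sequentially"
      using aA True by (intro order_tendstoD(2)[OF aA]) simp
    ultimately have "eventually (\<lambda>n. (\<Sum>t\<in>F. norm (\<zeta> (r n) t)) < 1 / (32 * m) \<and> a (r n) < 1 / 2) sequentially"
      by (rule eventually_conj)
    then obtain n where "(\<Sum>t\<in>F. norm (\<zeta> (r n) t)) < 1 / (32 * m)" "a (r n) < 1 / 2"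
      by (auto simp: eventually_sequentially)
    then show thesis using big[of "r n"] by linarith
  qed
qed

section \<open>Reduction of the supremum to finite maxima\<close>

text \<open>A modified multiple of the norm that grows only with slope \<open>d\<close> in the directions of \<open>K\<close>.\<close>

definition penalty :: "'a::real_normed_vector set \<Rightarrow> real \<Rightarrow> real \<Rightarrow> 'a \<Rightarrow> real" where
  "penalty K M d h = (INF (\<tau>, k)\<in>{0..} \<times> K. M * norm (h - \<tau> *\<^sub>R k) + d * \<tau>)"

context
  fixes K :: "'a::real_normed_vector set" and M d :: real
  assumes K: "K \<noteq> {}" and M: "0 \<le> M" and d: "0 \<le> d"
begin

lemma penalty_bdd: "bdd_below ((\<lambda>(\<tau>, k). M * norm (h - \<tau> *\<^sub>R k) + d * \<tau>) ` ({0..} \<times> K))"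
  by (rule bdd_belowI[of _ 0]) (use M d in auto)

lemma penalty_le: "0 \<le> \<tau> \<Longrightarrow> k \<in> K \<Longrightarrow> penalty K M d h \<le> M * norm (h - \<tau> *\<^sub>R k) + d * \<tau>"
  unfolding penalty_def by (rule cINF_lower2[OF penalty_bdd, of "(\<tau>, k)"]) auto

lemma penalty_nonneg: "0 \<le> penalty K M d h"
  unfolding penalty_def by (rule cINF_greatest) (use K M d in auto)

lemma penalty_le_norm: "penalty K M d h \<le> M * norm h"
  using penalty_le[of 0 _ h] K by auto

lemma penalty_le_member: "k \<in> K \<Longrightarrow> penalty K M d k \<le> d"
  using penalty_le[of 1 k k] by simp

lemma penalty_approx:
  assumes "penalty K M d h < c"
  obtains \<tau> k where "0 \<le> \<tau>" "k \<in> K" "M * norm (h - \<tau> *\<^sub>R k) + d * \<tau> < c"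
  using assms cINF_less_iff[OF _ penalty_bdd, of h c] K unfolding penalty_def by auto

text \<open>Convexity of \<open>K\<close> merges two admissible multiples:
  \<open>s *\<^sub>R k + t *\<^sub>R l\<close> is again \<open>s + t\<close> times a point of
  \<open>K\<close>.\<close>

lemma sublinear_penalty:
  assumes cvx: "convex K"
  shows "sublinear (penalty K M d)"
proof (rule sublinearI)
  fix x y
  show "penalty K M d (x + y) \<le> penalty K M d x + penalty K M d y"
  proof (rule field_le_epsilon)
    fix e :: real assume e: "0 < e"
    obtain s k where s: "0 \<le> s" "k \<in> K" "M * norm (x - s *\<^sub>R k) + d * s < penalty K M d x + e / 2"
      by (rule penalty_approx[of x "penalty K M d x + e / 2"]) (use e in auto)
    obtain t l where t: "0 \<le> t" "l \<in> K" "M * norm (y - t *\<^sub>R l) + d * t < penalty K M d y + e / 2"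
      by (rule penalty_approx[of y "penalty K M d y + e / 2"]) (use e in auto)
    obtain j where j: "j \<in> K" "(s + t) *\<^sub>R j = s *\<^sub>R k + t *\<^sub>R l"
    proof (cases "s + t = 0")
      case True
      then have "s = 0" "t = 0" using s(1) t(1) by auto
      then show thesis using that[OF s(2)] by simp
    next
      case False
      have "(s / (s + t)) *\<^sub>R k + (t / (s + t)) *\<^sub>R l \<in> K"
        by (rule convexD[OF cvx s(2) t(2)]) (use False s(1) t(1) in \<open>auto simp: add_divide_distrib[symmetric]\<close>)
      then show thesis by (rule that) (use False in \<open>simp add: scaleR_add_right\<close>)
    qed
    have eq: "x + y - (s + t) *\<^sub>R j = (x - s *\<^sub>R k) + (y - t *\<^sub>R l)" unfolding j(2) by simp
    have "M * norm (x + y - (s + t) *\<^sub>R j) \<le> M * (norm (x - s *\<^sub>R k) + norm (y - t *\<^sub>R l))"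
      unfolding eq by (rule mult_left_mono[OF norm_triangle_ineq M])
    moreover have "penalty K M d (x + y) \<le> M * norm (x + y - (s + t) *\<^sub>R j) + d * (s + t)"
      using s(1) t(1) j(1) by (intro penalty_le) auto
    ultimately show "penalty K M d (x + y) \<le> penalty K M d x + penalty K M d y + e"
      using s(3) t(3) by (simp add: distrib_left)
  qed
next
  fix c :: real and x assume c: "0 < c"
  show "penalty K M d (c *\<^sub>R x) \<le> c * penalty K M d x"
  proof (rule field_le_epsilon)
    fix e :: real assume e: "0 < e"
    obtain s k where s: "0 \<le> s" "k \<in> K" "M * norm (x - s *\<^sub>R k) + d * s < penalty K M d x + e / c"
      by (rule penalty_approx[of x "penalty K M d x + e / c"]) (use e c in auto)
    have "norm (c *\<^sub>R x - (c * s) *\<^sub>R k) = c * norm (x - s *\<^sub>R k)"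
      using c by (simp flip: scaleR_scaleR scaleR_diff_right)
    then have "penalty K M d (c *\<^sub>R x) \<le> c * (M * norm (x - s *\<^sub>R k) + d * s)"
      using penalty_le[of "c * s" k "c *\<^sub>R x"] s(1,2) c by (simp add: algebra_simps)
    also have "\<dots> \<le> c * (penalty K M d x + e / c)" using c s(3) by (intro mult_left_mono) auto
    finally show "penalty K M d (c *\<^sub>R x) \<le> c * penalty K M d x + e" using c by (simp add: distrib_left)
  qed
next
  show "penalty K M d 0 = 0" using penalty_nonneg[of 0] penalty_le_norm[of 0] by simp
qed

end

section \<open>Finite subfamilies by compactness\<close>

lemma lsc_eventually_real:
  fixes h :: "'a::t2_space \<Rightarrow> ereal" and \<phi> :: "'b::t2_space \<Rightarrow> real"
  assumes h: "lsc h" and lt: "ereal (\<phi> p) < h (s p)" and \<phi>: "isCont \<phi> p" and s: "isCont s p"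
  shows "eventually (\<lambda>q. ereal (\<phi> q) < h (s q)) (nhds p)"
proof -
  from ereal_dense2[OF lt] obtain c where c: "ereal (\<phi> p) < ereal c" "ereal c < h (s p)" by blast
  have "filterlim s (nhds (s p)) (nhds p)" using s by (simp add: continuous_at tendsto_nhds_iff)
  then have "eventually (\<lambda>q. ereal c < h (s q)) (nhds p)"
    by (rule eventually_compose_filterlim[OF lsc_eventually[OF h c(2)]])
  moreover have "filterlim \<phi> (nhds (\<phi> p)) (nhds p)" using \<phi> by (simp add: continuous_at tendsto_nhds_iff)
  then have "eventually (\<lambda>q. \<phi> q < c) (nhds p)" using c(1) by (intro order_tendstoD(2)) auto
  ultimately show ?thesis
    by eventually_elim (meson less_trans less_ereal.simps(1))
qed

text \<open>The multiple \<tau> is kept as a coordinate, since the cost \<open>d * \<tau>\<close>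
  depends on it and not only on the point reached. On the compact set \<open>D\<close> the supremum
  exceeds the tilted bound; lower semicontinuity turns this into an open cover, and a finite
  subfamily works on a \<rho>-neighbourhood. Elsewhere the penalty is so large that the single
  function \<open>t0\<close> suffices. The radius \<open>r\<close> is found before \<eta> and the
  family, so \<eta> may be chosen relative to \<open>r\<close>.\<close>

lemma sup_family_finite_minorant:
  fixes f :: "'t \<Rightarrow> 'a::real_normed_vector \<Rightarrow> ereal"
  assumes lsc: "\<And>t. t \<in> T \<Longrightarrow> lsc (f t)" and v: "sup_family T f x = ereal v"
    and fs: "\<And>\<epsilon>. 0 < \<epsilon> \<Longrightarrow> \<exists>\<delta>>0. \<forall>h. norm h < \<delta> \<longrightarrow> ereal (v + blinfun_apply \<xi> h - \<epsilon> * norm h) \<le> sup_family T f (x + h)"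
    and K: "compact K" "K \<noteq> {}" and d: "0 < d" and e: "0 < e"
  obtains r where "0 < r" "r \<le> e"
    "\<And>\<eta>. 0 < \<eta> \<Longrightarrow> \<exists>F M. finite F \<and> F \<noteq> {} \<and> F \<subseteq> T \<and> 0 \<le> M \<and> (\<forall>y. norm (y - x) \<le> r \<longrightarrow>
        (\<exists>t\<in>F. ereal (v + \<xi> (y - x) - penalty K M d (y - x) - \<eta>) < f t y) \<and> (\<exists>t\<in>F. ereal (v - e) < f t y))"
proof -
  have lt: "ereal a < X" if "a \<le> b" "ereal b < X" for a b :: real and X
    by (rule le_less_trans[OF _ that(2)]) (use that(1) in simp)
  obtain \<kappa> where \<kappa>: "0 < \<kappa>" "\<And>k. k \<in> K \<Longrightarrow> norm k \<le> \<kappa>"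
    using compact_imp_bounded[OF K(1)] by (auto simp: bounded_pos)
  obtain \<rho>0 where \<rho>0: "0 < \<rho>0"
    "\<And>h. norm h < \<rho>0 \<Longrightarrow> ereal (v + \<xi> h - d / \<kappa> * norm h) \<le> sup_family T f (x + h)"
    using fs[of "d / \<kappa>"] d \<kappa>(1) by auto
  define \<tau>m where "\<tau>m = min (\<rho>0 / (2 * \<kappa>)) (e / d)"
  have \<tau>m: "0 < \<tau>m" "\<tau>m \<le> \<rho>0 / (2 * \<kappa>)" "\<tau>m \<le> e / d" using \<rho>0(1) \<kappa>(1) e d by (auto simp: \<tau>m_def)
  have d\<tau>: "0 < d * \<tau>m" "d * \<tau>m \<le> e" using d \<tau>m by (auto simp: pos_le_divide_eq mult.commute)
  have supl: "ereal (v + \<xi> (\<tau> *\<^sub>R k) - d * \<tau>) \<le> sup_family T f (x + \<tau> *\<^sub>R k)"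
    if \<tau>: "0 \<le> \<tau>" "\<tau> \<le> \<tau>m" and k: "k \<in> K" for \<tau> k
  proof -
    have le: "norm (\<tau> *\<^sub>R k) \<le> \<tau> * \<kappa>" using \<tau>(1) \<kappa>(2)[OF k] by (simp add: mult_left_mono)
    have "\<tau> * \<kappa> \<le> \<rho>0 / (2 * \<kappa>) * \<kappa>" using \<tau>(2) \<tau>m(2) \<kappa>(1) by (intro mult_right_mono) auto
    also have "\<dots> = \<rho>0 / 2" using \<kappa>(1) by simp
    finally have "norm (\<tau> *\<^sub>R k) < \<rho>0" using le \<rho>0(1) by linarith
    from \<rho>0(2)[OF this] have 1: "ereal (v + \<xi> (\<tau> *\<^sub>R k) - d / \<kappa> * norm (\<tau> *\<^sub>R k)) \<le> sup_family T f (x + \<tau> *\<^sub>R k)" .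
    have "d / \<kappa> * norm (\<tau> *\<^sub>R k) \<le> d / \<kappa> * (\<tau> * \<kappa>)" using le d \<kappa>(1) by (intro mult_left_mono) auto
    also have "\<dots> = d * \<tau>" using \<kappa>(1) by simp
    finally show ?thesis by (intro order_trans[OF _ 1]) simp
  qed
  have "ereal (v - d * \<tau>m / 2) < sup_family T f x" using d\<tau>(1) by (simp add: v)
  then obtain t0 where t0: "t0 \<in> T" "ereal (v - d * \<tau>m / 2) < f t0 x"
    by (auto simp: sup_family_def less_SUP_iff)
  obtain r1 where r1: "0 < r1" "\<And>y. dist y x < r1 \<Longrightarrow> ereal (v - d * \<tau>m / 2) < f t0 y"
    using lsc_eventually[OF lsc[OF t0(1)] t0(2)] by (auto simp: eventually_nhds_metric)
  \<comment> \<open>Within radius \<open>r\<close> the tilt by \<xi> gains at most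
    \<open>d * \<tau>m / 2\<close>, half of what the penalty costs off the neighbourhood; the other
    half is the margin of \<open>t0\<close>.\<close>
  define r where "r = min (min (r1 / 2) e) (d * \<tau>m / 2 / (norm \<xi> + 1))"
  have r: "0 < r" "r \<le> r1 / 2" "r \<le> e" "r \<le> d * \<tau>m / 2 / (norm \<xi> + 1)"
  proof -
    have "0 < d * \<tau>m / 2 / (norm \<xi> + 1)" using d\<tau>(1) by (intro divide_pos_pos add_nonneg_pos) auto
    then show "0 < r" using r1(1) e by (simp add: r_def)
  qed (simp_all only: r_def min.coboundedI1 min.cobounded1 min.cobounded2 min.coboundedI2)
  have \<xi>r: "norm \<xi> * r \<le> d * \<tau>m / 2"
  proof -
    have "0 < norm \<xi> + 1" by (simp add: add_nonneg_pos)
    then have "r * (norm \<xi> + 1) \<le> d * \<tau>m / 2" using r(4) by (simp only: pos_le_divide_eq)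
    then show ?thesis using r(1) by (simp add: algebra_simps)
  qed
  have near: "ereal (v - d * \<tau>m / 2) < f t0 y" if "norm (y - x) \<le> r" for y
    using r1(2)[of y] that r(1,2) by (simp add: dist_norm)
  have \<xi>le: "\<xi> (y - x) \<le> d * \<tau>m / 2" if "norm (y - x) \<le> r" for y
  proof -
    have "\<xi> (y - x) \<le> norm \<xi> * norm (y - x)" by (rule blinfun_le_norm)
    also have "\<dots> \<le> norm \<xi> * r" using that by (simp add: mult_left_mono)
    finally show ?thesis using \<xi>r by simp
  qed
  show thesis
  proof (rule that[OF r(1,3)])
    fix \<eta> :: real assume \<eta>: "0 < \<eta>"
    define \<phi> where "\<phi> p = v + \<xi> (snd p - x) - d * fst p - \<eta> / 2" for p :: "real \<times> 'a"
    define O\<^sub>t where "O\<^sub>t t = {p. ereal (\<phi> p) < f t (snd p)}" for t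
    define D where "D = (\<lambda>q. (fst q, x + fst q *\<^sub>R snd q)) ` ({0..\<tau>m} \<times> K)"
    have opn: "open (O\<^sub>t t)" if "t \<in> T" for t
    proof (subst open_subopen, intro ballI)
      fix p assume "p \<in> O\<^sub>t t"
      moreover have "isCont \<phi> p" unfolding \<phi>_def[abs_def] by (intro continuous_intros)
      ultimately have "eventually (\<lambda>q. ereal (\<phi> q) < f t (snd q)) (nhds p)"
        by (intro lsc_eventually_real[OF lsc[OF that]]) (auto simp: O\<^sub>t_def intro: continuous_intros)
      then show "\<exists>S. open S \<and> p \<in> S \<and> S \<subseteq> O\<^sub>t t" by (auto simp: eventually_nhds O\<^sub>t_def)
    qed
    have D: "compact D" unfolding D_def
      by (intro compact_continuous_image compact_Times compact_Icc K(1) continuous_intros)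
    have cover: "D \<subseteq> (\<Union>t\<in>T. O\<^sub>t t)"
    proof
      fix p assume "p \<in> D"
      then obtain q where "q \<in> {0..\<tau>m} \<times> K" "p = (fst q, x + fst q *\<^sub>R snd q)" unfolding D_def by blast
      then obtain \<tau> k where p: "p = (\<tau>, x + \<tau> *\<^sub>R k)" "0 \<le> \<tau>" "\<tau> \<le> \<tau>m" "k \<in> K"
        using that[of "fst q" "snd q"] by auto
      have "ereal (\<phi> p) < ereal (v + \<xi> (\<tau> *\<^sub>R k) - d * \<tau>)" using \<eta> by (simp add: \<phi>_def p(1))
      also have "\<dots> \<le> (SUP t\<in>T. f t (x + \<tau> *\<^sub>R k))" using supl[OF p(2-4)] by (simp add: sup_family_def)
      finally show "p \<in> (\<Union>t\<in>T. O\<^sub>t t)" by (auto simp: less_SUP_iff O\<^sub>t_def p(1))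
    qed
    obtain F' where F': "F' \<subseteq> T" "finite F'" "D \<subseteq> (\<Union>t\<in>F'. O\<^sub>t t)"
      by (rule compactE_image[OF D opn cover])
    have "open (\<Union>t\<in>F'. O\<^sub>t t)" using opn F'(1) by blast
    then obtain \<rho> where \<rho>: "0 < \<rho>" "(\<Union>p\<in>D. ball p \<rho>) \<subseteq> (\<Union>t\<in>F'. O\<^sub>t t)"
      using compact_subset_open_imp_ball_epsilon_subset[OF D _ F'(3)] by blast
    \<comment> \<open>Steep enough that leaving the \<rho>-neighbourhood costs at least
      \<open>d * \<tau>m\<close>.\<close>
    define M where "M = d * \<tau>m / \<rho>"
    have M: "0 \<le> M" using d\<tau>(1) \<rho>(1) by (simp add: M_def)
    have main: "\<exists>t\<in>insert t0 F'. ereal (v + \<xi> (y - x) - penalty K M d (y - x) - \<eta>) < f t y" if y: "norm (y - x) \<le> r" for y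
    proof -
      let ?P = "penalty K M d (y - x)"
      obtain \<tau> k where \<tau>: "0 \<le> \<tau>" "k \<in> K" "M * norm (y - x - \<tau> *\<^sub>R k) + d * \<tau> < ?P + \<eta> / 2"
        by (rule penalty_approx[of K M d "y - x" "?P + \<eta> / 2"]) (use K(2) M d \<eta> in auto)
      show ?thesis
      proof (cases "\<tau> \<le> \<tau>m \<and> norm (y - x - \<tau> *\<^sub>R k) < \<rho>")
        case True
        have "(\<tau>, x + \<tau> *\<^sub>R k) \<in> D" unfolding D_def using True \<tau>(1,2) by (intro image_eqI[of _ _ "(\<tau>, k)"]) auto
        moreover have "(\<tau>, y) \<in> ball (\<tau>, x + \<tau> *\<^sub>R k) \<rho>"
          using True by (simp add: dist_Pair_Pair dist_norm norm_minus_commute algebra_simps)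
        ultimately have "(\<tau>, y) \<in> (\<Union>t\<in>F'. O\<^sub>t t)" using \<rho>(2) by blast
        then obtain t where t: "t \<in> F'" "ereal (\<phi> (\<tau>, y)) < f t y" by (auto simp: O\<^sub>t_def)
        have "0 \<le> M * norm (y - x - \<tau> *\<^sub>R k)" using M by simp
        then have "v + \<xi> (y - x) - ?P - \<eta> \<le> \<phi> (\<tau>, y)" using \<tau>(3) by (simp add: \<phi>_def)
        then show ?thesis using lt[OF _ t(2)] t(1) by blast
      next
        case False
        have "d * \<tau>m \<le> M * norm (y - x - \<tau> *\<^sub>R k) + d * \<tau>"
        proof (cases "\<tau> \<le> \<tau>m")
          case True
          then have "M * \<rho> \<le> M * norm (y - x - \<tau> *\<^sub>R k)" using False M by (intro mult_left_mono) auto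
          moreover have "M * \<rho> = d * \<tau>m" using \<rho>(1) by (simp add: M_def)
          moreover have "0 \<le> d * \<tau>" using d \<tau>(1) by simp
          ultimately show ?thesis by linarith
        next
          case False
          then have "d * \<tau>m \<le> d * \<tau>" using d by (intro mult_left_mono) auto
          moreover have "0 \<le> M * norm (y - x - \<tau> *\<^sub>R k)" using M by simp
          ultimately show ?thesis by linarith
        qed
        then have "v + \<xi> (y - x) - ?P - \<eta> \<le> v - d * \<tau>m / 2" using \<tau>(3) \<xi>le[OF y] \<eta> by linarith
        then show ?thesis using lt[OF _ near[OF y]] by blast
      qed
    qed
    have "ereal (v - e) < f t0 y" if "norm (y - x) \<le> r" for y
    proof -
      have "v - e \<le> v - d * \<tau>m / 2" using d\<tau> by linarith
      then show ?thesis by (rule lt[OF _ near[OF that]])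
    qed
    then show "\<exists>F M. finite F \<and> F \<noteq> {} \<and> F \<subseteq> T \<and> 0 \<le> M \<and> (\<forall>y. norm (y - x) \<le> r \<longrightarrow>
        (\<exists>t\<in>F. ereal (v + \<xi> (y - x) - penalty K M d (y - x) - \<eta>) < f t y) \<and> (\<exists>t\<in>F. ereal (v - e) < f t y))"
      using main F'(1,2) t0(1) M by (intro exI[of _ "insert t0 F'"] exI[of _ M]) auto
  qed
qed

lemma penalty_lipschitz:
  assumes K: "K \<noteq> {}" "convex K" and M: "0 \<le> M" and d: "0 \<le> d"
  shows "penalty K M d x - penalty K M d y \<le> M * norm (x - y)"
  using sublinear_add[OF sublinear_penalty[OF K(1) M d K(2)], of y "x - y"]
    penalty_le_norm[OF K(1) M d, of "x - y"] by simp

text \<open>The tested directions and their negatives lie in \<open>K\<close>, where the penalty is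
  at most \<open>d\<close>, so the sum of subgradients is compared with \<xi> from both sides. In
  other directions the slope \<open>M\<close> may be huge, which a weak* neighbourhood does not
  see.\<close>

theorem supremum_fuzzy_rule:
  fixes f :: "'t \<Rightarrow> 'a::banach \<Rightarrow> ereal"
  assumes asp: "asplund_space TYPE('a)" and T: "T \<noteq> {}"
    and nm: "\<And>t x. t \<in> T \<Longrightarrow> f t x \<noteq> - \<infinity>" and lsc: "\<And>t. t \<in> T \<Longrightarrow> lsc (f t)"
    and U: "open U" "x \<in> U"
    and snec: "\<And>x. x \<in> U \<Longrightarrow> \<exists>\<^sub>\<le>\<^sub>1t. t \<in> T \<and> \<bar>f t x\<bar> \<noteq> \<infinity> \<and> \<not> snec_at (f t) x"
    and qual: "\<And>x F w. x \<in> U \<Longrightarrow> finite F \<Longrightarrow> F \<subseteq> T \<Longrightarrow> (\<And>t. t \<in> F \<Longrightarrow> w t \<in> singular_subdiff (f t) x) \<Longrightarrow>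
      (\<Sum>t\<in>F. w t) = 0 \<Longrightarrow> \<forall>t\<in>F. w t = 0"
    and \<xi>: "\<xi> \<in> frechet_subdiff (sup_family T f) x" and B: "finite B" and \<delta>: "0 < \<delta>" and e: "0 < e"
  obtains \<zeta> where "\<zeta> \<in> approx_sums T f x e" "\<And>b. b \<in> B \<Longrightarrow> \<bar>blinfun_apply \<zeta> b - \<xi> b\<bar> \<le> \<delta>"
proof -
  have supnm: "sup_family T f y \<noteq> - \<infinity>" for y
  proof -
    obtain t where "t \<in> T" using T by blast
    then have "f t y \<le> sup_family T f y" by (auto simp: sup_family_def intro: SUP_upper)
    then show ?thesis using nm[OF \<open>t \<in> T\<close>] by auto
  qed
  define v where "v = rl (sup_family T f) x"
  have fs: "fsub (dom_of (sup_family T f)) (rl (sup_family T f)) UNIV x \<xi>"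
    using \<xi> frechet_subdiff_iff_fsub[where h = "sup_family T f", OF supnm] by simp
  then have "x \<in> dom_of (sup_family T f)" by (simp add: fsub_def)
  from ereal_rl[OF supnm this] have v: "sup_family T f x = ereal v" by (simp add: v_def)
  have low: "\<exists>\<delta>>0. \<forall>h. norm h < \<delta> \<longrightarrow> ereal (v + \<xi> h - \<epsilon> * norm h) \<le> sup_family T f (x + h)" if "0 < \<epsilon>" for \<epsilon>
  proof -
    from fs that obtain \<delta> where \<delta>: "0 < \<delta>" "\<And>y. y \<in> dom_of (sup_family T f) \<Longrightarrow> norm (y - x) < \<delta> \<Longrightarrow>
        v + \<xi> (y - x) - \<epsilon> * norm (y - x) \<le> rl (sup_family T f) y"
      by (auto simp: fsub_def v_def)
    have "ereal (v + \<xi> h - \<epsilon> * norm h) \<le> sup_family T f (x + h)" if h: "norm h < \<delta>" for h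
    proof (cases "x + h \<in> dom_of (sup_family T f)")
      case True
      then show ?thesis using ereal_rl[OF supnm True] \<delta>(2)[OF True] h by simp
    qed (simp add: dom_of_def)
    then show ?thesis using \<delta>(1) by blast
  qed
  \<comment> \<open>Dominates every \<open>1 + norm b\<close>, which is, up to the factor
    \<open>d\<close>, the joint contribution of the penalty and the Ekeland term in direction
    \<open>b\<close>.\<close>
  define \<beta> where "\<beta> = 1 + (\<Sum>b\<in>B. norm b)"
  have \<beta>: "0 < \<beta>" unfolding \<beta>_def by (intro add_pos_nonneg sum_nonneg) auto
  define d where "d = \<delta> / (2 * \<beta>)"
  have d: "0 < d" using \<delta> \<beta> by (simp add: d_def)
  have dB: "d * (1 + norm b) \<le> \<delta>" if "b \<in> B" for b
  proof -
    have "norm b \<le> (\<Sum>b\<in>B. norm b)" by (rule member_le_sum[OF that _ B]) simp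
    then have "d * (1 + norm b) \<le> d * \<beta>" using d by (intro mult_left_mono) (auto simp: \<beta>_def)
    also have "\<dots> \<le> \<delta>" using \<beta> \<delta> by (simp add: d_def)
    finally show ?thesis .
  qed
  \<comment> \<open>Inserting 0 keeps the hull nonempty when \<open>B\<close> is empty.\<close>
  define K where "K = convex hull (insert 0 (B \<union> uminus ` B))"
  have K: "compact K" "K \<noteq> {}" "convex K"
    unfolding K_def using B by (auto intro: finite_imp_compact_convex_hull)
  have BK: "b \<in> K" "- b \<in> K" if "b \<in> B" for b unfolding K_def using that by (auto intro: hull_inc)
  obtain e0 where e0: "0 < e0" "cball x e0 \<subseteq> U" using U open_contains_cball_eq by blast
  \<comment> \<open>Within distance \<open>e1\<close> the tilt and the Ekeland term change by at
    most \<open>e\<close>, so the maximum stays \<open>e\<close>-close to \<open>v\<close>; the new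
    point also remains in \<open>U\<close>.\<close>
  define e1 where "e1 = min e e0 / (norm \<xi> + d + 1)"
  have nd: "1 \<le> norm \<xi> + d + 1" using d by simp
  have e1: "0 < e1" "e1 * (norm \<xi> + d + 1) \<le> e" "e1 * (norm \<xi> + d + 1) \<le> e0"
    using e e0(1) nd by (auto simp: e1_def)
  have e1': "e1 \<le> e" "e1 \<le> e0"
    using order_trans[OF mult_left_mono[OF nd less_imp_le[OF e1(1)]] e1(2)]
      order_trans[OF mult_left_mono[OF nd less_imp_le[OF e1(1)]] e1(3)] by simp_all
  obtain r where r: "0 < r" "r \<le> e1"
    "\<And>\<eta>. 0 < \<eta> \<Longrightarrow> \<exists>F M. finite F \<and> F \<noteq> {} \<and> F \<subseteq> T \<and> 0 \<le> M \<and> (\<forall>y. norm (y - x) \<le> r \<longrightarrow>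
        (\<exists>t\<in>F. ereal (v + \<xi> (y - x) - penalty K M d (y - x) - \<eta>) < f t y) \<and> (\<exists>t\<in>F. ereal (v - e1) < f t y))"
    by (rule sup_family_finite_minorant[OF lsc v low K(1,2) d e1(1)]) (assumption | rule that)+
  \<comment> \<open>Ekeland's principle with slope \<open>d\<close> moves by at most
    \<open>8 * \<eta> / d = r / 2\<close>, which leaves a ball of radius \<open>r / 2\<close> for
    local minimality.\<close>
  define \<eta> where "\<eta> = d * r / 16"
  have \<eta>: "0 < \<eta>" using d r(1) by (simp add: \<eta>_def)
  obtain F M where F: "finite F" "F \<noteq> {}" "F \<subseteq> T" and M: "0 \<le> M"
    and FM: "\<And>y. norm (y - x) \<le> r \<Longrightarrow> \<exists>t\<in>F. ereal (v + \<xi> (y - x) - penalty K M d (y - x) - \<eta>) < f t y"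
      "\<And>y. norm (y - x) \<le> r \<Longrightarrow> \<exists>t\<in>F. ereal (v - e1) < f t y"
    using r(3)[OF \<eta>] by blast
  define pen where "pen = penalty K M d"
  have pen: "sublinear pen" "\<And>h. 0 \<le> pen h" "\<And>h. pen h \<le> M * norm h" "\<And>k. k \<in> K \<Longrightarrow> pen k \<le> d"
    "\<And>x y. pen x - pen y \<le> M * norm (x - y)"
    unfolding pen_def using K(2,3) M d
    by (auto intro!: sublinear_penalty penalty_nonneg penalty_le_norm penalty_le_member penalty_lipschitz)
  define g where "g t = rl (f t)" for t
  have fg: "f t y = ereal (g t y)" if "t \<in> F" "y \<in> dom_of (f t)" for t y
    unfolding g_def using F(3) that by (intro ereal_rl nm) auto
  define fm where "fm y = Max ((\<lambda>t. g t y) ` F)" for y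
  have fm_ge: "g t y \<le> fm y" if "t \<in> F" for t y unfolding fm_def using F(1) that by (intro Max_ge) auto
  have fm_in: "\<exists>t\<in>F. fm y = g t y" for y
  proof -
    have "fm y \<in> (\<lambda>t. g t y) ` F" unfolding fm_def using F(1,2) by (intro Max_in) auto
    then show ?thesis by blast
  qed
  define G1 where "G1 y = - \<xi> (y - x) + pen (y - x)" for y
  define S where "S = {y. norm (y - x) \<le> r \<and> (\<forall>t\<in>F. y \<in> dom_of (f t))}"
  have xdom: "x \<in> dom_of (f t)" "g t x \<le> v" if t: "t \<in> F" for t
  proof -
    have "f t x \<le> sup_family T f x" using t F(3) by (auto simp: sup_family_def intro: SUP_upper)
    then have le: "f t x \<le> ereal v" by (simp add: v)
    then show "x \<in> dom_of (f t)" by (auto simp: dom_of_def)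
    from fg[OF t this] le show "g t x \<le> v" by simp
  qed
  have xS: "x \<in> S" using xdom r(1) by (simp add: S_def)
  have Sbound: "v - \<eta> \<le> fm y + G1 y" "v - e1 < fm y" if y: "y \<in> S" for y
  proof -
    obtain t where t: "t \<in> F" "ereal (v + \<xi> (y - x) - pen (y - x) - \<eta>) < f t y"
      using FM(1)[of y] y by (auto simp: S_def pen_def)
    have "y \<in> dom_of (f t)" using t(1) y by (simp add: S_def)
    then show "v - \<eta> \<le> fm y + G1 y" using t(2) fg[OF t(1)] fm_ge[OF t(1), of y] by (simp add: G1_def)
  next
    obtain t where t: "t \<in> F" "ereal (v - e1) < f t y" using FM(2)[of y] y by (auto simp: S_def)
    have "y \<in> dom_of (f t)" using t(1) y by (simp add: S_def)
    then show "v - e1 < fm y" using t(2) fg[OF t(1)] fm_ge[OF t(1), of y] by simp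
  qed
  have fmx: "fm x + G1 x \<le> v"
  proof -
    have "fm x \<le> v" using fm_in[of x] xdom(2) by auto
    then show ?thesis using sublinear_zero[OF pen(1)] by (simp add: G1_def blinfun.zero_right)
  qed
  have G1lim: "(\<lambda>n. G1 (ys n)) \<longlonglongrightarrow> G1 y" if "ys \<longlonglongrightarrow> y" for ys y
  proof -
    have "(\<lambda>n. pen (ys n - x)) \<longlonglongrightarrow> pen (y - x)"
      by (rule lipschitz_tendsto[OF pen(5)]) (intro tendsto_intros that)
    then show ?thesis unfolding G1_def by (intro tendsto_intros that)
  qed
  \<comment> \<open>A function of one variable, put into the form of the variational principle with
    \<open>unit\<close> as index type.\<close>
  define \<Theta> where "\<Theta> z = fm (z ()) + G1 (z ())" for z
  have clsc: "coordinatewise_lsc {()} {z. z () \<in> S} \<Theta>"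
    unfolding coordinatewise_lsc_def
  proof (intro allI impI, elim conjE)
    fix zs L and z :: "unit \<Rightarrow> 'a" and l
    assume zs: "\<forall>n. zs n \<in> {z. z () \<in> S} \<and> \<Theta> (zs n) \<le> L n" and L: "L \<longlonglongrightarrow> l"
      and "\<forall>i\<in>{()}. (\<lambda>n. zs n i) \<longlonglongrightarrow> z i"
    then have lim: "(\<lambda>n. zs n ()) \<longlonglongrightarrow> z ()" by simp
    have lim2: "(\<lambda>n. L n - G1 (zs n ())) \<longlonglongrightarrow> l - G1 (z ())" by (intro tendsto_diff L G1lim lim)
    have *: "z () \<in> dom_of (f t) \<and> g t (z ()) \<le> l - G1 (z ())" if t: "t \<in> F" for t
    proof -
      have p: "plsc (dom_of (f t)) (g t)" unfolding g_def using t F(3) by (intro lsc_plsc lsc nm) auto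
      have 1: "zs n () \<in> dom_of (f t)" for n using zs t by (auto simp: S_def)
      have 2: "g t (zs n ()) \<le> L n - G1 (zs n ())" for n
      proof -
        have "\<Theta> (zs n) \<le> L n" using zs by blast
        then show ?thesis using fm_ge[OF t, of "zs n ()"] by (simp add: \<Theta>_def)
      qed
      from plscD[where xs = "\<lambda>n. zs n ()" and L = "\<lambda>n. L n - G1 (zs n ())", OF p 1 2 lim2 lim]
      show ?thesis by blast
    qed
    have "norm (z () - x) \<le> r"
      by (rule LIMSEQ_le_const2[OF tendsto_norm[OF tendsto_diff[OF lim tendsto_const]]])
        (use zs in \<open>auto simp: S_def\<close>)
    moreover have "\<Theta> z \<le> l"
    proof -
      obtain t where "t \<in> F" "fm (z ()) = g t (z ())" using fm_in by blast
      then show ?thesis using *[of t] by (simp add: \<Theta>_def)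
    qed
    ultimately show "z \<in> {z. z () \<in> S} \<and> \<Theta> z \<le> l" using * by (simp add: S_def)
  qed
  obtain z where z: "z () \<in> S" "norm (z () - x) \<le> 8 * \<eta> / d"
    "\<And>y. y \<in> S \<Longrightarrow> fm (z ()) + G1 (z ()) \<le> fm y + G1 y + d * norm (y - z ())"
  proof (rule ekeland_variational_principle[OF _ clsc, of "v - \<eta>" "\<lambda>_. x" \<eta> d])
    fix z assume z: "z \<in> {z. z () \<in> S}" "\<And>i. i \<in> {()} \<Longrightarrow> norm (z i - x) \<le> 8 * \<eta> / d"
      "\<And>y. y \<in> {z. z () \<in> S} \<Longrightarrow> \<Theta> z \<le> \<Theta> y + d * (\<Sum>i\<in>{()}. norm (y i - z i))"
    have "fm (z ()) + G1 (z ()) \<le> fm y + G1 y + d * norm (y - z ())" if "y \<in> S" for y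
      using z(3)[of "\<lambda>_. y"] that by (simp add: \<Theta>_def)
    then show thesis using that z(1,2) by simp
  next
    fix z assume "z \<in> {z. z () \<in> S}"
    then have "z () \<in> S" by simp
    from Sbound(1)[OF this] show "v - \<eta> \<le> \<Theta> z" "\<Theta> (\<lambda>_. x) \<le> \<Theta> z + \<eta>" using fmx by (auto simp: \<Theta>_def)
  qed (use xS \<eta> d in auto)
  define x' where "x' = z ()"
  have x': "x' \<in> S" "norm (x' - x) \<le> r / 2"
    using z(1,2) d by (auto simp: x'_def \<eta>_def)
  have min': "fm x' + G1 x' \<le> fm y + G1 y + d * norm (y - x')" if "y \<in> S" for y
    using z(3)[OF that] by (simp add: x'_def)
  have x'dom: "x' \<in> dom_of (f t)" if "t \<in> F" for t using x'(1) that by (simp add: S_def)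
  have fmle: "fm x' \<le> v + e"
  proof -
    have "fm x' + G1 x' \<le> v + d * (r / 2)"
      using min'[OF xS] fmx mult_left_mono[OF x'(2) less_imp_le[OF d]] unfolding norm_minus_commute[of x x'] by linarith
    moreover have "\<xi> (x' - x) \<le> norm \<xi> * (r / 2)"
      using blinfun_le_norm[of \<xi> "x' - x"] mult_left_mono[OF x'(2) norm_ge_zero[of \<xi>]] by simp
    moreover have "norm \<xi> * (r / 2) + d * (r / 2) \<le> e"
    proof -
      have "norm \<xi> * (r / 2) + d * (r / 2) = (norm \<xi> + d) * (r / 2)" by (simp add: distrib_right)
      also have "\<dots> \<le> (norm \<xi> + d + 1) * e1" using r(1,2) d by (intro mult_mono) auto
      finally show ?thesis using e1(2) by (simp add: mult.commute)
    qed
    ultimately show ?thesis using pen(2)[of "x' - x"] by (simp add: G1_def)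
  qed
  have fmge: "v - e \<le> fm x'" using Sbound(2)[OF x'(1)] e1'(1) by simp
  have x'U: "x' \<in> U" and x'e: "x' \<in> cball x e"
    using x'(2) r(1,2) e1' e0(2) by (auto simp: dist_norm norm_minus_commute subset_iff)
  \<comment> \<open>Tilt, penalty and Ekeland term together; \<open>q\<close> is a sublinear bound
    for the increments, the form in which the exact rule takes them.\<close>
  define G where "G y = G1 y + d * norm (y - x')" for y
  define q where "q h = - \<xi> h + pen h + d * norm h" for h
  have q: "sublinear q"
  proof (rule sublinearI)
    show "q (x + y) \<le> q x + q y" for x y
      using sublinear_add[OF pen(1), of x y] mult_left_mono[OF norm_triangle_ineq[of x y], of d] d
      by (simp add: q_def blinfun.add_right distrib_left)
    show "q (c *\<^sub>R x) \<le> c * q x" if "0 < c" for c x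
      using that sublinear_scaleR[OF pen(1), of c x] by (simp add: q_def blinfun.scaleR_right algebra_simps)
    show "q 0 = 0" using sublinear_zero[OF pen(1)] by (simp add: q_def blinfun.zero_right)
  qed
  have qM: "\<bar>q h\<bar> \<le> (norm \<xi> + M + d) * norm h" for h
  proof -
    have "\<bar>\<xi> h\<bar> \<le> norm \<xi> * norm h" using norm_blinfun[of \<xi> h] by simp
    moreover have "\<bar>pen h\<bar> \<le> M * norm h" using pen(2,3)[of h] by simp
    moreover have "0 \<le> d * norm h" using d by simp
    ultimately have "\<bar>q h\<bar> \<le> norm \<xi> * norm h + M * norm h + d * norm h" unfolding q_def by linarith
    then show ?thesis by (simp add: distrib_right)
  qed
  have Gq: "G (u + h) - G u \<le> q h" for u h
  proof -
    have "pen (u + h - x) \<le> pen (u - x) + pen h"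
      using sublinear_add[OF pen(1), of "u - x" h] by (simp add: algebra_simps)
    moreover have "\<xi> (u + h - x) = \<xi> (u - x) + \<xi> h"
      by (simp add: blinfun.add_right blinfun.diff_right)
    moreover have "d * norm (u + h - x') \<le> d * norm (u - x') + d * norm h"
      using mult_left_mono[OF norm_triangle_ineq[of "u - x'" h], of d] d by (simp add: algebra_simps)
    ultimately show ?thesis by (simp add: G_def G1_def q_def)
  qed
  have M': "0 \<le> norm \<xi> + M + d" using M d by simp
  have r2: "0 < r / 2" using r(1) by simp
  have fT: "f t y \<noteq> - \<infinity>" "lsc (f t)" if "t \<in> F" for t y using that F(3) nm lsc by auto
  have cin: "fm x' \<in> (\<lambda>t. rl (f t) x') ` F" using fm_in[of x'] by (auto simp: g_def)
  have cle: "rl (f t) x' \<le> fm x'" if "t \<in> F" for t using fm_ge[OF that] by (simp add: g_def)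
  have locmin: "\<exists>t\<in>F. fm x' \<le> rl (f t) u + (G u - G x')"
    if u: "norm (u - x') \<le> r / 2" "\<And>t. t \<in> F \<Longrightarrow> u \<in> dom_of (f t)" for u
  proof -
    have "norm (u - x) \<le> r"
      using norm_triangle_ineq[of "u - x'" "x' - x"] u(1) x'(2) by simp
    then have "u \<in> S" using u(2) by (simp add: S_def)
    from min'[OF this] have "fm x' \<le> fm u + (G u - G x')" by (simp add: G_def)
    then show ?thesis using fm_in[of u] by (auto simp: g_def)
  qed
  have fin': "\<bar>f t x'\<bar> \<noteq> \<infinity>" if "t \<in> F" for t using fg[OF that x'dom[OF that]] by simp
  have one: "t = t'" if "t \<in> F" "t' \<in> F" "\<not> snec_at (f t) x'" "\<not> snec_at (f t') x'" for t t'
  proof (rule Uniq_D[OF snec[OF x'U]])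
    show "t \<in> T \<and> \<bar>f t x'\<bar> \<noteq> \<infinity> \<and> \<not> snec_at (f t) x'" "t' \<in> T \<and> \<bar>f t' x'\<bar> \<noteq> \<infinity> \<and> \<not> snec_at (f t') x'"
      using that fin' F(3) by (simp_all add: subset_iff)
  qed
  obtain l w where l: "l \<in> simplex_on F" "\<And>t. t \<in> F \<Longrightarrow> l t \<noteq> 0 \<Longrightarrow> rl (f t) x' = fm x'"
    and w: "\<And>t. t \<in> F \<Longrightarrow> w t \<in> circ_subdiff (l t) (f t) x'" "\<And>h. - blinfun_apply (\<Sum>t\<in>F. w t) h \<le> q h"
    by (rule exact_multiplier_rule[OF asp F(1,2) fT x'dom q qM M' Gq r2 cin cle locmin qual[OF x'U F(1,3)] one])
      (assumption | rule that)+
  have mx: "max_family F f x' = ereal (fm x')"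
    unfolding max_family_def
  proof (rule Max_eqI)
    show "finite ((\<lambda>t. f t x') ` F)" using F(1) by simp
    show "y \<le> ereal (fm x')" if "y \<in> (\<lambda>t. f t x') ` F" for y
      using that fg[OF _ x'dom] fm_ge by auto
    show "ereal (fm x') \<in> (\<lambda>t. f t x') ` F" using fm_in[of x'] fg[OF _ x'dom] by force
  qed
  show thesis
  proof (rule that)
    have "\<bar>max_family F f x' - sup_family T f x\<bar> \<le> ereal e"
      using fmle fmge by (simp add: mx v abs_le_iff)
    moreover have "\<forall>t\<in>supp_on F l. f t x' = max_family F f x'"
      using l(2) fg[OF _ x'dom] by (auto simp: supp_on_def mx g_def)
    ultimately show "(\<Sum>t\<in>F. w t) \<in> approx_sums T f x e"
      unfolding approx_sums_def using F(1,3) x'e l(1) w(1) by blast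
    fix b assume b: "b \<in> B"
    have "q b \<le> - \<xi> b + \<delta>" "q (- b) \<le> \<xi> b + \<delta>"
      using pen(4)[OF BK(1)[OF b]] pen(4)[OF BK(2)[OF b]] dB[OF b] d
      by (auto simp: q_def blinfun.minus_right distrib_left)
    then show "\<bar>blinfun_apply (\<Sum>t\<in>F. w t) b - \<xi> b\<bar> \<le> \<delta>"
      using w(2)[of b] w(2)[of "- b"] by (simp add: blinfun.minus_right abs_le_iff)
  qed
qed

section \<open>Passage to weak* closures\<close>

lemma approx_sums_mono:
  assumes "norm (x - x0) \<le> a" "sup_family T f x = ereal v" "sup_family T f x0 = ereal v0" "\<bar>v - v0\<bar> \<le> a" "a + b \<le> e"
  shows "approx_sums T f x b \<subseteq> approx_sums T f x0 e"
proof -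
  have "\<bar>m - ereal v0\<bar> \<le> ereal e" if "\<bar>m - ereal v\<bar> \<le> ereal b" for m
    using that assms(4,5) by (cases m) auto
  moreover have "y \<in> cball x0 e" if "y \<in> cball x b" for y
    using that dist_triangle[of x0 y x] assms(1,5) by (simp add: dist_norm norm_minus_commute)
  ultimately show ?thesis unfolding approx_sums_def assms(2,3) by blast
qed

text \<open>A basic neighbourhood in the product topology restricts finitely many coordinates, and
  each restriction contains an interval around the value of \<eta>.\<close>

lemma in_weak_star_closureI:
  fixes \<eta> :: "'a::real_normed_vector \<Rightarrow>\<^sub>L real"
  assumes "\<And>B \<delta>. finite B \<Longrightarrow> 0 < \<delta> \<Longrightarrow> \<exists>\<zeta>\<in>S. \<forall>b\<in>B. \<bar>blinfun_apply \<zeta> b - \<eta> b\<bar> < \<delta>"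
  shows "\<eta> \<in> weak_star closure_of S"
  unfolding in_closure_of
proof (intro conjI allI impI)
  show "\<eta> \<in> topspace weak_star" by (simp add: strong_operator_topology_topspace)
  fix U :: "('a \<Rightarrow>\<^sub>L real) set" assume "\<eta> \<in> U \<and> openin weak_star U"
  then obtain V where V: "open V" "U = blinfun_apply -` V" "blinfun_apply \<eta> \<in> V"
    by (auto simp: strong_operator_topology_def openin_pullback_topology)
  then have "openin (product_topology (\<lambda>_. euclidean) UNIV) V" by (simp add: open_fun_def)
  from product_topology_open_contains_basis[OF this V(3)]
  obtain X where X: "blinfun_apply \<eta> \<in> (\<Pi>\<^sub>E i\<in>UNIV. X i)" "\<And>i. open (X i)"
    "finite {i. X i \<noteq> UNIV}" "(\<Pi>\<^sub>E i\<in>UNIV. X i) \<subseteq> V" by auto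
  have "\<exists>d>0. \<forall>s. \<bar>s - \<eta> i\<bar> < d \<longrightarrow> s \<in> X i" for i
    using X(1) X(2)[of i] by (auto simp: open_dist dist_real_def)
  then obtain d where d: "\<And>i. 0 < d i" "\<And>i s. \<bar>s - \<eta> i\<bar> < d i \<Longrightarrow> s \<in> X i" by metis
  define B where "B = {i. X i \<noteq> UNIV}"
  define \<delta> where "\<delta> = Min (insert 1 (d ` B))"
  have B: "finite B" using X(3) by (simp add: B_def)
  then have "0 < \<delta>" using d(1) by (auto simp: \<delta>_def)
  from assms[OF B this] obtain \<zeta> where \<zeta>: "\<zeta> \<in> S" "\<And>b. b \<in> B \<Longrightarrow> \<bar>blinfun_apply \<zeta> b - \<eta> b\<bar> < \<delta>" by blast
  have "blinfun_apply \<zeta> i \<in> X i" for i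
  proof (cases "i \<in> B")
    case True
    then have "\<delta> \<le> d i" unfolding \<delta>_def using B by (intro Min_le) auto
    then show ?thesis using \<zeta>(2)[OF True] d(2)[of "\<zeta> i" i] by simp
  qed (simp add: B_def)
  then have "\<zeta> \<in> U" using X(4) by (auto simp: V(2))
  then show "\<exists>y. y \<in> S \<and> y \<in> U" using \<zeta>(1) by blast
qed

theorem theorem4p8:
  fixes f :: "'t \<Rightarrow> 'a::banach \<Rightarrow> ereal" and T :: "'t set" and x0 :: 'a
  assumes "asplund_space TYPE('a)"
    and "T \<noteq> {}"
    and "\<And>t x. t \<in> T \<Longrightarrow> f t x \<noteq> -\<infinity>"
    and "\<And>t. t \<in> T \<Longrightarrow> lsc (f t)"
    and "snec_family_near T f x0"
    and "limiting_condition_near T f x0"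
  shows "limiting_subdiff (sup_family T f) x0
           \<subseteq> (\<Inter>e\<in>{0<..}. weak_star closure_of approx_sums T f x0 e)
       \<and> singular_subdiff (sup_family T f) x0
           \<subseteq> (\<Inter>e\<in>{0<..}. weak_star closure_of
                  {r *\<^sub>R \<xi> | r \<xi>. r \<in> {0..e} \<and> \<xi> \<in> approx_sums T f x0 e})"
proof -
  obtain U1 where U1: "open U1" "x0 \<in> U1"
    "\<forall>x\<in>U1. \<exists>\<^sub>\<le>\<^sub>1t. t \<in> T \<and> \<bar>f t x\<bar> \<noteq> \<infinity> \<and> \<not> snec_at (f t) x"
    using assms(5) unfolding snec_family_near_def by (elim exE conjE) (rule that)
  obtain U2 where U2: "open U2" "x0 \<in> U2"
    "\<forall>x\<in>U2. \<forall>F w. finite F \<and> F \<subseteq> T \<and> (\<forall>t\<in>F. w t \<in> singular_subdiff (f t) x)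
       \<and> (\<Sum>t\<in>F. w t) = 0 \<longrightarrow> (\<forall>t\<in>F. w t = 0)"
    using assms(6) unfolding limiting_condition_near_def by (elim exE conjE) (rule that)
  \<comment> \<open>The tolerance varies with \<open>n\<close> because in the singular case the
    subgradients are afterwards multiplied by \<open>l n\<close>.\<close>
  have approx: "eventually (\<lambda>n. \<exists>\<zeta>\<in>approx_sums T f x0 e. \<forall>b\<in>B. \<bar>blinfun_apply \<zeta> b - \<xi> n b\<bar> \<le> \<delta> n) sequentially"
    if fin: "\<bar>sup_family T f x0\<bar> \<noteq> \<infinity>" and conv: "g_converges (sup_family T f) xs x0"
      and \<xi>: "\<And>n. \<xi> n \<in> frechet_subdiff (sup_family T f) (xs n)" and B: "finite B"
      and \<delta>: "\<And>n. 0 < \<delta> n" and e: "0 < e" for xs \<xi> B \<delta> e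
  proof -
    obtain v0 where v0: "sup_family T f x0 = ereal v0" using fin by auto
    have "\<bar>sup_family T f (xs n)\<bar> \<noteq> \<infinity>" for n using \<xi>[of n] by (simp add: frechet_subdiff_def)
    then have "\<exists>v. sup_family T f (xs n) = ereal v" for n by auto
    then obtain v where v: "\<And>n. sup_family T f (xs n) = ereal (v n)" by metis
    have xs: "xs \<longlonglongrightarrow> x0" and vl: "v \<longlonglongrightarrow> v0" using conv by (auto simp: g_converges_def v v0)
    have "eventually (\<lambda>n. xs n \<in> U1 \<inter> U2) sequentially"
      using U1(1,2) U2(1,2) by (intro topological_tendstoD[OF xs]) auto
    moreover have "eventually (\<lambda>n. dist (xs n) x0 < e / 2) sequentially" using e by (intro tendstoD[OF xs]) simp
    moreover have "eventually (\<lambda>n. dist (v n) v0 < e / 2) sequentially" using e by (intro tendstoD[OF vl]) simp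
    ultimately show ?thesis
    proof eventually_elim
      case (elim n)
      have U: "open (U1 \<inter> U2)" using U1(1) U2(1) by blast
      \<comment> \<open>Half of \<open>e\<close> is spent on the rule at \<open>xs n\<close>, the
        other half on moving the centre back to \<open>x0\<close>.\<close>
      have e2: "0 < e / 2" using e by simp
      have U3: "\<exists>\<^sub>\<le>\<^sub>1t. t \<in> T \<and> \<bar>f t x\<bar> \<noteq> \<infinity> \<and> \<not> snec_at (f t) x" if "x \<in> U1 \<inter> U2" for x
        using U1(3) that by simp
      have U4: "\<forall>t\<in>F. w t = 0"
        if "x \<in> U1 \<inter> U2" "finite F" "F \<subseteq> T" "\<And>t. t \<in> F \<Longrightarrow> w t \<in> singular_subdiff (f t) x" "(\<Sum>t\<in>F. w t) = 0" for x F w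
        using U2(3)[rule_format, of x F w] that by auto
      obtain \<zeta> where \<zeta>: "\<zeta> \<in> approx_sums T f (xs n) (e / 2)" "\<And>b. b \<in> B \<Longrightarrow> \<bar>blinfun_apply \<zeta> b - \<xi> n b\<bar> \<le> \<delta> n"
        by (rule supremum_fuzzy_rule[OF assms(1-4) U elim(1) U3 U4 \<xi> B \<delta> e2]) (assumption | rule that)+
      have "approx_sums T f (xs n) (e / 2) \<subseteq> approx_sums T f x0 e"
        using elim(2,3) by (intro approx_sums_mono[where a = "e / 2", OF _ v v0]) (auto simp: dist_norm)
      then show ?case using \<zeta> by blast
    qed
  qed
  have limit: "\<exists>n. P n \<and> (\<forall>b\<in>B. \<bar>blinfun_apply (\<xi> n) b - \<eta> b\<bar> < \<delta>)"
    if "limitin weak_star \<xi> \<eta> sequentially" "eventually P sequentially" "finite B" "0 < \<delta>" for \<xi> \<eta> P \<delta> and B :: "'a set"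
  proof -
    have "eventually (\<lambda>n. \<forall>b\<in>B. \<bar>blinfun_apply (\<xi> n) b - \<eta> b\<bar> < \<delta>) sequentially"
    proof (rule eventually_ball_finite[OF that(3)], intro ballI)
      fix b
      have "(\<lambda>n. blinfun_apply (\<xi> n) b) \<longlonglongrightarrow> \<eta> b" using that(1) by (simp add: limitin_weak_star_iff)
      from tendstoD[OF this that(4)] show "eventually (\<lambda>n. \<bar>blinfun_apply (\<xi> n) b - \<eta> b\<bar> < \<delta>) sequentially"
        by (simp add: dist_real_def)
    qed
    from eventually_conj[OF that(2) this] show ?thesis by (auto simp: eventually_sequentially)
  qed
  have 1: "\<eta> \<in> weak_star closure_of approx_sums T f x0 e"
    if "\<eta> \<in> limiting_subdiff (sup_family T f) x0" and e: "0 < e" for \<eta> e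
  proof (rule in_weak_star_closureI)
    fix B :: "'a set" and \<delta> :: real assume B: "finite B" and \<delta>: "0 < \<delta>"
    from that(1) obtain xs \<xi> where fin: "\<bar>sup_family T f x0\<bar> \<noteq> \<infinity>" and conv: "g_converges (sup_family T f) xs x0"
      and \<xi>: "\<And>n. \<xi> n \<in> frechet_subdiff (sup_family T f) (xs n)" and lim: "limitin weak_star \<xi> \<eta> sequentially"
      unfolding limiting_subdiff_def mem_Collect_eq by (elim conjE exE) (rule that, (assumption | erule spec)+)
    have \<delta>2: "0 < \<delta> / 2" using \<delta> by simp
    obtain n where n: "\<exists>\<zeta>\<in>approx_sums T f x0 e. \<forall>b\<in>B. \<bar>blinfun_apply \<zeta> b - \<xi> n b\<bar> \<le> \<delta> / 2"
      "\<And>b. b \<in> B \<Longrightarrow> \<bar>blinfun_apply (\<xi> n) b - \<eta> b\<bar> < \<delta> / 2"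
      using limit[OF lim approx[OF fin conv \<xi> B \<delta>2 e] B \<delta>2] by blast
    then obtain \<zeta> where \<zeta>: "\<zeta> \<in> approx_sums T f x0 e" "\<And>b. b \<in> B \<Longrightarrow> \<bar>blinfun_apply \<zeta> b - \<xi> n b\<bar> \<le> \<delta> / 2" by blast
    have "\<bar>blinfun_apply \<zeta> b - \<eta> b\<bar> < \<delta>" if "b \<in> B" for b
      using \<zeta>(2)[OF that] n(2)[OF that] by linarith
    then show "\<exists>\<zeta>\<in>approx_sums T f x0 e. \<forall>b\<in>B. \<bar>blinfun_apply \<zeta> b - \<eta> b\<bar> < \<delta>" using \<zeta>(1) by blast
  qed
  have 2: "\<eta> \<in> weak_star closure_of {r *\<^sub>R \<xi> | r \<xi>. r \<in> {0..e} \<and> \<xi> \<in> approx_sums T f x0 e}" (is "_ \<in> _ closure_of ?S")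
    if "\<eta> \<in> singular_subdiff (sup_family T f) x0" and e: "0 < e" for \<eta> e
  proof (rule in_weak_star_closureI)
    fix B :: "'a set" and \<delta> :: real assume B: "finite B" and \<delta>: "0 < \<delta>"
    from that(1) obtain xs \<xi> l where fin: "\<bar>sup_family T f x0\<bar> \<noteq> \<infinity>" and conv: "g_converges (sup_family T f) xs x0"
      and \<xi>: "\<And>n. \<xi> n \<in> frechet_subdiff (sup_family T f) (xs n)" and l: "\<And>n. 0 < l n" "l \<longlonglongrightarrow> 0"
      and lim: "limitin weak_star (\<lambda>n. l n *\<^sub>R \<xi> n) \<eta> sequentially"
      unfolding singular_subdiff_def mem_Collect_eq by (elim conjE exE) (rule that, (assumption | erule spec)+)
    have \<delta>2: "0 < \<delta> / 2" and \<delta>l: "\<And>n. 0 < \<delta> / 2 / l n" using \<delta> l(1) by auto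
    have "eventually (\<lambda>n. l n < e) sequentially" using e by (rule order_tendstoD(2)[OF l(2)])
    from limit[OF lim eventually_conj[OF this approx[where \<delta> = "\<lambda>n. \<delta> / 2 / l n", OF fin conv \<xi> B \<delta>l e]] B \<delta>2]
    obtain n where n: "l n < e \<and> (\<exists>\<zeta>\<in>approx_sums T f x0 e. \<forall>b\<in>B. \<bar>blinfun_apply \<zeta> b - \<xi> n b\<bar> \<le> \<delta> / 2 / l n)"
      "\<forall>b\<in>B. \<bar>blinfun_apply (l n *\<^sub>R \<xi> n) b - \<eta> b\<bar> < \<delta> / 2"
      by (elim exE conjE) (rule that, (assumption | rule conjI)+)
    from conjunct2[OF n(1)] obtain \<zeta> where \<zeta>: "\<zeta> \<in> approx_sums T f x0 e"
      "\<forall>b\<in>B. \<bar>blinfun_apply \<zeta> b - \<xi> n b\<bar> \<le> \<delta> / 2 / l n" by (elim bexE) (rule that)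
    have "\<bar>blinfun_apply (l n *\<^sub>R \<zeta>) b - \<eta> b\<bar> < \<delta>" if b: "b \<in> B" for b
    proof -
      have "l n * \<bar>\<zeta> b - \<xi> n b\<bar> \<le> l n * (\<delta> / 2 / l n)" using bspec[OF \<zeta>(2) b] l(1)[of n] by (intro mult_left_mono) auto
      also have "\<dots> = \<delta> / 2" using l(1)[of n] by simp
      also have "l n * \<bar>\<zeta> b - \<xi> n b\<bar> = \<bar>l n * \<zeta> b - l n * \<xi> n b\<bar>"
        using l(1)[of n] by (simp add: abs_mult flip: right_diff_distrib)
      finally have "\<bar>l n * \<zeta> b - l n * \<xi> n b\<bar> \<le> \<delta> / 2" .
      then show ?thesis using bspec[OF n(2) b] unfolding blinfun.scaleR_left real_scaleR_def by linarith
    qed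
    moreover have "l n *\<^sub>R \<zeta> \<in> ?S" using \<zeta>(1) conjunct1[OF n(1)] l(1)[of n] by (auto intro!: exI[of _ "l n"] exI[of _ \<zeta>])
    ultimately show "\<exists>\<zeta>\<in>?S. \<forall>b\<in>B. \<bar>blinfun_apply \<zeta> b - \<eta> b\<bar> < \<delta>" by blast
  qed
  show ?thesis using 1 2 by auto
qed

end
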